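(* Let $c(n)$ be defined by $\sum_{n\ge0}c(n)q^n=\frac{E_5^4}{E_1}$, with the convention $c(x)=0$ whenever $x$ is not a nonnegative integer. For $\alpha\ge1$ let $\tilde{\delta}_\alpha=\frac{23\cdot 5^{\alpha}-19}{24}$ if $\alpha$ is odd and $\tilde{\delta}_\alpha=\frac{19(5^{\alpha}-1)}{24}$ if $\alpha$ is even. Let $\ell\ge7$ be prime and for a nonzero rational $t$ define \[ y_{\alpha,t}:=\begin{cases}\dfrac{23\cdot 5^{\alpha}t^{2}-19}{24}, & \alpha\text{ odd},\\[2mm] \dfrac{19\cdot 5^{\alpha}t^{2}-19}{24}, & \alpha\text{ even}\end{cases} \] (used with $t=\ell$ and $t=\ell^{-1}$). Then for every nonnegative integer $n$: (1) if $\alpha\ge1$ is odd, \[ c\left(5^\alpha\ell^2n+y_{\alpha,\ell}\right)\equiv\left(\frac{15}{\ell}\right)\left(1+\ell-\left(\frac{-24n-23}{\ell}\right)\right)c\left(5^\alpha n+\tilde{\delta}_\alpha\right)-\ell\, c\left(\frac{5^\alpha n}{\ell^2}+y_{\alpha,\ell^{-1}}\right)\pmod{5^{\alpha+1}}; \] (2) if $\alpha\ge2$ is even, \[ c\left(5^\alpha\ell^2n+y_{\alpha,\ell}\right)\equiv\left(\frac{15}{\ell}\right)\left(1+\ell-\ell^2\left(\frac{-24n-19}{\ell}\right)\right)c\left(5^\alpha n+\tilde{\delta}_\alpha\right)-\ell\, c\left(\frac{5^\alpha n}{\ell^2}+y_{\alpha,\ell^{-1}}\right)\pmod{5^{\alpha+1}}.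 \]
   Context: $E_j:=\prod_{n\ge1}(1-q^{jn})$. $\left(\frac{\cdot}{\ell}\right)$ denotes the Legendre symbol. (One has $c(n)=NT(4,5,5n+4)-NT(1,5,5n+4)$, where $NT(m,k,n)$ is the total number of parts in partitions of $n$ with rank $\equiv m\pmod k$.) *)

theory Defs
  imports
    "HOL-Analysis.Analysis"
    "HOL-Number_Theory.Number_Theory"
    "HOL-Computational_Algebra.Formal_Power_Series"
begin

(* The infinite product is taken in the usual (coefficientwise stable) topology on
   formal power series; it is meaningful for j > 0, see euler_E_has_prod. *)
definition euler_E :: "nat \<Rightarrow> int fps" where
  "euler_E j = (\<Prod>n. 1 - fps_X ^ (j * (n + 1)))"

lemma euler_E_has_prod:
  assumes "j > 0"
  shows "(\<lambda>n. 1 - fps_X ^ (j * (n + 1)) :: int fps) has_prod euler_E j"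
    and "fps_nth (euler_E j) 0 = 1"
proof -
  define f where "f = (\<lambda>n. 1 - fps_X ^ (j * (n + 1)) :: int fps)"
  have f0: "fps_nth (f n) 0 = 1" for n
    using assms by (simp add: f_def fps_X_power_nth)
  then have f_nz: "f n \<noteq> 0" for n
    by (metis fps_zero_nth zero_neq_one)
  have sub: "subdegree (f k - 1) > n" if "k > n" for n k
  proof -
    have "f k - 1 = - (fps_X ^ (j * (k + 1)))" by (simp add: f_def)
    then have "subdegree (f k - 1) = j * (k + 1)"
      by (simp only: subdegree_uminus fps_X_power_subdegree)
    also have "\<dots> \<ge> 1 * (k + 1)" using assms by (intro mult_right_mono) auto
    finally show ?thesis using that by simp
  qed
  obtain P where P: "(\<lambda>n. \<Prod>k\<le>n. f k) \<longlonglongrightarrow> P"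
    using tendsto_prod_fps[of f "\<lambda>n. n", OF f_nz sub] by blast
  have partial0: "fps_nth (\<Prod>k\<in>A. f k) 0 = 1" if "finite A" for A
    using that by induction (simp_all add: f0)
  from P have "\<forall>\<^sub>F n in sequentially. fps_nth (\<Prod>k\<le>n. f k) 0 = fps_nth P 0"
    by (simp add: tendsto_fps_iff)
  then have P0: "fps_nth P 0 = 1"
    by (simp add: partial0)
  then have "P \<noteq> 0" by auto
  with P have "f has_prod P"
    by (simp add: has_prod_def raw_has_prod_def)
  moreover from this have "euler_E j = P"
    using has_prod_unique unfolding euler_E_def f_def by fastforce
  ultimately show "(\<lambda>n. 1 - fps_X ^ (j * (n + 1)) :: int fps) has_prod euler_E j"
    and "fps_nth (euler_E j) 0 = 1"
    using P0 by (simp_all add: f_def)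
qed

(* E_5^4 / E_1. Since E_1 has constant coefficient 1 it is a unit over the integers;
   fps_right_inverse is its inverse there, as int fps has no division. *)
definition c_gf :: "int fps" where
  "c_gf = euler_E 5 ^ 4 * fps_right_inverse (euler_E 1) 1"

lemma c_gf_times_euler_E: "c_gf * euler_E 1 = euler_E 5 ^ 4"
  using fps_right_inverse[of "euler_E 1" 1] euler_E_has_prod(2)[of 1]
  by (simp add: c_gf_def mult_ac)

definition c_coeff :: "rat \<Rightarrow> int" where
  "c_coeff x = (if x \<in> \<nat> then fps_nth c_gf (nat \<lfloor>x\<rfloor>) else 0)"

lemma c_coeff_of_nat [simp]: "c_coeff (of_nat n) = fps_nth c_gf n"
  by (simp add: c_coeff_def)

definition delta_tilde :: "nat \<Rightarrow> rat" where
  "delta_tilde \<alpha> = (if odd \<alpha> then (23 * 5 ^ \<alpha> - 19) / 24 else 19 * (5 ^ \<alpha> - 1) / 24)"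

definition y_arg :: "nat \<Rightarrow> rat \<Rightarrow> rat" where
  "y_arg \<alpha> t = (if odd \<alpha> then (23 * 5 ^ \<alpha> * t\<^sup>2 - 19) / 24 else (19 * 5 ^ \<alpha> * t\<^sup>2 - 19) / 24)"

end

theory Submission
  imports Defs "HOL-Complex_Analysis.Complex_Analysis" "HOL-Probability.Probability"
begin

text \<open>
  Let $p(n)$ denote the coefficients of $1/E_1$. Applying the Hecke operator of index $l^2$ to $1/\eta$
  and multiplying by $\eta$ gives a holomorphic function on the upper half plane that is invariant under the
  full modular group. It is therefore a polynomial in the level one function $J$ obtained as the trace
  of the inverse of $(\eta(5z)/\eta(z))^6$, and $qJ$ agrees with $E_1^6/E_5^6$ modulo $625$.
  In this polynomial relation only the exponents of $q$ in suitable classes modulo 5 are kept. On these classes the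
  Hecke transform of $1/E_1$ has no pole, whereas the powers of $J$ contribute poles of distinct orders;
  hence modulo 5 (modulo 25 in the class giving $p(5n+4)$) only the constant coefficient of the
  polynomial survives. This makes $E_1^{23}$ and $E_1^{19}$ Hecke eigenforms modulo 5.
  Watson's iteration for powers of 5 shows that $c(5^\alpha n + \tilde\delta_\alpha)$ is, modulo
  $5^{\alpha+1}$, a fixed multiple of $5^\alpha$ times the coefficient of $q^n$ in $E_1^{23}$ for odd
  $\alpha$ and in $E_1^{19}$ for even $\alpha$.
\<close>

section \<open>The pentagonal number theorem\<close>

text \<open>The transformation constants of eta are not evaluated through Dedekind sums. Only their
  absolute value 1 is derived, from the invariance of |eta|^4 Im z; their phases at levels l and l^2
  are then forced by coefficients: eta is supported on squares, so Hecke-type sums of eta have known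
  coefficients, and Parseval together with equality in the triangle inequality leaves a single
  possibility, given by the Legendre symbol. A trace from level 5 takes the place of the classical j
  because powers of E_1^6/E_5^6 have explicit sections modulo 5, and the correction 625 = 125 * 5 is
  invisible to all moduli in use. The Hecke transform, shifted by q^s with s = (l^2-1)/24, has only
  the exponents 0 and s up to s; as l^2 is 1 or 4 modulo 5, s is 0 or 2 modulo 5, which keeps both
  out of the classes s+1, s+2, s+4. The surviving constant coefficient is chi12(l)(l + l^2) modulo
  5. After multiplication by l it becomes (15/l)(1 + l), because chi12(l) = (3/l) and l^2 = (5/l)
  modulo 5; the latter also produces the l^2 in the even case.\<close>

lemma mod_5_cases: "k mod 5 = 0 \<or> k mod 5 = 1 \<or> k mod 5 = 2 \<or> k mod 5 = 3 \<or> k mod 5 = (4::nat)"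
proof -
  have "j = 0 \<or> j = 1 \<or> j = 2 \<or> j = 3 \<or> j = 4" if "j < 5" for j :: nat using that by auto
  from this[of "k mod 5"] show ?thesis by simp
qed

lemma div_3_le: "m \<le> n + 3 * i \<Longrightarrow> m div 3 \<le> i + n div (3::nat)"
  using div_le_mono[of m "n + 3 * i" 3] by simp

lemma nat_diff_le_diff: "a + d \<le> c + b + i \<Longrightarrow> a - b \<le> c - d + (i::nat)"
  by arith

lemma mod_5_24: "(24 * m + b) mod 5 = (4 * (m mod 5) + b) mod (5::nat)"
proof -
  define d r where "d = m div 5" and "r = m mod 5"
  have m: "m = 5 * d + r" by (simp add: d_def r_def)
  have "24 * (x + y) + z = 24 * x + 24 * y + z" for x y z :: nat by (simp add: distrib_left)
  then have "24 * (5 * d + r) + b = 120 * d + 24 * r + b" by simp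
  also have "\<dots> = 4 * r + b + 5 * (24 * d + 4 * r)" by simp
  finally have e: "24 * m + b = 4 * r + b + 5 * (24 * d + 4 * r)" by (simp only: m[symmetric])
  show ?thesis unfolding e r_def[symmetric] by (simp only: mod_mult_self2)
qed

lemma fps_X_power_dvd_imp_nth_zero:
  fixes f :: "'a::comm_ring_1 fps"
  assumes "fps_X ^ n dvd f" "i < n"
  shows "fps_nth f i = 0"
  using assms by (auto simp: dvd_def fps_X_power_mult_nth)

lemma fps_X_power_dvd_iff:
  fixes f :: "'a::comm_ring_1 fps"
  shows "fps_X ^ n dvd f \<longleftrightarrow> (\<forall>i<n. fps_nth f i = 0)"
proof
  assume "\<forall>i<n. fps_nth f i = 0"
  then have "f = fps_X ^ n * fps_shift n f"
    by (auto simp: fps_eq_iff fps_X_power_mult_nth)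
  then show "fps_X ^ n dvd f" by (metis dvd_triv_left)
qed (auto intro: fps_X_power_dvd_imp_nth_zero)

section \<open>Finite Euler products\<close>

definition qpoch :: "nat \<Rightarrow> int fps" where
  "qpoch n = (\<Prod>k<n. 1 - fps_X ^ (k + 1))"

lemma qpoch_Suc: "qpoch (Suc n) = (1 - fps_X ^ (n + 1)) * qpoch n"
  by (simp add: qpoch_def)

text \<open>Factors beyond the N-th only change exponents above N, so a finite product already fixes
  the coefficient. Identities for E_j are proved on finite products and transferred by this.\<close>

lemma euler_E_nth:
  assumes "j > 0" "n \<le> N"
  shows "fps_nth (euler_E j) n = fps_nth (\<Prod>k<N. 1 - fps_X ^ (j * (k + 1))) n"
proof -
  define f where "f = (\<lambda>n. 1 - fps_X ^ (j * (n + 1)) :: int fps)"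
  have stab: "fps_nth (\<Prod>k<M. f k) n = fps_nth (\<Prod>k<n. f k) n" if "n \<le> M" for M
    using that
  proof (induction M rule: dec_induct)
    case (step M)
    have "n < j * (M + 1)" using step assms(1)
      by (metis One_nat_def Suc_eq_plus1 Suc_leI le_imp_less_Suc less_le_trans mult.commute
          mult_le_mono2 nat_mult_1_right)
    then show ?case using step
      by (simp add: f_def right_diff_distrib fps_X_power_mult_right_nth del: mult_Suc_right)
  qed auto
  have "(\<lambda>N. \<Prod>k\<le>N. f k) \<longlonglongrightarrow> euler_E j"
    using has_prod_imp_tendsto[OF euler_E_has_prod(1)[OF assms(1)]] by (simp add: f_def)
  then have "\<forall>\<^sub>F M in sequentially. fps_nth (\<Prod>k\<le>M. f k) n = fps_nth (euler_E j) n"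
    by (simp add: tendsto_fps_iff)
  then obtain M0 where M0: "\<And>M. M \<ge> M0 \<Longrightarrow> fps_nth (\<Prod>k\<le>M. f k) n = fps_nth (euler_E j) n"
    by (auto simp: eventually_sequentially)
  have "fps_nth (euler_E j) n = fps_nth (\<Prod>k<Suc (max M0 N). f k) n"
    using M0[of "max M0 N"] by (simp add: lessThan_Suc_atMost del: prod.lessThan_Suc)
  also have "\<dots> = fps_nth (\<Prod>k<n. f k) n"
    using assms by (intro stab) auto
  also have "\<dots> = fps_nth (\<Prod>k<N. f k) n"
    using stab[OF assms(2)] by simp
  finally show ?thesis by (simp add: f_def)
qed

lemma euler_E_1_nth: "n \<le> N \<Longrightarrow> fps_nth (euler_E 1) n = fps_nth (qpoch N) n"
  using euler_E_nth[of 1 n N] by (simp add: qpoch_def)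

lemma euler_E_1_cong: "fps_X ^ (N + 1) dvd euler_E 1 - qpoch N"
  unfolding fps_X_power_dvd_iff using euler_E_1_nth[of _ N] by simp

lemma euler_E_nth_0 [simp]: "j > 0 \<Longrightarrow> fps_nth (euler_E j) 0 = 1"
  by (rule euler_E_has_prod)

subsection \<open>The pentagonal number theorem\<close>

text \<open>The k-th term of Shanks's finite form of the pentagonal number theorem, (-1)^k q^(nk +
  k(k+1)/2) (q;q)_n/(q;q)_k. The quotient is written as a product over \<open>{k..<n}\<close>, so
  that no division occurs.\<close>

definition shanks :: "nat \<Rightarrow> nat \<Rightarrow> int fps" where
  "shanks n k = (-1) ^ k * fps_X ^ (n * k + k * (k + 1) div 2) * (\<Prod>i\<in>{k..<n}. 1 - fps_X ^ (i + 1))"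

lemma triangle_Suc: "Suc k * (Suc k + 1) div 2 = k * (k + 1) div 2 + (k + 1)"
  by (simp add: algebra_simps)

lemma shanks_step: "k < n \<Longrightarrow> shanks n (Suc k) * (1 - fps_X ^ (k + 1)) = - (fps_X ^ (n + k + 1)) * shanks n k"
proof -
  assume "k < n"
  then have "(\<Prod>i\<in>{k..<n}. 1 - fps_X ^ (i + 1) :: int fps) =
      (1 - fps_X ^ (k + 1)) * (\<Prod>i\<in>{Suc k..<n}. 1 - fps_X ^ (i + 1))"
    by (rule prod.atLeast_Suc_lessThan)
  then show ?thesis
    unfolding shanks_def triangle_Suc by (simp only: power_add power_Suc mult_Suc_right) (simp add: mult_ac)
qed

lemma shanks_Suc: "k \<le> n \<Longrightarrow> shanks (Suc n) k = (1 - fps_X ^ (n + 1)) * fps_X ^ k * shanks n k"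
  by (simp add: shanks_def power_add algebra_simps)

text \<open>Passing from n to n+1 multiplies the k-th term by (1 - q^(n+1)) q^k. In the difference
  the part with 1 - q^k is traded for the term k-1 by \<open>shanks_step\<close>, and consecutive
  differences cancel.\<close>

lemma shanks_telescope:
  "K \<le> n \<Longrightarrow> (\<Sum>k\<le>K. shanks (Suc n) k - shanks n k) = - (fps_X ^ (n + 1 + K)) * shanks n K"
proof (induction K)
  case 0
  then show ?case by (simp add: shanks_Suc algebra_simps)
next
  case (Suc K)
  then have "(\<Sum>k\<le>Suc K. shanks (Suc n) k - shanks n k) =
      - (fps_X ^ (n + 1 + K)) * shanks n K + (shanks (Suc n) (Suc K) - shanks n (Suc K))"
    by simp
  also have "- (fps_X ^ (n + 1 + K)) * shanks n K = shanks n (Suc K) * (1 - fps_X ^ (K + 1))"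
    using shanks_step[of K n] Suc.prems by (simp add: algebra_simps)
  also have "shanks (Suc n) (Suc K) = (1 - fps_X ^ (n + 1)) * fps_X ^ (Suc K) * shanks n (Suc K)"
    using Suc.prems by (intro shanks_Suc)
  finally show ?case by (simp add: algebra_simps power_add)
qed

text \<open>Raising n adds the new last term and the telescoped increments; these are exactly the
  two monomials of the pentagonal pair of index n+1.\<close>

lemma shanks_sum:
  "(\<Sum>k\<le>n. shanks n k) =
     1 + (\<Sum>j=1..n. (-1) ^ j * (fps_X ^ (j * (3 * j + 1) div 2) + fps_X ^ (j * (3 * j - 1) div 2)))"
proof (induction n)
  case 0
  show ?case by (simp add: shanks_def)
next
  case (Suc n)
  have e1: "Suc n * Suc n + Suc n * (Suc n + 1) div 2 = Suc n * (3 * Suc n + 1) div 2"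
  proof -
    have "even (Suc n * (Suc n + 1))" by simp
    moreover have "2 * (Suc n * Suc n) + Suc n * (Suc n + 1) = Suc n * (3 * Suc n + 1)"
      by (simp add: algebra_simps)
    ultimately show ?thesis by presburger
  qed
  have e2: "n + 1 + n + (n * n + n * (n + 1) div 2) = Suc n * (3 * Suc n - 1) div 2"
  proof -
    have "even (n * (n + 1))" by simp
    moreover have "2 * (n + 1 + n + n * n) + n * (n + 1) = Suc n * (3 * Suc n - 1)"
      by (simp add: algebra_simps)
    ultimately show ?thesis by presburger
  qed
  have last: "shanks (Suc n) (Suc n) = (-1) ^ Suc n * fps_X ^ (Suc n * (3 * Suc n + 1) div 2)"
    by (simp only: shanks_def e1 atLeastLessThan_empty order_refl prod.empty mult_1_right)
  have tel: "- (fps_X ^ (n + 1 + n)) * shanks n n = (-1) ^ Suc n * fps_X ^ (Suc n * (3 * Suc n - 1) div 2)"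
    unfolding e2[symmetric] by (simp add: shanks_def power_add algebra_simps)
  have "(\<Sum>k\<le>Suc n. shanks (Suc n) k) = (\<Sum>k\<le>n. shanks n k)
      + (\<Sum>k\<le>n. shanks (Suc n) k - shanks n k) + shanks (Suc n) (Suc n)"
    by (simp add: sum_subtractf)
  also have "\<dots> = (\<Sum>k\<le>n. shanks n k) + (-1) ^ Suc n * fps_X ^ (Suc n * (3 * Suc n - 1) div 2)
      + (-1) ^ Suc n * fps_X ^ (Suc n * (3 * Suc n + 1) div 2)"
    by (simp only: shanks_telescope order_refl tel last)
  finally show ?case unfolding Suc.IH by (simp add: algebra_simps)
qed

text \<open>The even quadratic character modulo 12, that is the Kronecker symbol (12/k). It is the
  sign pattern of eta(24z) = sum of chi12(k) q^(k^2) over k \<ge> 1.\<close>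

definition chi12 :: "nat \<Rightarrow> int" where
  "chi12 k = (if k mod 12 \<in> {1, 11} then 1 else if k mod 12 \<in> {5, 7} then -1 else 0)"

lemma chi12_mod: "chi12 (k mod 12) = chi12 k"
  by (simp add: chi12_def)

lemma all_less_12: 
  assumes "list_all P [0, 1, 2, 3, 4, 5, 6, 7, 8, 9, 10, 11]" "k < (12::nat)"
  shows "P k"
proof -
  have "[0..<12] = [0, 1, 2, 3, 4, 5, 6, 7, 8, 9, 10, 11]" by (simp add: upt_rec)
  then have "list_all P [0..<12]" using assms(1) by simp
  then show ?thesis using assms(2) by (simp add: list_all_iff)
qed

lemma chi12_mult: "chi12 (a * b) = chi12 a * chi12 b"
proof -
  have "list_all (\<lambda>r. list_all (\<lambda>s. chi12 (r * s) = chi12 r * chi12 s)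
      [0, 1, 2, 3, 4, 5, 6, 7, 8, 9, 10, 11]) [0, 1, 2, 3, 4, 5, 6, 7, 8, 9, 10, 11]"
    by (simp add: chi12_def)
  then have "chi12 ((a mod 12) * (b mod 12)) = chi12 (a mod 12) * chi12 (b mod 12)"
    using all_less_12[of "\<lambda>r. list_all (\<lambda>s. chi12 (r * s) = chi12 r * chi12 s)
      [0, 1, 2, 3, 4, 5, 6, 7, 8, 9, 10, 11]" "a mod 12"]
      all_less_12[of "\<lambda>s. chi12 ((a mod 12) * s) = chi12 (a mod 12) * chi12 s" "b mod 12"]
    by linarith
  then show ?thesis
    by (metis chi12_mod mod_mult_eq)
qed

lemma chi12_6: "chi12 (6 * j + 1) = (-1) ^ j" "j > 0 \<Longrightarrow> chi12 (6 * j - 1) = (-1) ^ j"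
proof -
  have a: "chi12 (12 * i + r) = chi12 r" for i r
    by (simp add: chi12_def)
  obtain i where "j = 2 * i \<or> j = 2 * i + 1" by (metis oddE evenE)
  then show "chi12 (6 * j + 1) = (-1) ^ j"
    using a[of i 1] a[of i 7] by (auto simp: chi12_def)
  assume "j > 0"
  then have "\<exists>i. j = 2 * i + 1 \<or> j = 2 * i + 2" by presburger
  then obtain i where "j = 2 * i + 1 \<or> j = 2 * i + 2" by blast
  then show "chi12 (6 * j - 1) = (-1) ^ j"
    using a[of i 5] a[of i 11] by (auto simp: chi12_def)
qed

lemma chi12_nonzero_cases:
  assumes "chi12 k \<noteq> 0"
  obtains j where "k = 6 * j + 1" | j where "j > 0" "k = 6 * j - 1"
proof -
  have "k mod 12 < 12" by simp
  with assms have "k mod 12 \<in> {1,5,7,11}" by (auto simp: chi12_def split: if_splits)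
  then have "k mod 6 = 1 \<or> k mod 6 = 5"
    by (auto simp: mod_mod_cancel[of 6 12 k, symmetric])
  then show ?thesis
  proof
    assume "k mod 6 = 1"
    then have "k = 6 * (k div 6) + 1" by presburger
    then show ?thesis using that by blast
  next
    assume "k mod 6 = 5"
    then have "k = 6 * (k div 6 + 1) - 1" by presburger
    then show ?thesis using that(2)[of "k div 6 + 1"] by simp
  qed
qed

lemma chi12_square_mod_24:
  assumes "24 * m + 1 = k\<^sup>2" shows "chi12 k \<noteq> 0"
proof -
  have "list_all (\<lambda>r. r\<^sup>2 mod 12 = 1 \<longrightarrow> chi12 r \<noteq> 0) [0, 1, 2, 3, 4, 5, 6, 7, 8, 9, 10, 11]"
    by (simp add: chi12_def)
  from all_less_12[OF this, of "k mod 12"] have "(k mod 12)\<^sup>2 mod 12 = 1 \<longrightarrow> chi12 (k mod 12) \<noteq> 0"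
    by simp
  moreover have "(k mod 12)\<^sup>2 mod 12 = 1"
    unfolding power_mod assms[symmetric] by presburger
  ultimately have "chi12 (k mod 12) \<noteq> 0" by simp
  then show ?thesis by (simp add: chi12_mod)
qed

lemma pentagonal_24: 
  "24 * (j * (3 * j + 1) div 2) + 1 = (6 * j + 1 :: nat)\<^sup>2"
  "j > 0 \<Longrightarrow> 24 * (j * (3 * j - 1) div 2) + 1 = (6 * j - 1 :: nat)\<^sup>2"
proof -
  have "even (j * (3 * j + 1))" by simp
  then have "24 * (j * (3 * j + 1) div 2) = 12 * (j * (3 * j + 1))" by presburger
  then show "24 * (j * (3 * j + 1) div 2) + 1 = (6 * j + 1 :: nat)\<^sup>2"
    by (simp only:) (simp add: power2_eq_square algebra_simps)
  assume "j > 0"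
  then obtain i where j: "j = Suc i" using gr0_implies_Suc by blast
  have "even (j * (3 * j - 1))" using j by simp
  then have "24 * (j * (3 * j - 1) div 2) = 12 * (j * (3 * j - 1))" by presburger
  then show "24 * (j * (3 * j - 1) div 2) + 1 = (6 * j - 1 :: nat)\<^sup>2"
    by (simp only:) (simp add: j power2_eq_square algebra_simps)
qed

lemma square_nat_unique: "k\<^sup>2 = (m::nat) \<Longrightarrow> j\<^sup>2 = m \<Longrightarrow> j = k"
  by (metis power2_eq_iff_nonneg zero_le)

text \<open>Stated through 24m+1: the generalized pentagonal exponents are those with 24m+1 = k^2,
  and k = 6j+1 or k = 6j-1 determines both the index and the sign. In this form the coefficients
  become multiplicative in k, which the Hecke argument needs.\<close>

theorem pentagonal_number_theorem:
  shows "24 * m + 1 = k\<^sup>2 \<Longrightarrow> fps_nth (euler_E 1) m = chi12 k"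
    and "(\<nexists>k. 24 * m + 1 = k\<^sup>2) \<Longrightarrow> fps_nth (euler_E 1) m = 0"
proof -
  \<comment> \<open>With n > m every term with k \<ge> 1 starts beyond q^m, so only the term k = 0,
    the finite product itself, contributes.\<close>
  define n where "n = m + 1"
  have "(\<Sum>k\<in>{1..n}. fps_nth (shanks n k) m) = 0"
  proof (intro sum.neutral ballI)
    fix k assume k: "k \<in> {1..n}"
    then have "m < n * k + k * (k + 1) div 2"
      by (metis atLeastAtMost_iff add.commute add_lessD1 less_add_one mult_le_mono2 n_def nat_mult_1_right
          order_less_le_trans trans_less_add2)
    moreover have "fps_X ^ (n * k + k * (k + 1) div 2) dvd shanks n k"
      unfolding shanks_def by (metis dvd_mult2 dvd_triv_right)
    ultimately show "fps_nth (shanks n k) m = 0"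
      using fps_X_power_dvd_imp_nth_zero by blast
  qed
  moreover have "{..n} = insert 0 {1..n}" by auto
  ultimately have "fps_nth (\<Sum>k\<le>n. shanks n k) m = fps_nth (shanks n 0) m"
    by (simp add: fps_sum_nth)
  also have "shanks n 0 = qpoch n"
    by (simp add: shanks_def qpoch_def atLeast0LessThan)
  finally have E: "fps_nth (euler_E 1) m = fps_nth (\<Sum>k\<le>n. shanks n k) m"
    using euler_E_1_nth[of m n] by (simp add: n_def)
  have E2: "fps_nth (euler_E 1) m = (if m = 0 then 1 else 0) + (\<Sum>j=1..n. (-1) ^ j *
      ((if m = j * (3 * j + 1) div 2 then 1 else 0) + (if m = j * (3 * j - 1) div 2 then 1 else 0)))"
  proof -
    have "fps_nth ((-1) ^ j * (fps_X ^ a + fps_X ^ b)) m =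
        (-1) ^ j * ((if m = a then 1 else 0) + (if m = b then 1 else 0 :: int))" for j a b
      by (cases "even j") (simp_all add: fps_X_power_nth)
    then show ?thesis unfolding E shanks_sum by (simp add: fps_sum_nth del: One_nat_def)
  qed
  show "fps_nth (euler_E 1) m = 0" if no: "\<nexists>k. 24 * m + 1 = k\<^sup>2"
  proof -
    have "m \<noteq> 0" using no by (metis mult_0_right add_0 power_one)
    moreover have "m \<noteq> j * (3 * j + 1) div 2" for j using no pentagonal_24(1)[of j] by metis
    moreover have "m \<noteq> j * (3 * j - 1) div 2" if "j > 0" for j using no pentagonal_24(2)[of j] that by metis
    ultimately show ?thesis unfolding E2 by (auto intro!: sum.neutral)
  qed
  show "fps_nth (euler_E 1) m = chi12 k" if k: "24 * m + 1 = k\<^sup>2"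
  proof -
    have iff1: "m = j * (3 * j + 1) div 2 \<longleftrightarrow> k = 6 * j + 1" for j
    proof
      assume "m = j * (3 * j + 1) div 2"
      then have "(6 * j + 1)\<^sup>2 = 24 * m + 1" using pentagonal_24(1)[of j] by simp
      then show "k = 6 * j + 1" using k square_nat_unique by metis
    next
      assume "k = 6 * j + 1"
      then have "24 * m + 1 = 24 * (j * (3 * j + 1) div 2) + 1" using k pentagonal_24(1)[of j] by simp
      then show "m = j * (3 * j + 1) div 2" by simp
    qed
    have iff2: "m = j * (3 * j - 1) div 2 \<longleftrightarrow> k = 6 * j - 1" if "j > 0" for j
    proof
      assume "m = j * (3 * j - 1) div 2"
      then have "(6 * j - 1)\<^sup>2 = 24 * m + 1" using pentagonal_24(2)[of j] that by simp
      then show "k = 6 * j - 1" using k square_nat_unique by metis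
    next
      assume "k = 6 * j - 1"
      then have "24 * m + 1 = 24 * (j * (3 * j - 1) div 2) + 1" using k pentagonal_24(2)[of j] that by simp
      then show "m = j * (3 * j - 1) div 2" by simp
    qed
    have m0: "m = 0 \<longleftrightarrow> k = 1"
      using iff1[of 0] by simp
    have kk: "k \<le> 24 * m + 1" unfolding k by (simp add: power2_eq_square)
    have E3: "fps_nth (euler_E 1) m = (if k = 1 then 1 else 0) + (\<Sum>j=1..n. (-1) ^ j *
      ((if k = 6 * j + 1 then 1 else 0) + (if k = 6 * j - 1 then 1 else 0)))"
    proof -
      have "(m = j * (3 * j + 1) div 2) = (k = 6 * j + 1)" "(m = j * (3 * j - 1) div 2) = (k = 6 * j - 1)"
        if "j \<in> {1..n}" for j
        using that by (auto intro!: iff1 iff2 simp del: One_nat_def)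
      then show ?thesis unfolding E2 m0 by simp
    qed
    from chi12_square_mod_24[OF k] show ?thesis
    proof (cases rule: chi12_nonzero_cases)
      case (1 j)
      have eq: "m = j * (3 * j + 1) div 2" using iff1 1 by simp
      have "2 * j \<le> j * (3 * j + 1)" by (cases j) auto
      then have "j \<le> m" unfolding eq by linarith
      then have "j = 0 \<or> j \<in> {1..n}" by (auto simp: n_def)
      moreover have "(\<Sum>i=1..n. (-1) ^ i * ((if k = 6 * i + 1 then 1 else 0) + (if k = 6 * i - 1 then 1 else 0)))
          = (\<Sum>i=1..n. if i = j then (-1) ^ i else (0::int))"
      proof (intro sum.cong refl)
        fix i assume "i \<in> {1..n}"
        have "k = 6 * i + 1 \<longleftrightarrow> i = j" "k \<noteq> 6 * i - 1" using 1 by presburger+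
        then show "(-1) ^ i * ((if k = 6 * i + 1 then 1 else 0) + (if k = 6 * i - 1 then 1 else 0))
            = (if i = j then (-1) ^ i else (0::int))" by simp
      qed
      ultimately have "fps_nth (euler_E 1) m = (-1) ^ j" unfolding E3 using 1 by (auto simp del: One_nat_def)
      then show ?thesis using 1 chi12_6(1) by metis
    next
      case (2 j)
      have eq: "m = j * (3 * j - 1) div 2" using iff2 2 by simp
      obtain i where i: "j = Suc i" using 2 gr0_implies_Suc by blast
      have "2 * j \<le> j * (3 * j - 1)" by (simp add: i)
      then have "j \<le> m" unfolding eq by linarith
      then have "j \<in> {1..n}" using 2 by (auto simp: n_def)
      moreover have "(\<Sum>i=1..n. (-1) ^ i * ((if k = 6 * i + 1 then 1 else 0) + (if k = 6 * i - 1 then 1 else 0)))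
          = (\<Sum>i=1..n. if i = j then (-1) ^ i else (0::int))"
      proof (intro sum.cong refl)
        fix i assume "i \<in> {1..n}"
        then have i1: "1 \<le> i" by simp
        have kj: "k + 1 = 6 * j" using 2 by linarith
        have "k \<noteq> 6 * i + 1"
        proof
          assume "k = 6 * i + 1"
          then have "6 * i + 2 = 6 * j" using kj by simp
          then show False by presburger
        qed
        moreover have "k = 6 * i - 1 \<longleftrightarrow> i = j" using kj i1 by auto
        ultimately show "(-1) ^ i * ((if k = 6 * i + 1 then 1 else 0) + (if k = 6 * i - 1 then 1 else 0))
            = (if i = j then (-1) ^ i else (0::int))" by simp
      qed
      moreover have "k \<noteq> 1" using 2 by auto
      ultimately have "fps_nth (euler_E 1) m = (-1) ^ j" unfolding E3 using 2 by (auto simp del: One_nat_def)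
      then show ?thesis using 2 chi12_6(2) by metis
    qed
  qed
qed

section \<open>Dissection of Euler products modulo 5\<close>

subsection \<open>Dilation and sections modulo 5\<close>

definition dil :: "int fps \<Rightarrow> int fps" where
  "dil f = f oo fps_X ^ 5"

definition sect :: "nat \<Rightarrow> int fps \<Rightarrow> int fps" where
  "sect r f = Abs_fps (\<lambda>n. fps_nth f (5 * n + r))"

lemma sect_nth [simp]: "fps_nth (sect r f) n = fps_nth f (5 * n + r)"
  by (simp add: sect_def)

lemma dil_nth: "fps_nth (dil f) n = (if 5 dvd n then fps_nth f (n div 5) else 0)"
proof -
  have "fps_nth (dil f) n = (\<Sum>i=0..n. fps_nth f i * (if n = 5 * i then 1 else 0))"
    by (simp add: dil_def fps_compose_nth fps_X_power_nth flip: power_mult)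
  also have "\<dots> = (\<Sum>i\<in>{0..n}. if i = n div 5 then (if 5 dvd n then fps_nth f i else 0) else 0)"
    by (intro sum.cong refl) auto
  also have "\<dots> = (if 5 dvd n then fps_nth f (n div 5) else 0)"
    by (subst sum.delta) auto
  finally show ?thesis .
qed

lemma dil_mult: "dil (f * g) = dil f * dil g"
  by (simp add: dil_def fps_compose_mult_distrib)
lemma dil_add: "dil (f + g) = dil f + dil g"
  by (simp add: dil_def fps_compose_add_distrib)
lemma dil_uminus: "dil (- f) = - dil f"
  by (simp add: dil_def fps_compose_uminus)
lemma dil_diff: "dil (f - g) = dil f - dil g"
  by (simp add: dil_def fps_compose_sub_distrib)
lemma dil_1: "dil 1 = 1"
  by (simp add: dil_def)
lemma dil_power: "dil (f ^ n) = dil f ^ n"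
  by (simp add: dil_def fps_compose_power)
lemma dil_X: "dil fps_X = fps_X ^ 5"
  by (simp add: dil_def)
lemma dil_prod: "dil (\<Prod>k\<in>A. f k) = (\<Prod>k\<in>A. dil (f k))"
  by (simp add: dil_def fps_compose_prod_distrib)
lemma dil_const: "dil (fps_const c) = fps_const c"
  by (simp add: dil_def)
lemma dil_numeral: "dil (numeral c) = numeral c"
  by (simp add: numeral_fps_const dil_const)
lemma dil_0: "dil 0 = 0"
  by (simp add: dil_def)

lemmas dil_simps = dil_mult dil_add dil_uminus dil_diff dil_1 dil_power dil_X dil_prod dil_const dil_numeral dil_0

lemma dil_eq_iff [simp]: "dil f = dil g \<longleftrightarrow> f = g"
proof
  assume "dil f = dil g"
  then have "fps_nth (dil f) (5 * n) = fps_nth (dil g) (5 * n)" for n by simp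
  then show "f = g" by (simp add: dil_nth fps_eq_iff)
qed simp

lemma sect_add: "sect r (f + g) = sect r f + sect r g"
  by (simp add: fps_eq_iff)
lemma sect_sum: "sect r (\<Sum>i\<in>A. f i) = (\<Sum>i\<in>A. sect r (f i))"
  by (simp add: fps_eq_iff fps_sum_nth)

lemma sect_dil_mult:
  assumes "r < 5"
  shows "sect r (dil g * f) = g * sect r f"
proof (rule fps_ext)
  fix n
  have "fps_nth (sect r (dil g * f)) n
      = (\<Sum>i=0..5*n+r. (if 5 dvd i then fps_nth g (i div 5) else 0) * fps_nth f (5*n+r-i))"
    by (simp add: fps_mult_nth dil_nth)
  also have "\<dots> = (\<Sum>i\<in>(\<lambda>i. 5 * i) ` {0..n}. fps_nth g (i div 5) * fps_nth f (5*n+r-i))"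
  proof (intro sum.mono_neutral_cong_right ballI)
    fix i assume "i \<in> {0..5*n+r} - (\<lambda>i. 5 * i) ` {0..n}"
    then have "\<not> 5 dvd i" using assms by (auto simp: image_iff elim!: dvdE)
    then show "(if 5 dvd i then fps_nth g (i div 5) else 0) * fps_nth f (5*n+r-i) = 0" by simp
  qed auto
  also have "\<dots> = (\<Sum>i=0..n. fps_nth g i * fps_nth f (5*(n-i)+r))"
    by (subst sum.reindex) (auto simp: inj_on_def algebra_simps intro!: sum.cong)
  finally show "fps_nth (sect r (dil g * f)) n = fps_nth (g * sect r f) n"
    by (simp add: fps_mult_nth)
qed

lemma sect_X_power:
  assumes "r < 5"
  shows "sect r (fps_X ^ a * dil g) = (if a mod 5 = r then fps_X ^ (a div 5) * g else 0)"
proof -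
  have "sect r (fps_X ^ a) = (if a mod 5 = r then fps_X ^ (a div 5) else 0)"
  proof -
    have "5 * n + r = a \<longleftrightarrow> a mod 5 = r \<and> n = a div 5" for n
      using assms by auto
    then show ?thesis by (simp add: fps_eq_iff fps_X_power_nth)
  qed
  then show ?thesis
    using sect_dil_mult[OF assms, of g "fps_X ^ a"] by (simp add: mult.commute)
qed

lemma sect_decompose: "f = (\<Sum>r<5. fps_X ^ r * dil (sect r f))"
proof (rule fps_ext)
  fix n
  have "fps_nth (\<Sum>r<5. fps_X ^ r * dil (sect r f)) n
      = (\<Sum>r<5. if r = n mod 5 then fps_nth f n else 0)"
    unfolding fps_sum_nth
  proof (intro sum.cong refl)
    fix r :: nat assume "r \<in> {..<5}"
    then have r: "r < 5" by simp
    show "fps_nth (fps_X ^ r * dil (sect r f)) n = (if r = n mod 5 then fps_nth f n else 0)"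
    proof (cases "r = n mod 5")
      case True
      then have "r \<le> n" "5 dvd n - r" "5 * ((n - r) div 5) + r = n"
        by (auto simp: mod_less_eq_dividend dvd_minus_mod)
      then show ?thesis using True by (simp add: fps_X_power_mult_nth dil_nth)
    next
      case False
      then have "n < r \<or> \<not> 5 dvd n - r" using r by presburger
      then show ?thesis using False by (auto simp: fps_X_power_mult_nth dil_nth)
    qed
  qed
  also have "\<dots> = fps_nth f n" by simp
  finally show "fps_nth f n = fps_nth (\<Sum>r<5. fps_X ^ r * dil (sect r f)) n" by simp
qed

lemma dil_euler_E: "j > 0 \<Longrightarrow> dil (euler_E j) = euler_E (5 * j)"
proof (rule fps_ext)
  fix n assume j: "j > 0"
  have "fps_nth (euler_E (5 * j)) n = fps_nth (dil (\<Prod>k<n. 1 - fps_X ^ (j * (k + 1)))) n"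
    using j by (simp add: euler_E_nth[of "5 * j" n n] dil_simps flip: power_mult)
       (simp add: mult.assoc)
  also have "\<dots> = fps_nth (dil (euler_E j)) n"
    using j by (simp add: dil_nth euler_E_nth[of j "n div 5" n])
  finally show "fps_nth (dil (euler_E j)) n = fps_nth (euler_E (5 * j)) n" by simp
qed

text \<open>24(5n+1)+1 = 5(24n+5). If this is a square, its root is divisible by 5, hence so is n,
  and division by 25 leaves 24(n/5)+1. The sign is chi12(5) = -1.\<close>

lemma euler_sect_1: "sect 1 (euler_E 1) = - euler_E 5"
proof (rule fps_ext)
  fix n
  have E5: "fps_nth (euler_E 5) n = (if 5 dvd n then fps_nth (euler_E 1) (n div 5) else 0)"
    unfolding dil_euler_E[of 1, simplified, symmetric] by (simp add: dil_nth)
  show "fps_nth (sect 1 (euler_E 1)) n = fps_nth (- euler_E 5) n"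
  proof (cases "\<exists>k. 24 * (5 * n + 1) + 1 = k\<^sup>2")
    case True
    then obtain k where k: "24 * (5 * n + 1) + 1 = k\<^sup>2" by blast
    then have "5 dvd k\<^sup>2" by presburger
    then have "5 dvd k" by (simp add: prime_dvd_power_nat)
    then obtain k1 where k1: "k = 5 * k1" by blast
    then have "24 * n + 5 = 5 * k1\<^sup>2" using k by (simp add: power2_eq_square)
    then have "5 dvd n" by presburger
    then obtain n1 where n1: "n = 5 * n1" by blast
    then have "24 * n1 + 1 = k1\<^sup>2" using \<open>24 * n + 5 = 5 * k1\<^sup>2\<close> by simp
    then have "fps_nth (euler_E 1) n1 = chi12 k1" by (rule pentagonal_number_theorem)
    moreover have "fps_nth (euler_E 1) (5 * n + 1) = chi12 k" using k by (rule pentagonal_number_theorem)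
    moreover have "chi12 5 = -1" by (simp add: chi12_def)
    ultimately show ?thesis using n1 k1 E5 by (simp add: chi12_mult del: One_nat_def)
  next
    case False
    have "fps_nth (euler_E 5) n = 0"
    proof (cases "5 dvd n")
      case True
      then obtain n1 where n1: "n = 5 * n1" by blast
      have "24 * n1 + 1 \<noteq> k\<^sup>2" for k
      proof
        assume "24 * n1 + 1 = k\<^sup>2"
        then have "24 * (5 * n + 1) + 1 = (5 * k)\<^sup>2" using n1 by (simp add: power2_eq_square)
        with False show "False" by blast
      qed
      then show ?thesis using pentagonal_number_theorem(2)[of n1] n1 E5 by simp
    qed (simp add: E5)
    then show ?thesis using pentagonal_number_theorem(2)[OF False] by simp
  qed
qed

text \<open>For these r the number 24r+1 is 3 or 2 modulo 5, a quadratic nonresidue.\<close>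

lemma euler_sect_34: "r = 3 \<or> r = 4 \<Longrightarrow> sect r (euler_E 1) = 0"
proof (rule fps_ext)
  fix n assume r: "r = 3 \<or> r = 4"
  have "24 * (5 * n + r) + 1 \<noteq> k\<^sup>2" for k
  proof
    assume "24 * (5 * n + r) + 1 = k\<^sup>2"
    then have "k\<^sup>2 = 24 * r + 1 + 5 * (24 * n)" by simp
    then have "k\<^sup>2 mod 5 = (24 * r + 1) mod 5" by (simp only: mod_mult_self2)
    moreover have "k\<^sup>2 mod 5 = (k mod 5)\<^sup>2 mod 5" by (simp add: power_mod)
    moreover have "k mod 5 = 0 \<or> k mod 5 = 1 \<or> k mod 5 = 2 \<or> k mod 5 = 3 \<or> k mod 5 = 4" by (rule mod_5_cases)
    ultimately show False using r by auto
  qed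
  then show "fps_nth (sect r (euler_E 1)) n = fps_nth 0 n"
    using pentagonal_number_theorem(2) by auto
qed

text \<open>If R denotes the Rogers-Ramanujan continued fraction without its factor q^(1/5), then
  \<open>diss_a\<close> = E_5/R and \<open>diss_c\<close> = E_5 R.\<close>

definition diss_a :: "int fps" where "diss_a = sect 0 (euler_E 1)"
definition diss_c :: "int fps" where "diss_c = - sect 2 (euler_E 1)"

lemma euler_E_dissection:
  "euler_E 1 = dil diss_a - fps_X * dil (euler_E 5) - fps_X\<^sup>2 * dil diss_c"
proof -
  have "{..<5::nat} = {0,1,2,3,4}" by auto
  then have "euler_E 1 = dil (sect 0 (euler_E 1)) + fps_X * dil (sect 1 (euler_E 1))
     + fps_X\<^sup>2 * dil (sect 2 (euler_E 1)) + fps_X ^ 3 * dil (sect 3 (euler_E 1)) + fps_X ^ 4 * dil (sect 4 (euler_E 1))"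
    using sect_decompose[of "euler_E 1"] by (simp add: add.assoc)
  then show ?thesis
    by (simp add: euler_sect_1 euler_sect_34 dil_simps diss_a_def diss_c_def del: One_nat_def)
qed

subsection \<open>Vanishing of one section of the cube\<close>

text \<open>Gaussian binomials through the q-Pascal rule, which makes them power series by
  construction; the quotient form is recovered in \<open>qbin_qpoch\<close>.\<close>

fun qbin :: "nat \<Rightarrow> nat \<Rightarrow> int fps" where
  "qbin N 0 = 1"
| "qbin 0 (Suc k) = 0"
| "qbin (Suc N) (Suc k) = fps_X ^ (k + 1) * qbin N (Suc k) + qbin N k"

lemma qbin_eq_0: "N < k \<Longrightarrow> qbin N k = 0"
  by (induction N k rule: qbin.induct) auto

lemma qbin_qpoch: "k \<le> N \<Longrightarrow> qbin N k * qpoch k * qpoch (N - k) = qpoch N"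
proof (induction N k rule: qbin.induct)
  case (3 N k)
  show ?case
  proof (cases "k < N")
    case True
    have e: "Suc (k + (N - Suc k)) = N" using True by simp
    have q: "qpoch (N - k) = (1 - fps_X ^ (N - k)) * qpoch (N - Suc k)"
      using qpoch_Suc[of "N - Suc k"] True by (simp add: Suc_diff_Suc)
    have "qbin (Suc N) (Suc k) * qpoch (Suc k) * qpoch (Suc N - Suc k) =
       fps_X ^ (k + 1) * (1 - fps_X ^ (N - k)) * (qbin N (Suc k) * qpoch (Suc k) * qpoch (N - Suc k))
       + (1 - fps_X ^ (k + 1)) * (qbin N k * qpoch k * qpoch (N - k))"
      unfolding q diff_Suc_Suc by (simp add: q qpoch_Suc algebra_simps)
    also have "\<dots> = (fps_X ^ (k + 1) * (1 - fps_X ^ (N - k)) + (1 - fps_X ^ (k + 1))) * qpoch N"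
      using 3 True by (simp add: algebra_simps)
    also have "fps_X ^ (k + 1) * (1 - fps_X ^ (N - k)) + (1 - fps_X ^ (k + 1)) = (1 - fps_X ^ (N + 1) :: int fps)"
      using True by (simp add: algebra_simps flip: power_add power_Suc)
    finally show ?thesis by (simp add: qpoch_Suc)
  next
    case False
    then have "k = N" using 3 by simp
    then show ?thesis using 3(2) qbin_eq_0[of N "Suc N"] by (simp add: qpoch_Suc algebra_simps qpoch_def)
  qed
qed (auto simp: qpoch_def)

text \<open>Homogeneous in x and y so that x can be specialised to a power of q, which centres the
  exponents at the middle index.\<close>

lemma qbinomial_theorem:
  fixes x y :: "int fps poly"
  shows "(\<Prod>i<N. x + [:fps_X ^ i:] * y) =
    (\<Sum>k\<le>N. [:fps_X ^ (k * (k - 1) div 2) * qbin N k:] * x ^ (N - k) * y ^ k)"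
proof (induction N arbitrary: y)
  case (Suc N)
  let ?c = "\<lambda>N k. [:fps_X ^ (k * (k - 1) div 2) * qbin N k:] :: int fps poly"
  define z where "z = [:fps_X:] * y"
  have tri: "Suc k * (Suc k - 1) div 2 = k * (k - 1) div 2 + k" for k :: nat
    by (cases k) (simp_all add: algebra_simps)
  have hom: "[:f * g:] = [:f:] * [:g:]" "[:f ^ n:] = [:f:] ^ n" "[:f + g:] = [:f:] + [:g:]" for f g :: "int fps" and n
    by (simp_all add: poly_const_pow)
  have "(\<Prod>i<Suc N. x + [:fps_X ^ i:] * y) = (x + y) * (\<Prod>i<N. x + [:fps_X ^ i:] * z)"
    unfolding prod.lessThan_Suc_shift by (simp add: z_def mult_ac hom)
  also have "\<dots> = (x + y) * (\<Sum>k\<le>N. ?c N k * x ^ (N - k) * z ^ k)"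
    by (simp only: Suc.IH)
  also have "\<dots> = (\<Sum>k\<le>N. ?c N k * x ^ (Suc N - k) * z ^ k) + (\<Sum>k\<le>N. y * ?c N k * x ^ (N - k) * z ^ k)"
    by (simp add: distrib_right sum_distrib_left Suc_diff_le mult_ac smult_add_right sum.distrib)
  also have "(\<Sum>k\<le>N. ?c N k * x ^ (Suc N - k) * z ^ k) = (\<Sum>k\<le>Suc N. ?c N k * x ^ (Suc N - k) * z ^ k)"
    by (simp add: qbin_eq_0)
  also have "\<dots> = x ^ Suc N + (\<Sum>k\<le>N. ?c N (Suc k) * x ^ (N - k) * z ^ Suc k)"
    unfolding sum.atMost_Suc_shift by (simp add: one_pCons[symmetric])
  also have "\<dots> + (\<Sum>k\<le>N. y * ?c N k * x ^ (N - k) * z ^ k) =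
      x ^ Suc N + (\<Sum>k\<le>N. ?c (Suc N) (Suc k) * x ^ (N - k) * y ^ Suc k)"
    unfolding add.assoc sum.distrib[symmetric]
  proof (intro arg_cong2[of _ _ _ _ "(+)"] refl sum.cong)
    fix k
    show "?c N (Suc k) * x ^ (N - k) * z ^ Suc k + y * ?c N k * x ^ (N - k) * z ^ k =
        ?c (Suc N) (Suc k) * x ^ (N - k) * y ^ Suc k"
      unfolding tri qbin.simps z_def power_mult_distrib hom(1) distrib_left hom(3)
      by (simp only: hom power_add power_Suc power_one_right) (simp add: algebra_simps)
  qed
  also have "\<dots> = (\<Sum>k\<le>Suc N. ?c (Suc N) k * x ^ (Suc N - k) * y ^ k)"
    unfolding sum.atMost_Suc_shift by (simp add: one_pCons[symmetric])
  finally show ?case .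
qed (simp add: one_pCons[symmetric])

lemma two_tri: "2 * (r * (r - 1) div 2) = r * (r - 1 :: nat)" "2 * (r * (r + 1) div 2) = r * (r + 1 :: nat)"
proof -
  show "2 * (r * (r + 1) div 2) = r * (r + 1)" for r :: nat
    by (rule dvd_mult_div_cancel) simp
  from this[of "r - 1"] show "2 * (r * (r - 1) div 2) = r * (r - 1)"
    by (cases r) (simp_all add: mult.commute)
qed

lemma sum_lessThan_triangle: "(\<Sum>i<m. i) = m * (m - 1) div (2::nat)"
proof (induction m)
  case (Suc m)
  have "m * (m - 1) + 2 * m = Suc m * (Suc m - 1)" by (cases m) simp_all
  then have "m * (m - 1) div 2 + m = Suc m * (Suc m - 1) div 2"
    using two_tri(1)[of m] two_tri(1)[of "Suc m"] by linarith
  then show ?case using Suc by simp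
qed simp

lemma pderiv_sum: "pderiv (\<Sum>i\<in>A. f i) = (\<Sum>i\<in>A. pderiv (f i))"
  by (induction A rule: infinite_finite_induct) (auto simp: pderiv_add)

text \<open>The triangular exponent (k-m)(k-m-1)/2 of the centred index k-m; the case split avoids
  truncated subtraction.\<close>

definition tri_offset :: "nat \<Rightarrow> nat \<Rightarrow> nat" where
  "tri_offset m k = (if m \<le> k then (k - m) * (k - m - 1) div 2 else (m - k) * (m - k + 1) div 2)"

lemma tri_offset_shift:
  assumes "k \<le> 2 * m"
  shows "k * (k - 1) div 2 + m * (2 * m - k) = m * (m - 1) div 2 + m * m + tri_offset m k"
proof -
  have i: "int (2 * (r * (r - 1) div 2)) = int r * (int r - 1)" for r
    unfolding two_tri by (cases r) (simp_all add: algebra_simps)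
  have i2: "int (2 * (r * (r + 1) div 2)) = int r * (int r + 1)" for r
    unfolding two_tri by (simp add: algebra_simps)
  have "int (2 * tri_offset m k) = (int k - int m) * (int k - int m - 1)"
    unfolding tri_offset_def
  proof (split if_split, intro conjI impI)
    assume "m \<le> k"
    then show "int (2 * ((k - m) * (k - m - 1) div 2)) = (int k - int m) * (int k - int m - 1)"
      unfolding i by (simp add: of_nat_diff)
  next
    assume "\<not> m \<le> k"
    then show "int (2 * ((m - k) * (m - k + 1) div 2)) = (int k - int m) * (int k - int m - 1)"
      unfolding i2 by (simp add: of_nat_diff algebra_simps)
  qed
  moreover have "int (2 * (k * (k - 1) div 2) + 2 * (m * (2 * m - k)))
      = int k * (int k - 1) + 2 * (int m * (2 * int m - int k))"
    using assms by (simp only: of_nat_add i) (simp add: of_nat_diff algebra_simps)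
  moreover have "int (2 * (m * (m - 1) div 2) + 2 * (m * m)) = int m * (int m - 1) + 2 * (int m * int m)"
    by (simp only: of_nat_add i) simp
  ultimately have "int (2 * (k * (k - 1) div 2) + 2 * (m * (2 * m - k)))
      = int (2 * (m * (m - 1) div 2) + 2 * (m * m) + 2 * tri_offset m k)"
    by (simp only: of_nat_add) (simp add: algebra_simps)
  then have "2 * (k * (k - 1) div 2) + 2 * (m * (2 * m - k)) = 2 * (m * (m - 1) div 2) + 2 * (m * m) + 2 * tri_offset m k"
    by (simp only: of_nat_eq_iff)
  then show ?thesis by linarith
qed

text \<open>Finite form of Jacobi's series for E_1^3. In the q-binomial theorem with 2m factors one
  factor vanishes at 1, so the derivative at 1 leaves the product of all other factors on the left
  and the weights k on the right.\<close>

lemma finite_jacobi: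
  assumes "m > 0"
  shows "(-1) ^ (m + 1) * qpoch m * qpoch (m - 1) =
    (\<Sum>k\<le>2*m. of_int ((-1) ^ k * (int k - int m)) * fps_X ^ tri_offset m k * qbin (2 * m) k)"
proof -
  define e where "e = m * (m - 1) div 2 + m * m"
  \<comment> \<open>Minus the polynomial variable: this makes 1 + z vanish at 1 and brings in the
    alternating signs.\<close>
  define z :: "int fps poly" where "z = [:0, -1:]"
  define F :: "int fps poly" where
    "F = (\<Prod>i<m. [:fps_X ^ (m - i):] + z) * (\<Prod>i\<in>{1..<m}. 1 + [:fps_X ^ i:] * z)"
  have hom: "[:f * g:] = [:f:] * [:g:]" "[:f ^ n:] = [:f:] ^ n" for f g :: "int fps" and n
    by (simp_all add: poly_const_pow)
  have "(\<Prod>i<2*m. [:fps_X ^ m:] + [:fps_X ^ i:] * z)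
      = (\<Prod>i<m. [:fps_X ^ m:] + [:fps_X ^ i:] * z) * (\<Prod>i<m. [:fps_X ^ m:] + [:fps_X ^ (m + i):] * z)"
  proof -
    have "(\<Prod>i\<in>{0..<m}. f i) * (\<Prod>i\<in>{0..<m}. f (i + m)) = (\<Prod>i\<in>{0..<2*m}. f i)" for f :: "nat \<Rightarrow> int fps poly"
      using prod.atLeastLessThan_concat[of 0 m "2 * m" f] prod.shift_bounds_nat_ivl[of f 0 m m] by (simp add: mult_2)
    from this[of "\<lambda>i. [:fps_X ^ m:] + [:fps_X ^ i:] * z"] show ?thesis
      unfolding lessThan_atLeast0 add.commute[of m] by (rule sym)
  qed
  also have "(\<Prod>i<m. [:fps_X ^ m:] + [:fps_X ^ i:] * z) = (\<Prod>i<m. [:fps_X ^ i:] * ([:fps_X ^ (m - i):] + z))"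
    by (intro prod.cong refl) (simp add: distrib_left flip: hom power_add)
  also have "\<dots> = [:fps_X ^ (m * (m - 1) div 2):] * (\<Prod>i<m. [:fps_X ^ (m - i):] + z)"
    by (simp only: prod.distrib hom power_sum[symmetric] sum_lessThan_triangle)
  also have "(\<Prod>i<m. [:fps_X ^ m:] + [:fps_X ^ (m + i):] * z) = (\<Prod>i<m. [:fps_X ^ m:] * (1 + [:fps_X ^ i:] * z))"
    by (intro prod.cong refl) (simp add: distrib_left power_add hom)
  also have "\<dots> = [:fps_X ^ (m * m):] * (\<Prod>i<m. 1 + [:fps_X ^ i:] * z)"
    by (simp only: prod.distrib prod_constant card_lessThan hom power_mult)
  also have "(\<Prod>i<m. 1 + [:fps_X ^ i:] * z) = (1 + z) * (\<Prod>i\<in>{1..<m}. 1 + [:fps_X ^ i:] * z)"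
    using assms by (simp add: lessThan_atLeast0 prod.atLeast_Suc_lessThan one_pCons[symmetric])
  finally have L: "(\<Prod>i<2*m. [:fps_X ^ m:] + [:fps_X ^ i:] * z) = [:fps_X ^ e:] * ((1 + z) * F)"
    by (simp add: F_def e_def power_add hom mult_ac)
  define cc where "cc = (\<lambda>k. fps_X ^ e * (fps_X ^ tri_offset m k * qbin (2 * m) k) * (-1) ^ k :: int fps)"
  have "(\<Prod>i<2*m. [:fps_X ^ m:] + [:fps_X ^ i:] * z) = (\<Sum>k\<le>2*m. Polynomial.monom (cc k) k)"
    unfolding qbinomial_theorem
  proof (intro sum.cong refl)
    fix k assume "k \<in> {..2*m}"
    then have k: "k \<le> 2 * m" by simp
    have zk: "z ^ k = Polynomial.monom ((-1) ^ k) k"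
      by (induction k) (simp_all add: z_def one_pCons monom_altdef)
    have "fps_X ^ (k * (k - 1) div 2) * qbin (2 * m) k * (fps_X ^ m) ^ (2 * m - k)
        = (fps_X ^ (k * (k - 1) div 2 + m * (2 * m - k)) * qbin (2 * m) k :: int fps)"
      by (simp add: power_add power_mult mult_ac)
    also have "\<dots> = fps_X ^ e * (fps_X ^ tri_offset m k * qbin (2 * m) k)"
      unfolding tri_offset_shift[OF k] by (simp add: e_def power_add mult_ac)
    finally show "[:fps_X ^ (k * (k - 1) div 2) * qbin (2 * m) k:] * [:fps_X ^ m:] ^ (2 * m - k) * z ^ k
        = Polynomial.monom (cc k) k"
      unfolding hom(2)[symmetric] hom(1)[symmetric] zk by (simp add: cc_def smult_monom)
  qed
  with L have main: "[:fps_X ^ e:] * ((1 + z) * F) = (\<Sum>k\<le>2*m. Polynomial.monom (cc k) k)" by simp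
  have "poly ([:fps_X ^ e:] * ((1 + z) * F)) 1 = (\<Sum>k\<le>2*m. cc k)"
    unfolding main by (simp add: poly_sum poly_monom)
  then have s0: "(\<Sum>k\<le>2*m. cc k) = 0" by (simp add: z_def)
  have "poly (pderiv ([:fps_X ^ e:] * ((1 + z) * F))) 1 = (\<Sum>k\<le>2*m. of_nat k * cc k)"
    unfolding main by (simp add: pderiv_sum pderiv_monom poly_sum poly_monom)
  moreover have "poly (pderiv ([:fps_X ^ e:] * ((1 + z) * F))) 1 = - (fps_X ^ e * poly F 1)"
    by (simp add: pderiv_mult pderiv_smult pderiv_add pderiv_pCons z_def)
  \<comment> \<open>The value at 1 before differentiation is zero, so m times it may be subtracted;
    this centres the weight k to k - m.\<close>
  ultimately have "- (fps_X ^ e * poly F 1) = (\<Sum>k\<le>2*m. of_nat k * cc k) - of_nat m * (\<Sum>k\<le>2*m. cc k)"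
    unfolding s0 by simp
  also have "\<dots> = (\<Sum>k\<le>2*m. (of_nat k - of_nat m) * cc k)"
    by (simp add: sum_distrib_left sum_subtractf left_diff_distrib)
  also have "\<dots> = fps_X ^ e * (\<Sum>k\<le>2*m. of_int ((-1) ^ k * (int k - int m)) * fps_X ^ tri_offset m k * qbin (2 * m) k)"
    by (simp add: sum_distrib_left cc_def mult_ac)
  finally have "fps_X ^ e * (- poly F 1) = fps_X ^ e * (\<Sum>k\<le>2*m. of_int ((-1) ^ k * (int k - int m)) * fps_X ^ tri_offset m k * qbin (2 * m) k)"
    by simp
  then have "- poly F 1 = (\<Sum>k\<le>2*m. of_int ((-1) ^ k * (int k - int m)) * fps_X ^ tri_offset m k * qbin (2 * m) k)"
    by (rule mult_left_cancel[THEN iffD1, rotated]) simp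
  moreover have "poly F 1 = (-1) ^ m * qpoch m * qpoch (m - 1)"
  proof -
    have "(\<Prod>i<m. fps_X ^ (m - i) - 1 :: int fps) = (\<Prod>i<m. fps_X ^ (i + 1) - 1)"
      by (rule prod.reindex_bij_witness[of _ "\<lambda>i. m - 1 - i" "\<lambda>i. m - 1 - i"])
        (auto simp: Suc_diff_Suc simp del: power_Suc)
    also have "\<dots> = (\<Prod>i<m. (-1) * (1 - fps_X ^ (i + 1)))" by simp
    also have "\<dots> = (-1) ^ m * qpoch m" unfolding prod.distrib by (simp add: qpoch_def)
    finally have 1: "(\<Prod>i<m. fps_X ^ (m - i) - 1 :: int fps) = (-1) ^ m * qpoch m" .
    have 2: "(\<Prod>i\<in>{1..<m}. 1 - fps_X ^ i :: int fps) = qpoch (m - 1)"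
      unfolding qpoch_def
      by (rule prod.reindex_bij_witness[of _ "\<lambda>i. i + 1" "\<lambda>i. i - 1"]) auto
    show ?thesis unfolding F_def by (simp add: poly_prod z_def 1 2[simplified])
  qed
  ultimately show ?thesis by simp
qed

definition part_gf :: "int fps" where
  "part_gf = fps_right_inverse (euler_E 1) 1"

lemma euler_part: "euler_E 1 * part_gf = 1"
  unfolding part_gf_def by (rule fps_right_inverse) simp

text \<open>The three finite products in \<open>qbin_qpoch\<close> agree with E_1 up to the given
  order, so the Gaussian binomial is 1/E_1 to that order.\<close>

lemma qbin_euler_cong:
  assumes "k \<le> N"
  shows "fps_X ^ (min k (N - k) + 1) dvd qbin N k * euler_E 1 - 1"
proof -
  let ?d = "fps_X ^ (min k (N - k) + 1) :: int fps"
  have le: "?d dvd euler_E 1 - qpoch M" if "min k (N - k) \<le> M" for M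
    using that by (intro dvd_trans[OF le_imp_power_dvd euler_E_1_cong[of M]]) simp
  have "?d dvd euler_E 1 - qpoch k" "?d dvd euler_E 1 - qpoch (N - k)" "?d dvd euler_E 1 - qpoch N"
    by (rule le, use assms in simp)+
  moreover have "qbin N k * euler_E 1 * euler_E 1 - euler_E 1 =
     qbin N k * (euler_E 1 - qpoch k) * euler_E 1 + qbin N k * qpoch k * (euler_E 1 - qpoch (N - k))
      - (euler_E 1 - qpoch N)"
    using qbin_qpoch[OF assms] by (simp add: algebra_simps)
  ultimately have "?d dvd qbin N k * euler_E 1 * euler_E 1 - euler_E 1"
    by (metis dvd_diff dvd_add dvd_mult2[OF dvd_mult] dvd_mult)
  then have "?d dvd (qbin N k * euler_E 1 * euler_E 1 - euler_E 1) * part_gf" by (rule dvd_mult2)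
  also have "(qbin N k * euler_E 1 * euler_E 1 - euler_E 1) * part_gf = (qbin N k * euler_E 1 - 1) * (euler_E 1 * part_gf)"
    by (simp add: algebra_simps)
  finally show ?thesis by (simp only: euler_part mult_1_right)
qed

text \<open>Twice a triangular number is r(r+1), which is 0, 1 or 2 modulo 5 and never 4.\<close>

lemma tri_offset_mod_5: "tri_offset m k mod 5 \<noteq> 2"
proof -
  have *: "(r * (r + 1) div 2) mod 5 \<noteq> 2" for r :: nat
  proof
    assume a: "(r * (r + 1) div 2) mod 5 = 2"
    have "r * (r + 1) = 2 * (r * (r + 1) div 2)" by simp
    from arg_cong[OF this, of "\<lambda>x. x mod 5"] have "(r * (r + 1)) mod 5 = 2 * (r * (r + 1) div 2) mod 5" .
    also have "\<dots> = 2 * ((r * (r + 1) div 2) mod 5) mod 5" by (rule mod_mult_right_eq[symmetric])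
    also have "\<dots> = 4" unfolding a by simp
    finally have "(r * (r + 1)) mod 5 = 4" .
    moreover have "(r * (r + 1)) mod 5 = ((r mod 5) * ((r + 1) mod 5)) mod 5"
      by (rule mod_mult_eq[symmetric])
    moreover have "r mod 5 = 0 \<or> r mod 5 = 1 \<and> (r + 1) mod 5 = 2 \<or> r mod 5 = 2 \<and> (r + 1) mod 5 = 3
        \<or> r mod 5 = 3 \<and> (r + 1) mod 5 = 4 \<or> (r + 1) mod 5 = 0" using mod_5_cases[of r] by (auto simp: mod_Suc)
    ultimately show False by auto
  qed
  have "(r * (r - 1) div 2) mod 5 \<noteq> 2" for r :: nat
    using *[of "r - 1"] by (cases r) (simp_all add: mult.commute)
  from *[of "m - k"] this[of "k - m"] show ?thesis unfolding tri_offset_def by (cases "m \<le> k") simp_all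
qed

text \<open>Jacobi's series for E_1^3 has only triangular exponents, none of them 2 modulo 5. The
  finite form is multiplied by E_1, which turns each relevant Gaussian binomial into 1 up to high
  order.\<close>

lemma euler_cube_sect_2: "sect 2 (euler_E 1 ^ 3) = 0"
proof (rule fps_ext)
  fix n0 :: nat
  define n where "n = 5 * n0 + 2"
  \<comment> \<open>Large enough for the coefficient of q^n: an offset below n forces k to stay
    within n+1 of m, and then both k and 2m-k are at least n.\<close>
  define m where "m = 2 * n + 2"
  have d: "fps_X ^ (n + 1) dvd euler_E 1 - qpoch m" "fps_X ^ (n + 1) dvd euler_E 1 - qpoch (m - 1)"
    by (rule dvd_trans[OF _ euler_E_1_cong]; simp add: m_def le_imp_power_dvd)+
  have "euler_E 1 ^ 3 - qpoch m * qpoch (m - 1) * euler_E 1 =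
    (euler_E 1 - qpoch m) * (euler_E 1 * euler_E 1) + (euler_E 1 - qpoch (m - 1)) * (qpoch m * euler_E 1)"
    by (simp add: algebra_simps power3_eq_cube)
  with d have "fps_X ^ (n + 1) dvd euler_E 1 ^ 3 - qpoch m * qpoch (m - 1) * euler_E 1"
    by (auto intro!: dvd_add dvd_mult2)
  then have "fps_nth (euler_E 1 ^ 3) n = fps_nth (qpoch m * qpoch (m - 1) * euler_E 1) n"
    using fps_X_power_dvd_imp_nth_zero[of "n + 1" "euler_E 1 ^ 3 - qpoch m * qpoch (m - 1) * euler_E 1" n]
    by simp
  also have "qpoch m * qpoch (m - 1) * euler_E 1 = (-1) ^ (m + 1) * ((-1) ^ (m + 1) * qpoch m * qpoch (m - 1)) * euler_E 1"
  proof -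
    have sq: "(-1) ^ (m + 1) * (-1) ^ (m + 1) = (1 :: int fps)"
      unfolding power_mult_distrib[symmetric] by simp
    show ?thesis by (simp only: mult.assoc[symmetric] sq mult_1_left)
  qed
  also have "(-1) ^ (m + 1) * qpoch m * qpoch (m - 1) = (\<Sum>k\<le>2*m. of_int ((-1) ^ k * (int k - int m)) * fps_X ^ tri_offset m k * qbin (2 * m) k)"
    by (rule finite_jacobi) (simp add: m_def)
  also have "(-1) ^ (m + 1) * \<dots> * euler_E 1 =
     (\<Sum>k\<le>2*m. of_int ((-1) ^ (m + 1) * (-1) ^ k * (int k - int m)) * (fps_X ^ tri_offset m k * (qbin (2 * m) k * euler_E 1)))"
    unfolding sum_distrib_left sum_distrib_right
    by (intro sum.cong refl) (simp only: of_int_mult of_int_power of_int_minus of_int_1 mult.assoc)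
  also have "fps_nth \<dots> n = 0"
    unfolding fps_sum_nth
  proof (intro sum.neutral ballI)
    fix k assume "k \<in> {..2*m}"
    then have k: "k \<le> 2 * m" by simp
    have "fps_nth (fps_X ^ tri_offset m k * (qbin (2 * m) k * euler_E 1)) n = 0"
    proof (cases "n < tri_offset m k")
      case False
      have "n \<noteq> tri_offset m k" proof -
        have "n mod 5 = 2" unfolding n_def by presburger
        then show ?thesis using tri_offset_mod_5[of m k] by metis
      qed
      with False have lt: "tri_offset m k < n" by simp
      have r1: "r - 1 \<le> r * (r - 1) div 2" "r \<le> r * (r + 1) div 2" for r :: nat
      proof -
        have "2 * (r - 1) \<le> r * (r - 1)" by (cases "r < 2") (auto intro: mult_le_mono1)
        then show "r - 1 \<le> r * (r - 1) div 2" by linarith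
        have "2 * r \<le> r * (r + 1)" by (cases r) auto
        then show "r \<le> r * (r + 1) div 2" by linarith
      qed
      have "k \<le> m + n + 1 \<and> m \<le> k + n"
      proof (cases "m \<le> k")
        case True
        then have "k - m - 1 < n" using lt r1(1)[of "k - m"] unfolding tri_offset_def by simp
        then show ?thesis using True by linarith
      next
        case False
        then have "m - k < n" using lt r1(2)[of "m - k"] unfolding tri_offset_def by simp
        then show ?thesis using False by linarith
      qed
      then have "n \<le> min k (2 * m - k)" unfolding m_def by auto
      then have "n - tri_offset m k < min k (2 * m - k) + 1" by linarith
      from fps_X_power_dvd_imp_nth_zero[OF qbin_euler_cong[OF k] this]
      have "fps_nth (qbin (2 * m) k * euler_E 1) (n - tri_offset m k) = 0" using lt by simp
      then show ?thesis by (simp add: fps_X_power_mult_nth)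
    qed (simp add: fps_X_power_mult_nth)
    then show "fps_nth (of_int ((-1) ^ (m + 1) * (-1) ^ k * (int k - int m)) * (fps_X ^ tri_offset m k * (qbin (2 * m) k * euler_E 1))) n = 0"
      by (simp only: fps_of_int[symmetric] fps_mult_left_const_nth mult_zero_right)
  qed
  finally show "fps_nth (sect 2 (euler_E 1 ^ 3)) n0 = fps_nth 0 n0" by (simp add: n_def)
qed

text \<open>Cubing the dissection with parts a, b = E_5, c gives 3a(b^2 - ac) in class 2 modulo 5.
  This section vanishes, and a has constant term 1.\<close>

lemma diss_ac: "diss_a * diss_c = euler_E 5 ^ 2"
proof -
  define b where "b = euler_E 5"
  note E = euler_E_dissection[folded b_def]
  have E3: "euler_E 1 ^ 3 = fps_X ^ 0 * dil (diss_a ^ 3) + fps_X ^ 1 * dil (- 3 * diss_a\<^sup>2 * b) + fps_X ^ 2 * dil (3 * diss_a * b\<^sup>2 - 3 * diss_a\<^sup>2 * diss_c)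
    + fps_X ^ 3 * dil (6 * diss_a * b * diss_c - b ^ 3) + fps_X ^ 4 * dil (3 * diss_a * diss_c\<^sup>2 - 3 * b\<^sup>2 * diss_c)
    + fps_X ^ 5 * dil (- 3 * b * diss_c\<^sup>2) + fps_X ^ 6 * dil (- (diss_c ^ 3))"
    unfolding E dil_simps by (simp add: algebra_simps power_numeral_reduce)
  have "sect 2 (euler_E 1 ^ 3) = 3 * diss_a * b\<^sup>2 - 3 * diss_a\<^sup>2 * diss_c"
    unfolding E3 sect_add by (subst sect_X_power, simp)+ simp
  also have "\<dots> = 3 * diss_a * (b\<^sup>2 - diss_a * diss_c)"
    by (simp add: right_diff_distrib power2_eq_square mult.assoc)
  finally have "3 * diss_a * (b\<^sup>2 - diss_a * diss_c) = 0"
    unfolding euler_cube_sect_2 by (rule sym)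
  moreover have "fps_nth diss_a 0 = 1" by (simp add: diss_a_def)
  then have "3 * diss_a \<noteq> 0" by (auto simp: numeral_fps_const)
  ultimately have "b\<^sup>2 - diss_a * diss_c = 0" by (metis mult_eq_0_iff)
  then show ?thesis by (simp add: b_def)
qed

text \<open>The difference of the two sides is a multiple of y^2 - Az. With A, y, z taken from the
  dissection of E_1 it becomes the modular equation of degree 5, in which the coefficients of the
  powers of E_1 involve y only.\<close>

lemma diss_poly_identity:
  fixes A y z :: "'a::comm_ring_1"
  assumes "A * z = y\<^sup>2"
  shows "(A-y-z)^5 + 5*y*(A-y-z)^4 + 15*y^2*(A-y-z)^3 + 25*y^3*(A-y-z)^2 + 25*y^4*(A-y-z) = A^5 - 11*y^5 - z^5"
proof -
  have "(A-y-z)^5 + 5*y*(A-y-z)^4 + 15*y^2*(A-y-z)^3 + 25*y^3*(A-y-z)^2 + 25*y^4*(A-y-z) - (A^5 - 11*y^5 - z^5)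
     = (y^2 - A*z) * (5*A*y^2 + 10*A*z^2 - 10*A^2*z + 5*A^3 - 5*y^2*z - 5*z^3)"
    by (simp add: algebra_simps power_numeral_reduce)
  with assms show ?thesis by simp
qed

lemma cyclotomic_product:
  fixes z Y :: "'a::comm_ring_1"
  assumes "1 + z + z^2 + z^3 + z^4 = 0"
  shows "(1-Y) * (1 - z*Y) * (1 - z^2*Y) * (1 - z^3*Y) * (1 - z^4*Y) = 1 - Y^5"
proof -
  have "(1-Y) * (1 - z*Y) * (1 - z^2*Y) * (1 - z^3*Y) * (1 - z^4*Y) - (1 - Y^5) = 
     (1 + z + z^2 + z^3 + z^4) * (-Y + Y^2*z + Y^2*z^3 - Y^3*z^3 - Y^3*z^5 + Y^4*z^6 + Y^5 - Y^5*z + Y^5*z^5 - Y^5*z^6)"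
    by (simp add: algebra_simps power_numeral_reduce)
  with assms show ?thesis by simp
qed

text \<open>The norm of A - y - z under q -> wq for a fifth root of unity w. The conjugates are
  paired, 1 with 4 and 2 with 3, so that only the Gaussian periods g and h of w enter.\<close>

lemma diss_norm_identity:
  fixes A y z w :: "'a::comm_ring_1"
  assumes "A * z = y\<^sup>2" "1 + w + w^2 + w^3 + w^4 = 0"
  shows "(A-y-z) * (A - w*y - w^2*z) * (A - w^2*y - w^4*z) * (A - w^3*y - w^6*z) * (A - w^4*y - w^8*z) = A^5 - 11*y^5 - z^5"
proof -
  define g where "g = w + w^4"
  define h where "h = w^2 + w^3"
  have w5: "w^5 = 1"
  proof -
    have "w^5 - 1 = (w - 1) * (1 + w + w^2 + w^3 + w^4)" by (simp add: algebra_simps power_numeral_reduce)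
    then show ?thesis using assms(2) by simp
  qed
  have h: "h = -1 - g"
  proof -
    have "h - (-1 - g) = 1 + w + w^2 + w^3 + w^4" unfolding g_def h_def by (simp add: algebra_simps)
    then show ?thesis using assms(2) by simp
  qed
  have g: "g^2 = 1 - g"
  proof -
    have "g^2 - (1 - g) = (w^5 - 1) * (w^3 + 2) + (1 + w + w^2 + w^3 + w^4)"
      unfolding g_def by (simp add: algebra_simps power_numeral_reduce)
    then show ?thesis using assms(2) w5 by simp
  qed
  have 1: "(A - w*y - w^2*z) * (A - w^4*y - w^8*z) = A^2 + y^2 + z^2 - g*A*y - h*A*z + g*y*z"
  proof -
    have "(A - w*y - w^2*z) * (A - w^4*y - w^8*z) - (A^2 + y^2 + z^2 - g*A*y - h*A*z + g*y*z)
      = (w^5 - 1) * (-A*w^3*z + w*y*z + w^4*y*z + w^5*z^2 + y^2 + z^2)"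
      unfolding g_def h_def by (simp add: algebra_simps power_numeral_reduce)
    then show ?thesis using w5 by simp
  qed
  have 2: "(A - w^2*y - w^4*z) * (A - w^3*y - w^6*z) = A^2 + y^2 + z^2 - h*A*y - g*A*z + h*y*z"
  proof -
    have "(A - w^2*y - w^4*z) * (A - w^3*y - w^6*z) - (A^2 + y^2 + z^2 - h*A*y - g*A*z + h*y*z)
      = (w^5 - 1) * (-A*w*z + w^2*y*z + w^3*y*z + w^5*z^2 + y^2 + z^2)"
      unfolding g_def h_def by (simp add: algebra_simps power_numeral_reduce)
    then show ?thesis using w5 by simp
  qed
  have "(A-y-z) * ((A^2 + y^2 + z^2 - g*A*y - h*A*z + g*y*z) * (A^2 + y^2 + z^2 - h*A*y - g*A*z + h*y*z)) - (A^5 - 11*y^5 - z^5)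
     = (g^2 - (1 - g)) * (2*A*y*z^3 - A*y^2*z^2 - 2*A*y^3*z - 3*A^2*y*z^2 + A^2*y^2*z + A^2*y^3 + A^2*z^3 + 2*A^3*y*z - A^3*y^2 - A^3*z^2 + y^2*z^3 + y^3*z^2)
     + (y^2 - A * z) * (5*A*y*z + 10*y^3)" unfolding h 
    by (simp add: algebra_simps power_numeral_reduce)
  then have "(A-y-z) * ((A^2 + y^2 + z^2 - g*A*y - h*A*z + g*y*z) * (A^2 + y^2 + z^2 - h*A*y - g*A*z + h*y*z)) = A^5 - 11*y^5 - z^5"
    using g assms(1) by simp
  then show ?thesis unfolding 1[symmetric] 2[symmetric] by (simp only: mult_ac)
qed

subsection \<open>The norm of the Euler function\<close>

text \<open>Complex coefficients serve twice: for fifth roots of unity here, and for evaluation on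
  the unit disc later.\<close>

definition cfps :: "int fps \<Rightarrow> complex fps" where
  "cfps f = Abs_fps (\<lambda>n. of_int (fps_nth f n))"

lemma cfps_nth [simp]: "fps_nth (cfps f) n = of_int (fps_nth f n)"
  by (simp add: cfps_def)
lemma cfps_mult: "cfps (f * g) = cfps f * cfps g"
  by (simp add: fps_eq_iff fps_mult_nth)
lemma cfps_add: "cfps (f + g) = cfps f + cfps g"
  by (simp add: fps_eq_iff)
lemma cfps_diff: "cfps (f - g) = cfps f - cfps g"
  by (simp add: fps_eq_iff)
lemma cfps_1: "cfps 1 = 1"
  by (simp add: fps_eq_iff)
lemma cfps_0: "cfps 0 = 0"
  by (simp add: fps_eq_iff)
lemma cfps_X: "cfps fps_X = fps_X"
  by (simp add: fps_eq_iff fps_X_def)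
lemma cfps_power: "cfps (f ^ n) = cfps f ^ n"
  by (induction n) (simp_all add: cfps_1 cfps_mult)
lemma cfps_sum: "cfps (\<Sum>k\<in>A. f k) = (\<Sum>k\<in>A. cfps (f k))"
  by (induction A rule: infinite_finite_induct) (simp_all add: cfps_0 cfps_add)
lemma cfps_prod: "cfps (\<Prod>k\<in>A. f k) = (\<Prod>k\<in>A. cfps (f k))"
  by (induction A rule: infinite_finite_induct) (simp_all add: cfps_1 cfps_mult)
lemma cfps_of_int: "cfps (of_int c) = of_int c"
  by (simp add: fps_eq_iff flip: fps_of_int)
lemma cfps_numeral: "cfps (numeral c) = numeral c"
  by (simp add: fps_eq_iff numeral_fps_const)
lemma cfps_eq_iff [simp]: "cfps f = cfps g \<longleftrightarrow> f = g"
  by (simp add: fps_eq_iff)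

lemmas cfps_simps = cfps_mult cfps_add cfps_diff cfps_1 cfps_0 cfps_X cfps_power cfps_sum cfps_prod cfps_of_int cfps_numeral

definition rot :: "complex \<Rightarrow> complex fps \<Rightarrow> complex fps" where
  "rot w f = Abs_fps (\<lambda>n. w ^ n * fps_nth f n)"

lemma rot_nth [simp]: "fps_nth (rot w f) n = w ^ n * fps_nth f n"
  by (simp add: rot_def)
lemma rot_mult: "rot w (f * g) = rot w f * rot w g"
proof (rule fps_ext)
  fix n
  have "fps_nth (rot w (f * g)) n = (\<Sum>i=0..n. w ^ n * (fps_nth f i * fps_nth g (n - i)))"
    by (simp add: fps_mult_nth sum_distrib_left)
  also have "\<dots> = (\<Sum>i=0..n. (w ^ i * fps_nth f i) * (w ^ (n - i) * fps_nth g (n - i)))"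
    by (intro sum.cong refl) (simp add: mult_ac flip: power_add)
  finally show "fps_nth (rot w (f * g)) n = fps_nth (rot w f * rot w g) n"
    by (simp add: fps_mult_nth)
qed
lemma rot_diff: "rot w (f - g) = rot w f - rot w g"
  by (simp add: fps_eq_iff algebra_simps)
lemma rot_1: "rot w 1 = 1"
  by (simp add: fps_eq_iff)
lemma rot_X_power: "rot w (fps_X ^ k) = fps_const (w ^ k) * fps_X ^ k"
  by (simp add: fps_eq_iff fps_X_power_nth)
lemma rot_prod: "rot w (\<Prod>k\<in>A. f k) = (\<Prod>k\<in>A. rot w (f k))"
  by (induction A rule: infinite_finite_induct) (simp_all add: rot_1 rot_mult)
lemma rot_dil: "w ^ 5 = 1 \<Longrightarrow> rot w (cfps (dil f)) = cfps (dil f)"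
  by (auto simp: fps_eq_iff dil_nth power_mult elim!: dvdE)

definition fps_agree :: "nat \<Rightarrow> 'a::comm_ring_1 fps \<Rightarrow> 'a fps \<Rightarrow> bool" where
  "fps_agree N f g \<longleftrightarrow> (\<forall>n\<le>N. fps_nth f n = fps_nth g n)"

lemma fps_agree_mult: "fps_agree N f f' \<Longrightarrow> fps_agree N g g' \<Longrightarrow> fps_agree N (f * g) (f' * g')"
  by (auto simp: fps_agree_def fps_mult_nth intro!: sum.cong)
lemma fps_agree_refl: "fps_agree N f f"
  by (simp add: fps_agree_def)
lemma fps_agree_power: "fps_agree N f f' \<Longrightarrow> fps_agree N (f ^ k) (f' ^ k)"
  by (induction k) (simp_all add: fps_agree_refl fps_agree_mult)
lemma fps_agree_prod: "(\<And>i. i \<in> A \<Longrightarrow> fps_agree N (f i) (g i)) \<Longrightarrow> fps_agree N (\<Prod>i\<in>A. f i) (\<Prod>i\<in>A. g i)"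
  by (induction A rule: infinite_finite_induct) (simp_all add: fps_agree_refl fps_agree_mult)
lemma fps_agree_rot: "fps_agree N f g \<Longrightarrow> fps_agree N (rot w f) (rot w g)"
  by (simp add: fps_agree_def)

definition euler_trunc :: "nat \<Rightarrow> nat \<Rightarrow> 'a::comm_ring_1 fps" where
  "euler_trunc j M = (\<Prod>k<M. 1 - fps_X ^ (j * (k + 1)))"

lemma fps_agree_euler: "j > 0 \<Longrightarrow> N \<le> M \<Longrightarrow> fps_agree N (euler_E j) (euler_trunc j M)"
  unfolding fps_agree_def euler_trunc_def using euler_E_nth le_trans by blast

lemma fps_agree_cfps_euler: 
  assumes "j > 0" "N \<le> M" shows "fps_agree N (cfps (euler_E j)) (euler_trunc j M)"
proof -
  have "cfps (euler_trunc j M) = euler_trunc j M"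
    by (simp add: euler_trunc_def cfps_simps)
  moreover have "fps_agree N (cfps (euler_E j)) (cfps (euler_trunc j M))"
    using fps_agree_euler[OF assms] by (simp add: fps_agree_def)
  ultimately show ?thesis by simp
qed

lemma prod_lessThan_5: "(\<Prod>i<5::nat. f i) = f 0 * f 1 * f 2 * f 3 * (f 4 :: 'a::comm_monoid_mult)"
proof -
  have "{..<5::nat} = {0,1,2,3,4}" by auto
  then show ?thesis by (simp add: mult_ac)
qed

lemma root_of_unity_5: obtains w :: complex where "w ^ 5 = 1" "w \<noteq> 1"
proof -
  have "cis (2 * pi / 5) ^ 5 = 1" unfolding Complex.DeMoivre by simp
  moreover have "sin (2 * pi / 5) > 0" by (rule sin_gt_zero) auto
  then have "cis (2 * pi / 5) \<noteq> 1" by (auto simp: complex_eq_iff)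
  ultimately show ?thesis using that by blast
qed

lemma geometric_sum_root_of_unity_5:
  fixes w :: complex
  assumes "w ^ 5 = 1" "w \<noteq> 1" "\<not> 5 dvd k"
  shows "1 + w ^ k + (w ^ k)^2 + (w ^ k)^3 + (w ^ k)^4 = 0"
proof -
  have "w ^ k \<noteq> 1"
  proof
    assume wk: "w ^ k = 1"
    have red: "w ^ n = w ^ (n mod 5)" for n
      using assms(1) by (metis div_mult_mod_eq mult.commute mult_1_left power_add power_mult power_one)
    have kc: "k mod 5 = 1 \<or> k mod 5 = 2 \<or> k mod 5 = 3 \<or> k mod 5 = 4"
      using assms(3) mod_5_cases[of k] by (simp add: dvd_eq_mod_eq_0)
    have r: "k * j mod 5 = (k mod 5) * j mod 5" for j by (rule mod_mult_left_eq[symmetric])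
    have "k * 1 mod 5 = 1 \<or> k * 3 mod 5 = 1 \<or> k * 2 mod 5 = 1 \<or> k * 4 mod 5 = 1"
      using kc unfolding r by (elim disjE) simp_all
    then obtain j where "k * j mod 5 = 1" by blast
    then have "w ^ (k * j) = w" using red[of "k * j"] by simp
    moreover have "w ^ (k * j) = 1" by (simp add: power_mult wk)
    ultimately show False using assms(2) by simp
  qed
  moreover have "(w ^ k - 1) * (1 + w ^ k + (w ^ k)^2 + (w ^ k)^3 + (w ^ k)^4) = (w ^ 5) ^ k - 1"
    by (simp add: algebra_simps power_numeral_reduce power_mult_distrib)
  ultimately show ?thesis using assms(1) by simp
qed

text \<open>If 5 does not divide k, the numbers w^(ik) run through all fifth roots of unity;
  otherwise all five factors coincide.\<close>

lemma rot_product_factor: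
  fixes w :: complex
  assumes "w ^ 5 = 1" "w \<noteq> 1"
  shows "(\<Prod>i<5::nat. rot (w ^ i) (1 - fps_X ^ k)) = (if 5 dvd k then (1 - fps_X ^ k) ^ 5 else 1 - fps_X ^ (5 * k))"
proof -
  have r: "rot (w ^ i) (1 - fps_X ^ k) = 1 - fps_const (w ^ k) ^ i * fps_X ^ k" for i
    by (simp add: rot_diff rot_1 rot_X_power power_commutes mult.commute[of i k] flip: power_mult)
  show ?thesis
  proof (cases "5 dvd k")
    case True
    then have "w ^ k = 1" using assms(1) by (auto simp: power_mult)
    then show ?thesis using True by (simp add: r)
  next
    case False
    have "1 + fps_const (w ^ k) + fps_const (w ^ k)^2 + fps_const (w ^ k)^3 + fps_const (w ^ k)^4 =
      fps_const (1 + w ^ k + (w ^ k)^2 + (w ^ k)^3 + (w ^ k)^4)"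
      by (simp flip: fps_const_add fps_const_power fps_const_1_eq_1)
    also have "\<dots> = 0" using geometric_sum_root_of_unity_5[OF assms False] by simp
    finally show ?thesis
      using cyclotomic_product[of "fps_const (w ^ k)" "fps_X ^ k"] False
      unfolding prod_lessThan_5 r by (simp add: mult.commute flip: power_mult)
  qed
qed

text \<open>Exponents k prime to 5 contribute 1 - q^(5k), and multiples of 5 contribute fifth
  powers. The factor E_25 supplies the terms 1 - q^(5k) with 5 dividing k; the lengths M and 5M make
  this exact for finite products.\<close>

lemma euler_trunc_norm:
  fixes w :: complex
  assumes "w ^ 5 = 1" "w \<noteq> 1"
  shows "euler_trunc 25 M * (\<Prod>i<5::nat. rot (w ^ i) (euler_trunc 1 (5 * M))) = euler_trunc 5 (5 * M) * euler_trunc 5 M ^ 5"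
proof -
  have *: "euler_trunc 25 M * (\<Prod>k<5*M. \<Prod>i<5::nat. rot (w ^ i) (1 - fps_X ^ (k + 1))) = euler_trunc 5 (5 * M) * euler_trunc 5 M ^ 5"
  proof (induction M)
    case (Suc M)
    have split: "(\<Prod>k<5 * Suc M. g k) = (\<Prod>k<5*M. g k) * (g (5*M) * g (5*M+1) * g (5*M+2) * g (5*M+3) * g (5*M+4))" for g :: "nat \<Rightarrow> complex fps"
      by (simp add: eval_nat_numeral mult_ac)
    have nd: "\<not> 5 dvd 5 * M + 0 + 1" "\<not> 5 dvd 5 * M + 1 + 1" "\<not> 5 dvd 5 * M + 2 + 1" "\<not> 5 dvd 5 * M + 3 + 1" "5 dvd 5 * M + 4 + 1"
      by presburger+
    define h where "h = (\<lambda>k. \<Prod>i<5::nat. rot (w ^ i) (1 - fps_X ^ (k + 1)))"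
    have h: "h (5*M) = 1 - fps_X ^ (5 * (5*M+1))" "h (5*M+1) = 1 - fps_X ^ (5 * (5*M+1+1))"
      "h (5*M+2) = 1 - fps_X ^ (5 * (5*M+2+1))" "h (5*M+3) = 1 - fps_X ^ (5 * (5*M+3+1))"
      "h (5*M+4) = (1 - fps_X ^ (5*M+4+1)) ^ 5"
      unfolding h_def rot_product_factor[OF assms] using nd by simp_all
    have "euler_trunc 25 (Suc M) * (\<Prod>k<5 * Suc M. h k) = 
      (1 - fps_X ^ (25 * (M + 1))) * (h (5*M) * h (5*M+1) * h (5*M+2) * h (5*M+3) * h (5*M+4)) * (euler_trunc 25 M * (\<Prod>k<5*M. h k))"
      unfolding split by (simp add: euler_trunc_def mult_ac)
    also have "\<dots> = (1 - fps_X ^ (25 * (M + 1))) * (h (5*M) * h (5*M+1) * h (5*M+2) * h (5*M+3) * h (5*M+4)) * (euler_trunc 5 (5 * M) * euler_trunc 5 M ^ 5)"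
      using Suc.IH by (simp add: h_def)
    also have "\<dots> = euler_trunc 5 (5 * Suc M) * euler_trunc 5 (Suc M) ^ 5"
    proof -
      have e: "25 * (M + 1) = 5 * (5 * M + 4 + 1)" "5 * M + 4 + 1 = 5 * (M + 1)" by simp_all
      show ?thesis
        unfolding euler_trunc_def[of 5 "5 * Suc M"] split unfolding euler_trunc_def[symmetric] h e(1)
        unfolding e(2) by (simp add: euler_trunc_def power_mult_distrib mult_ac)
    qed
    finally show ?case by (simp add: h_def)
  qed (simp add: euler_trunc_def)
  have "(\<Prod>i<5::nat. rot (w ^ i) (euler_trunc 1 (5 * M))) = (\<Prod>k<5*M. \<Prod>i<5::nat. rot (w ^ i) (1 - fps_X ^ (k + 1)))"
    unfolding euler_trunc_def rot_prod by (subst prod.swap) simp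
  then show ?thesis using * by simp
qed

lemma euler_norm:
  fixes w :: complex
  assumes "w ^ 5 = 1" "w \<noteq> 1"
  shows "cfps (euler_E 25) * (\<Prod>i<5::nat. rot (w ^ i) (cfps (euler_E 1))) = cfps (euler_E 5) ^ 6"
proof (rule fps_ext)
  fix n
  have "fps_agree n (cfps (euler_E 25) * (\<Prod>i<5::nat. rot (w ^ i) (cfps (euler_E 1))))
     (euler_trunc 25 n * (\<Prod>i<5::nat. rot (w ^ i) (euler_trunc 1 (5 * n))))"
    by (intro fps_agree_mult fps_agree_prod fps_agree_rot fps_agree_cfps_euler) auto
  moreover have "fps_agree n (cfps (euler_E 5) * cfps (euler_E 5) ^ 5) (euler_trunc 5 (5 * n) * euler_trunc 5 n ^ 5)"
    by (intro fps_agree_mult fps_agree_power fps_agree_cfps_euler) auto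
  moreover have "cfps (euler_E 5) ^ 6 = cfps (euler_E 5) * cfps (euler_E 5) ^ 5"
    by (simp flip: power_Suc)
  ultimately show "fps_nth (cfps (euler_E 25) * (\<Prod>i<5::nat. rot (w ^ i) (cfps (euler_E 1)))) n = fps_nth (cfps (euler_E 5) ^ 6) n"
    unfolding euler_trunc_norm[OF assms] by (simp add: fps_agree_def)
qed

text \<open>In terms of R this is E_5^5 (1/R^5 - 11q - q^2 R^5), and the next result is the
  classical evaluation of that expression.\<close>

definition diss_K :: "int fps" where
  "diss_K = diss_a ^ 5 - 11 * fps_X * euler_E 5 ^ 5 - fps_X\<^sup>2 * diss_c ^ 5"

lemma dil_diss_K: "dil diss_K = dil diss_a ^ 5 - 11 * (fps_X * dil (euler_E 5)) ^ 5 - (fps_X\<^sup>2 * dil diss_c) ^ 5"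
  by (simp add: diss_K_def dil_simps power_mult_distrib mult.assoc flip: power_mult)

lemma diss_relation: "dil diss_a * (fps_X\<^sup>2 * dil diss_c) = (fps_X * dil (euler_E 5))\<^sup>2"
  using diss_ac by (simp add: power_mult_distrib mult.left_commute flip: dil_mult dil_power)

text \<open>The norm of E_1 under q -> wq is computed twice, once from the dissection and once from
  the product. The comparison takes place after q -> q^5, and \<open>dil\<close> is
  injective.\<close>

lemma euler_E_5_diss_K: "euler_E 5 * diss_K = euler_E 1 ^ 6"
proof -
  obtain w :: complex where w: "w ^ 5 = 1" "w \<noteq> 1" by (rule root_of_unity_5)
  define A where "A = cfps (dil diss_a)"
  define y where "y = cfps (fps_X * dil (euler_E 5))"
  define z where "z = cfps (fps_X\<^sup>2 * dil diss_c)"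
  define v where "v = fps_const w"
  have wi: "(w ^ i) ^ 5 = 1" for i using w(1) by (metis mult.commute power_mult power_one)
  have r: "rot (w ^ i) (cfps (euler_E 1)) = A - v ^ i * y - (v ^ i)\<^sup>2 * z" for i
  proof -
    have "rot (w ^ i) y = v ^ i * y"
      using rot_X_power[of "w ^ i" 1] by (simp add: y_def v_def cfps_simps rot_mult rot_dil[OF wi] fps_const_power mult.assoc)
    moreover have "rot (w ^ i) z = (v ^ i)\<^sup>2 * z"
      using rot_X_power[of "w ^ i" 2] by (simp add: z_def v_def cfps_simps rot_mult rot_dil[OF wi] fps_const_power mult.assoc)
    ultimately show ?thesis
      unfolding euler_E_dissection cfps_diff rot_diff y_def[symmetric] z_def[symmetric] A_def[symmetric]
      by (simp add: A_def rot_dil[OF wi])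
  qed
  have rel: "A * z = y\<^sup>2"
    unfolding A_def y_def z_def cfps_mult[symmetric] cfps_power[symmetric] diss_relation ..
  have "1 + v + v^2 + v^3 + v^4 = fps_const (1 + w + w^2 + w^3 + w^4)"
    by (simp add: v_def flip: fps_const_add fps_const_power fps_const_1_eq_1)
  also have "\<dots> = 0" using geometric_sum_root_of_unity_5[OF w, of 1] by simp
  finally have "(\<Prod>i<5::nat. rot (w ^ i) (cfps (euler_E 1))) = A ^ 5 - 11 * y ^ 5 - z ^ 5"
    using diss_norm_identity[OF rel, of v] unfolding prod_lessThan_5 r by (simp flip: power_mult)
  also have "\<dots> = cfps (dil diss_K)"
    unfolding dil_diss_K A_def y_def z_def cfps_simps ..
  finally have "cfps (euler_E 25 * dil diss_K) = cfps (euler_E 5 ^ 6)"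
    using euler_norm[OF w] by (simp add: cfps_simps)
  then have "dil (euler_E 5 * diss_K) = dil (euler_E 1 ^ 6)"
    by (simp add: dil_simps dil_euler_E del: dil_eq_iff)
  then show ?thesis by simp
qed

lemma euler_quintic:
  fixes E y defines "E \<equiv> euler_E 1" and "y \<equiv> fps_X * dil (euler_E 5)"
  shows "E^5 + 5*y*E^4 + 15*y^2*E^3 + 25*y^3*E^2 + 25*y^4*E = dil diss_K"
  using diss_poly_identity[OF diss_relation]
  unfolding dil_diss_K E_def y_def euler_E_dissection[symmetric] .

section \<open>Sections of powers of the Euler product\<close>

subsection \<open>Sections of powers of the Euler function\<close>

text \<open>Unlike \<open>sect\<close> this leaves exponents in place, so multiplication by a power
  of q merely shifts the class, see \<open>respart_X_mult\<close>.\<close>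

definition respart :: "nat \<Rightarrow> int fps \<Rightarrow> int fps" where
  "respart r f = fps_X ^ (r mod 5) * dil (sect (r mod 5) f)"

lemma respart_nth: "fps_nth (respart r f) n = (if n mod 5 = r mod 5 then fps_nth f n else 0)"
proof (cases "n mod 5 = r mod 5")
  case True
  have h1: "r mod 5 \<le> n" unfolding True[symmetric] by (rule mod_less_eq_dividend)
  have h2: "5 dvd n - r mod 5" unfolding True[symmetric] by (rule dvd_minus_mod)
  have h3: "5 * ((n - r mod 5) div 5) + r mod 5 = n" using h1 h2 by simp
  from h1 h2 h3 show ?thesis using True by (simp add: respart_def fps_X_power_mult_nth dil_nth)
next
  case False
  have "n < r mod 5 \<or> \<not> 5 dvd n - r mod 5"
    using False mod_eq_dvd_iff_nat[of "r mod 5" n 5] by (cases "r mod 5 \<le> n") auto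
  then show ?thesis using False by (auto simp: respart_def fps_X_power_mult_nth dil_nth)
qed

lemma respart_add: "respart r (f + g) = respart r f + respart r g"
  by (simp add: fps_eq_iff respart_nth)
lemma respart_diff: "respart r (f - g) = respart r f - respart r g"
  by (simp add: fps_eq_iff respart_nth)
lemma respart_cong: "r mod 5 = r' mod 5 \<Longrightarrow> respart r f = respart r' f"
  by (simp add: respart_def)

lemma respart_dil_mult: "respart r (dil g * f) = dil g * respart r f"
proof -
  have "r mod 5 < 5" by simp
  from sect_dil_mult[OF this] show ?thesis by (simp add: respart_def dil_mult mult.left_commute)
qed

lemma respart_X_mult: "respart (r + a) (fps_X ^ a * f) = fps_X ^ a * respart r f"
proof (rule fps_ext)
  fix n
  have "n mod 5 = (r + a) mod 5 \<longleftrightarrow> (n - a) mod 5 = r mod 5" if "a \<le> n"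
    using cong_add_lcancel_nat[of a "n - a" r 5] that by (simp add: cong_def add.commute)
  then show "fps_nth (respart (r + a) (fps_X ^ a * f)) n = fps_nth (fps_X ^ a * respart r f) n"
    by (simp add: respart_nth fps_X_power_mult_nth)
qed

lemma respart_numeral_mult: "respart r (numeral c * f) = numeral c * respart r f"
  by (simp add: fps_eq_iff respart_nth)

lemma respart_X_dil: "respart r (fps_X ^ a * dil g) = (if a mod 5 = r mod 5 then fps_X ^ a * dil g else 0)"
proof (rule fps_ext)
  fix n
  have "n mod 5 = a mod 5" if "a \<le> n" "5 dvd n - a" using that mod_eq_dvd_iff_nat[of a n 5] by simp
  then show "fps_nth (respart r (fps_X ^ a * dil g)) n = fps_nth (if a mod 5 = r mod 5 then fps_X ^ a * dil g else 0) n"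
    by (auto simp: respart_nth fps_X_power_mult_nth dil_nth)
qed

definition einv :: "int fps" where "einv = fps_right_inverse (euler_E 5) 1"

lemma einv: "euler_E 5 * einv = 1"
  unfolding einv_def by (rule fps_right_inverse) simp

text \<open>q \<open>psi\<close> is the expansion of (eta(5z)/eta(z))^6, a generator of the modular
  functions on Gamma_0(5).\<close>

definition psi :: "int fps" where "psi = (euler_E 5 * part_gf) ^ 6"
definition phi :: "int fps" where "phi = (euler_E 1 * einv) ^ 6"

lemma phi_psi: "phi * psi = 1"
proof -
  have "phi * psi = (euler_E 1 * part_gf) ^ 6 * (euler_E 5 * einv) ^ 6"
    by (simp add: phi_def psi_def power_mult_distrib mult_ac)
  then show ?thesis by (simp only: euler_part einv) simp
qed

lemma diss_K_phi: "diss_K = euler_E 5 ^ 5 * phi"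
proof -
  have "euler_E 5 * (euler_E 5 ^ 5 * phi) = euler_E 1 ^ 6 * (euler_E 5 * einv) ^ 6"
    by (simp add: phi_def power_mult_distrib mult_ac power_numeral_reduce)
  also have "\<dots> = euler_E 5 * diss_K" by (simp add: einv euler_E_5_diss_K)
  finally have "euler_E 5 * (euler_E 5 ^ 5 * phi) = euler_E 5 * diss_K" .
  moreover have "euler_E 5 \<noteq> 0" using einv by auto
  ultimately show ?thesis by (simp del: power_Suc)
qed

text \<open>Starting values for the recurrences below. The class k is the right one for E_1^k
  because the modular equation is homogeneous in E_1 and y, and y lies in class 1. The relation ac =
  b^2 makes each section a monomial in y.\<close>

lemma small_sections:
  fixes E y defines "E \<equiv> euler_E 1" and "y \<equiv> fps_X * dil (euler_E 5)"
  shows "respart 0 1 = 1" "respart 1 E = - y" "respart 2 (E\<^sup>2) = - y\<^sup>2" "respart 3 (E ^ 3) = 5 * y ^ 3" "respart 4 (E ^ 4) = - 5 * y ^ 4"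
proof -
  define a b c where "a = diss_a" and "b = euler_E 5" and "c = diss_c"
  have ac: "b\<^sup>2 = a * c" using diss_ac by (simp add: a_def b_def c_def)
  have E: "E = dil a - fps_X * dil b - fps_X\<^sup>2 * dil c"
    unfolding E_def a_def b_def c_def by (rule euler_E_dissection)
  have b3: "b ^ 3 = a * b * c" and b4: "b ^ 4 = a\<^sup>2 * c\<^sup>2" 
    using ac by (simp_all add: power_numeral_reduce mult_ac)
  have d: "5 * y ^ 3 = fps_X ^ 3 * dil (5 * (a * b * c))" "- 5 * y ^ 4 = fps_X ^ 4 * dil (- 5 * (a\<^sup>2 * c\<^sup>2))" "- y\<^sup>2 = fps_X ^ 2 * dil (- (a * c))" "- y = fps_X ^ 1 * dil (- b)"
    unfolding y_def b_def[symmetric] b3[symmetric] b4[symmetric] ac[symmetric]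
    by (simp_all add: dil_simps power_mult_distrib algebra_simps)
  show "respart 0 1 = 1" using respart_X_dil[of 0 0 1] by (simp add: dil_1)
  have "E = fps_X ^ 0 * dil a + fps_X ^ 1 * dil (- b) + fps_X ^ 2 * dil (- c)"
    unfolding E by (simp add: dil_simps)
  then show "respart 1 E = - y" unfolding d
    by (simp only: respart_add respart_X_dil) simp
  have "E\<^sup>2 = fps_X ^ 0 * dil (a\<^sup>2) + fps_X ^ 1 * dil (- 2 * a * b) + fps_X ^ 2 * dil (a * c - 2 * a * c) + fps_X ^ 3 * dil (2 * b * c) + fps_X ^ 4 * dil (c\<^sup>2)"
    unfolding E ac[symmetric] by (simp add: dil_simps algebra_simps power_numeral_reduce ac)
  then show "respart 2 (E\<^sup>2) = - y\<^sup>2" unfolding d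
    by (simp only: respart_add respart_X_dil) simp
  have "E ^ 3 = fps_X ^ 0 * dil (a ^ 3) + fps_X ^ 1 * dil (- 3 * a\<^sup>2 * b) + fps_X ^ 2 * dil (3 * a * b\<^sup>2 - 3 * a\<^sup>2 * c)
    + fps_X ^ 3 * dil (6 * a * b * c - b ^ 3) + fps_X ^ 4 * dil (3 * a * c\<^sup>2 - 3 * b\<^sup>2 * c)
    + fps_X ^ 5 * dil (- 3 * b * c\<^sup>2) + fps_X ^ 6 * dil (- (c ^ 3))"
    unfolding E dil_simps by (simp add: algebra_simps power_numeral_reduce)
  then show "respart 3 (E ^ 3) = 5 * y ^ 3" unfolding d b3
    by (simp only: respart_add respart_X_dil) simp
  have E4: "E ^ 4 = fps_X ^ 0 * dil (a ^ 4) + fps_X ^ 1 * dil (- 4 * a ^ 3 * b) + fps_X ^ 2 * dil (6 * a\<^sup>2 * b\<^sup>2 - 4 * a ^ 3 * c)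
    + fps_X ^ 3 * dil (12 * a\<^sup>2 * b * c - 4 * a * b ^ 3) + fps_X ^ 4 * dil (6 * a\<^sup>2 * c\<^sup>2 - 12 * a * b\<^sup>2 * c + b ^ 4)
    + fps_X ^ 5 * dil (- 12 * a * b * c\<^sup>2 + 4 * b ^ 3 * c) + fps_X ^ 6 * dil (- 4 * a * c ^ 3 + 6 * b\<^sup>2 * c\<^sup>2)
    + fps_X ^ 7 * dil (4 * b * c ^ 3) + fps_X ^ 8 * dil (c ^ 4)"
    unfolding E dil_simps by (simp add: algebra_simps power_numeral_reduce)
  have "6 * a\<^sup>2 * c\<^sup>2 - 12 * a * b\<^sup>2 * c + b ^ 4 = - 5 * (a\<^sup>2 * c\<^sup>2)"
    unfolding b4 ac by (simp add: power2_eq_square algebra_simps)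
  then show "respart 4 (E ^ 4) = - 5 * y ^ 4" unfolding d E4
    by (simp only: respart_add respart_X_dil) simp
qed

text \<open>Coefficients of the class k part of E_1^k in powers of phi(q^5). The last equation is
  the modular equation times E_1^k; its right-hand side \<open>dil diss_K\<close> carries one factor
  phi(q^5), hence the shift e - 1.\<close>

fun pos_coeff :: "nat \<Rightarrow> nat \<Rightarrow> int" where
  "pos_coeff 0 e = (if e = 0 then 1 else 0)"
| "pos_coeff (Suc 0) e = (if e = 0 then -1 else 0)"
| "pos_coeff (Suc (Suc 0)) e = (if e = 0 then -1 else 0)"
| "pos_coeff (Suc (Suc (Suc 0))) e = (if e = 0 then 5 else 0)"
| "pos_coeff (Suc (Suc (Suc (Suc 0)))) e = (if e = 0 then -5 else 0)"
| "pos_coeff (Suc (Suc (Suc (Suc (Suc k))))) e = (if e = 0 then 0 else pos_coeff k (e - 1))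
     - 5 * pos_coeff (Suc (Suc (Suc (Suc k)))) e - 15 * pos_coeff (Suc (Suc (Suc k))) e
     - 25 * pos_coeff (Suc (Suc k)) e - 25 * pos_coeff (Suc k) e"

lemma pos_coeff_rec: "pos_coeff (k + 5) e = (if e = 0 then 0 else pos_coeff k (e - 1))
     - 5 * pos_coeff (k + 4) e - 15 * pos_coeff (k + 3) e - 25 * pos_coeff (k + 2) e - 25 * pos_coeff (k + 1) e"
  by (simp add: eval_nat_numeral)

lemma induct_step_5:
  fixes P :: "nat \<Rightarrow> bool"
  assumes "P 0" "P 1" "P 2" "P 3" "P 4"
    and "\<And>k. P k \<Longrightarrow> P (k + 1) \<Longrightarrow> P (k + 2) \<Longrightarrow> P (k + 3) \<Longrightarrow> P (k + 4) \<Longrightarrow> P (k + 5)"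
  shows "P k"
proof (induction k rule: less_induct)
  case (less k)
  show ?case
  proof (cases "k < 5")
    case True
    then have "k = 0 \<or> k = 1 \<or> k = 2 \<or> k = 3 \<or> k = 4" by linarith
    then show ?thesis using assms(1-5) by blast
  next
    case False
    then have "k = (k - 5) + 5" by simp
    moreover have "P (k - 5)" "P (k - 5 + 1)" "P (k - 5 + 2)" "P (k - 5 + 3)" "P (k - 5 + 4)"
      using False by (intro less; simp)+
    ultimately show ?thesis using assms(6)[of "k - 5"] by simp
  qed
qed

lemma pos_coeff_base:
  "pos_coeff 0 e = (if e = 0 then 1 else 0)" "pos_coeff 1 e = (if e = 0 then -1 else 0)"
  "pos_coeff 2 e = (if e = 0 then -1 else 0)" "pos_coeff 3 e = (if e = 0 then 5 else 0)"
  "pos_coeff 4 e = (if e = 0 then -5 else 0)"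
  by (simp_all add: eval_nat_numeral)

lemma pos_coeff_eq_0: "k < 5 * e \<Longrightarrow> pos_coeff k e = 0"
proof (induction k arbitrary: e rule: induct_step_5)
  case (6 k)
  then show ?case by (simp add: pos_coeff_rec)
qed (auto simp: pos_coeff_base)

text \<open>Steps back by 1, 2, 3, 4 in the recurrence carry the factors 5, 15, 25, 25, at least
  half a power of 5 per unit, while the first summand leaves k - 5e unchanged.\<close>

lemma pos_coeff_dvd: "5 ^ ((k - 5 * e - 1) div 2) dvd pos_coeff k e"
proof (induction k arbitrary: e rule: induct_step_5)
  case (6 k)
  define v where "v = (k + 5 - 5 * e - 1) div 2"
  have step: "5 ^ v dvd 5 ^ i * x" if "5 ^ w dvd x" "v \<le> i + w" for i w and x :: int
  proof -
    have "(5::int) ^ v dvd 5 ^ (i + w)" using that by (intro le_imp_power_dvd)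
    also have "\<dots> dvd 5 ^ i * x" unfolding power_add using that by (intro mult_dvd_mono) auto
    finally show ?thesis .
  qed
  have "5 ^ v dvd pos_coeff k (e - 1)" if "e > 0"
    using 6(1)[of "e - 1"] that by (simp add: v_def right_diff_distrib')
  moreover have "5 ^ v dvd 5 ^ 1 * pos_coeff (k + 4) e"
    using 6(5)[of e] by (rule step) (unfold v_def, linarith)
  moreover have "5 ^ v dvd 5 ^ 2 * pos_coeff (k + 2) e"
    using 6(3)[of e] by (rule step) (unfold v_def, linarith)
  moreover have "5 ^ v dvd 5 ^ 2 * pos_coeff (k + 1) e"
    using 6(2)[of e] by (rule step) (unfold v_def, linarith)
  moreover have "5 ^ v dvd 5 ^ 1 * pos_coeff (k + 3) e"
    using 6(4)[of e] by (rule step) (unfold v_def, linarith)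
  then have "5 ^ v dvd 3 * (5 ^ 1 * pos_coeff (k + 3) e)" by (rule dvd_mult)
  then have "5 ^ v dvd 15 * pos_coeff (k + 3) e" by simp
  ultimately show ?case unfolding pos_coeff_rec v_def[symmetric]
    by (intro dvd_diff) simp_all
qed (auto simp: pos_coeff_base)

abbreviation (input) yy :: "int fps" where "yy \<equiv> fps_X * dil (euler_E 5)"

lemma respart_yy: "respart (r + i) (yy ^ i * f) = yy ^ i * respart r f"
proof -
  have "respart (r + i) (fps_X ^ i * (dil (euler_E 5 ^ i) * f)) = fps_X ^ i * (dil (euler_E 5 ^ i) * respart r f)"
    by (simp only: respart_X_mult respart_dil_mult)
  then show ?thesis by (simp only: power_mult_distrib dil_power mult.assoc)
qed

text \<open>The truncated exponent is harmless, since \<open>pos_coeff\<close> k e is zero for k <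
  5e.\<close>

definition pos_term :: "nat \<Rightarrow> nat \<Rightarrow> int fps" where
  "pos_term k e = fps_X ^ (k - 5 * e) * dil (phi ^ e * euler_E 5 ^ k)"

lemma pos_term_yy:
  assumes "5 * e \<le> k" shows "yy ^ i * pos_term k e = pos_term (k + i) e"
proof -
  have "yy ^ i * pos_term k e = (fps_X ^ i * fps_X ^ (k - 5 * e)) * dil (phi ^ e * euler_E 5 ^ (k + i))"
    by (simp only: pos_term_def power_mult_distrib dil_simps power_add mult_ac)
  also have "fps_X ^ i * fps_X ^ (k - 5 * e) = (fps_X ^ (k + i - 5 * e) :: int fps)"
    using assms by (simp add: power_add[symmetric])
  finally show ?thesis by (simp only: pos_term_def)
qed

lemma pos_term_K:
  assumes "5 * e \<le> k" shows "dil diss_K * pos_term k e = pos_term (k + 5) (Suc e)"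
proof -
  have "dil diss_K * pos_term k e = fps_X ^ (k - 5 * e) * dil (phi ^ Suc e * euler_E 5 ^ (k + 5))"
    by (simp only: pos_term_def diss_K_phi dil_simps power_add power_Suc mult_ac)
  then show ?thesis by (simp add: pos_term_def)
qed

text \<open>The modular equation times E_1^k, restricted to class k+5: by homogeneity each term
  falls into the class attached to its own power. Any N > k is allowed as range, so that the five
  rows of one step share it.\<close>

theorem pos_section:
  "k < N \<Longrightarrow> respart k (euler_E 1 ^ k) = (\<Sum>e<N. of_int (pos_coeff k e) * pos_term k e)"
proof (induction k rule: induct_step_5)
  case (6 k)
  define E where "E = euler_E 1"
  obtain N' where N': "N = Suc N'" "k < 5 * N'" using 6(6) by (cases N) auto
  have y: "yy ^ i * (\<Sum>e<N. of_int (pos_coeff m e) * pos_term m e) = (\<Sum>e<N. of_int (pos_coeff m e) * pos_term (m + i) e)" for m i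
    unfolding sum_distrib_left
  proof (intro sum.cong refl)
    fix e
    show "yy ^ i * (of_int (pos_coeff m e) * pos_term m e) = of_int (pos_coeff m e) * pos_term (m + i) e"
      by (cases "5 * e \<le> m") (simp_all add: pos_coeff_eq_0 mult.left_commute[of _ "of_int _"] pos_term_yy)
  qed
  have K: "dil diss_K * (\<Sum>e<N. of_int (pos_coeff k e) * pos_term k e) =
      (\<Sum>e<N. of_int (if e = 0 then 0 else pos_coeff k (e - 1)) * pos_term (k + 5) e)"
  proof -
    have "dil diss_K * (\<Sum>e<N. of_int (pos_coeff k e) * pos_term k e) = (\<Sum>e<N. of_int (pos_coeff k e) * pos_term (k + 5) (Suc e))"
      unfolding sum_distrib_left
    proof (intro sum.cong refl)
      fix e
      show "dil diss_K * (of_int (pos_coeff k e) * pos_term k e) = of_int (pos_coeff k e) * pos_term (k + 5) (Suc e)"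
        by (cases "5 * e \<le> k") (simp_all add: pos_coeff_eq_0 mult.left_commute[of _ "of_int _"] pos_term_K)
    qed
    also have "\<dots> = (\<Sum>e<N. of_int (if e = 0 then 0 else pos_coeff k (e - 1)) * pos_term (k + 5) e)"
      unfolding N'(1) by (subst (2) sum.lessThan_Suc_shift) (simp add: pos_coeff_eq_0 N'(2))
    finally show ?thesis .
  qed
  have ks: "k + 4 + 1 = k + 5" "k + 3 + 2 = k + 5" "k + 2 + 3 = k + 5" "k + 1 + 4 = k + 5" by simp_all
  have e: "E ^ (k + 5) = dil diss_K * E ^ k - 5 * (yy ^ 1 * E ^ (k + 4)) - 15 * (yy ^ 2 * E ^ (k + 3)) - 25 * (yy ^ 3 * E ^ (k + 2)) - 25 * (yy ^ 4 * E ^ (k + 1))"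
    unfolding euler_quintic[symmetric] E_def[symmetric] by (simp add: algebra_simps power_add power_numeral_reduce)
  have "respart (k + 5) (E ^ (k + 5)) = dil diss_K * respart (k + 5) (E ^ k) - 5 * respart (k + 4 + 1) (yy ^ 1 * E ^ (k + 4))
    - 15 * respart (k + 3 + 2) (yy ^ 2 * E ^ (k + 3)) - 25 * respart (k + 2 + 3) (yy ^ 3 * E ^ (k + 2)) - 25 * respart (k + 1 + 4) (yy ^ 4 * E ^ (k + 1))"
    unfolding e ks by (simp only: respart_diff respart_dil_mult respart_numeral_mult)
  also have "respart (k + 5) (E ^ k) = respart k (E ^ k)"
    by (rule respart_cong) simp
  also have "dil diss_K * respart k (E ^ k) - 5 * respart (k + 4 + 1) (yy ^ 1 * E ^ (k + 4))
    - 15 * respart (k + 3 + 2) (yy ^ 2 * E ^ (k + 3)) - 25 * respart (k + 2 + 3) (yy ^ 3 * E ^ (k + 2)) - 25 * respart (k + 1 + 4) (yy ^ 4 * E ^ (k + 1))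
    = (\<Sum>e<N. of_int (if e = 0 then 0 else pos_coeff k (e - 1)) * pos_term (k + 5) e)
     - 5 * (\<Sum>e<N. of_int (pos_coeff (k + 4) e) * pos_term (k + 5) e)
     - 15 * (\<Sum>e<N. of_int (pos_coeff (k + 3) e) * pos_term (k + 5) e)
     - 25 * (\<Sum>e<N. of_int (pos_coeff (k + 2) e) * pos_term (k + 5) e)
     - 25 * (\<Sum>e<N. of_int (pos_coeff (k + 1) e) * pos_term (k + 5) e)"
  proof -
    have IH: "respart (k + i) (E ^ (k + i)) = (\<Sum>e<N. of_int (pos_coeff (k + i) e) * pos_term (k + i) e)" if "i \<in> {0,1,2,3,4}" for i
      using 6 that unfolding E_def by auto
    have IH0: "respart k (E ^ k) = (\<Sum>e<N. of_int (pos_coeff k e) * pos_term k e)" using IH[of 0] by simp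
    have IH1: "respart (k + 1) (E ^ (k + 1)) = (\<Sum>e<N. of_int (pos_coeff (k + 1) e) * pos_term (k + 1) e)" by (rule IH) simp
    have IH2: "respart (k + 2) (E ^ (k + 2)) = (\<Sum>e<N. of_int (pos_coeff (k + 2) e) * pos_term (k + 2) e)" by (rule IH) simp
    have IH3: "respart (k + 3) (E ^ (k + 3)) = (\<Sum>e<N. of_int (pos_coeff (k + 3) e) * pos_term (k + 3) e)" by (rule IH) simp
    have IH4: "respart (k + 4) (E ^ (k + 4)) = (\<Sum>e<N. of_int (pos_coeff (k + 4) e) * pos_term (k + 4) e)" by (rule IH) simp
    show ?thesis
      unfolding respart_yy unfolding IH0 K IH1 IH2 IH3 IH4 y unfolding ks ..
  qed
  also have "\<dots> = (\<Sum>e<N. of_int (pos_coeff (k + 5) e) * pos_term (k + 5) e)"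
    unfolding sum_distrib_left sum_subtractf[symmetric] pos_coeff_rec
    by (intro sum.cong refl) (simp add: algebra_simps)
  finally show ?case by (simp add: E_def)
next
  have b: "(\<Sum>e<N. of_int (if e = 0 then c else 0) * pos_term k e) = of_int c * (fps_X ^ k * dil (euler_E 5 ^ k))"
    if "k < N" for c k
  proof -
    have "(\<Sum>e<N. of_int (if e = 0 then c else 0) * pos_term k e) = (\<Sum>e<N. if e = 0 then of_int c * pos_term k 0 else 0)"
      by (intro sum.cong refl) simp
    also have "\<dots> = of_int c * pos_term k 0" using that by (subst sum.delta) auto
    finally show ?thesis by (simp add: pos_term_def)
  qed
  { case 1 then show ?case using b[of 0 1] small_sections(1) by (simp add: pos_coeff_base dil_1) }
  { case 2 then show ?case using b[of 1 "-1"] small_sections(2) by (simp add: pos_coeff_base) }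
  { case 3 then show ?case using b[of 2 "-1"] small_sections(3) by (simp add: pos_coeff_base power_mult_distrib dil_power) }
  { case 4 then show ?case using b[of 3 5] small_sections(4) by (simp add: pos_coeff_base power_mult_distrib dil_power) }
  { case 5 then show ?case using b[of 4 "-5"] small_sections(5) by (simp add: pos_coeff_base power_mult_distrib dil_power) }
qed

text \<open>Row n belongs to E_1^(4-n): the modular equation is now solved for its lowest power. The
  first five rows are the sections of E_1^4, ..., E_1^0.\<close>

fun neg_coeff :: "nat \<Rightarrow> nat \<Rightarrow> int" where
  "neg_coeff 0 j = (if j = 0 then -5 else 0)"
| "neg_coeff (Suc 0) j = (if j = 0 then 5 else 0)"
| "neg_coeff (Suc (Suc 0)) j = (if j = 0 then -1 else 0)"
| "neg_coeff (Suc (Suc (Suc 0))) j = (if j = 0 then -1 else 0)"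
| "neg_coeff (Suc (Suc (Suc (Suc 0)))) j = (if j = 0 then 1 else 0)"
| "neg_coeff (Suc (Suc (Suc (Suc (Suc n))))) j = (if j = 0 then 0 else neg_coeff n (j - 1)
     + 5 * neg_coeff (Suc n) (j - 1) + 15 * neg_coeff (Suc (Suc n)) (j - 1)
     + 25 * neg_coeff (Suc (Suc (Suc n))) (j - 1) + 25 * neg_coeff (Suc (Suc (Suc (Suc n)))) (j - 1))"

lemma neg_coeff_rec: "neg_coeff (n + 5) j = (if j = 0 then 0 else neg_coeff n (j - 1)
     + 5 * neg_coeff (n + 1) (j - 1) + 15 * neg_coeff (n + 2) (j - 1)
     + 25 * neg_coeff (n + 3) (j - 1) + 25 * neg_coeff (n + 4) (j - 1))"
  by (simp add: eval_nat_numeral)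

lemma neg_coeff_base:
  "neg_coeff 0 e = (if e = 0 then -5 else 0)" "neg_coeff 1 e = (if e = 0 then 5 else 0)"
  "neg_coeff 2 e = (if e = 0 then -1 else 0)" "neg_coeff 3 e = (if e = 0 then -1 else 0)"
  "neg_coeff 4 e = (if e = 0 then 1 else 0)"
  by (simp_all add: eval_nat_numeral)

lemma neg_coeff_low: "5 * j + 4 < n \<Longrightarrow> neg_coeff n j = 0"
proof (induction n arbitrary: j rule: induct_step_5)
  case (6 n)
  then show ?case by (auto simp: neg_coeff_rec)
qed auto

lemma neg_coeff_high: "0 < j \<Longrightarrow> n \<le> j + 3 \<Longrightarrow> neg_coeff n j = 0"
proof (induction n arbitrary: j rule: induct_step_5)
  case (6 n)
  then show ?case by (auto simp: neg_coeff_rec)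
qed (auto simp: neg_coeff_base)

text \<open>The estimate behind Watson's theorem. It fails in rows below 5, for instance at the
  entry -5 of row 0, so the induction starts from rows 5 to 9.\<close>

lemma neg_coeff_dvd: "5 \<le> n \<Longrightarrow> 5 ^ ((6 * j + 9 - 2 * n) div 3) dvd neg_coeff n j"
proof -
  have rest: "5 ^ ((6 * j + 9 - 2 * (n + 5)) div 3) dvd neg_coeff (n + 5) j" for n
  proof (induction n arbitrary: j rule: induct_step_5)
    case (6 n)
    show ?case
    proof (cases "j = 0")
      case False
      define v where "v = (6 * j + 9 - 2 * (n + 5 + 5)) div 3"
      have step: "5 ^ v dvd 5 ^ i * x" if "5 ^ w dvd x" "v \<le> i + w" for i w and x :: int
      proof -
        have "(5::int) ^ v dvd 5 ^ (i + w)" using that by (intro le_imp_power_dvd)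
        also have "\<dots> dvd 5 ^ i * x" unfolding power_add using that by (intro mult_dvd_mono) auto
        finally show ?thesis .
      qed
      have "5 ^ v dvd 5 ^ 0 * neg_coeff (n + 5) (j - 1)"
        using 6(1)[of "j - 1"] by (rule step) (insert False, unfold v_def, rule div_3_le, rule nat_diff_le_diff, cases j, simp_all)
      moreover have "5 ^ v dvd 5 ^ 1 * neg_coeff (n + 1 + 5) (j - 1)"
        using 6(2)[of "j - 1"] by (rule step) (insert False, unfold v_def, rule div_3_le, rule nat_diff_le_diff, cases j, simp_all)
      moreover have "5 ^ v dvd 5 ^ 2 * neg_coeff (n + 3 + 5) (j - 1)"
        using 6(4)[of "j - 1"] by (rule step) (insert False, unfold v_def, rule div_3_le, rule nat_diff_le_diff, cases j, simp_all)
      moreover have "5 ^ v dvd 5 ^ 2 * neg_coeff (n + 4 + 5) (j - 1)"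
        using 6(5)[of "j - 1"] by (rule step) (insert False, unfold v_def, rule div_3_le, rule nat_diff_le_diff, cases j, simp_all)
      moreover have "5 ^ v dvd 5 ^ 1 * neg_coeff (n + 2 + 5) (j - 1)"
        using 6(3)[of "j - 1"] by (rule step) (insert False, unfold v_def, rule div_3_le, rule nat_diff_le_diff, cases j, simp_all)
      then have "5 ^ v dvd 3 * (5 ^ 1 * neg_coeff (n + 2 + 5) (j - 1))" by (rule dvd_mult)
      then have "5 ^ v dvd 15 * neg_coeff (n + 2 + 5) (j - 1)" by simp
      ultimately show ?thesis unfolding neg_coeff_rec[of "n + 5"] v_def[symmetric] using False
        by (simp add: ac_simps)
    qed (simp add: neg_coeff_rec[of "n + 5"])
  next
    \<comment> \<open>The nonzero entries form Watson's table 5; 10, 125; 9, 375, 3125; and so on,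
      which describes the action of U_5 on powers of (eta(5z)/eta(z))^6.\<close>
    have vals: "neg_coeff 5 0 = 0"
      "neg_coeff 5 1 = 5"
      "neg_coeff 6 0 = 0"
      "neg_coeff 6 1 = 10"
      "neg_coeff 6 2 = 125"
      "neg_coeff 7 0 = 0"
      "neg_coeff 7 1 = 9"
      "neg_coeff 7 2 = 375"
      "neg_coeff 7 3 = 3125"
      "neg_coeff 8 0 = 0"
      "neg_coeff 8 1 = 4"
      "neg_coeff 8 2 = 550"
      "neg_coeff 8 3 = 12500"
      "neg_coeff 8 4 = 78125"
      "neg_coeff 9 0 = 0"
      "neg_coeff 9 1 = 1"
      "neg_coeff 9 2 = 500"
      "neg_coeff 9 3 = 25000"
      "neg_coeff 9 4 = 390625"
      "neg_coeff 9 5 = 1953125"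
      by (simp_all add: eval_nat_numeral)
    { case 1
      have "j = 0 \<or> j = 1 \<or> 2 \<le> j" by linarith
      then show ?case using neg_coeff_high[of j 5]
        by (elim disjE) (simp_all add: vals del: One_nat_def neg_coeff.simps) }
    { case 2
      have "j = 0 \<or> j = 1 \<or> j = 2 \<or> 3 \<le> j" by linarith
      then show ?case using neg_coeff_high[of j 6]
        by (elim disjE) (simp_all add: vals del: One_nat_def neg_coeff.simps) }
    { case 3
      have "j = 0 \<or> j = 1 \<or> j = 2 \<or> j = 3 \<or> 4 \<le> j" by linarith
      then show ?case using neg_coeff_high[of j 7]
        by (elim disjE) (simp_all add: vals del: One_nat_def neg_coeff.simps) }
    { case 4
      have "j = 0 \<or> j = 1 \<or> j = 2 \<or> j = 3 \<or> j = 4 \<or> 5 \<le> j" by linarith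
      then show ?case using neg_coeff_high[of j 8]
        by (elim disjE) (simp_all add: vals del: One_nat_def neg_coeff.simps) }
    { case 5
      have "j = 0 \<or> j = 1 \<or> j = 2 \<or> j = 3 \<or> j = 4 \<or> j = 5 \<or> 6 \<le> j" by linarith
      then show ?case using neg_coeff_high[of j 9]
        by (elim disjE) (simp_all add: vals del: One_nat_def neg_coeff.simps) }
  qed
  assume "5 \<le> n"
  then show ?thesis using rest[of "n - 5"] by simp
qed

definition neg_term :: "nat \<Rightarrow> nat \<Rightarrow> int fps" where
  "neg_term n j = fps_X ^ (5 * j + 4 - n) * dil (psi ^ j * euler_E 5 ^ 4 * einv ^ n)"

lemma neg_term_yy:
  assumes "n + i \<le> 5 * j + 4" 
  shows "dil (einv ^ 5 * psi) * (yy ^ i * neg_term (n + i) j) = neg_term (n + 5) (Suc j)"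
proof -
  have "dil (einv ^ 5 * psi) * (yy ^ i * neg_term (n + i) j) =
    (fps_X ^ i * fps_X ^ (5 * j + 4 - (n + i))) * dil (psi ^ Suc j * euler_E 5 ^ 4 * (einv ^ (n + 5) * (euler_E 5 * einv) ^ i))"
    by (simp only: neg_term_def power_mult_distrib dil_simps power_add power_Suc mult_ac)
  also have "\<dots> = fps_X ^ (i + (5 * j + 4 - (n + i))) * dil (psi ^ Suc j * euler_E 5 ^ 4 * einv ^ (n + 5))"
    by (simp only: einv power_one mult_1_right power_add)
  also have "i + (5 * j + 4 - (n + i)) = 5 * Suc j + 4 - (n + 5)"
    using assms by simp
  finally show ?thesis by (simp only: neg_term_def)
qed

text \<open>The class 4 + 4n is 4 - n modulo 5, written without subtraction. The modular equation is
  divided by \<open>dil diss_K\<close>, whose inverse is \<open>dil (einv ^ 5 * psi)\<close>; each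
  factor of it raises j by one.\<close>

theorem neg_section:
  "n < N \<Longrightarrow> respart (4 + 4 * n) (euler_E 1 ^ 4 * part_gf ^ n) = (\<Sum>j<N. of_int (neg_coeff n j) * neg_term n j)"
proof (induction n rule: induct_step_5)
  case (6 n)
  define E F where "E = euler_E 1" and "F = part_gf"
  have EF: "E * F = 1" by (simp add: E_def F_def euler_part del: One_nat_def)
  have N0: "neg_coeff (n + i) (N - 1) = 0" if "i \<le> 4" for i
    using that 6(6) by (intro neg_coeff_high) auto
  obtain N' where N': "N = Suc N'" using 6(6) by (cases N) auto
  have y: "dil (einv ^ 5 * psi) * (yy ^ i * (\<Sum>j<N. of_int (neg_coeff (n + i) j) * neg_term (n + i) j)) =
     (\<Sum>j<N. of_int (if j = 0 then 0 else neg_coeff (n + i) (j - 1)) * neg_term (n + 5) j)" if "i \<le> 4" for i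
  proof -
    have "dil (einv ^ 5 * psi) * (yy ^ i * (\<Sum>j<N. of_int (neg_coeff (n + i) j) * neg_term (n + i) j)) =
      (\<Sum>j<N. of_int (neg_coeff (n + i) j) * neg_term (n + 5) (Suc j))"
      unfolding sum_distrib_left
    proof (intro sum.cong refl)
      fix j
      show "dil (einv ^ 5 * psi) * (yy ^ i * (of_int (neg_coeff (n + i) j) * neg_term (n + i) j)) = of_int (neg_coeff (n + i) j) * neg_term (n + 5) (Suc j)"
      proof (cases "n + i \<le> 5 * j + 4")
        case True
        then show ?thesis by (simp only: mult.left_commute[of _ "of_int _"] neg_term_yy)
      qed (simp add: neg_coeff_low)
    qed
    also have "\<dots> = (\<Sum>j<N. of_int (if j = 0 then 0 else neg_coeff (n + i) (j - 1)) * neg_term (n + 5) j)"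
      unfolding N' by (subst (2) sum.lessThan_Suc_shift) (use N0[OF that] N' in simp)
    finally show ?thesis .
  qed
  define G where "G = (\<lambda>i. E ^ 4 * F ^ (n + i))"
  have r: "E ^ i * F ^ (n + 5) = F ^ (n + (5 - i))" if "i \<le> 5" for i
  proof -
    have "n + 5 = (n + (5 - i)) + i" using that by simp
    then have "E ^ i * F ^ (n + 5) = F ^ (n + (5 - i)) * (E * F) ^ i"
      by (simp only: power_add power_mult_distrib mult_ac)
    then show ?thesis by (simp add: EF)
  qed
  have inv: "dil (einv ^ 5 * psi) * dil diss_K = 1"
  proof -
    have "einv ^ 5 * psi * diss_K = (euler_E 5 * einv) ^ 5 * (phi * psi)"
      by (simp only: diss_K_phi power_mult_distrib mult_ac)
    then have "einv ^ 5 * psi * diss_K = 1" by (simp add: einv phi_psi)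
    then show ?thesis by (simp only: dil_mult[symmetric] dil_1)
  qed
  have "G 5 = dil (einv ^ 5 * psi) * (dil diss_K * G 5)"
    by (simp only: mult.assoc[symmetric] inv mult_1_left)
  also have "dil diss_K * G 5 = E ^ 4 * (E ^ 5 * F ^ (n + 5)) + 5 * yy * (E ^ 4 * (E ^ 4 * F ^ (n + 5))) + 15 * yy^2 * (E ^ 4 * (E ^ 3 * F ^ (n + 5)))
     + 25 * yy ^ 3 * (E ^ 4 * (E ^ 2 * F ^ (n + 5))) + 25 * yy ^ 4 * (E ^ 4 * (E ^ 1 * F ^ (n + 5)))"
    unfolding euler_quintic[symmetric] G_def E_def[symmetric] by (simp only: distrib_left distrib_right power_one_right mult_ac)
  also have "\<dots> = G 0 + 5 * (yy ^ 1 * G 1) + 15 * (yy ^ 2 * G 2) + 25 * (yy ^ 3 * G 3) + 25 * (yy ^ 4 * G 4)"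
    unfolding G_def using r[of 5] r[of 4] r[of 3] r[of 2] r[of 1] by (simp add: mult.assoc)
  finally have G5: "G 5 = dil (einv ^ 5 * psi) * (yy ^ 0 * G 0 + 5 * (yy ^ 1 * G 1) + 15 * (yy ^ 2 * G 2) + 25 * (yy ^ 3 * G 3) + 25 * (yy ^ 4 * G 4))"
    by simp
  have rr: "respart (4 + 4 * (n + 5)) (yy ^ i * G i) = yy ^ i * respart (4 + 4 * (n + i)) (G i)" for i
  proof -
    have "respart (4 + 4 * (n + 5)) (yy ^ i * G i) = respart (4 + 4 * (n + i) + i) (yy ^ i * G i)"
    proof (rule respart_cong)
      have "4 + 4 * (n + 5) = 4 + 4 * n + 5 * 4" "4 + 4 * (n + i) + i = 4 + 4 * n + 5 * i" by simp_all
      then show "(4 + 4 * (n + 5)) mod 5 = (4 + 4 * (n + i) + i) mod 5" by (metis mod_mult_self2)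
    qed
    then show ?thesis by (simp only: respart_yy)
  qed
  define S where "S = (\<lambda>i. \<Sum>j<N. of_int (if j = 0 then 0 else neg_coeff (n + i) (j - 1)) * neg_term (n + 5) j)"
  have IH: "dil (einv ^ 5 * psi) * (yy ^ i * respart (4 + 4 * (n + i)) (G i)) = S i" if "i \<in> {0,1,2,3,4}" for i
  proof -
    have "respart (4 + 4 * (n + i)) (G i) = (\<Sum>j<N. of_int (neg_coeff (n + i) j) * neg_term (n + i) j)"
      using that 6 unfolding G_def E_def F_def by auto
    then show ?thesis using y[of i] that unfolding S_def by auto
  qed
  have "respart (4 + 4 * (n + 5)) (G 5) = dil (einv ^ 5 * psi) * (yy ^ 0 * respart (4 + 4 * (n + 0)) (G 0)) 
    + 5 * (dil (einv ^ 5 * psi) * (yy ^ 1 * respart (4 + 4 * (n + 1)) (G 1)))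
    + 15 * (dil (einv ^ 5 * psi) * (yy ^ 2 * respart (4 + 4 * (n + 2)) (G 2)))
    + 25 * (dil (einv ^ 5 * psi) * (yy ^ 3 * respart (4 + 4 * (n + 3)) (G 3)))
    + 25 * (dil (einv ^ 5 * psi) * (yy ^ 4 * respart (4 + 4 * (n + 4)) (G 4)))"
    unfolding G5 respart_dil_mult respart_add respart_numeral_mult rr by (simp only: distrib_left mult_ac)
  also have "\<dots> = S 0 + 5 * S 1 + 15 * S 2 + 25 * S 3 + 25 * S 4"
    by (simp only: IH insertI1 insertI2)
  also have "\<dots> = (\<Sum>j<N. of_int (neg_coeff (n + 5) j) * neg_term (n + 5) j)"
    unfolding S_def sum_distrib_left sum.distrib[symmetric] neg_coeff_rec
    by (intro sum.cong refl) (simp add: algebra_simps)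
  finally show ?case unfolding G_def E_def F_def .
next
  have b: "(\<Sum>e<N. of_int (if e = 0 then c else 0) * neg_term k e) = of_int c * (fps_X ^ (4 - k) * dil (euler_E 5 ^ (4 - k)))"
    if "k < N" "k \<le> 4" for c k
  proof -
    have "(\<Sum>e<N. of_int (if e = 0 then c else 0) * neg_term k e) = (\<Sum>e<N. if e = 0 then of_int c * neg_term k 0 else 0)"
      by (intro sum.cong refl) simp
    also have "\<dots> = of_int c * neg_term k 0" using that by (subst sum.delta) auto
    also have "euler_E 5 ^ 4 * einv ^ k = euler_E 5 ^ (4 - k) * (euler_E 5 * einv) ^ k"
      using that by (simp add: power_mult_distrib mult.assoc flip: power_add)
    then have "euler_E 5 ^ 4 * einv ^ k = euler_E 5 ^ (4 - k)" by (simp add: einv)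
    then have "neg_term k 0 = fps_X ^ (4 - k) * dil (euler_E 5 ^ (4 - k))" by (simp add: neg_term_def)
    finally show ?thesis .
  qed
  have e: "euler_E 1 ^ 4 * part_gf ^ k = euler_E 1 ^ (4 - k)" if "k \<le> 4" for k
  proof -
    have "euler_E 1 ^ 4 * part_gf ^ k = euler_E 1 ^ (4 - k) * (euler_E 1 * part_gf) ^ k"
      using that by (simp add: power_mult_distrib mult.assoc flip: power_add)
    then show ?thesis by (simp add: euler_part del: One_nat_def)
  qed
  have rc: "respart 8 f = respart 3 f" "respart 12 f = respart 2 f" "respart 16 f = respart 1 f" "respart 20 f = respart 0 f" for f
    by (rule respart_cong; simp)+
  { case 1 then show ?case using b[of 0 "-5"] e[of 0] small_sections(5) by (simp add: neg_coeff_base power_mult_distrib dil_power) }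
  { case 2 then show ?case using b[of 1 5] e[of 1] small_sections(4) by (simp add: neg_coeff_base power_mult_distrib dil_power rc) }
  { case 3 then show ?case using b[of 2 "-1"] e[of 2] small_sections(3) by (simp add: neg_coeff_base power_mult_distrib dil_power rc) }
  { case 4 then show ?case using b[of 3 "-1"] e[of 3] small_sections(2) by (simp add: neg_coeff_base rc) }
  { case 5 then show ?case using b[of 4 1] e[of 4] small_sections(1) by (simp add: neg_coeff_base dil_1 rc) }
qed

section \<open>Theta inversion\<close>

subsection \<open>Poisson summation for the Gaussian\<close>

text \<open>The real part of the characteristic function of the standard normal
  distribution.\<close>

lemma std_normal_cos_integral:
  "has_bochner_integral lborel (\<lambda>x. std_normal_density x * cos (t * x)) (exp (- (t\<^sup>2) / 2))"
proof -
  have int: "integrable lborel (\<lambda>x. std_normal_density x *\<^sub>R iexp (t * x))"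
  proof (rule Bochner_Integration.integrable_bound)
    show "integrable lborel std_normal_density" by (rule integrable_normal_density) simp
  qed (auto simp: normal_density_nonneg)
  have "exp (- (t\<^sup>2) / 2) = (CLINT x|std_normal_distribution. iexp (t * x))"
    using char_std_normal_distribution by (simp add: fun_eq_iff char_def)
  also have "\<dots> = (CLINT x|lborel. std_normal_density x *\<^sub>R iexp (t * x))"
    by (subst integral_density) (auto simp: normal_density_nonneg)
  finally have "complex_of_real (exp (- (t\<^sup>2) / 2)) = (CLINT x|lborel. std_normal_density x *\<^sub>R iexp (t * x))" .
  then have hb: "has_bochner_integral lborel (\<lambda>x. std_normal_density x *\<^sub>R iexp (t * x)) (complex_of_real (exp (- (t\<^sup>2) / 2)))"
    using int by (simp add: has_bochner_integral_iff)
  have "has_bochner_integral lborel (\<lambda>x. Re (std_normal_density x *\<^sub>R iexp (t * x))) (Re (complex_of_real (exp (- (t\<^sup>2) / 2))))"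
    by (rule has_bochner_integral_bounded_linear[OF bounded_linear_Re hb])
  then show ?thesis by (simp add: Re_exp)
qed

lemma gaussian_cos_integral:
  assumes s: "s > 0"
  shows "has_bochner_integral lborel (\<lambda>x. exp (- pi * x\<^sup>2 / s) * cos (2 * pi * real k * x)) (sqrt s * exp (- pi * (real k)\<^sup>2 * s))"
proof -
  \<comment> \<open>The scaling that turns x^2/2 into pi x^2/s.\<close>
  define c where "c = sqrt (2 * pi / s)"
  have c: "c > 0" "c\<^sup>2 = 2 * pi / s" using s by (simp_all add: c_def)
  define t where "t = 2 * pi * real k / c"
  have "has_bochner_integral lborel (\<lambda>x. std_normal_density (0 + c * x) * cos (t * (0 + c * x))) (exp (- (t\<^sup>2) / 2) /\<^sub>R \<bar>c\<bar>)"
    using lborel_has_bochner_integral_real_affine_iff[of c "\<lambda>x. std_normal_density x * cos (t * x)" "exp (- (t\<^sup>2) / 2)" 0] c(1)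
      std_normal_cos_integral[of t] by simp
  then have "has_bochner_integral lborel (\<lambda>x. sqrt (2 * pi) * (std_normal_density (0 + c * x) * cos (t * (0 + c * x)))) (sqrt (2 * pi) * (exp (- (t\<^sup>2) / 2) /\<^sub>R \<bar>c\<bar>))"
    by (rule has_bochner_integral_mult_right[rotated])
  moreover have "sqrt (2 * pi) * (std_normal_density (0 + c * x) * cos (t * (0 + c * x))) = exp (- pi * x\<^sup>2 / s) * cos (2 * pi * real k * x)" for x
  proof -
    have "(c * x)\<^sup>2 / 2 = pi * x\<^sup>2 / s" by (simp add: power_mult_distrib c(2))
    then show ?thesis using c(1) by (simp add: std_normal_density_def t_def mult.assoc)
  qed
  moreover have "sqrt (2 * pi) * (exp (- (t\<^sup>2) / 2) /\<^sub>R \<bar>c\<bar>) = sqrt s * exp (- pi * (real k)\<^sup>2 * s)"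
  proof -
    have "t\<^sup>2 / 2 = pi * (real k)\<^sup>2 * s"
    proof -
      have "t\<^sup>2 = (2 * pi * real k)\<^sup>2 / c\<^sup>2" by (simp add: t_def power_divide)
      then show ?thesis unfolding c(2) using s by (simp add: field_simps power2_eq_square)
    qed
    then have e: "exp (- (t\<^sup>2) / 2) = exp (- pi * (real k)\<^sup>2 * s)" by simp
    have "sqrt (2 * pi) = c * sqrt s"
      using s by (simp add: c_def real_sqrt_mult[symmetric])
    then show ?thesis unfolding e using c(1) by simp
  qed
  ultimately show ?thesis by simp
qed

lemma integral_even_interval:
  fixes f :: "real \<Rightarrow> real"
  assumes "continuous_on UNIV f" "\<And>x. f (- x) = f x" "a \<ge> 0"
  shows "integral {-a..a} f = 2 * integral {0..a} f"
proof -
  have io: "f integrable_on {u..v}" for u v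
    by (rule integrable_continuous_real) (rule continuous_on_subset[OF assms(1)], simp)
  have "integral {-a..a} f = integral {-a..0} f + integral {0..a} f"
    by (rule Henstock_Kurzweil_Integration.integral_combine[symmetric]) (use assms(3) io in auto)
  also have "integral {-a..0} f = integral {0..a} f"
    using Henstock_Kurzweil_Integration.integral_reflect_real[of a 0 f] assms(2) by simp
  finally show ?thesis by simp
qed

text \<open>Integrals over [0, N] are what the unfolding in \<open>gaussian_poisson\<close>
  produces; evenness of the integrand relates them to the whole line.\<close>

lemma gaussian_cos_limit:
  assumes s: "s > 0"
  shows "(\<lambda>N. 2 * integral {0..real N} (\<lambda>x. exp (- pi * x\<^sup>2 / s) * cos (2 * pi * real k * x))) \<longlonglongrightarrow> sqrt s * exp (- pi * (real k)\<^sup>2 * s)"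
proof -
  define f where "f = (\<lambda>x. exp (- pi * x\<^sup>2 / s) * cos (2 * pi * real k * x))"
  have hb: "has_bochner_integral lborel f (sqrt s * exp (- pi * (real k)\<^sup>2 * s))"
    unfolding f_def by (rule gaussian_cos_integral[OF s])
  then have int: "integrable lborel f" by (simp add: has_bochner_integral_iff)
  have "(\<lambda>N. LINT x|lborel. indicator {- real N..real N} x *\<^sub>R f x) \<longlonglongrightarrow> (LINT x|lborel. f x)"
  proof (rule integral_dominated_convergence[where w = "\<lambda>x. norm (f x)"])
    show "AE x in lborel. (\<lambda>N. indicator {- real N..real N} x *\<^sub>R f x) \<longlonglongrightarrow> f x"
    proof (rule AE_I2)
      fix x :: real
      obtain N0 where N0: "\<bar>x\<bar> \<le> real N0" using real_arch_simple by blast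
      have "\<forall>\<^sub>F N in sequentially. indicator {- real N..real N} x *\<^sub>R f x = f x"
        using eventually_ge_at_top[of N0]
      proof eventually_elim
        case (elim N)
        then have "\<bar>x\<bar> \<le> real N" using N0 by linarith
        then have "x \<in> {- real N..real N}" by auto
        then show ?case by simp
      qed
      then show "(\<lambda>N. indicator {- real N..real N} x *\<^sub>R f x) \<longlonglongrightarrow> f x" by (rule tendsto_eventually)
    qed
  qed (use int in \<open>auto simp: indicator_def\<close>)
  moreover have "(LINT x|lborel. indicator {- real N..real N} x *\<^sub>R f x) = 2 * integral {0..real N} f" for N
  proof -
    have cont: "continuous_on UNIV f" unfolding f_def using s by (intro continuous_intros) auto
    have "(LINT x|lborel. indicator {- real N..real N} x *\<^sub>R f x) = integral {- real N..real N} f"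
      using set_borel_integral_eq_integral(2)[of "{- real N..real N}" f]
        borel_integrable_atLeastAtMost'[OF continuous_on_subset[OF cont], of "- real N" "real N"]
      by (simp add: set_lebesgue_integral_def)
    then show ?thesis using integral_even_interval[OF cont] by (simp add: f_def)
  qed
  moreover have "(LINT x|lborel. f x) = sqrt s * exp (- pi * (real k)\<^sup>2 * s)"
    using hb by (simp add: has_bochner_integral_iff)
  ultimately show ?thesis by (simp add: f_def)
qed

text \<open>The symmetry lets h descend to a continuous function of cos(2 pi x). By Weierstrass it
  is a uniform limit of polynomials in the cosine, to all of which h is orthogonal, so the integral
  of h^2 is below every positive bound.\<close>

lemma cos_orthogonal_imp_zero:
  fixes h :: "real \<Rightarrow> real"
  assumes cont: "continuous_on {0..1} h"
    and sym: "\<And>x. x \<in> {0..1} \<Longrightarrow> h (1 - x) = h x"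
    and orth: "\<And>k::nat. integral {0..1} (\<lambda>x. h x * cos (2 * pi * real k * x)) = 0"
    and x: "x \<in> {0..1}"
  shows "h x = 0"
proof -
  have ci: "continuous_on {0..1} (\<lambda>x. h x * cos (2 * pi * real k * x) * cos (2 * pi * x) ^ m)" for k m
    by (intro continuous_intros cont)
  have orth': "integral {0..1} (\<lambda>x. h x * cos (2 * pi * real k * x) * cos (2 * pi * x) ^ m) = 0" for k m
  proof (induction m arbitrary: k)
    case 0
    then show ?case using orth by simp
  next
    case (Suc m)
    \<comment> \<open>Product-to-sum produces the frequencies k+1 and k-1; for k = 0 the frequency
      -1 is replaced by 1, the cosine being even.\<close>
    define k' where "k' = (if k = 0 then 1 else k - 1)"
    have c: "cos (2 * pi * real k * x) * cos (2 * pi * x) = (cos (2 * pi * real (k + 1) * x) + cos (2 * pi * real k' * x)) / 2" for x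
    proof -
      have "cos (2 * pi * real k * x) * cos (2 * pi * x) = (cos (2 * pi * real k * x - 2 * pi * x) + cos (2 * pi * real k * x + 2 * pi * x)) / 2"
        by (rule cos_times_cos)
      also have "2 * pi * real k * x + 2 * pi * x = 2 * pi * real (k + 1) * x" by (simp add: algebra_simps)
      also have "cos (2 * pi * real k * x - 2 * pi * x) = cos (2 * pi * real k' * x)"
        by (cases k) (simp_all add: k'_def algebra_simps)
      finally show ?thesis by simp
    qed
    have "integral {0..1} (\<lambda>x. h x * cos (2 * pi * real k * x) * cos (2 * pi * x) ^ Suc m)
       = integral {0..1} (\<lambda>x. (h x * cos (2 * pi * real (k + 1) * x) * cos (2 * pi * x) ^ m + h x * cos (2 * pi * real k' * x) * cos (2 * pi * x) ^ m) / 2)"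
    proof (intro integral_cong)
      fix x
      have "h x * cos (2 * pi * real k * x) * cos (2 * pi * x) ^ Suc m = h x * (cos (2 * pi * real k * x) * cos (2 * pi * x)) * cos (2 * pi * x) ^ m"
        by simp
      then show "h x * cos (2 * pi * real k * x) * cos (2 * pi * x) ^ Suc m = (h x * cos (2 * pi * real (k + 1) * x) * cos (2 * pi * x) ^ m + h x * cos (2 * pi * real k' * x) * cos (2 * pi * x) ^ m) / 2"
        unfolding c by (simp add: algebra_simps add_divide_distrib)
    qed
    also have "\<dots> = 0"
      unfolding integral_divide Henstock_Kurzweil_Integration.integral_add[OF
          integrable_continuous_real[OF ci] integrable_continuous_real[OF ci]] Suc.IH by simp
    finally show ?case .
  qed
  define phi where "phi = (\<lambda>y. h (arccos y / (2 * pi)))"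
  have phi: "h x = phi (cos (2 * pi * x))" if "x \<in> {0..1}" for x
  proof (cases "x \<le> 1 / 2")
    case True
    then have "2 * pi * x \<le> pi" using that by (simp add: field_simps)
    then have "arccos (cos (2 * pi * x)) = 2 * pi * x" using that by (intro arccos_cos) auto
    then show ?thesis by (simp add: phi_def)
  next
    case False
    have "cos (2 * pi * x) = cos (2 * pi * (1 - x))"
      by (simp add: right_diff_distrib cos_diff)
    moreover have "2 * pi * (1 - x) \<le> pi" using False by (simp add: field_simps)
    then have "arccos (cos (2 * pi * (1 - x))) = 2 * pi * (1 - x)" using that by (intro arccos_cos) auto
    ultimately show ?thesis using sym[OF that] by (simp add: phi_def)
  qed
  have "continuous_on {-1..1} phi"
    unfolding phi_def
  proof (rule continuous_on_compose2[OF cont])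
    show "continuous_on {-1..1} (\<lambda>y. arccos y / (2 * pi))"
      by (intro continuous_intros continuous_on_arccos') auto
    show "(\<lambda>y. arccos y / (2 * pi)) ` {-1..1} \<subseteq> {0..1}"
    proof (intro image_subsetI)
      fix y :: real assume "y \<in> {-1..1}"
      then have "0 \<le> arccos y" "arccos y \<le> pi" by (auto intro: arccos_lbound arccos_ubound)
      then show "arccos y / (2 * pi) \<in> {0..1}" by (auto simp: divide_le_eq)
    qed
  qed
  have hh: "integral {0..1} (\<lambda>x. h x * h x) \<le> e" if e: "e > 0" for e
  proof -
    define M where "M = integral {0..1} (\<lambda>x. \<bar>h x\<bar>)"
    have M: "M \<ge> 0" unfolding M_def by (intro integral_nonneg integrable_continuous_real continuous_intros cont) auto
    define d where "d = e / (M + 1)"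
    have d: "d > 0" using M e by (simp add: d_def)
    obtain p where p: "real_polynomial_function p" "\<And>y. y \<in> {-1..1} \<Longrightarrow> \<bar>phi y - p y\<bar> < d"
      using Stone_Weierstrass_real_polynomial_function[OF _ \<open>continuous_on {-1..1} phi\<close> d] by auto
    obtain a n where pe: "p = (\<lambda>y. \<Sum>i\<le>n. a i * y ^ i)"
      using p(1) real_polynomial_function_iff_sum by blast
    define P where "P = (\<lambda>x. p (cos (2 * pi * x)))"
    have Pc: "continuous_on {0..1} P" unfolding P_def pe by (intro continuous_intros)
    have "integral {0..1} (\<lambda>x. h x * P x) = integral {0..1} (\<lambda>x. \<Sum>i\<le>n. a i * (h x * cos (2 * pi * real 0 * x) * cos (2 * pi * x) ^ i))"
      unfolding P_def pe by (intro integral_cong) (simp add: sum_distrib_left mult_ac)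
    also have "\<dots> = (\<Sum>i\<le>n. integral {0..1} (\<lambda>x. a i * (h x * cos (2 * pi * real 0 * x) * cos (2 * pi * x) ^ i)))"
      by (intro integral_sum integrable_continuous_real continuous_on_mult_left ci) auto
    also have "\<dots> = 0" by (subst integral_mult_right) (simp only: orth' mult_zero_right sum.neutral_const)
    finally have z: "integral {0..1} (\<lambda>x. h x * P x) = 0" .
    have "integral {0..1} (\<lambda>x. h x * h x) = integral {0..1} (\<lambda>x. h x * h x) - integral {0..1} (\<lambda>x. h x * P x)"
      by (simp add: z)
    also have "\<dots> = integral {0..1} (\<lambda>x. h x * h x - h x * P x)"
      by (intro Henstock_Kurzweil_Integration.integral_diff[symmetric] integrable_continuous_real continuous_intros cont Pc)
    also have "\<dots> \<le> integral {0..1} (\<lambda>x. d * \<bar>h x\<bar>)"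
    proof (intro integral_le integrable_continuous_real continuous_intros cont Pc)
      fix x :: real assume x: "x \<in> {0..1}"
      have "\<bar>h x - P x\<bar> < d" unfolding P_def phi[OF x] by (intro p) auto
      then have "\<bar>h x\<bar> * \<bar>h x - P x\<bar> \<le> \<bar>h x\<bar> * d" by (intro mult_left_mono) auto
      then have "\<bar>h x * (h x - P x)\<bar> \<le> d * \<bar>h x\<bar>" by (simp add: abs_mult mult.commute)
      then show "h x * h x - h x * P x \<le> d * \<bar>h x\<bar>" by (simp add: right_diff_distrib)
    qed
    also have "\<dots> = d * M" by (simp add: M_def)
    also have "\<dots> \<le> e" using M e by (simp add: d_def field_simps)
    finally show ?thesis .
  qed
  have "integral {0..1} (\<lambda>x. h x * h x) = 0"
  proof (rule antisym)
    show "integral {0..1} (\<lambda>x. h x * h x) \<le> 0"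
      by (rule field_le_epsilon) (use hh in simp)
    have "(\<lambda>x. h x * h x) integrable_on {0..1}"
      by (intro integrable_continuous_real continuous_intros cont)
    then show "0 \<le> integral {0..1} (\<lambda>x. h x * h x)"
      by (rule Henstock_Kurzweil_Integration.integral_nonneg) simp
  qed
  then have "h x * h x = 0"
    using integral_eq_0_iff[of 0 1 "\<lambda>x. h x * h x"] x continuous_on_mult[OF cont cont] by simp
  then show ?thesis by simp
qed

lemma integral_flip_unit:
  fixes f :: "real \<Rightarrow> real"
  assumes "continuous_on UNIV f"
  shows "integral {0..1} (\<lambda>x. f (1 - x)) = integral {0..1} f"
proof -
  have "integral {0..1} f = integral {-1..-0} (\<lambda>x. f (- x))"
    by (rule Henstock_Kurzweil_Integration.integral_reflect_real[symmetric])
  also have "continuous_on {0 + -1..1 + -1} (\<lambda>x. f (- x))"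
    by (intro continuous_on_compose2[OF assms] continuous_intros) auto
  then have "integral {-1..-0} (\<lambda>x. f (- x)) = integral {0..1} ((\<lambda>x. f (- x)) \<circ> (\<lambda>x. x + -1))"
    using integral_shift[of 0 "-1" 1 "\<lambda>x. f (- x)"] by simp
  also have "(\<lambda>x. f (- x)) \<circ> (\<lambda>x. x + -1) = (\<lambda>x. f (1 - x))" by (simp add: fun_eq_iff)
  finally show ?thesis by simp
qed

lemma integral_shift_unit:
  fixes f :: "real \<Rightarrow> real"
  assumes "continuous_on UNIV f"
  shows "integral {0..1} (\<lambda>x. f (c + x)) = integral {c..c + 1} f"
proof -
  have "continuous_on {0 + c..1 + c} f" by (rule continuous_on_subset[OF assms]) simp
  from integral_shift[OF this] have "integral {0..1} (f \<circ> (\<lambda>x. x + c)) = integral {0 + c..1 + c} f" .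
  then show ?thesis by (simp add: o_def add.commute)
qed

lemma cos_period_nat: "cos (2 * pi * real k * (real n + x)) = cos (2 * pi * real k * x)"
proof -
  have "2 * pi * real k * (real n + x) = 2 * pi * real k * x + 2 * pi * real_of_int (int (k * n))"
    by (simp add: algebra_simps)
  then show ?thesis by (simp only: cos_add cos_int_2pin sin_int_2pin mult_1_right mult_zero_right diff_0_right)
qed

lemma integral_cos_int: "integral {0..1} (\<lambda>x. cos (2 * pi * of_int m * x)) = (if m = 0 then 1 else 0 :: real)"
proof (cases "m = 0")
  case False
  define c where "c = 2 * pi * of_int m"
  have c: "c \<noteq> 0" using False by (simp add: c_def)
  have "((\<lambda>x. cos (c * x)) has_integral (sin (c * 1) / c - sin (c * 0) / c)) {0..1}"
    by (rule fundamental_theorem_of_calculus)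
       (use c in \<open>auto intro!: derivative_eq_intros simp flip: has_real_derivative_iff_has_vector_derivative\<close>)
  moreover have "sin c = 0" by (simp add: c_def sin_int_2pin)
  ultimately have "((\<lambda>x. cos (c * x)) has_integral 0) {0..1}" by simp
  then show ?thesis using False by (simp add: c_def integral_unique)
qed simp

lemma integral_cos_cos:
  "integral {0..1} (\<lambda>x. cos (2 * pi * real j * x) * cos (2 * pi * real k * x)) = 
    (if j = k then if k = 0 then 1 else 1/2 else 0 :: real)"
proof -
  have io: "(\<lambda>x. cos (2 * pi * of_int m * x)) integrable_on {0..1}" for m
    by (intro integrable_continuous_real continuous_intros)
  have "integral {0..1} (\<lambda>x. cos (2 * pi * real j * x) * cos (2 * pi * real k * x)) =
    integral {0..1} (\<lambda>x. (cos (2 * pi * of_int (int j - int k) * x) + cos (2 * pi * of_int (int j + int k) * x)) / 2)"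
    unfolding cos_times_cos by (simp add: algebra_simps)
  also have "\<dots> = ((if int j - int k = 0 then 1 else 0) + (if int j + int k = 0 then 1 else 0)) / 2"
    unfolding integral_divide Henstock_Kurzweil_Integration.integral_add[OF io io] integral_cos_int ..
  finally show ?thesis by auto
qed

lemma uniform_limit_integral_cos:
  fixes f :: "nat \<Rightarrow> real \<Rightarrow> real"
  assumes ul: "uniform_limit {0..1} f F sequentially" and cont: "\<And>N. continuous_on {0..1} (f N)"
  shows "(\<lambda>N. integral {0..1} (\<lambda>x. f N x * cos (2 * pi * real k * x))) \<longlonglongrightarrow> integral {0..1} (\<lambda>x. F x * cos (2 * pi * real k * x))"
proof -
  have "uniform_limit (cbox 0 1) (\<lambda>N x. f N x * cos (2 * pi * real k * x)) (\<lambda>x. F x * cos (2 * pi * real k * x)) sequentially"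
  proof (rule uniform_limitI)
    fix e :: real assume "e > 0"
    with ul have "\<forall>\<^sub>F N in sequentially. \<forall>x\<in>{0..1}. dist (f N x) (F x) < e" by (rule uniform_limitD)
    then show "\<forall>\<^sub>F N in sequentially. \<forall>x\<in>cbox 0 1. dist (f N x * cos (2 * pi * real k * x)) (F x * cos (2 * pi * real k * x)) < e"
    proof eventually_elim
      case (elim N)
      show ?case
      proof
        fix x :: real assume "x \<in> cbox 0 1"
        then have "dist (f N x) (F x) < e" using elim by simp
        moreover have "\<bar>f N x - F x\<bar> * \<bar>cos (2 * pi * real k * x)\<bar> \<le> \<bar>f N x - F x\<bar> * 1"
          by (intro mult_left_mono) auto
        ultimately show "dist (f N x * cos (2 * pi * real k * x)) (F x * cos (2 * pi * real k * x)) < e"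
          by (simp add: dist_real_def abs_mult flip: left_diff_distrib)
      qed
    qed
  qed
  moreover have "continuous_on (cbox 0 1) (\<lambda>x. f N x * cos (2 * pi * real k * x))" for N
    using cont[of N] by (simp only: cbox_interval) (intro continuous_intros)
  ultimately obtain I J where I: "\<And>N. ((\<lambda>x. f N x * cos (2 * pi * real k * x)) has_integral I N) (cbox 0 1)"
      "((\<lambda>x. F x * cos (2 * pi * real k * x)) has_integral J) (cbox 0 1)" "I \<longlonglongrightarrow> J"
    by (rule uniform_limit_integral_cbox) auto
  have "integral {0..1} (\<lambda>x. f N x * cos (2 * pi * real k * x)) = I N" for N
    using integral_unique[OF I(1)[of N]] by simp
  then show ?thesis using I(3) integral_unique[OF I(2)] by simp
qed

lemma exp_square_summable:
  fixes c :: real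
  assumes "c > 0"
  shows "exp (- c * (real n)\<^sup>2) \<le> exp (- c) ^ n" "summable (\<lambda>n. exp (- c) ^ n)"
proof -
  have "real n \<le> (real n)\<^sup>2" by (cases n) (auto simp: power2_eq_square)
  then have "c * real n \<le> c * (real n)\<^sup>2" using assms by (intro mult_left_mono) auto
  then show "exp (- c * (real n)\<^sup>2) \<le> exp (- c) ^ n" by (simp flip: exp_of_nat_mult add: mult.commute)
  show "summable (\<lambda>n. exp (- c) ^ n)" using assms by (intro summable_geometric) simp
qed

text \<open>The sum over all integers is folded into the pairs n + x and n + 1 - x with n \<ge> 0.
  Both sides are continuous, symmetric under x -> 1-x and have the same cosine coefficients, so they
  agree by \<open>cos_orthogonal_imp_zero\<close>.\<close>

theorem gaussian_poisson:
  fixes s x :: real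
  assumes s: "s > 0" and x: "x \<in> {0..1}"
  defines "g \<equiv> \<lambda>x. exp (- pi * x\<^sup>2 / s)"
  shows "summable (\<lambda>n. g (real n + x) + g (real n + (1 - x)))"
    and "summable (\<lambda>k. 2 * sqrt s * (exp (- pi * (real (Suc k))\<^sup>2 * s) * cos (2 * pi * real (Suc k) * x)))"
    and "(\<Sum>n. g (real n + x) + g (real n + (1 - x))) =
      sqrt s + (\<Sum>k. 2 * sqrt s * (exp (- pi * (real (Suc k))\<^sup>2 * s) * cos (2 * pi * real (Suc k) * x)))"
proof -
  define gs where "gs = (\<lambda>n x. g (real n + x) + g (real n + (1 - x)))"
  define hs where "hs = (\<lambda>k x. 2 * sqrt s * (exp (- pi * (real (Suc k))\<^sup>2 * s) * cos (2 * pi * real (Suc k) * x)))"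
  have gc: "continuous_on UNIV g" unfolding g_def using s by (intro continuous_intros) auto
  have c1: "continuous_on {0..1} (gs n)" for n
    unfolding gs_def by (intro continuous_intros continuous_on_compose2[OF gc]) auto
  have c2: "continuous_on {0..1} (hs n)" for n
    unfolding hs_def by (intro continuous_intros)
  define r where "r = exp (- (pi / s))"
  define r' where "r' = exp (- (pi * s))"
  have b1: "norm (gs n x) \<le> 2 * r ^ n" if "x \<in> {0..1}" for n x
  proof -
    have "g (real n + u) \<le> r ^ n" if "u \<ge> 0" for u
    proof -
      have "(real n)\<^sup>2 \<le> (real n + u)\<^sup>2" using that by (intro power_mono) auto
      then have "pi / s * (real n)\<^sup>2 \<le> pi / s * (real n + u)\<^sup>2" using s by (intro mult_left_mono) auto
      then have "g (real n + u) \<le> exp (- (pi / s) * (real n)\<^sup>2)" by (simp add: g_def)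
      also have "\<dots> \<le> r ^ n" unfolding r_def by (rule exp_square_summable) (use s in simp)
      finally show ?thesis .
    qed
    from this[of x] this[of "1 - x"] that have "gs n x \<le> 2 * r ^ n" by (simp add: gs_def)
    moreover have "gs n x \<ge> 0" by (simp add: gs_def g_def add_nonneg_nonneg)
    ultimately show ?thesis by simp
  qed
  have s1: "summable (\<lambda>n. 2 * r ^ n)"
    unfolding r_def by (intro summable_mult exp_square_summable) (use s in simp)
  have b2: "norm (hs n x) \<le> 2 * sqrt s * r' ^ Suc n" for n x
  proof -
    have "exp (- (pi * s) * (real (Suc n))\<^sup>2) \<le> r' ^ Suc n" unfolding r'_def by (rule exp_square_summable) (use s in simp)
    then have "exp (- pi * (real (Suc n))\<^sup>2 * s) \<le> r' ^ Suc n" by (simp add: mult_ac)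
    moreover have "\<bar>cos (2 * pi * real (Suc n) * x)\<bar> \<le> 1" by simp
    ultimately have "exp (- pi * (real (Suc n))\<^sup>2 * s) * \<bar>cos (2 * pi * real (Suc n) * x)\<bar> \<le> r' ^ Suc n * 1"
      by (intro mult_mono) (auto simp: r'_def)
    then have "2 * sqrt s * (exp (- pi * (real (Suc n))\<^sup>2 * s) * \<bar>cos (2 * pi * real (Suc n) * x)\<bar>) \<le> 2 * sqrt s * r' ^ Suc n"
      using s by (intro mult_left_mono) auto
    moreover have "norm (hs n x) = 2 * sqrt s * (exp (- pi * (real (Suc n))\<^sup>2 * s) * \<bar>cos (2 * pi * real (Suc n) * x)\<bar>)"
      unfolding hs_def norm_mult using s by (simp add: abs_mult del: of_nat_Suc)
    ultimately show ?thesis by simp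
  qed
  have s2: "summable (\<lambda>n. 2 * sqrt s * r' ^ Suc n)"
    unfolding r'_def by (intro summable_mult, subst summable_Suc_iff, intro exp_square_summable) (use s in simp)
  define G where "G = (\<lambda>x. \<Sum>n. gs n x)"
  define H where "H = (\<lambda>x. \<Sum>n. hs n x)"
  have u1: "uniform_limit {0..1} (\<lambda>N x. \<Sum>n<N. gs n x) G sequentially"
    unfolding G_def by (rule Weierstrass_m_test[OF b1 s1])
  have u2: "uniform_limit {0..1} (\<lambda>N x. \<Sum>n<N. hs n x) H sequentially"
    unfolding H_def by (rule Weierstrass_m_test[OF b2 s2])
  \<comment> \<open>The cosine has period 1, so integration over [0,1] unfolds the translates to
    [0,N]; the two halves of each pair contribute equally.\<close>
  have gsum: "integral {0..1} (\<lambda>x. (\<Sum>n<N. gs n x) * cos (2 * pi * real k * x)) = 2 * integral {0..real N} (\<lambda>x. g x * cos (2 * pi * real k * x))" for N k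
  proof -
    define f where "f = (\<lambda>x. g x * cos (2 * pi * real k * x))"
    have fc: "continuous_on UNIV f" unfolding f_def by (intro continuous_intros gc)
    have io: "f integrable_on {u..v}" for u v
      by (rule integrable_continuous_real) (rule continuous_on_subset[OF fc], simp)
    have fl: "(\<lambda>x. f (real n + x)) integrable_on {0..1}" "(\<lambda>x. f (real n + (1 - x))) integrable_on {0..1}" for n
      by (rule integrable_continuous_real, intro continuous_intros continuous_on_compose2[OF fc], auto)+
    have e: "gs n x * cos (2 * pi * real k * x) = f (real n + x) + f (real n + (1 - x))" for n x
    proof -
      have "cos (2 * pi * real k * (1 - x)) = cos (2 * pi * real k * x)"
        using cos_period_nat[of k 1 "- x"] by simp
      then show ?thesis unfolding f_def gs_def cos_period_nat by (simp add: distrib_right)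
    qed
    have one: "integral {0..1} (\<lambda>x. gs n x * cos (2 * pi * real k * x)) = 2 * integral {real n..real n + 1} f" for n
    proof -
      have cc: "continuous_on UNIV (\<lambda>x. f (real n + x))" by (intro continuous_on_compose2[OF fc] continuous_intros) auto
      have "integral {0..1} (\<lambda>x. gs n x * cos (2 * pi * real k * x)) = integral {0..1} (\<lambda>x. f (real n + x)) + integral {0..1} (\<lambda>x. f (real n + (1 - x)))"
        unfolding e by (rule Henstock_Kurzweil_Integration.integral_add[OF fl])
      also have "integral {0..1} (\<lambda>x. f (real n + (1 - x))) = integral {0..1} (\<lambda>x. f (real n + x))"
        by (rule integral_flip_unit[OF cc])
      also have "integral {0..1} (\<lambda>x. f (real n + x)) = integral {real n..real n + 1} f"
        by (rule integral_shift_unit[OF fc])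
      finally show ?thesis by simp
    qed
    have "integral {0..1} (\<lambda>x. (\<Sum>n<N. gs n x) * cos (2 * pi * real k * x)) = (\<Sum>n<N. integral {0..1} (\<lambda>x. gs n x * cos (2 * pi * real k * x)))"
      unfolding sum_distrib_right
      by (intro integral_sum integrable_continuous_real continuous_intros c1) auto
    also have "\<dots> = (\<Sum>n<N. 2 * integral {real n..real n + 1} f)" by (simp only: one)
    also have "\<dots> = 2 * integral {0..real N} f"
    proof (induction N)
      case (Suc N)
      have "integral {0..real N} f + integral {real N..real N + 1} f = integral {0..real N + 1} f"
        by (rule Henstock_Kurzweil_Integration.integral_combine) (use io in auto)
      then show ?case using Suc by (simp add: add.commute)
    qed simp
    finally show ?thesis by (simp add: f_def)
  qed
  define E where "E = (\<lambda>k. sqrt s * exp (- pi * (real k)\<^sup>2 * s))"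
  have lim1: "(\<lambda>N. integral {0..1} (\<lambda>x. (\<Sum>n<N. gs n x) * cos (2 * pi * real k * x))) \<longlonglongrightarrow> E k" for k
    unfolding gsum g_def E_def by (rule gaussian_cos_limit[OF s])
  have I1: "integral {0..1} (\<lambda>x. G x * cos (2 * pi * real k * x)) = E k" for k
    by (rule LIMSEQ_unique[OF uniform_limit_integral_cos[OF u1] lim1]) (intro continuous_intros c1)
  have hsum: "integral {0..1} (\<lambda>x. (\<Sum>n<N. hs n x) * cos (2 * pi * real k * x)) = (if k = 0 then 0 else E k)" if "N > k" for N k
  proof -
    have "integral {0..1} (\<lambda>x. (\<Sum>n<N. hs n x) * cos (2 * pi * real k * x)) = (\<Sum>n<N. integral {0..1} (\<lambda>x. hs n x * cos (2 * pi * real k * x)))"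
      unfolding sum_distrib_right
      by (intro integral_sum integrable_continuous_real continuous_intros c2) auto
    also have "\<dots> = (\<Sum>n<N. 2 * E (Suc n) * integral {0..1} (\<lambda>x. cos (2 * pi * real (Suc n) * x) * cos (2 * pi * real k * x)))"
      unfolding integral_mult_right[symmetric] hs_def E_def by (simp only: mult_ac)
    also have "\<dots> = (\<Sum>n<N. if n = k - 1 then (if k = 0 then 0 else E k) else 0)"
      unfolding integral_cos_cos by (intro sum.cong refl) auto
    also have "\<dots> = (if k = 0 then 0 else E k)" using that by (subst sum.delta) auto
    finally show ?thesis .
  qed
  have lim2: "(\<lambda>N. integral {0..1} (\<lambda>x. (\<Sum>n<N. hs n x) * cos (2 * pi * real k * x))) \<longlonglongrightarrow> (if k = 0 then 0 else E k)" for k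
    by (rule tendsto_eventually, rule eventually_mono[OF eventually_gt_at_top[of k]], rule hsum)
  have I2: "integral {0..1} (\<lambda>x. H x * cos (2 * pi * real k * x)) = (if k = 0 then 0 else E k)" for k
    by (rule LIMSEQ_unique[OF uniform_limit_integral_cos[OF u2] lim2]) (intro continuous_intros c2)
  have cG: "continuous_on {0..1} G"
    by (rule uniform_limit_theorem[OF _ u1]) (auto intro!: always_eventually continuous_on_sum c1)
  have cH: "continuous_on {0..1} H"
    by (rule uniform_limit_theorem[OF _ u2]) (auto intro!: always_eventually continuous_on_sum c2)
  have "G x - sqrt s - H x = 0"
  proof (rule cos_orthogonal_imp_zero[OF _ _ _ x])
    show "continuous_on {0..1} (\<lambda>x. G x - sqrt s - H x)" by (intro continuous_intros cG cH)
    show "G (1 - x) - sqrt s - H (1 - x) = G x - sqrt s - H x" if "x \<in> {0..1}" for x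
    proof -
      have "gs n (1 - x) = gs n x" for n by (simp add: gs_def)
      moreover have "hs n (1 - x) = hs n x" for n
        using cos_period_nat[of "Suc n" 1 "- x"] unfolding of_nat_1 hs_def by (simp del: of_nat_Suc)
      ultimately show ?thesis by (simp add: G_def H_def)
    qed
    fix k :: nat
    have io: "(\<lambda>x. G x * cos (2 * pi * real k * x)) integrable_on {0..1}" "(\<lambda>x. sqrt s * cos (2 * pi * of_int (int k) * x)) integrable_on {0..1}"
        "(\<lambda>x. H x * cos (2 * pi * real k * x)) integrable_on {0..1}"
      by (intro integrable_continuous_real continuous_intros cG cH)+
    have "integral {0..1} (\<lambda>x. (G x - sqrt s - H x) * cos (2 * pi * real k * x)) =
      integral {0..1} (\<lambda>x. G x * cos (2 * pi * real k * x) - sqrt s * cos (2 * pi * of_int (int k) * x) - H x * cos (2 * pi * real k * x))"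
      by (simp add: left_diff_distrib)
    also have "\<dots> = E k - sqrt s * (if int k = 0 then 1 else 0) - (if k = 0 then 0 else E k)"
      unfolding Henstock_Kurzweil_Integration.integral_diff[OF integrable_diff[OF io(1,2)] io(3)]
        Henstock_Kurzweil_Integration.integral_diff[OF io(1,2)] I1 I2 integral_mult_right integral_cos_int ..
    also have "\<dots> = 0" by (simp add: E_def)
    finally show "integral {0..1} (\<lambda>x. (G x - sqrt s - H x) * cos (2 * pi * real k * x)) = 0" .
  qed
  then show "(\<Sum>n. g (real n + x) + g (real n + (1 - x))) =
      sqrt s + (\<Sum>k. 2 * sqrt s * (exp (- pi * (real (Suc k))\<^sup>2 * s) * cos (2 * pi * real (Suc k) * x)))"
    by (simp add: G_def H_def gs_def hs_def)
  show "summable (\<lambda>n. g (real n + x) + g (real n + (1 - x)))"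
    using summable_comparison_test'[OF s1 b1[OF x]] by (simp add: gs_def)
  show "summable (\<lambda>k. 2 * sqrt s * (exp (- pi * (real (Suc k))\<^sup>2 * s) * cos (2 * pi * real (Suc k) * x)))"
    using summable_comparison_test'[OF s2 b2] by (simp add: hs_def)
qed

text \<open>The Gauss sum of the character. The difference equals 2 sin(pi k/2) sin(pi k/3), and the
  sign changes under k -> k+2 and k -> k+3 reduce the claim to six values.\<close>

lemma chi12_cos: "cos (2 * pi * real k * (1/12)) - cos (2 * pi * real k * (5/12)) = sqrt 3 * of_int (chi12 k)"
proof -
  define f where "f = (\<lambda>k. sin (pi * real k / 2))"
  define g where "g = (\<lambda>k. sin (pi * real k / 3))"
  have A: "(2 * pi * real k * (1/12) + 2 * pi * real k * (5/12)) / 2 = pi * real k / 2" by (simp add: field_simps)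
  have B: "(2 * pi * real k * (5/12) - 2 * pi * real k * (1/12)) / 2 = pi * real k / 3" by (simp add: field_simps)
  have F: "cos (2 * pi * real k * (1/12)) - cos (2 * pi * real k * (5/12)) = 2 * f k * g k" for k
  proof -
    have A: "(2 * pi * real k * (1/12) + 2 * pi * real k * (5/12)) / 2 = pi * real k / 2" by (simp add: field_simps)
    have B: "(2 * pi * real k * (5/12) - 2 * pi * real k * (1/12)) / 2 = pi * real k / 3" by (simp add: field_simps)
    show ?thesis unfolding cos_diff_cos A B f_def g_def by simp
  qed
  have f2: "f (k + 2) = - f k" for k
  proof -
    have "pi * real (k + 2) / 2 = pi * real k / 2 + pi" by (simp add: field_simps)
    then show ?thesis unfolding f_def by (simp only: sin_periodic_pi)
  qed
  have g3: "g (k + 3) = - g k" for k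
  proof -
    have "pi * real (k + 3) / 3 = pi * real k / 3 + pi" by (simp add: field_simps)
    then show ?thesis unfolding g_def by (simp only: sin_periodic_pi)
  qed
  have "sin (pi * 2 / 3) = sqrt 3 / 2"
  proof -
    have "pi * 2 / 3 = pi - pi / 3" by simp
    then show ?thesis by (simp only: sin_pi_minus sin_60)
  qed
  then have base: "f 0 = 0" "f 1 = 1" "g 0 = 0" "g 1 = sqrt 3 / 2" "g 2 = sqrt 3 / 2"
    by (simp_all add: f_def g_def sin_60)
  have "2 * f k * g k = sqrt 3 * of_int (chi12 k)"
  proof (induction k rule: less_induct)
    case (less k)
    show ?case
    proof (cases "k < 6")
      case True
      then have "k = 0 \<or> k = 1 \<or> k = 2 \<or> k = 3 \<or> k = 4 \<or> k = 5" by linarith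
      moreover have "f 2 = 0" "f 3 = -1" "f 4 = 0" "f 5 = 1" "g 3 = 0" "g 5 = - (sqrt 3 / 2)"
        using f2[of 0] f2[of 1] f2[of 2] f2[of 3] g3[of 0] g3[of 2] base by (simp_all add: eval_nat_numeral)
      ultimately show ?thesis using base by (elim disjE) (simp_all add: chi12_def)
    next
      case False
      define m where "m = k - 6"
      have k: "k = m + 6" using False by (simp add: m_def)
      have "f (m + 6) = - f m" using f2[of m] f2[of "m + 2"] f2[of "m + 4"] by (simp add: eval_nat_numeral)
      moreover have "g (m + 6) = g m" using g3[of m] g3[of "m + 3"] by (simp add: eval_nat_numeral)
      moreover have "chi12 (m + 6) = - chi12 m"
      proof -
        have "list_all (\<lambda>r. chi12 (r + 6) = - chi12 r) [0, 1, 2, 3, 4, 5, 6, 7, 8, 9, 10, 11]"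
          by (simp add: chi12_def)
        from all_less_12[OF this, of "m mod 12"] have "chi12 (m mod 12 + 6) = - chi12 m" by (simp add: chi12_mod)
        moreover have "chi12 (m mod 12 + 6) = chi12 (m + 6)" by (simp add: chi12_def mod_simps)
        ultimately show ?thesis by simp
      qed
      ultimately show ?thesis using less[of m] k by simp
    qed
  qed
  then show ?thesis using F by simp
qed

definition theta12 :: "real \<Rightarrow> real" where
  "theta12 u = (\<Sum>k. of_int (chi12 k) * exp (- pi * (real k)\<^sup>2 * u))"

lemma abs_chi12_le: "\<bar>chi12 k\<bar> \<le> 1"
  by (simp add: chi12_def)

lemma theta12_summable: 
  assumes "u > 0" shows "summable (\<lambda>k. of_int (chi12 k) * exp (- pi * (real k)\<^sup>2 * u))"
proof (rule summable_comparison_test')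
  show "summable (\<lambda>n. exp (- (pi * u)) ^ n)" by (rule exp_square_summable) (use assms in simp)
  show "norm (of_int (chi12 n) * exp (- pi * (real n)\<^sup>2 * u)) \<le> exp (- (pi * u)) ^ n" for n
  proof -
    have "exp (- (pi * u) * (real n)\<^sup>2) \<le> exp (- (pi * u)) ^ n" by (rule exp_square_summable) (use assms in simp)
    moreover have "\<bar>real_of_int (chi12 n)\<bar> \<le> 1" using abs_chi12_le[of n] by linarith
    ultimately have "\<bar>real_of_int (chi12 n)\<bar> * exp (- (pi * u) * (real n)\<^sup>2) \<le> 1 * exp (- (pi * u)) ^ n"
      by (intro mult_mono) auto
    then show ?thesis by (simp add: abs_mult mult_ac)
  qed
qed

text \<open>Poisson summation at x = 1/12 minus that at x = 5/12: on the left the residues 1, 11, 5,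
  7 modulo 12 appear with the signs of the character, and on the right the same character arises
  through \<open>chi12_cos\<close>.\<close>

theorem theta12_inversion:
  assumes t: "t > 0"
  shows "theta12 (1 / (12 * t)) = sqrt t * theta12 (t / 12)"
proof -
  \<comment> \<open>With this choice (n + i/12)^2/s = (12n + i)^2/(12t).\<close>
  define s where "s = t / 12"
  have s: "s > 0" using t by (simp add: s_def)
  define g where "g = (\<lambda>x. exp (- pi * x\<^sup>2 / s))"
  define a where "a = (\<lambda>k. of_int (chi12 k) * exp (- pi * (real k)\<^sup>2 * (1 / (12 * t))))"
  define b where "b = (\<lambda>k. of_int (chi12 k) * exp (- pi * (real k)\<^sup>2 * s))"
  define gs where "gs = (\<lambda>x n. g (real n + x) + g (real n + (1 - x)))"
  define hs where "hs = (\<lambda>x k. 2 * sqrt s * (exp (- pi * (real (Suc k))\<^sup>2 * s) * cos (2 * pi * real (Suc k) * x)))"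
  have P: "summable (gs x)" "summable (hs x)" "suminf (gs x) = sqrt s + suminf (hs x)" if "x \<in> {0..1}" for x
    using gaussian_poisson[OF s that] by (simp_all only: gs_def hs_def g_def)
  have "a sums theta12 (1 / (12 * t))"
    unfolding a_def theta12_def by (rule summable_sums[OF theta12_summable]) (use t in simp)
  from sums_group[OF this, of 12]
  have "(\<lambda>n. sum a {n * 12..<n * 12 + 12}) sums theta12 (1 / (12 * t))" by simp
  moreover have "sum a {n * 12..<n * 12 + 12} =
      (g (real n + 1/12) + g (real n + (1 - 1/12))) - (g (real n + 5/12) + g (real n + (1 - 5/12)))" for n
  proof -
    have g: "g (real n + real i / 12) = exp (- pi * (real (n * 12 + i))\<^sup>2 * (1 / (12 * t)))" for i
    proof -
      have "(real n + real i / 12)\<^sup>2 / s = (real (n * 12 + i))\<^sup>2 * (1 / (12 * t))"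
        using t by (simp add: s_def field_simps power2_eq_square)
      then show ?thesis unfolding g_def by (simp add: mult.assoc flip: times_divide_eq_right)
    qed
    have c: "chi12 (n * 12 + i) = chi12 i" for i
      by (simp add: chi12_def)
    have "sum a {n * 12..<n * 12 + 12} = (\<Sum>i<12. a (n * 12 + i))"
      by (simp add: sum.atLeastLessThan_shift_0[of a "n * 12" "n * 12 + 12"] lessThan_atLeast0)
    also have "\<dots> = (\<Sum>i<12. of_int (chi12 i) * g (real n + real i / 12))"
      unfolding a_def c g ..
    also have "{..<12::nat} = {0,1,2,3,4,5,6,7,8,9,10,11}"
      unfolding atLeast_upt by (simp add: upt_rec eval_nat_numeral)
    also have "(\<Sum>i\<in>\<dots>. of_int (chi12 i) * g (real n + real i / 12)) =
        (g (real n + 1/12) + g (real n + 11/12)) - (g (real n + 5/12) + g (real n + 7/12))"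
      by (simp add: chi12_def)
    finally show ?thesis by simp
  qed
  ultimately have "(\<lambda>n. (g (real n + 1/12) + g (real n + (1 - 1/12))) - (g (real n + 5/12) + g (real n + (1 - 5/12)))) sums theta12 (1 / (12 * t))"
    by simp
  then have "(\<lambda>n. gs (1/12) n - gs (5/12) n) sums theta12 (1 / (12 * t))"
    by (simp only: gs_def)
  then have "theta12 (1 / (12 * t)) = (\<Sum>n. gs (1/12) n - gs (5/12) n)"
    by (rule sums_unique)
  also have "\<dots> = suminf (gs (1/12)) - suminf (gs (5/12))"
    by (rule suminf_diff[symmetric]) (rule P, simp)+
  also have "\<dots> = suminf (hs (1/12)) - suminf (hs (5/12))"
    by (simp add: P)
  also have "\<dots> = (\<Sum>k. hs (1/12) k - hs (5/12) k)"
    by (rule suminf_diff) (rule P, simp)+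
  also have "\<dots> = (\<Sum>k. 2 * sqrt s * sqrt 3 * b (Suc k))"
  proof (rule arg_cong[of _ _ suminf], rule ext)
    fix k
    show "hs (1/12) k - hs (5/12) k = 2 * sqrt s * sqrt 3 * b (Suc k)"
      unfolding hs_def right_diff_distrib[symmetric] chi12_cos b_def by (simp only: mult_ac)
  qed
  also have "\<dots> = 2 * sqrt s * sqrt 3 * (\<Sum>k. b (Suc k))"
    using theta12_summable[OF s] by (intro suminf_mult) (simp only: b_def[symmetric] summable_Suc_iff)
  also have "(\<Sum>k. b (Suc k)) = theta12 s"
  proof -
    have "suminf b = b 0 + (\<Sum>k. b (Suc k))"
      using theta12_summable[OF s] by (intro suminf_split_head[of b, THEN eq_diff_eq[THEN iffD1], symmetric, unfolded add.commute[of "suminf _"]])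
        (simp add: b_def)
    then show ?thesis by (simp add: b_def theta12_def chi12_def)
  qed
  also have "2 * sqrt s * sqrt 3 = sqrt t"
  proof -
    have "2 * sqrt s * sqrt 3 = sqrt 4 * sqrt s * sqrt 3" by simp
    also have "\<dots> = sqrt (4 * s * 3)" by (simp only: real_sqrt_mult)
    finally have "2 * sqrt s * sqrt 3 = sqrt (4 * s * 3)" .
    then show ?thesis by (simp add: s_def)
  qed
  finally show ?thesis by (simp add: s_def)
qed

section \<open>The Dedekind eta function\<close>

subsection \<open>Convergence on the unit disc\<close>

text \<open>Convergence on the open unit disc, where \<open>ee\<close> takes its values on the upper
  half plane.\<close>

definition on_disc :: "complex fps \<Rightarrow> bool" where
  "on_disc f \<longleftrightarrow> fps_conv_radius f \<ge> 1"

lemma on_discD: "on_disc f \<Longrightarrow> norm q < 1 \<Longrightarrow> ereal (norm q) < fps_conv_radius f"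
  unfolding on_disc_def by (metis ereal_less(3) less_le_trans one_ereal_def)

lemma on_disc_mult: "on_disc f \<Longrightarrow> on_disc g \<Longrightarrow> on_disc (f * g)"
  unfolding on_disc_def using fps_conv_radius_mult[of f g] by (meson min.boundedI order_trans)
lemma on_disc_add: "on_disc f \<Longrightarrow> on_disc g \<Longrightarrow> on_disc (f + g)"
  unfolding on_disc_def using fps_conv_radius_add[of f g] by (meson min.boundedI order_trans)
lemma on_disc_diff: "on_disc f \<Longrightarrow> on_disc g \<Longrightarrow> on_disc (f - g)"
  unfolding on_disc_def using fps_conv_radius_diff[of f g] by (meson min.boundedI order_trans)
lemma on_disc_power: "on_disc f \<Longrightarrow> on_disc (f ^ n)"
  unfolding on_disc_def using fps_conv_radius_power[of f n] by (meson order_trans)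
lemma on_disc_1: "on_disc 1" and on_disc_X: "on_disc fps_X" and on_disc_0: "on_disc 0" and on_disc_const: "on_disc (fps_const c)"
  by (simp_all add: on_disc_def)
lemma on_disc_X_power: "on_disc (fps_X ^ n)"
  by (intro on_disc_power on_disc_X)
lemma on_disc_sum: "(\<And>i. i \<in> A \<Longrightarrow> on_disc (f i)) \<Longrightarrow> on_disc (\<Sum>i\<in>A. f i)"
  by (induction A rule: infinite_finite_induct) (auto intro: on_disc_add on_disc_0)

lemmas on_disc_intros = on_disc_mult on_disc_add on_disc_diff on_disc_power on_disc_1 on_disc_X on_disc_0 on_disc_const on_disc_sum

lemma on_discI:
  assumes "\<And>r. 0 < r \<Longrightarrow> r < 1 \<Longrightarrow> summable (\<lambda>n. norm (fps_nth f n) * r ^ n)"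
  shows "on_disc f"
  unfolding on_disc_def fps_conv_radius_def
proof (rule conv_radius_geI_ex)
  fix r :: real assume "0 < r" "ereal r < 1"
  then have r: "0 < r" "r < 1" by (simp_all add: one_ereal_def)
  have "summable (\<lambda>n. fps_nth f n * of_real r ^ n)"
    by (rule summable_norm_cancel) (use assms[OF r] r in \<open>simp add: norm_mult norm_power\<close>)
  then show "\<exists>z. norm z = r \<and> summable (\<lambda>n. fps_nth f n * z ^ n)"
    using r by (intro exI[of _ "of_real r"]) simp
qed

lemma on_disc_bounded:
  assumes "\<And>n. norm (fps_nth f n) \<le> C" shows "on_disc f"
proof (rule on_discI)
  fix r :: real assume r: "0 < r" "r < 1"
  have "summable (\<lambda>n. C * r ^ n)" using r by (intro summable_mult summable_geometric) simp
  then show "summable (\<lambda>n. norm (fps_nth f n) * r ^ n)"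
    by (rule summable_comparison_test') (use r assms in \<open>auto simp: abs_mult intro!: mult_right_mono\<close>)
qed

lemma on_disc_norm_summable:
  assumes "on_disc f" "norm q < 1" shows "summable (\<lambda>n. norm (fps_nth f n * q ^ n))"
  using norm_summable_fps[of q f] on_discD[OF assms] by simp

lemma on_disc_sums: "on_disc f \<Longrightarrow> norm q < 1 \<Longrightarrow> (\<lambda>n. fps_nth f n * q ^ n) sums eval_fps f q"
  by (rule sums_eval_fps) (rule on_discD)

lemma on_disc_le:
  assumes "on_disc f" "\<And>n. norm (fps_nth g n) \<le> C * norm (fps_nth f n)" shows "on_disc g"
proof (rule on_discI)
  fix r :: real assume r: "0 < r" "r < 1"
  have "summable (\<lambda>n. C * norm (fps_nth f n * of_real r ^ n))"
    by (intro summable_mult on_disc_norm_summable assms) (use r in simp)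
  then show "summable (\<lambda>n. norm (fps_nth g n) * r ^ n)"
  proof (rule summable_comparison_test')
    fix n
    have "norm (fps_nth g n) * r ^ n \<le> (C * norm (fps_nth f n)) * r ^ n"
      using r by (intro mult_right_mono assms) auto
    then show "norm (norm (fps_nth g n) * r ^ n) \<le> C * norm (fps_nth f n * of_real r ^ n)"
      using r by (simp add: norm_mult norm_power)
  qed
qed

lemma eval_add: "on_disc f \<Longrightarrow> on_disc g \<Longrightarrow> norm q < 1 \<Longrightarrow> eval_fps (f + g) q = eval_fps f q + eval_fps g q"
  by (intro eval_fps_add on_discD)
lemma eval_diff: "on_disc f \<Longrightarrow> on_disc g \<Longrightarrow> norm q < 1 \<Longrightarrow> eval_fps (f - g) q = eval_fps f q - eval_fps g q"
  by (intro eval_fps_diff on_discD)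
lemma eval_mult: "on_disc f \<Longrightarrow> on_disc g \<Longrightarrow> norm q < 1 \<Longrightarrow> eval_fps (f * g) q = eval_fps f q * eval_fps g q"
  by (intro eval_fps_mult on_discD)
lemma eval_power: "on_disc f \<Longrightarrow> norm q < 1 \<Longrightarrow> eval_fps (f ^ n) q = eval_fps f q ^ n"
  by (intro eval_fps_power on_discD)
lemma eval_sum: "(\<And>i. i \<in> A \<Longrightarrow> on_disc (f i)) \<Longrightarrow> norm q < 1 \<Longrightarrow> eval_fps (\<Sum>i\<in>A. f i) q = (\<Sum>i\<in>A. eval_fps (f i) q)"
  by (induction A rule: infinite_finite_induct) (auto simp: eval_add on_disc_sum)

text \<open>Identities come from points q = \<open>ee z\<close>, which are never 0; continuity
  supplies the value there.\<close>

lemma eval_unique: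
  assumes "on_disc f" "on_disc g" "\<And>q. norm q < 1 \<Longrightarrow> q \<noteq> 0 \<Longrightarrow> eval_fps f q = eval_fps g q"
  shows "f = g"
proof (rule eval_fps_eqD)
  have p: "(0::ereal) < 1" by simp
  show "0 < fps_conv_radius f" "0 < fps_conv_radius g"
    using assms(1,2) p unfolding on_disc_def by (metis less_le_trans)+
  have c: "isCont (\<lambda>q. eval_fps f q - eval_fps g q) 0"
    using \<open>0 < fps_conv_radius f\<close> \<open>0 < fps_conv_radius g\<close>
    by (intro continuous_intros continuous_eval_fps) (simp_all add: zero_ereal_def)
  have ev: "\<forall>\<^sub>F q in at 0. eval_fps f q - eval_fps g q = (0::complex)"
    unfolding eventually_at using assms(3) by (intro exI[of _ 1]) (auto simp: dist_norm)
  have "((\<lambda>q. eval_fps f q - eval_fps g q) \<longlongrightarrow> 0) (at 0)"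
    using ev by (rule tendsto_eventually)
  then have z: "eval_fps f 0 - eval_fps g 0 = (0::complex)"
    using c LIM_unique unfolding isCont_def by blast
  show "\<forall>\<^sub>F z in nhds 0. eval_fps f z = eval_fps g z"
    unfolding eventually_nhds_metric
  proof (intro exI[of _ 1] conjI allI impI)
    fix q :: complex assume "dist q 0 < 1"
    then show "eval_fps f q = eval_fps g q"
      using assms(3)[of q] z by (cases "q = 0") (auto simp: dist_norm)
  qed simp
qed

lemma euler_coeff_bound: "\<bar>fps_nth (euler_E 1) m\<bar> \<le> 1"
proof (cases "\<exists>k. 24 * m + 1 = k\<^sup>2")
  case True
  then obtain k where "24 * m + 1 = k\<^sup>2" by blast
  then show ?thesis using pentagonal_number_theorem(1)[of m k] abs_chi12_le[of k] by simp
next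
  case False
  then show ?thesis using pentagonal_number_theorem(2)[of m] by simp
qed

lemma on_disc_euler: "on_disc (cfps (euler_E 1))"
proof (rule on_disc_bounded[where C = 1])
  fix n
  have "\<bar>real_of_int (fps_nth (euler_E 1) n)\<bar> \<le> 1" using euler_coeff_bound[of n] by linarith
  then show "norm (fps_nth (cfps (euler_E 1)) n) \<le> 1" by simp
qed

section \<open>Convergence of the partition series\<close>

definition geo :: "nat \<Rightarrow> int fps" where
  "geo k = Abs_fps (\<lambda>n. if k dvd n then 1 else 0)"

lemma geo_mult: assumes "k > 0" shows "geo k * (1 - fps_X ^ k) = 1"
proof (rule fps_ext)
  fix n
  have "k dvd n - k \<longleftrightarrow> k dvd n" if "k \<le> n" using that by (metis dvd_minus_self not_less)
  moreover have "\<not> k dvd n" if "n < k" "n > 0" using that nat_dvd_not_less by blast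
  ultimately show "fps_nth (geo k * (1 - fps_X ^ k)) n = fps_nth 1 n"
    using assms by (auto simp: geo_def right_diff_distrib fps_X_power_mult_right_nth)
qed

definition partN :: "nat \<Rightarrow> int fps" where "partN N = (\<Prod>k<N. geo (k + 1))"

lemma partN_qpoch: "partN N * qpoch N = 1"
  unfolding partN_def qpoch_def prod.distrib[symmetric] by (simp add: geo_mult del: One_nat_def)

lemma partN_nth: "n \<le> N \<Longrightarrow> fps_nth part_gf n = fps_nth (partN N) n"
proof -
  assume "n \<le> N"
  have "part_gf - partN N = (partN N * qpoch N) * part_gf - partN N * (euler_E 1 * part_gf)"
    by (simp only: partN_qpoch euler_part) simp
  also have "\<dots> = - (euler_E 1 - qpoch N) * (part_gf * partN N)" by (simp add: algebra_simps)
  finally have "fps_X ^ (N + 1) dvd part_gf - partN N"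
    using euler_E_1_cong[of N] by (metis dvd_mult2 dvd_minus_iff)
  then show ?thesis using fps_X_power_dvd_imp_nth_zero[of "N + 1" "part_gf - partN N" n] \<open>n \<le> N\<close> by simp
qed

lemma partN_nonneg: "fps_nth (partN N) n \<ge> 0"
  by (induction N arbitrary: n) (auto simp: partN_def geo_def fps_mult_nth intro!: sum_nonneg)

text \<open>Since the coefficients are nonnegative, multiplying back by 1 - q^k bounds the partial
  sums by those of the shorter product. Together with \<open>prod_geometric_bound\<close> the bound
  is uniform in N.\<close>

lemma partN_bound:
  assumes r: "0 < r" "r < (1::real)"
  shows "(\<Sum>n\<le>M. of_int (fps_nth (partN N) n) * r ^ n) \<le> (\<Prod>k<N. 1 / (1 - r ^ (k + 1)))"
proof (induction N)
  case 0
  have "(\<Sum>n\<le>M. of_int (fps_nth (partN 0) n) * r ^ n) = (\<Sum>n\<le>M. if n = 0 then 1 else 0)"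
    by (intro sum.cong refl) (simp add: partN_def)
  then show ?case by simp
next
  case (Suc N)
  define k where "k = N + 1"
  define h where "h = (\<lambda>M. \<Sum>n\<le>M. real_of_int (fps_nth (partN (Suc N)) n) * r ^ n)"
  have eq: "partN (Suc N) = partN N + fps_X ^ k * partN (Suc N)"
  proof -
    have "partN (Suc N) * (1 - fps_X ^ k) = partN N * (geo k * (1 - fps_X ^ k))"
      by (simp add: partN_def k_def mult_ac)
    moreover have "geo k * (1 - fps_X ^ k) = 1" by (rule geo_mult) (simp add: k_def)
    ultimately have "partN (Suc N) * (1 - fps_X ^ k) = partN N" by (simp only: mult_1_right)
    then show ?thesis by (simp add: algebra_simps)
  qed
  have e: "fps_nth (partN (Suc N)) n = fps_nth (partN N) n + (if n < k then 0 else fps_nth (partN (Suc N)) (n - k))" for n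
    using arg_cong[OF eq, of "\<lambda>f. fps_nth f n"] by (simp add: fps_X_power_mult_nth)
  have "h M = (\<Sum>n\<le>M. real_of_int (fps_nth (partN N) n) * r ^ n) + (\<Sum>n\<le>M. real_of_int (if n < k then 0 else fps_nth (partN (Suc N)) (n - k)) * r ^ n)"
    unfolding h_def by (subst e) (simp add: distrib_right sum.distrib)
  also have "(\<Sum>n\<le>M. real_of_int (if n < k then 0 else fps_nth (partN (Suc N)) (n - k)) * r ^ n) = (\<Sum>n\<in>{n. n \<le> M \<and> k \<le> n}. real_of_int (fps_nth (partN (Suc N)) (n - k)) * r ^ n)"
    by (rule sum.mono_neutral_cong_right) auto
  also have "\<dots> = (\<Sum>n\<in>{n. n + k \<le> M}. real_of_int (fps_nth (partN (Suc N)) n) * r ^ (n + k))"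
    by (rule sum.reindex_bij_witness[of _ "\<lambda>n. n + k" "\<lambda>n. n - k"]) auto
  also have "\<dots> \<le> (\<Sum>n\<le>M. real_of_int (fps_nth (partN (Suc N)) n) * r ^ (n + k))"
    using r partN_nonneg by (intro sum_mono2) auto
  also have "\<dots> = r ^ k * h M" unfolding h_def sum_distrib_left by (simp add: power_add mult_ac)
  finally have "h M * (1 - r ^ k) \<le> (\<Sum>n\<le>M. real_of_int (fps_nth (partN N) n) * r ^ n)" by (simp add: algebra_simps)
  also have "\<dots> \<le> (\<Prod>k<N. 1 / (1 - r ^ (k + 1)))" by (rule Suc.IH)
  finally have "h M * (1 - r ^ k) \<le> (\<Prod>k<N. 1 / (1 - r ^ (k + 1)))" .
  moreover have "1 - r ^ k > 0" using power_Suc_less_one[of r N] r by (simp add: k_def)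
  ultimately have "h M \<le> (\<Prod>k<N. 1 / (1 - r ^ (k + 1))) / (1 - r ^ k)" by (simp add: pos_le_divide_eq)
  then show ?case by (simp add: h_def k_def)
qed

lemma prod_geometric_bound:
  assumes r: "0 < r" "r < (1::real)"
  shows "(\<Prod>k<N. 1 / (1 - r ^ (k + 1))) \<le> exp (r / (1 - r) / (1 - r))"
proof -
  have "(\<Prod>k<N. 1 / (1 - r ^ (k + 1))) \<le> (\<Prod>k<N. exp (r ^ (k + 1) / (1 - r)))"
  proof (intro prod_mono conjI)
    fix k
    define x where "x = r ^ (k + 1)"
    have x: "0 < x" "x \<le> r" using r unfolding x_def by (auto simp: power_le_one mult_left_le)
    then show "0 \<le> 1 / (1 - r ^ (k + 1))" using r unfolding x_def[symmetric] by simp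
    have "1 / (1 - x) = 1 + x / (1 - x)" using x r by (simp add: field_simps)
    also have "\<dots> \<le> exp (x / (1 - x))" by (rule exp_ge_add_one_self)
    also have "\<dots> \<le> exp (x / (1 - r))" using x r by (simp add: frac_le)
    finally show "1 / (1 - r ^ (k + 1)) \<le> exp (r ^ (k + 1) / (1 - r))" by (simp add: x_def)
  qed
  also have "\<dots> = exp (\<Sum>k<N. r ^ (k + 1) / (1 - r))" by (simp add: exp_sum)
  also have "(\<Sum>k<N. r ^ (k + 1) / (1 - r)) = r * (\<Sum>k<N. r ^ k) / (1 - r)"
    by (simp add: sum_divide_distrib sum_distrib_left)
  also have "(\<Sum>k<N. r ^ k) \<le> 1 / (1 - r)"
    using r by (simp add: sum_gp_strict divide_right_mono)
  then have "r * (\<Sum>k<N. r ^ k) / (1 - r) \<le> r * (1 / (1 - r)) / (1 - r)"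
    using r by (intro divide_right_mono mult_left_mono) auto
  finally show ?thesis by simp
qed

lemma on_disc_part: "on_disc (cfps part_gf)"
proof (rule on_discI)
  fix r :: real assume r: "0 < r" "r < 1"
  show "summable (\<lambda>n. norm (fps_nth (cfps part_gf) n) * r ^ n)"
  proof (rule summableI_nonneg_bounded)
    show "0 \<le> norm (fps_nth (cfps part_gf) n) * r ^ n" for n using r by simp
    show "(\<Sum>n<M. norm (fps_nth (cfps part_gf) n) * r ^ n) \<le> exp (r / (1 - r) / (1 - r))" for M
    proof -
      have "(\<Sum>n<M. norm (fps_nth (cfps part_gf) n) * r ^ n) \<le> (\<Sum>n\<le>M. norm (fps_nth (cfps part_gf) n) * r ^ n)"
        using r by (intro sum_mono2) auto
      also have "\<dots> = (\<Sum>n\<le>M. of_int (fps_nth (partN M) n) * r ^ n)"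
        by (intro sum.cong refl) (auto simp: partN_nth[of _ M] partN_nonneg)
      also have "\<dots> \<le> exp (r / (1 - r) / (1 - r))"
        using partN_bound[OF r, of M M] prod_geometric_bound[OF r, of M] by linarith
      finally show ?thesis .
    qed
  qed
qed

subsection \<open>The eta function\<close>

definition ee :: "complex \<Rightarrow> complex" where "ee z = exp (2 * pi * \<i> * z)"

lemma ee_add: "ee (z + w) = ee z * ee w"
  by (simp add: ee_def distrib_left exp_add)
lemma ee_minus: "ee (- z) = inverse (ee z)"
  by (simp add: ee_def exp_minus)
lemma ee_nonzero [simp]: "ee z \<noteq> 0"
  by (simp add: ee_def)
lemma ee_0 [simp]: "ee 0 = 1"
  by (simp add: ee_def)
lemma ee_of_int [simp]: "ee (of_int n) = 1"
  using exp_integer_2pi[of "of_int n"] by (simp add: ee_def mult_ac)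
lemma ee_of_nat [simp]: "ee (of_nat n) = 1"
  using ee_of_int[of "int n"] by simp
lemma ee_power: "ee z ^ n = ee (of_nat n * z)"
  by (simp add: ee_def mult_ac flip: exp_of_nat_mult)
lemma norm_ee: "norm (ee z) = exp (- 2 * pi * Im z)"
  by (simp add: ee_def)
lemma norm_ee_less_1: "Im z > 0 \<Longrightarrow> norm (ee z) < 1"
  by (simp add: norm_ee)
lemma holomorphic_on_ee [holomorphic_intros]: "f holomorphic_on A \<Longrightarrow> (\<lambda>z. ee (f z)) holomorphic_on A"
  unfolding ee_def by (intro holomorphic_intros)

abbreviation upper_half :: "complex set" where "upper_half \<equiv> {z. Im z > 0}"

lemma open_upper_half: "open upper_half"
  by (rule open_halfspace_Im_gt)
lemma connected_upper_half: "connected upper_half"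
  by (intro convex_connected convex_halfspace_Im_gt)

lemma holomorphic_on_eval_ee:
  assumes "on_disc f" "g holomorphic_on A" "\<And>z. z \<in> A \<Longrightarrow> Im (g z) > 0"
  shows "(\<lambda>z. eval_fps f (ee (g z))) holomorphic_on A"
proof -
  have "eval_fps f holomorphic_on ball 0 1"
    by (rule holomorphic_on_eval_fps) (auto intro!: on_discD[OF assms(1)])
  moreover have "(\<lambda>z. ee (g z)) holomorphic_on A" by (intro holomorphic_intros assms)
  ultimately have "(eval_fps f \<circ> (\<lambda>z. ee (g z))) holomorphic_on A"
    using assms(3) by (intro holomorphic_on_compose_gen[where t = "ball 0 1"]) (auto simp: norm_ee)
  then show ?thesis by (simp add: o_def)
qed

definition eta :: "complex \<Rightarrow> complex" where
  "eta z = ee (z / 24) * eval_fps (cfps (euler_E 1)) (ee z)"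

lemma eta_holomorphic: "eta holomorphic_on upper_half"
proof -
  have "(\<lambda>z. ee (z / 24) * eval_fps (cfps (euler_E 1)) (ee z)) holomorphic_on upper_half"
    by (intro holomorphic_intros holomorphic_on_eval_ee on_disc_euler) auto
  then show ?thesis by (simp add: eta_def[abs_def])
qed

lemma eval_euler_part: "norm q < 1 \<Longrightarrow> eval_fps (cfps (euler_E 1)) q * eval_fps (cfps part_gf) q = 1"
  by (subst eval_mult[symmetric]) (auto simp: on_disc_euler on_disc_part euler_part cfps_1 simp flip: cfps_mult simp del: One_nat_def)

lemma eta_nonzero: "Im z > 0 \<Longrightarrow> eta z \<noteq> 0"
  using eval_euler_part[OF norm_ee_less_1[of z]] by (auto simp: eta_def)

lemma inverse_eta: "Im z > 0 \<Longrightarrow> inverse (eta z) = ee (- z / 24) * eval_fps (cfps part_gf) (ee z)"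
  using eval_euler_part[OF norm_ee_less_1[of z]] ee_minus[of "z / 24"]
  by (simp add: eta_def inverse_unique)

lemma eta_add_of_int: "eta (z + of_int n) = ee (of_int n / 24) * eta z"
  by (simp add: eta_def ee_add add_divide_distrib)

text \<open>Coefficients of eta as a series in q^(1/24), so that all exponents are integers and the
  index l^2 acts by n -> l^2 n.\<close>

definition e24 :: "nat \<Rightarrow> int" where
  "e24 n = (if \<exists>k. n = k\<^sup>2 then chi12 (THE k. n = k\<^sup>2) else 0)"

lemma e24_square [simp]: "e24 (k\<^sup>2) = chi12 k"
proof -
  have "(THE j. k\<^sup>2 = j\<^sup>2) = k" by (rule the_equality) auto
  then show ?thesis by (auto simp: e24_def)
qed

lemma e24_nonsquare: "(\<nexists>k. n = k\<^sup>2) \<Longrightarrow> e24 n = 0"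
  by (simp add: e24_def)

lemma e24_pentagonal: "e24 (24 * m + 1) = fps_nth (euler_E 1) m"
proof (cases "\<exists>k. 24 * m + 1 = k\<^sup>2")
  case True
  then obtain k where k: "24 * m + 1 = k\<^sup>2" by blast
  then show ?thesis using pentagonal_number_theorem(1)[OF k] by simp
qed (use pentagonal_number_theorem(2) e24_nonsquare in auto)

lemma e24_nonzero_imp: "e24 n \<noteq> 0 \<Longrightarrow> \<exists>m. n = 24 * m + 1"
proof -
  assume "e24 n \<noteq> 0"
  then obtain k where n: "n = k\<^sup>2" and c: "chi12 k \<noteq> 0" by (cases "\<exists>k. n = k\<^sup>2") (auto simp: e24_nonsquare)
  from c show ?thesis
  proof (cases rule: chi12_nonzero_cases)
    case (1 j)
    then show ?thesis using n pentagonal_24(1)[of j] by metis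
  next
    case (2 j)
    then show ?thesis using n pentagonal_24(2)[of j] by metis
  qed
qed

lemma abs_e24_le: "\<bar>e24 n\<bar> \<le> 1"
  by (cases "\<exists>k. n = k\<^sup>2") (auto simp: e24_nonsquare abs_chi12_le)

definition eta_fps :: "complex fps" where "eta_fps = Abs_fps (\<lambda>n. of_int (e24 n))"

lemma eta_fps_nth [simp]: "fps_nth eta_fps n = of_int (e24 n)"
  by (simp add: eta_fps_def)

lemma on_disc_eta_fps: "on_disc eta_fps"
proof (rule on_disc_bounded[where C = 1])
  fix n
  have "\<bar>real_of_int (e24 n)\<bar> \<le> 1" using abs_e24_le[of n] by linarith
  then show "norm (fps_nth eta_fps n) \<le> 1" by simp
qed

lemma eta_eval: assumes "Im z > 0" shows "eta z = eval_fps eta_fps (ee (z / 24))"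
proof -
  have q: "norm (ee z) < 1" "norm (ee (z / 24)) < 1" using assms by (auto intro: norm_ee_less_1)
  have "(\<lambda>m. fps_nth (cfps (euler_E 1)) m * ee z ^ m) sums eval_fps (cfps (euler_E 1)) (ee z)"
    by (rule on_disc_sums[OF on_disc_euler q(1)])
  then have "(\<lambda>m. ee (z / 24) * (fps_nth (cfps (euler_E 1)) m * ee z ^ m)) sums eta z"
    unfolding eta_def by (rule sums_mult)
  moreover have "ee (z / 24) * (fps_nth (cfps (euler_E 1)) m * ee z ^ m) = of_int (e24 (24 * m + 1)) * ee (z / 24) ^ (24 * m + 1)" for m
  proof -
    have "ee z = ee (z / 24) ^ 24" by (simp add: ee_power)
    then show ?thesis unfolding e24_pentagonal by (simp add: power_mult)
  qed
  ultimately have "(\<lambda>m. of_int (e24 (24 * m + 1)) * ee (z / 24) ^ (24 * m + 1)) sums eta z" by (simp only:)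
  then have "(\<lambda>n. of_int (e24 n) * ee (z / 24) ^ n) sums eta z"
  proof (rule sums_mono_reindex[where g = "\<lambda>m. 24 * m + 1", THEN iffD1, rotated 2])
    show "strict_mono (\<lambda>m::nat. 24 * m + 1)" by (simp add: strict_mono_def)
    fix n :: nat assume "n \<notin> range (\<lambda>m. 24 * m + 1)"
    then have "e24 n = 0" using e24_nonzero_imp by blast
    then show "of_int (e24 n) * ee (z / 24) ^ n = 0" by simp
  qed
  moreover have "(\<lambda>n. of_int (e24 n) * ee (z / 24) ^ n) sums eval_fps eta_fps (ee (z / 24))"
    using on_disc_sums[OF on_disc_eta_fps q(2)] by simp
  ultimately show ?thesis by (rule sums_unique2)
qed

lemma eta_imaginary: assumes t: "t > 0" shows "eta (\<i> * of_real t) = of_real (theta12 (t / 12))"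
proof -
  define x where "x = exp (- pi * (t / 12))"
  have ex: "ee (\<i> * of_real t / 24) = of_real x"
    by (simp add: ee_def x_def flip: exp_of_real)
  have "(\<lambda>k. of_int (chi12 k) * exp (- pi * (real k)\<^sup>2 * (t / 12))) sums theta12 (t / 12)"
    unfolding theta12_def by (rule summable_sums[OF theta12_summable]) (use t in simp)
  moreover have "exp (- pi * (real k)\<^sup>2 * (t / 12)) = x ^ (k\<^sup>2)" for k
    by (simp add: x_def algebra_simps flip: exp_of_nat_mult)
  ultimately have "(\<lambda>k. (of_int (e24 (k\<^sup>2)) * x ^ (k\<^sup>2) :: real)) sums theta12 (t / 12)" by simp
  then have "(\<lambda>n. of_int (e24 n) * x ^ n) sums theta12 (t / 12)"
  proof (rule sums_mono_reindex[where g = "\<lambda>k. k\<^sup>2", THEN iffD1, rotated 2])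
    show "strict_mono (\<lambda>k::nat. k\<^sup>2)" by (simp add: strict_mono_def power_strict_mono)
    fix n :: nat assume "n \<notin> range (\<lambda>k. k\<^sup>2)"
    then have "e24 n = 0" by (intro e24_nonsquare) blast
    then show "of_int (e24 n) * x ^ n = 0" by simp
  qed
  then have "(\<lambda>n. complex_of_real (of_int (e24 n) * x ^ n)) sums of_real (theta12 (t / 12))"
    by (rule sums_of_real)
  moreover have "norm (ee (\<i> * of_real t / 24)) < 1" by (rule norm_ee_less_1) (use t in simp)
  then have "(\<lambda>n. of_int (e24 n) * ee (\<i> * of_real t / 24) ^ n) sums eval_fps eta_fps (ee (\<i> * of_real t / 24))"
    using on_disc_sums[OF on_disc_eta_fps] by simp
  ultimately show ?thesis unfolding ex using t by (simp add: eta_eval ex sums_unique2)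
qed

lemma Im_minus_inverse: "Im (- 1 / z) = Im z / (norm z)\<^sup>2"
  by (simp add: Im_divide cmod_power2)

lemma Im_minus_inverse_pos: "Im z > 0 \<Longrightarrow> Im (- 1 / z) > 0"
  unfolding Im_minus_inverse by (auto intro!: divide_pos_pos)

lemma csqrt_holomorphic_comp:
  assumes "g holomorphic_on upper_half" "\<And>z. Im z > 0 \<Longrightarrow> Re (g z) > 0"
  shows "(\<lambda>z. csqrt (g z)) holomorphic_on upper_half"
  by (rule holomorphic_on_csqrt'[OF assms(1)]) (use assms(2) in \<open>auto simp: complex_nonpos_Reals_iff not_le\<close>)

text \<open>Analytic continuation from the imaginary axis, where the claim is
  \<open>theta12_inversion\<close>. For z in the upper half plane -iz has positive real part, so the
  principal root is holomorphic.\<close>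

theorem eta_inversion:
  assumes "Im z > 0"
  shows "eta (- 1 / z) = csqrt (- \<i> * z) * eta z"
proof -
  define f where "f = (\<lambda>z. eta (- 1 / z) - csqrt (- \<i> * z) * eta z)"
  have "(eta \<circ> (\<lambda>z. - 1 / z)) holomorphic_on upper_half"
    by (rule holomorphic_on_compose_gen[OF _ eta_holomorphic])
       (auto intro!: holomorphic_intros Im_minus_inverse_pos[simplified])
  moreover have "(\<lambda>z. csqrt (- \<i> * z)) holomorphic_on upper_half"
    by (rule csqrt_holomorphic_comp, intro holomorphic_intros, simp)
  ultimately have hol: "f holomorphic_on upper_half"
    unfolding f_def o_def by (intro holomorphic_on_diff holomorphic_on_mult eta_holomorphic)
  define U where "U = (\<lambda>t. \<i> * complex_of_real t) ` {0<..}"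
  have "f z = 0"
  proof (rule analytic_continuation[OF hol open_upper_half connected_upper_half, of U \<i>])
    show "U \<subseteq> upper_half" "\<i> \<in> upper_half" by (auto simp: U_def)
    show "\<i> islimpt U"
      unfolding islimpt_approachable
    proof (intro allI impI)
      fix e :: real assume e: "e > 0"
      have "\<i> * complex_of_real (1 + e / 2) \<in> U" unfolding U_def using e by (intro imageI) simp
      moreover have "\<i> * complex_of_real (1 + e / 2) \<noteq> \<i>" using e by (auto simp: complex_eq_iff)
      moreover have "dist (\<i> * complex_of_real (1 + e / 2)) \<i> < e"
      proof -
        have eq: "\<i> * complex_of_real (1 + e / 2) - \<i> = \<i> * complex_of_real (e / 2)" by (simp add: complex_eq_iff)
        have "norm (\<i> * complex_of_real (e / 2)) = e / 2" using e by (simp add: norm_mult)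
        then show ?thesis unfolding dist_norm eq using e by linarith
      qed
      ultimately show "\<exists>x'\<in>U. x' \<noteq> \<i> \<and> dist x' \<i> < e" by blast
    qed
    show "f w = 0" if "w \<in> U" for w
    proof -
      from that obtain t where w: "w = \<i> * complex_of_real t" and "t \<in> {0<..}"
        unfolding U_def by (rule imageE)
      then have t: "t > 0" "w = \<i> * complex_of_real t" by simp_all
      have "- 1 / w = \<i> * complex_of_real (1 / t)" using t by (simp add: field_simps)
      then have "eta (- 1 / w) = of_real (theta12 (1 / t / 12))" using eta_imaginary[of "1 / t"] t by simp
      also have "1 / t / 12 = 1 / (12 * t)" by simp
      also have "theta12 (1 / (12 * t)) = sqrt t * theta12 (t / 12)" by (rule theta12_inversion[OF t(1)])
      also have "complex_of_real (sqrt t * theta12 (t / 12)) = csqrt (- \<i> * w) * eta w"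
        using t eta_imaginary[of t] by (simp add: mult.assoc[symmetric])
      finally show ?thesis by (simp add: f_def)
    qed
    show "z \<in> upper_half" using assms by simp
  qed
  then show ?thesis by (simp add: f_def)
qed

subsection \<open>Modular substitutions\<close>

definition moeb :: "int \<Rightarrow> int \<Rightarrow> int \<Rightarrow> int \<Rightarrow> complex \<Rightarrow> complex" where
  "moeb a b c d z = (of_int a * z + of_int b) / (of_int c * z + of_int d)"

lemma moeb_denom_nonzero:
  assumes "Im z > 0" "a * d - b * c = (1::int)"
  shows "of_int c * z + of_int d \<noteq> (0::complex)"
proof
  assume e: "of_int c * z + of_int d = (0::complex)"
  then have "Im (of_int c * z + of_int d) = 0" by simp
  then have "c = 0" using assms(1) by simp
  with e have "d = 0" by simp
  with \<open>c = 0\<close> assms(2) show False by simp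
qed

lemma Im_moeb:
  assumes "a * d - b * c = (1::int)"
  shows "Im (moeb a b c d z) = Im z / (norm (of_int c * z + of_int d))\<^sup>2"
proof -
  have "real_of_int a * of_int d - of_int b * of_int c = of_int (a * d - b * c)" by simp
  then have d: "real_of_int a * of_int d - of_int b * of_int c = 1" unfolding assms by simp
  have "(of_int a * Im z) * (of_int c * Re z + of_int d) - (of_int a * Re z + of_int b) * (of_int c * Im z)
     = Im z * (real_of_int a * of_int d - of_int b * of_int c)" by (simp add: algebra_simps)
  then show ?thesis unfolding moeb_def Im_divide d by (simp add: cmod_power2)
qed

lemma Im_moeb_pos: "Im z > 0 \<Longrightarrow> a * d - b * c = (1::int) \<Longrightarrow> Im (moeb a b c d z) > 0"
  using Im_moeb[of a d b c z] moeb_denom_nonzero[of z a d b c] by simp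

text \<open>Euclid's algorithm on the first column (a, c): a translation by a div c followed by an
  inversion replaces c by a mod c.\<close>

lemma modular_invariance:
  assumes S: "\<And>z. Im z > 0 \<Longrightarrow> f (- 1 / z) = f z" and T: "\<And>z. Im z > 0 \<Longrightarrow> f (z + 1) = f z"
    and det: "a * d - b * c = (1::int)" and z: "Im z > 0"
  shows "f (moeb a b c d z) = f z"
proof -
  have Tn: "f (z + of_nat n) = f z" if "Im z > 0" for z n
  proof (induction n)
    case (Suc n)
    have "f (z + of_nat n + 1) = f (z + of_nat n)" by (rule T) (use that in simp)
    then show ?case using Suc by (simp add: add_ac)
  qed simp
  have Ti: "f (z + of_int n) = f z" if "Im z > 0" for z n
  proof (cases "n \<ge> 0")
    case True
    then show ?thesis using Tn[OF that, of "nat n"] by simp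
  next
    case False
    then show ?thesis using Tn[of "z + of_int n" "nat (- n)"] that by simp
  qed
  show ?thesis using det
  proof (induction "nat \<bar>c\<bar>" arbitrary: a b c d rule: less_induct)
    case less
    show ?case
    proof (cases "c = 0")
      case True
      then have "a * d = 1" using less by simp
      then have "a = 1 \<and> d = 1 \<or> a = -1 \<and> d = -1" by (rule zmult_eq_1_iff[THEN iffD1])
      then have "moeb a b c d z = z + of_int (if d = 1 then b else - b)" using True by (auto simp: moeb_def)
      then show ?thesis using Ti[OF z] by simp
    next
      case False
      define q where "q = a div c"
      define r where "r = a mod c"
      have a: "a = q * c + r" by (simp add: q_def r_def)
      define b' where "b' = b - q * d"
      have det': "(- c) * b' - (- d) * r = 1"
        using less(2) by (simp add: a b'_def algebra_simps)
      have "nat \<bar>r\<bar> < nat \<bar>c\<bar>" using False abs_mod_less[of c a] by (simp add: r_def)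
      then have IH: "f (moeb (- c) (- d) r b' z) = f z"
        using less(1)[of r "- c" b' "- d"] det' by simp
      have nz1: "of_int c * z + of_int d \<noteq> (0::complex)" using moeb_denom_nonzero[OF z less(2)] .
      have nz2: "of_int r * z + of_int b' \<noteq> (0::complex)" using moeb_denom_nonzero[OF z det'] .
      define w where "w = moeb (- c) (- d) r b' z"
      have w: "Im w > 0" unfolding w_def by (rule Im_moeb_pos[OF z det'])
      have "moeb a b c d z = - 1 / w + of_int q"
      proof -
        define X where "X = of_int c * z + (of_int d :: complex)"
        define Y where "Y = of_int r * z + (of_int b' :: complex)"
        have num: "of_int a * z + of_int b = of_int q * X + Y"
          by (simp add: a b'_def X_def Y_def algebra_simps)
        have "of_int (- c) * z + of_int (- d) = - X" by (simp add: X_def)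
        then have "- 1 / w = Y / X" unfolding w_def moeb_def Y_def[symmetric] by simp
        moreover have "(of_int q * X + Y) / X = Y / X + of_int q" using nz1 by (simp add: X_def[symmetric] add_divide_distrib)
        ultimately show ?thesis unfolding moeb_def num by (simp add: X_def)
      qed
      then have "f (moeb a b c d z) = f (- 1 / w)" using Ti[of "- 1 / w" q] Im_minus_inverse_pos[OF w] by simp
      also have "\<dots> = f w" by (rule S[OF w])
      finally show ?thesis using IH by (simp add: w_def)
    qed
  qed
qed

lemma csqrt_norm: "norm (csqrt z) ^ 2 = norm z"
  by (metis norm_power power2_csqrt)

lemma eta_norm_invariant:
  assumes "a * d - b * c = (1::int)" "Im z > 0"
  shows "norm (eta (moeb a b c d z)) ^ 4 * Im (moeb a b c d z) = norm (eta z) ^ 4 * Im z"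
proof (rule modular_invariance[where f = "\<lambda>z. norm (eta z) ^ 4 * Im z", OF _ _ assms])
  fix z assume z: "Im z > 0"
  have nz: "norm z \<noteq> 0" using z by auto
  have "norm (csqrt (- \<i> * z)) ^ 4 = (norm (csqrt (- \<i> * z)) ^ 2) ^ 2" by (simp only: power_mult[symmetric]) simp
  also have "\<dots> = norm z ^ 2" unfolding csqrt_norm by (simp add: norm_mult)
  finally show "norm (eta (- 1 / z)) ^ 4 * Im (- 1 / z) = norm (eta z) ^ 4 * Im z"
    unfolding eta_inversion[OF z] Im_minus_inverse using nz by (simp add: norm_mult power_mult_distrib)
  have "norm (ee (1 / 24)) = 1" by (simp add: norm_ee)
  then show "norm (eta (z + 1)) ^ 4 * Im (z + 1) = norm (eta z) ^ 4 * Im z"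
    using eta_add_of_int[of z 1] by (simp add: norm_mult)
qed

lemma holomorphic_constant_norm:
  assumes hol: "h holomorphic_on upper_half" and n: "\<And>z. Im z > 0 \<Longrightarrow> norm (h z) = 1"
  obtains v where "norm v = 1" "\<And>z. Im z > 0 \<Longrightarrow> h z = v"
proof -
  have "h constant_on upper_half"
    by (rule maximum_modulus_principle[OF hol open_upper_half connected_upper_half open_upper_half, of \<i>])
       (use n in auto)
  then obtain v where v: "\<And>z. Im z > 0 \<Longrightarrow> h z = v" unfolding constant_on_def by auto
  moreover have "norm v = 1" using v[of \<i>] n[of \<i>] by simp
  ultimately show ?thesis using that by blast
qed

text \<open>The quotient of the two sides has absolute value 1, because |eta|^4 Im z is invariant,
  and is therefore constant by the maximum principle. The phase is left open. The sign of c keeps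
  -i(cz+d) in the right half plane, where \<open>csqrt\<close> is holomorphic.\<close>

theorem eta_modular:
  assumes det: "a * d - b * c = (1::int)" and c: "c > 0"
  obtains v where "norm v = 1"
    "\<And>z. Im z > 0 \<Longrightarrow> eta (moeb a b c d z) = v * csqrt (- \<i> * (of_int c * z + of_int d)) * eta z"
proof -
  define g where "g = (\<lambda>z. csqrt (- \<i> * (of_int c * z + of_int d)))"
  define h where "h = (\<lambda>z. eta (moeb a b c d z) / (g z * eta z))"
  have gnz: "g z \<noteq> 0" if "Im z > 0" for z
    using moeb_denom_nonzero[OF that det] by (simp add: g_def)
  have "(\<lambda>z. eta (moeb a b c d z)) holomorphic_on upper_half"
  proof -
    have "(eta \<circ> moeb a b c d) holomorphic_on upper_half"
    proof (rule holomorphic_on_compose_gen[OF _ eta_holomorphic])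
      show "moeb a b c d holomorphic_on upper_half"
        unfolding moeb_def[abs_def] using moeb_denom_nonzero[OF _ det] by (intro holomorphic_intros) auto
    qed (use Im_moeb_pos det in auto)
    then show ?thesis by (simp add: o_def)
  qed
  moreover have "g holomorphic_on upper_half"
    unfolding g_def by (rule csqrt_holomorphic_comp, intro holomorphic_intros, use c in simp)
  ultimately have hh: "h holomorphic_on upper_half"
    unfolding h_def using gnz eta_nonzero by (intro holomorphic_intros eta_holomorphic) auto
  have hn: "norm (h z) = 1" if z: "Im z > 0" for z
  proof -
    define D where "D = norm (of_int c * z + of_int d)"
    have D: "D > 0" using moeb_denom_nonzero[OF z det] by (simp add: D_def)
    have "norm (g z) ^ 4 = (norm (g z) ^ 2) ^ 2" by (simp only: power_mult[symmetric]) simp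
    also have "norm (g z) ^ 2 = D" unfolding g_def csqrt_norm D_def by (simp add: norm_mult)
    finally have g4: "norm (g z) ^ 4 = D\<^sup>2" .
    have "norm (eta (moeb a b c d z)) ^ 4 * (Im z / D\<^sup>2) = norm (eta z) ^ 4 * Im z"
      using eta_norm_invariant[OF det z] unfolding Im_moeb[OF det] D_def .
    then have "norm (eta (moeb a b c d z)) ^ 4 = norm (eta z) ^ 4 * norm (g z) ^ 4"
      unfolding g4 using z D by (simp add: field_simps)
    then have "norm (h z) ^ 4 = 1" unfolding h_def using gnz[OF z] eta_nonzero[OF z]
      by (simp add: norm_divide norm_mult power_divide power_mult_distrib)
    then show ?thesis by (metis norm_ge_zero power_eq_iff_eq_base power_one zero_less_numeral zero_le_one)
  qed
  obtain v where v: "norm v = 1" "\<And>z. Im z > 0 \<Longrightarrow> h z = v"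
    using holomorphic_constant_norm[OF hh hn] by blast
  show ?thesis
  proof (rule that[OF v(1)])
    fix z assume z: "Im z > 0"
    show "eta (moeb a b c d z) = v * csqrt (- \<i> * (of_int c * z + of_int d)) * eta z"
      using v(2)[OF z] gnz[OF z] eta_nonzero[OF z] by (simp add: h_def g_def field_simps)
  qed
qed

text \<open>A nonzero function with these properties would attain its maximal modulus on a compact
  part of a region meeting every orbit, hence be constant, against its decay at the cusp.\<close>

lemma modular_zero:
  assumes hol: "h holomorphic_on upper_half"
    and S: "\<And>z. Im z > 0 \<Longrightarrow> h (- 1 / z) = h z" and T: "\<And>z. Im z > 0 \<Longrightarrow> h (z + 1) = h z"
    and lim: "\<And>e. e > 0 \<Longrightarrow> \<exists>Y. \<forall>z. Im z > Y \<longrightarrow> norm (h z) < e"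
    and z: "Im z > 0"
  shows "h z = 0"
proof (rule ccontr)
  assume nz: "h z \<noteq> 0"
  \<comment> \<open>Coarser than the usual fundamental domain: it has to meet every orbit, and below
    height 1/2 one inversion at least doubles the imaginary part, which yields a simple
    induction.\<close>
  define B where "B = {z. Im z \<ge> 1/2 \<and> \<bar>Re z\<bar> \<le> 1/2}"
  have Tn: "h (z + of_nat n) = h z" if "Im z > 0" for z n
  proof (induction n)
    case (Suc n)
    have "h (z + of_nat n + 1) = h (z + of_nat n)" by (rule T) (use that in simp)
    then show ?case using Suc by (simp add: add_ac)
  qed simp
  have Ti: "h (z + of_int n) = h z" if "Im z > 0" for z n
  proof (cases "n \<ge> 0")
    case True
    then show ?thesis using Tn[OF that, of "nat n"] by simp
  next
    case False
    then show ?thesis using Tn[of "z + of_int n" "nat (- n)"] that by simp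
  qed
  have red: "\<exists>w\<in>B. h w = h z" if "Im z > 0" "Im z \<ge> 1 / 2 ^ n" for z n
    using that
  proof (induction n arbitrary: z)
    case (0 z)
    define w where "w = z + of_int (- round (Re z))"
    have "\<bar>Re w\<bar> \<le> 1/2" unfolding w_def using of_int_round_abs_le[of "Re z"] by (simp add: abs_minus_commute)
    then have "w \<in> B" using 0 by (simp add: B_def w_def)
    then show ?case using Ti[OF 0(1)] unfolding w_def by blast
  next
    case (Suc n z)
    define w where "w = z + of_int (- round (Re z))"
    have w: "\<bar>Re w\<bar> \<le> 1/2" "Im w = Im z" unfolding w_def using of_int_round_abs_le[of "Re z"] by (simp_all add: abs_minus_commute)
    have hw: "h w = h z" unfolding w_def by (rule Ti[OF Suc(2)])
    show ?case
    proof (cases "Im w \<ge> 1/2")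
      case True
      then have "w \<in> B" using w by (simp add: B_def)
      then show ?thesis using hw by blast
    next
      case False
      have "(Re w)\<^sup>2 \<le> (1/2)\<^sup>2" using w(1) by (simp add: abs_le_square_iff[symmetric])
      moreover have "(Im w)\<^sup>2 \<le> (1/2)\<^sup>2" using False Suc(2) w(2) by (intro power_mono) auto
      ultimately have "(norm w)\<^sup>2 \<le> (1/2)\<^sup>2 + (1/2)\<^sup>2" unfolding cmod_power2 by linarith
      then have "(norm w)\<^sup>2 \<le> 1/2" by (simp add: power2_eq_square)
      have pos: "(norm w)\<^sup>2 > 0" using Suc(2) w(2) by auto
      have "Im w * (2 * (norm w)\<^sup>2) \<le> Im w * 1" using \<open>(norm w)\<^sup>2 \<le> 1/2\<close> Suc(2) w(2) by (intro mult_left_mono) auto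
      then have "2 * Im w \<le> Im (- 1 / w)"
        unfolding Im_minus_inverse pos_le_divide_eq[OF pos] by (simp add: mult_ac)
      then have "Im (- 1 / w) \<ge> 1 / 2 ^ n" using Suc(3) w(2) by simp
      moreover have "Im (- 1 / w) > 0" using Suc(2) w(2) by (intro Im_minus_inverse_pos) simp
      ultimately obtain w' where "w' \<in> B" "h w' = h (- 1 / w)" using Suc(1) by blast
      then show ?thesis using S[of w] hw w(2) Suc(2) by auto
    qed
  qed
  have red': "\<exists>w\<in>B. h w = h z" if im: "Im z > 0" for z
  proof -
    obtain n where "1 / 2 ^ n < Im z" using real_arch_pow_inv[of "Im z" "1/2"] im by (auto simp: power_one_over)
    then show ?thesis using red[OF im, of n] by simp
  qed
  obtain Y where Y: "\<And>w. Im w > Y \<Longrightarrow> norm (h w) < norm (h z)"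
    using lim[of "norm (h z)"] nz by auto
  define K where "K = cbox (Complex (-1/2) (1/2)) (Complex (1/2) (max Y (1/2)))"
  have K: "w \<in> K \<longleftrightarrow> w \<in> B \<and> Im w \<le> max Y (1/2)" for w
    by (auto simp: K_def B_def in_cbox_complex_iff abs_le_iff)
  have BK: "w \<in> K" if "w \<in> B" "norm (h w) \<ge> norm (h z)" for w
    using that Y[of w] K by force
  obtain w0 where w0: "w0 \<in> B" "h w0 = h z" using red'[OF z] by blast
  then have w0K: "w0 \<in> K" by (intro BK) auto
  have KH: "K \<subseteq> upper_half" using K by (auto simp: B_def)
  have "compact K" "K \<noteq> {}" using w0K by (auto simp: K_def)
  moreover have "continuous_on K (\<lambda>w. norm (h w))"
    by (intro continuous_intros continuous_on_subset[OF holomorphic_on_imp_continuous_on[OF hol] KH])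
  ultimately obtain xi where xi: "xi \<in> K" "\<And>w. w \<in> K \<Longrightarrow> norm (h w) \<le> norm (h xi)"
    using continuous_attains_sup by (metis (no_types, lifting))
  have max: "norm (h w) \<le> norm (h xi)" if im: "Im w > 0" for w
  proof -
    obtain w' where w': "w' \<in> B" "h w' = h w" using red'[OF im] by blast
    show ?thesis
    proof (cases "norm (h w) \<ge> norm (h z)")
      case True
      then show ?thesis using xi(2)[OF BK[OF w'(1)]] w'(2) by simp
    next
      case False
      then show ?thesis using xi(2)[OF w0K] w0(2) by simp
    qed
  qed
  have "h constant_on upper_half"
    by (rule maximum_modulus_principle[OF hol open_upper_half connected_upper_half open_upper_half, of xi])
       (use max xi(1) KH in auto)
  then obtain c where c: "\<And>w. Im w > 0 \<Longrightarrow> h w = c" unfolding constant_on_def by auto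
  define w where "w = \<i> * complex_of_real (max Y 1 + 1)"
  have "Im w > Y" "Im w > 0" by (auto simp: w_def)
  then show False using Y[of w] c[of w] c[OF z] by simp
qed

section \<open>Hecke operators and the eta function\<close>

lemma csqrt_of_real_mult:
  assumes "a > 0" shows "csqrt (of_real a * z) = of_real (sqrt a) * csqrt z"
proof (rule csqrt_unique)
  show "(complex_of_real (sqrt a) * csqrt z)\<^sup>2 = of_real a * z"
    using assms by (simp add: power_mult_distrib flip: of_real_power)
  have "0 < Re (csqrt z) \<or> Re (csqrt z) = 0 \<and> 0 \<le> Im (csqrt z)" by (rule csqrt_principal)
  then show "0 < Re (complex_of_real (sqrt a) * csqrt z) \<or> Re (complex_of_real (sqrt a) * csqrt z) = 0 \<and> 0 \<le> Im (complex_of_real (sqrt a) * csqrt z)"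
    using assms by auto
qed

lemma ee_eq_1_iff: "ee (of_int n / of_nat N) = 1 \<longleftrightarrow> int N dvd n" if "N > 0"
proof
  assume "ee (of_int n / of_nat N) = 1"
  then obtain k :: int where "Im (2 * pi * \<i> * (of_int n / of_nat N)) = of_int (2 * k) * pi"
    unfolding ee_def exp_eq_1 by auto
  then have "2 * pi * (real_of_int n / real N) = 2 * pi * of_int k" by simp
  then have "real_of_int n / real N = of_int k" by (subst (asm) mult_left_cancel) auto
  then have "real_of_int n = of_int (k * int N)" using that by (simp add: field_simps)
  then have "n = k * int N" by (simp only: of_int_eq_iff)
  then show "int N dvd n" by simp
next
  assume "int N dvd n"
  then obtain k where k: "n = int N * k" by blast
  have "of_int n / of_nat N = (of_int k :: complex)" using that by (simp add: k)
  then show "ee (of_int n / of_nat N) = 1" by simp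
qed

lemma ee_sum:
  assumes "N > 0" shows "(\<Sum>b<N. ee (of_int n * of_nat b / of_nat N)) = (if int N dvd n then of_nat N else 0)"
proof -
  define w where "w = ee (of_int n / of_nat N)"
  have p: "ee (of_int n * of_nat b / of_nat N) = w ^ b" for b
    by (simp add: w_def ee_power mult_ac)
  have "w ^ N = 1" using assms by (simp add: w_def ee_power)
  then show ?thesis
    unfolding p using ee_eq_1_iff[OF assms, of n] by (auto simp: w_def[symmetric] sum_gp_strict)
qed

lemma on_disc_rot: "norm w = 1 \<Longrightarrow> on_disc f \<Longrightarrow> on_disc (rot w f)"
  by (rule on_disc_le[of f _ 1]) (simp_all add: norm_mult norm_power)

lemma eval_rot: "eval_fps (rot w f) q = eval_fps f (w * q)"
  by (simp add: eval_fps_def power_mult_distrib mult_ac)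

definition fps_dilate :: "nat \<Rightarrow> complex fps \<Rightarrow> complex fps" where
  "fps_dilate m f = Abs_fps (\<lambda>n. if m dvd n then fps_nth f (n div m) else 0)"

lemma fps_dilate_nth: "fps_nth (fps_dilate m f) n = (if m dvd n then fps_nth f (n div m) else 0)"
  by (simp add: fps_dilate_def)

lemma
  assumes "m > 0" "on_disc f"
  shows on_disc_dilate: "on_disc (fps_dilate m f)"
    and eval_dilate: "norm q < 1 \<Longrightarrow> eval_fps (fps_dilate m f) q = eval_fps f (q ^ m)"
proof -
  have mono: "strict_mono (\<lambda>n. m * n)" using assms by (simp add: strict_mono_def)
  have off: "fps_nth (fps_dilate m f) n = 0" if "n \<notin> range (\<lambda>n. m * n)" for n
    using that by (auto simp: fps_dilate_nth elim!: dvdE)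
  have on: "fps_nth (fps_dilate m f) (m * n) = fps_nth f n" for n
    using assms by (simp add: fps_dilate_nth)
  show disc: "on_disc (fps_dilate m f)"
  proof (rule on_discI)
    fix r :: real assume r: "0 < r" "r < 1"
    have "norm (complex_of_real (r ^ m)) < 1" using r assms by (simp add: power_less_one_iff norm_power)
    from on_disc_norm_summable[OF assms(2) this]
    have "summable (\<lambda>n. norm (fps_nth (fps_dilate m f) (m * n)) * r ^ (m * n))"
      unfolding on using r by (simp add: norm_mult norm_power power_mult)
    then show "summable (\<lambda>n. norm (fps_nth (fps_dilate m f) n) * r ^ n)"
      by (subst summable_mono_reindex[OF mono, symmetric]) (auto simp: off)
  qed
  show "eval_fps (fps_dilate m f) q = eval_fps f (q ^ m)" if q: "norm q < 1"
  proof -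
    have "norm (q ^ m) < 1" using q assms by (simp add: norm_power power_less_one_iff)
    from on_disc_sums[OF assms(2) this]
    have "(\<lambda>n. fps_nth (fps_dilate m f) (m * n) * q ^ (m * n)) sums eval_fps f (q ^ m)"
      unfolding on by (simp add: power_mult)
    then have "(\<lambda>n. fps_nth (fps_dilate m f) n * q ^ n) sums eval_fps f (q ^ m)"
      by (subst (asm) sums_mono_reindex[OF mono]) (auto simp: off)
    then show ?thesis using on_disc_sums[OF disc q] sums_unique2 by blast
  qed
qed

text \<open>Lets identities between functions of y be read as identities of power series in
  q^(1/24).\<close>

lemma ee_surj: assumes "q \<noteq> 0" "norm q < 1" obtains y where "Im y > 0" "q = ee (y / 24)"
proof -
  define y where "y = 24 * Ln q / (2 * pi * \<i>)"
  have q: "q = ee (y / 24)" using assms by (simp add: y_def ee_def)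
  moreover have "Im y > 0"
  proof (rule ccontr)
    assume "\<not> Im y > 0"
    then have "norm q \<ge> 1" unfolding q norm_ee by (simp add: mult_nonneg_nonpos)
    then show False using assms by simp
  qed
  ultimately show ?thesis using that by blast
qed

lemma eta_shift_eval: assumes "Im z > 0" 
  shows "eta (z + 24 * of_nat b / of_nat N) = eval_fps (rot (ee (of_nat b / of_nat N)) eta_fps) (ee (z / 24))"
proof -
  have "ee ((z + 24 * of_nat b / of_nat N) / 24) = ee (of_nat b / of_nat N) * ee (z / 24)"
    by (simp add: ee_add[symmetric] add_divide_distrib add.commute)
  moreover have "Im (z + 24 * of_nat b / of_nat N) > 0"
  proof -
    have "24 * of_nat b / of_nat N = complex_of_real (24 * real b / real N)" by simp
    then show ?thesis using assms by (simp only: plus_complex.simps Im_complex_of_real add_0_right)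
  qed
  ultimately show ?thesis by (simp add: eta_eval eval_rot)
qed

lemma norm_ee_real: "norm (ee (of_nat b / of_nat N)) = 1"
proof -
  have "of_nat b / of_nat N = complex_of_real (real b / real N)" by simp
  then show ?thesis by (simp only: norm_ee Im_complex_of_real) simp
qed

lemma eta_dilate_eval: assumes "Im z > 0" "m > 0"
  shows "eta (of_nat m * z) = eval_fps (fps_dilate m eta_fps) (ee (z / 24))"
proof -
  have "ee (of_nat m * z / 24) = ee (z / 24) ^ m" by (simp add: ee_power)
  moreover have "norm (ee (z / 24)) < 1" by (rule norm_ee_less_1) (use assms in simp)
  ultimately show ?thesis using assms by (simp add: eta_eval eval_dilate on_disc_eta_fps)
qed

locale hecke_prime =
  fixes l :: nat
  assumes prime_l: "prime l" and l_ge_7: "l \<ge> 7"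
begin

lemma l_pos: "l > 0" using l_ge_7 by simp

lemma chi_l: "chi12 l * chi12 l = 1"
proof -
  have "coprime l 12"
  proof -
    have "\<not> 2 dvd l" "\<not> 3 dvd l" using prime_l l_ge_7 by (auto simp: prime_nat_iff)
    then have "coprime 2 l" "coprime 3 l" by (auto intro: prime_imp_coprime_nat)
    then have "coprime (2 * 2 * 3) l" by (intro coprime_mult_left_iff[THEN iffD2] conjI)
    then show ?thesis by (simp add: coprime_commute)
  qed
  then have "\<not> 2 dvd l" "\<not> 3 dvd l"
    by (auto simp: coprime_def dest: spec[of _ "2::nat"] spec[of _ "3::nat"])
  then have "\<not> 2 dvd l mod 12" "\<not> 3 dvd l mod 12" by (auto simp: dvd_mod_iff)
  then have "chi12 (l mod 12) = 1 \<or> chi12 (l mod 12) = -1"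
    using all_less_12[of "\<lambda>r. \<not> 2 dvd r \<longrightarrow> \<not> 3 dvd r \<longrightarrow> chi12 r = 1 \<or> chi12 r = -1" "l mod 12"]
    by (simp add: chi12_def)
  then show ?thesis by (auto simp: chi12_mod)
qed

lemma coprime_l_576: "coprime (576::int) (int l)"
proof -
  have "\<not> l dvd 2" "\<not> l dvd 3" using l_ge_7 by (auto dest: dvd_imp_le)
  then have "\<not> l dvd 2 ^ 6 * 3 ^ 2" using prime_l by (metis prime_dvd_multD prime_dvd_power)
  then have "coprime l (2 ^ 6 * 3 ^ 2)" using prime_l prime_imp_coprime_nat by blast
  then have "coprime (int l) (int (2 ^ 6 * 3 ^ 2))" by (simp only: coprime_int_iff)
  then show ?thesis by (simp add: coprime_commute)
qed

definition units :: "nat \<Rightarrow> nat set" where "units N = {b. b < N \<and> \<not> l dvd b}"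

text \<open>576 = 24^2. All shifts are multiples of 24, the period of eta; the congruence makes the
  matrix with rows (24b, -m) and (N, -24c) have determinant 1.\<close>

definition star :: "nat \<Rightarrow> nat \<Rightarrow> nat" where
  "star N b = (SOME c. c < N \<and> int N dvd 576 * int b * int c + 1)"

context
  fixes N k :: nat
  assumes N: "N = l ^ k" and k: "k > 0"
begin

lemma N_pos: "N > 0" and l_dvd_N: "l dvd N"
  using N k l_pos by auto

lemma star_props:
  assumes "b \<in> units N"
  shows "star N b < N" "int N dvd 576 * int b * int (star N b) + 1"
proof -
  have "coprime l b" using assms prime_l by (auto simp: units_def intro: prime_imp_coprime_nat)
  then have "coprime (int l) (int b)" by (simp only: coprime_int_iff)
  then have "coprime (576 * int b) (int l)" using coprime_l_576 by (simp add: coprime_commute)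
  then have "coprime (576 * int b) (int N)" unfolding N by simp
  then obtain x where x: "[576 * int b * x = 1] (mod int N)" using cong_solve_coprime_int by blast
  define c where "c = nat ((- x) mod int N)"
  have c: "int c = (- x) mod int N" using N_pos by (simp add: c_def)
  have "[576 * int b * int c = 576 * int b * (- x)] (mod int N)"
    unfolding c by (intro cong_scalar_left) (simp add: cong_def)
  moreover have "[576 * int b * (- x) = - 1] (mod int N)" using x by (simp add: cong_minus_minus_iff)
  ultimately have "[576 * int b * int c = - 1] (mod int N)" by (rule cong_trans)
  then have "int N dvd 576 * int b * int c + 1" by (simp add: cong_iff_dvd_diff)
  moreover have "c < N" using c N_pos by (metis of_nat_less_iff pos_mod_bound of_nat_0_less_iff)
  ultimately have "c < N \<and> int N dvd 576 * int b * int c + 1" by simp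
  then have "star N b < N \<and> int N dvd 576 * int b * int (star N b) + 1"
    unfolding star_def by (rule someI)
  then show "star N b < N" "int N dvd 576 * int b * int (star N b) + 1" by auto
qed

lemma star_units: "b \<in> units N \<Longrightarrow> star N b \<in> units N"
proof -
  assume b: "b \<in> units N"
  have "\<not> l dvd star N b"
  proof
    assume "l dvd star N b"
    then have "int l dvd 576 * int b * int (star N b)" by simp
    moreover have "int l dvd 576 * int b * int (star N b) + 1"
      using star_props(2)[OF b] l_dvd_N by (meson dvd_trans int_dvd_int_iff)
    ultimately have "int l dvd 1" using dvd_add_right_iff by blast
    then show False using l_ge_7 by simp
  qed
  then show ?thesis using star_props(1)[OF b] by (simp add: units_def)
qed

lemma star_star: assumes b: "b \<in> units N" shows "star N (star N b) = b"
proof -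
  define c where "c = star N b"
  have c: "c \<in> units N" unfolding c_def by (rule star_units[OF b])
  have "int N dvd (576 * int b * int c + 1) * int (star N c) - (576 * int c * int (star N c) + 1) * int b"
    using star_props(2)[OF b] star_props(2)[OF c] unfolding c_def by (intro dvd_diff dvd_mult2)
  then have "int N dvd int (star N c) - int b" by (simp add: algebra_simps)
  moreover have "star N c < N" "b < N" using star_props(1)[OF c] b by (auto simp: units_def)
  ultimately have "int (star N c) - int b = 0"
    using dvd_imp_le_int[of "int (star N c) - int b" "int N"] by fastforce
  then show ?thesis by (simp add: c_def)
qed

lemma star_bij: "bij_betw (star N) (units N) (units N)"
  by (rule bij_betwI[of _ _ _ "star N"]) (auto simp: star_units star_star)

text \<open>The matrix with rows (24b, -m) and (N, -24c) is applied to w = (y + 24c)/N, for which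
  the denominator Nw - 24c is just y.\<close>

lemma eta_unit_relation:
  assumes "b \<in> units N"
  obtains v where "norm v = 1"
    "\<And>y. Im y > 0 \<Longrightarrow> eta ((24 * of_nat b - 1 / y) / of_nat N) = v * csqrt (- \<i> * y) * eta ((y + 24 * of_nat (star N b)) / of_nat N)"
proof -
  define c where "c = star N b"
  obtain m where m: "576 * int b * int c + 1 = int N * m" using star_props(2)[OF assms] unfolding c_def by blast
  have det: "(24 * int b) * (- 24 * int c) - (- m) * int N = 1" using m by (simp add: algebra_simps)
  obtain v where v: "norm v = 1" "\<And>z. Im z > 0 \<Longrightarrow> eta (moeb (24 * int b) (- m) (int N) (- 24 * int c) z) =
      v * csqrt (- \<i> * (of_int (int N) * z + of_int (- 24 * int c))) * eta z"
    using eta_modular[OF det] N_pos by auto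
  show ?thesis
  proof (rule that[OF v(1)])
    fix y assume y: "Im y > 0"
    define w where "w = (y + 24 * of_nat c) / of_nat N"
    have Nc: "of_nat N \<noteq> (0::complex)" using N_pos by simp
    have w: "Im w > 0" unfolding w_def using y N_pos by (simp add: Im_divide_of_nat)
    have dn: "of_int (int N) * w + of_int (- 24 * int c) = y" using Nc by (simp add: w_def)
    have y0: "y \<noteq> 0" using y by auto
    have mc: "576 * of_nat b * of_nat c + 1 = of_nat N * (of_int m :: complex)"
    proof -
      have "of_int (576 * int b * int c + 1) = (of_int (int N * m) :: complex)" using m by simp
      then show ?thesis by simp
    qed
    have "of_int (24 * int b) * w + of_int (- m) = (24 * of_nat b * y - 1) / of_nat N"
    proof -
      have "of_nat N * (of_int (24 * int b) * w + of_int (- m)) = 24 * of_nat b * (of_nat N * w) - of_nat N * of_int m"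
        by (simp add: algebra_simps)
      also have "of_nat N * w = y + 24 * of_nat c" using Nc by (simp add: w_def)
      also have "24 * of_nat b * (y + 24 * of_nat c) - of_nat N * of_int m = 24 * of_nat b * y - 1"
        unfolding mc[symmetric] by (simp add: algebra_simps)
      finally show ?thesis using Nc by (simp add: field_simps)
    qed
    moreover have "(24 * of_nat b * y - 1) / of_nat N / y = (24 * of_nat b - 1 / y) / of_nat N"
      using y0 Nc by (simp add: field_simps)
    ultimately have "moeb (24 * int b) (- m) (int N) (- 24 * int c) w = (24 * of_nat b - 1 / y) / of_nat N"
      unfolding moeb_def dn by simp
    then show "eta ((24 * of_nat b - 1 / y) / of_nat N) = v * csqrt (- \<i> * y) * eta ((y + 24 * of_nat (star N b)) / of_nat N)"
      using v(2)[OF w] unfolding dn by (simp add: w_def c_def)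
  qed
qed

end

definition vmul :: "nat \<Rightarrow> nat \<Rightarrow> complex" where
  "vmul N b = (SOME v. norm v = 1 \<and> (\<forall>y. Im y > 0 \<longrightarrow> eta ((24 * of_nat b - 1 / y) / of_nat N) = v * csqrt (- \<i> * y) * eta ((y + 24 * of_nat (star N b)) / of_nat N)))"

lemma vmul:
  assumes "N = l ^ k" "k > 0" "b \<in> units N"
  shows norm_vmul: "norm (vmul N b) = 1"
    and eta_vmul: "\<And>y. Im y > 0 \<Longrightarrow> eta ((24 * of_nat b - 1 / y) / of_nat N) = vmul N b * csqrt (- \<i> * y) * eta ((y + 24 * of_nat (star N b)) / of_nat N)"
proof -
  obtain v where "norm v = 1 \<and> (\<forall>y. Im y > 0 \<longrightarrow> eta ((24 * of_nat b - 1 / y) / of_nat N) = v * csqrt (- \<i> * y) * eta ((y + 24 * of_nat (star N b)) / of_nat N))"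
    using eta_unit_relation[OF assms] by metis
  then have "norm (vmul N b) = 1 \<and> (\<forall>y. Im y > 0 \<longrightarrow> eta ((24 * of_nat b - 1 / y) / of_nat N) = vmul N b * csqrt (- \<i> * y) * eta ((y + 24 * of_nat (star N b)) / of_nat N))"
    unfolding vmul_def by (rule someI)
  then show "norm (vmul N b) = 1" "\<And>y. Im y > 0 \<Longrightarrow> eta ((24 * of_nat b - 1 / y) / of_nat N) = vmul N b * csqrt (- \<i> * y) * eta ((y + 24 * of_nat (star N b)) / of_nat N)" by auto
qed

text \<open>At y = i, the fixed point of y -> -1/y, the square root is 1, and the relations for b
  and for its partner express the same two nonzero values through each other.\<close>

lemma vmul_star:
  assumes N: "N = l ^ k" "k > 0" and b: "b \<in> units N"
  shows "vmul N b * vmul N (star N b) = 1"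
proof -
  define c where "c = star N b"
  have c: "c \<in> units N" "star N c = b" unfolding c_def using star_units[OF N b] star_star[OF N b] by auto
  define X where "X = eta ((24 * of_nat b + \<i>) / of_nat N)"
  define Y where "Y = eta ((24 * of_nat c + \<i>) / of_nat N)"
  have i: "- 1 / \<i> = \<i>" by simp
  have "X = vmul N b * Y" using eta_vmul[OF N b, of \<i>] unfolding X_def Y_def c_def by (simp add: add.commute)
  moreover have "Y = vmul N c * X" using eta_vmul[OF N c(1), of \<i>] unfolding X_def Y_def c(2) by (simp add: add.commute)
  moreover have "X \<noteq> 0" unfolding X_def by (rule eta_nonzero) (use N l_pos in \<open>simp add: Im_divide_of_nat\<close>)
  ultimately show ?thesis by (simp add: c_def)
qed

lemma e24_l_square: "e24 (l\<^sup>2 * m) = chi12 l * e24 m"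
proof (cases "\<exists>k. m = k\<^sup>2")
  case True
  then obtain k where "m = k\<^sup>2" by blast
  then have "l\<^sup>2 * m = (l * k)\<^sup>2" by (simp add: power_mult_distrib)
  then show ?thesis using \<open>m = k\<^sup>2\<close> by (simp only: e24_square chi12_mult)
next
  case False
  have "l\<^sup>2 * m \<noteq> k\<^sup>2" for k
  proof
    assume e: "l\<^sup>2 * m = k\<^sup>2"
    then have "l\<^sup>2 dvd k\<^sup>2" by (metis dvd_triv_left)
    then have "l dvd k" by simp
    then obtain j where "k = l * j" by blast
    then have "m = j\<^sup>2" using e l_pos by (simp add: power_mult_distrib)
    then show False using False by blast
  qed
  then show ?thesis using False by (simp add: e24_nonsquare)
qed

lemma e24_l_dvd: "l dvd n \<Longrightarrow> \<not> l\<^sup>2 dvd n \<Longrightarrow> e24 n = 0"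
proof (rule e24_nonsquare, rule notI, erule exE)
  fix k assume "l dvd n" "\<not> l\<^sup>2 dvd n" "n = k\<^sup>2"
  then have "l dvd k" using prime_l prime_dvd_power by blast
  then show False using \<open>\<not> l\<^sup>2 dvd n\<close> \<open>n = k\<^sup>2\<close> by simp
qed

text \<open>Averaging extracts the exponents divisible by N. For N = l these are already divisible
  by l^2 wherever the coefficient is nonzero, because the exponents are squares; hence both cases
  give the same series.\<close>

lemma eta_fps_sum:
  assumes "N = l \<or> N = l\<^sup>2"
  shows "(\<Sum>b<N. rot (ee (of_nat b / of_nat N)) eta_fps) = fps_const (of_nat N * of_int (chi12 l)) * fps_dilate (l\<^sup>2) eta_fps"
proof (rule fps_ext)
  fix n
  have N: "N > 0" using assms l_pos by auto
  have "fps_nth (\<Sum>b<N. rot (ee (of_nat b / of_nat N)) eta_fps) n = (\<Sum>b<N. ee (of_int (int n) * of_nat b / of_nat N)) * of_int (e24 n)"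
    by (simp add: fps_sum_nth ee_power sum_distrib_right)
  also have "\<dots> = (if N dvd n then of_nat N else 0) * of_int (e24 n)"
    unfolding ee_sum[OF N] by simp
  also have "\<dots> = (if l\<^sup>2 dvd n then of_nat N * of_int (e24 n) else 0)"
    using assms e24_l_dvd[of n] by (auto simp: power2_eq_square)
  also have "\<dots> = fps_nth (fps_const (of_nat N * of_int (chi12 l)) * fps_dilate (l\<^sup>2) eta_fps) n"
    using l_pos by (auto simp: fps_dilate_nth e24_l_square elim!: dvdE)
  finally show "fps_nth (\<Sum>b<N. rot (ee (of_nat b / of_nat N)) eta_fps) n = fps_nth (fps_const (of_nat N * of_int (chi12 l)) * fps_dilate (l\<^sup>2) eta_fps) n" .
qed

lemma eta_sum:
  assumes "N = l \<or> N = l\<^sup>2" "Im z > 0"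
  shows "(\<Sum>b<N. eta (z + 24 * of_nat b / of_nat N)) = of_nat N * of_int (chi12 l) * eta (of_nat (l\<^sup>2) * z)"
proof -
  have q: "norm (ee (z / 24)) < 1" by (rule norm_ee_less_1) (use assms in simp)
  have "(\<Sum>b<N. eta (z + 24 * of_nat b / of_nat N)) = eval_fps (\<Sum>b<N. rot (ee (of_nat b / of_nat N)) eta_fps) (ee (z / 24))"
    using q by (subst eval_sum) (auto simp: eta_shift_eval[OF assms(2)] norm_ee_real intro!: on_disc_rot on_disc_eta_fps)
  also have "\<dots> = of_nat N * of_int (chi12 l) * eta (of_nat (l\<^sup>2) * z)"
  proof -
    have "eta (of_nat (l\<^sup>2) * z) = eval_fps (fps_dilate (l\<^sup>2) eta_fps) (ee (z / 24))"
      by (rule eta_dilate_eval[OF assms(2)]) (use l_pos in simp)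
    moreover have "on_disc (fps_dilate (l\<^sup>2) eta_fps)" by (rule on_disc_dilate) (use l_pos on_disc_eta_fps in auto)
    ultimately show ?thesis unfolding eta_fps_sum[OF assms(1)]
      by (simp only: eval_mult[OF on_disc_const _ q] eval_fps_const)
  qed
  finally show ?thesis .
qed

end

context hecke_prime
begin

section \<open>The multipliers at level l\<close>

lemma units_l: "units l = {1..<l}"
proof -
  have "l dvd b \<longleftrightarrow> b = 0" if "b < l" for b using that by (auto dest: dvd_imp_le)
  then show ?thesis by (auto simp: units_def)
qed

lemma lpow: "l = l ^ 1" "(1::nat) > 0" "l\<^sup>2 = l ^ 2" "(2::nat) > 0"
  by simp_all

text \<open>Indexed by the shift that occurs after inversion, and divided by sqrt(l) so that the
  coefficient of eta(l^2 y) in \<open>eta_nu_relation\<close> becomes 1.\<close>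

definition nu :: "nat \<Rightarrow> complex" where
  "nu c = vmul l (star l c) / of_real (sqrt (real l))"

lemma star_l: "b \<in> units l \<Longrightarrow> star l b \<in> units l" "b \<in> units l \<Longrightarrow> star l (star l b) = b"
  using star_units[OF lpow(1,2)] star_star[OF lpow(1,2)] by auto

lemma sqrt_l_nonzero: "complex_of_real (sqrt (real l)) \<noteq> 0" "complex_of_real (sqrt (real l)) * complex_of_real (sqrt (real l)) = of_nat l"
  using l_pos by (simp_all flip: of_real_mult)

lemma norm_nu: "c \<in> units l \<Longrightarrow> norm (nu c) ^ 2 = 1 / real l"
  using norm_vmul[OF lpow(1,2) star_l(1)[of c]] l_pos
  by (simp add: nu_def norm_divide power_divide)

lemma csqrt_nonzero: "Im y > 0 \<Longrightarrow> csqrt (- \<i> * y) \<noteq> 0"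
  by auto

lemma csqrt_scale: "csqrt (- \<i> * (of_nat m * y)) = of_real (sqrt (real m)) * csqrt (- \<i> * y)" if "m > 0"
  using csqrt_of_real_mult[of "real m" "- \<i> * y"] that by (simp add: mult.left_commute)

lemma eta_inversion_scaled:
  assumes "Im z > 0" "m > 0"
  shows "eta (- 1 / (of_nat m * z)) = of_real (sqrt (real m)) * csqrt (- \<i> * z) * eta (of_nat m * z)"
  using eta_inversion[of "of_nat m * z"] csqrt_scale[OF assms(2), of z] assms by simp

lemma eta_l_relation:
  assumes b: "b \<in> units l" and y: "Im y > 0"
  shows "eta (- 1 / (of_nat (l\<^sup>2) * y) + 24 * of_nat b / of_nat l)
      = of_real (sqrt (real l)) * vmul l b * csqrt (- \<i> * y) * eta (y + 24 * of_nat (star l b) / of_nat l)"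
proof -
  have l0: "of_nat l \<noteq> (0::complex)" "y \<noteq> 0" using l_pos y by auto
  have "- 1 / (of_nat (l\<^sup>2) * y) + 24 * of_nat b / of_nat l = (24 * of_nat b - 1 / (of_nat l * y)) / of_nat l"
    using l0 by (simp add: field_simps power2_eq_square)
  moreover have "(of_nat l * y + 24 * of_nat (star l b)) / of_nat l = y + 24 * of_nat (star l b) / of_nat l"
    using l0 by (simp add: field_simps)
  ultimately show ?thesis
    using eta_vmul[OF lpow(1,2) b, of "of_nat l * y"] y l_pos csqrt_scale[OF l_pos, of y] by (simp add: mult_ac)
qed

text \<open>\<open>eta_sum\<close> with N = l at z = -1/(l^2 y), each term inverted; the common
  factor l \<open>csqrt (- \<i> * y)\<close> cancels.\<close>

lemma eta_nu_relation:
  assumes y: "Im y > 0"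
  shows "eta (of_nat (l\<^sup>2) * y) + (\<Sum>c\<in>units l. nu c * eta (y + 24 * of_nat c / of_nat l)) = of_int (chi12 l) * eta y"
proof -
  define C where "C = csqrt (- \<i> * y)"
  have C: "C \<noteq> 0" unfolding C_def by (rule csqrt_nonzero[OF y])
  have l2: "l\<^sup>2 > 0" using l_pos by simp
  have l0: "of_nat l \<noteq> (0::complex)" "y \<noteq> 0" using l_pos y by auto
  define z where "z = - 1 / (of_nat (l\<^sup>2) * y)"
  have z: "Im z > 0" unfolding z_def by (rule Im_minus_inverse_pos) (use y l_pos in simp)
  have ins: "{..<l} = insert 0 (units l)" using l_pos by (auto simp: units_l)
  have "(\<Sum>b<l. eta (z + 24 * of_nat b / of_nat l)) = eta z + (\<Sum>b\<in>units l. eta (z + 24 * of_nat b / of_nat l))"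
    unfolding ins by (subst sum.insert) (auto simp: units_l)
  also have "eta z = of_nat l * C * eta (of_nat (l\<^sup>2) * y)"
    unfolding z_def C_def using eta_inversion_scaled[OF y l2] by (simp add: real_sqrt_power)
  also have "(\<Sum>b\<in>units l. eta (z + 24 * of_nat b / of_nat l)) = (\<Sum>b\<in>units l. of_nat l * C * (nu (star l b) * eta (y + 24 * of_nat (star l b) / of_nat l)))"
  proof (intro sum.cong refl)
    fix b assume b: "b \<in> units l"
    have "of_real (sqrt (real l)) * vmul l b = of_nat l * nu (star l b)"
      unfolding nu_def star_l(2)[OF b] using sqrt_l_nonzero by (simp add: field_simps)
    then show "eta (z + 24 * of_nat b / of_nat l) = of_nat l * C * (nu (star l b) * eta (y + 24 * of_nat (star l b) / of_nat l))"
      unfolding z_def eta_l_relation[OF b y] C_def by (simp add: mult_ac)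
  qed
  also have "\<dots> = (\<Sum>c\<in>units l. of_nat l * C * (nu c * eta (y + 24 * of_nat c / of_nat l)))"
    by (rule sum.reindex_bij_betw[OF star_bij[OF lpow(1,2)]])
  finally have "of_nat l * C * (eta (of_nat (l\<^sup>2) * y) + (\<Sum>c\<in>units l. nu c * eta (y + 24 * of_nat c / of_nat l)))
      = (\<Sum>b<l. eta (z + 24 * of_nat b / of_nat l))"
    by (simp add: distrib_left sum_distrib_left)
  also have "\<dots> = of_nat l * of_int (chi12 l) * eta (of_nat (l\<^sup>2) * z)"
    by (rule eta_sum) (use z in auto)
  also have "of_nat (l\<^sup>2) * z = - 1 / y" unfolding z_def using l0 by (simp add: field_simps)
  also have "eta (- 1 / y) = C * eta y" unfolding C_def by (rule eta_inversion[OF y])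
  finally have "of_nat l * C * (eta (of_nat (l\<^sup>2) * y) + (\<Sum>c\<in>units l. nu c * eta (y + 24 * of_nat c / of_nat l)))
      = of_nat l * C * (of_int (chi12 l) * eta y)" by (simp add: mult_ac)
  then show ?thesis using C l0(1) by simp
qed

text \<open>The finite Fourier transform of the unknown multipliers. The expansion of eta determines
  it at squares, and that is enough to determine it everywhere.\<close>

definition MM :: "int \<Rightarrow> complex" where
  "MM n = (\<Sum>c\<in>units l. nu c * ee (of_int n * of_nat c / of_nat l))"

lemma eta_nu_fps:
  "fps_dilate (l\<^sup>2) eta_fps + (\<Sum>c\<in>units l. fps_const (nu c) * rot (ee (of_nat c / of_nat l)) eta_fps)
    = fps_const (of_int (chi12 l)) * eta_fps"
proof (rule eval_unique)
  have l2: "l\<^sup>2 > 0" using l_pos by simp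
  have d: "on_disc (fps_dilate (l\<^sup>2) eta_fps)" by (rule on_disc_dilate[OF l2 on_disc_eta_fps])
  have r: "on_disc (fps_const (nu c) * rot (ee (of_nat c / of_nat l)) eta_fps)" for c
    by (intro on_disc_mult on_disc_const on_disc_rot on_disc_eta_fps norm_ee_real)
  show "on_disc (fps_dilate (l\<^sup>2) eta_fps + (\<Sum>c\<in>units l. fps_const (nu c) * rot (ee (of_nat c / of_nat l)) eta_fps))"
    by (intro on_disc_add d on_disc_sum r)
  show "on_disc (fps_const (of_int (chi12 l)) * eta_fps)"
    by (intro on_disc_mult on_disc_const on_disc_eta_fps)
  fix q :: complex assume q: "norm q < 1" "q \<noteq> 0"
  obtain y where y: "Im y > 0" "q = ee (y / 24)" using ee_surj[OF q(2,1)] by blast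
  have c: "eval_fps (fps_const (nu c) * rot (ee (of_nat c / of_nat l)) eta_fps) q = nu c * eta (y + 24 * of_nat c / of_nat l)" for c
    using q by (subst eval_mult) (auto simp: eta_shift_eval[OF y(1)] y(2)[symmetric] intro!: on_disc_const on_disc_rot on_disc_eta_fps norm_ee_real)
  have "eval_fps (fps_dilate (l\<^sup>2) eta_fps + (\<Sum>c\<in>units l. fps_const (nu c) * rot (ee (of_nat c / of_nat l)) eta_fps)) q
     = eta (of_nat (l\<^sup>2) * y) + (\<Sum>c\<in>units l. nu c * eta (y + 24 * of_nat c / of_nat l))"
    unfolding eta_dilate_eval[OF y(1) l2] y(2)[symmetric]
    by (simp only: eval_add[OF d on_disc_sum[OF r] q(1)] eval_sum[OF r q(1)] c)
  also have "\<dots> = of_int (chi12 l) * eta y" by (rule eta_nu_relation[OF y(1)])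
  also have "\<dots> = eval_fps (fps_const (of_int (chi12 l)) * eta_fps) q"
    unfolding eval_mult[OF on_disc_const on_disc_eta_fps q(1)] eta_eval[OF y(1)] y(2)[symmetric] by simp
  finally show "eval_fps (fps_dilate (l\<^sup>2) eta_fps + (\<Sum>c\<in>units l. fps_const (nu c) * rot (ee (of_nat c / of_nat l)) eta_fps)) q
     = eval_fps (fps_const (of_int (chi12 l)) * eta_fps) q" .
qed

lemma MM_coeff:
  "(if l\<^sup>2 dvd n then of_int (e24 (n div l\<^sup>2)) else 0) + MM (int n) * of_int (e24 n) = of_int (chi12 l) * of_int (e24 n)"
proof -
  have "fps_nth (fps_dilate (l\<^sup>2) eta_fps + (\<Sum>c\<in>units l. fps_const (nu c) * rot (ee (of_nat c / of_nat l)) eta_fps)) n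
     = (if l\<^sup>2 dvd n then of_int (e24 (n div l\<^sup>2)) else 0) + MM (int n) * of_int (e24 n)"
    by (simp add: fps_sum_nth fps_dilate_nth MM_def sum_distrib_left sum_distrib_right ee_power mult_ac)
  then show ?thesis unfolding eta_nu_fps by simp
qed

lemma MM_cong: "[m = n] (mod int l) \<Longrightarrow> MM m = MM n"
proof -
  assume "[m = n] (mod int l)"
  then obtain k where k: "m = n + int l * k" by (metis cong_iff_lin cong_sym)
  have "ee (of_int m * of_nat c / of_nat l) = ee (of_int n * of_nat c / of_nat l)" for c
  proof -
    have "of_int m * of_nat c / of_nat l = of_int n * of_nat c / of_nat l + (of_int (k * int c) :: complex)"
      using l_pos by (simp add: k field_simps)
    then show ?thesis by (simp only: ee_add ee_of_int mult_1_right)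
  qed
  then show ?thesis by (simp add: MM_def)
qed

text \<open>Read off at exponent l^2, where the coefficient 1 coming from eta(l^2 y) already
  accounts for chi12(l)^2 = 1.\<close>

lemma MM_0: "MM 0 = 0"
proof -
  have "e24 (l\<^sup>2) = chi12 l" by simp
  moreover have "e24 1 = 1" using e24_square[of 1] by (simp add: chi12_def)
  ultimately have "1 + MM (int (l\<^sup>2)) * of_int (chi12 l) = of_int (chi12 l) * (of_int (chi12 l) :: complex)"
    using MM_coeff[of "l\<^sup>2"] l_pos by simp
  also have "\<dots> = 1" using chi_l by (metis of_int_1 of_int_mult)
  finally have "MM (int (l\<^sup>2)) * of_int (chi12 l) = 0" by simp
  moreover have "chi12 l \<noteq> 0" using chi_l by auto
  ultimately have "MM (int (l\<^sup>2)) = 0" by simp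
  moreover have "[int (l\<^sup>2) = 0] (mod int l)" by (simp add: cong_def)
  ultimately show ?thesis using MM_cong by metis
qed

lemma coprime_l_12: "coprime l 12"
proof -
  have "coprime (int l) 576" using coprime_l_576 by (simp add: coprime_commute)
  moreover have "(12::int) dvd 576" by simp
  ultimately have "coprime (int l) 12" by (metis coprime_divisors dvd_refl)
  then have "coprime (int l) (int 12)" by simp
  then show ?thesis by (simp only: coprime_int_iff)
qed

text \<open>A usable exponent is a square k^2 with chi12(k) nonzero; the Chinese remainder theorem
  moves a to such a k without changing it modulo l.\<close>

lemma MM_square: assumes "\<not> l dvd a" shows "MM (int (a\<^sup>2)) = of_int (chi12 l)"
proof -
  obtain k where k: "[k = a] (mod l)" "[k = 1] (mod 12)"
    using binary_chinese_remainder_nat[OF coprime_l_12] by blast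
  have nd: "\<not> l dvd k" using assms k(1) cong_dvd_iff by blast
  then have "\<not> l\<^sup>2 dvd k\<^sup>2" by simp
  moreover have "chi12 k = 1" using k(2) by (simp add: chi12_def cong_def)
  ultimately have "MM (int (k\<^sup>2)) = of_int (chi12 l)" using MM_coeff[of "k\<^sup>2"] by simp
  moreover have "[int (k\<^sup>2) = int (a\<^sup>2)] (mod int l)"
    using cong_pow[OF k(1), of 2] by (simp only: cong_int_iff)
  ultimately show ?thesis using MM_cong by metis
qed

lemma MM_sum: "(\<Sum>x<l. MM (int x)) = 0"
proof -
  have "(\<Sum>x<l. MM (int x)) = (\<Sum>c\<in>units l. nu c * (\<Sum>x<l. ee (of_int (int c) * of_nat x / of_nat l)))"
    unfolding MM_def by (subst sum.swap) (simp add: sum_distrib_left mult_ac)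
  also have "\<dots> = 0"
    unfolding ee_sum[OF l_pos] by (intro sum.neutral) (auto simp: units_def)
  finally show ?thesis .
qed

lemma cnj_ee_real: "cnj (ee (of_real t)) = ee (of_real (- t))"
  by (simp add: ee_def exp_cnj)

text \<open>Parseval for the l-1 multipliers, each with |nu|^2 = 1/l.\<close>

lemma MM_norm_sum: "(\<Sum>x<l. norm (MM (int x)) ^ 2) = real l - 1"
proof -
  have arg: "of_int (int x) * of_nat c / of_nat l = complex_of_real (real x * real c / real l)" for x c by simp
  have cu: "card (units l) = l - 1" "finite (units l)" by (simp_all add: units_l)
  have prod: "ee (of_int (int x) * of_nat c / of_nat l) * cnj (ee (of_int (int x) * of_nat d / of_nat l))
     = ee (of_int (int c - int d) * of_nat x / of_nat l)" for x c d
    unfolding arg cnj_ee_real ee_add[symmetric] by (simp add: algebra_simps diff_divide_distrib)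
  have "complex_of_real (\<Sum>x<l. norm (MM (int x)) ^ 2) = (\<Sum>x<l. MM (int x) * cnj (MM (int x)))"
    by (simp add: complex_norm_square[symmetric] del: of_real_power)
  also have "\<dots> = (\<Sum>x<l. \<Sum>c\<in>units l. \<Sum>d\<in>units l. nu c * cnj (nu d) * ee (of_int (int c - int d) * of_nat x / of_nat l))"
    unfolding MM_def cnj_sum sum_product complex_cnj_mult
    by (intro sum.cong refl, unfold prod[symmetric]) (simp only: mult_ac)
  also have "\<dots> = (\<Sum>c\<in>units l. \<Sum>x<l. \<Sum>d\<in>units l. nu c * cnj (nu d) * ee (of_int (int c - int d) * of_nat x / of_nat l))"
    by (rule sum.swap)
  also have "\<dots> = (\<Sum>c\<in>units l. \<Sum>d\<in>units l. \<Sum>x<l. nu c * cnj (nu d) * ee (of_int (int c - int d) * of_nat x / of_nat l))"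
    by (rule sum.cong[OF refl], rule sum.swap)
  also have "\<dots> = (\<Sum>c\<in>units l. \<Sum>d\<in>units l. nu c * cnj (nu d) * (\<Sum>x<l. ee (of_int (int c - int d) * of_nat x / of_nat l)))"
    unfolding sum_distrib_left ..
  also have "\<dots> = (\<Sum>c\<in>units l. \<Sum>d\<in>units l. if d = c then nu c * cnj (nu c) * of_nat l else 0)"
  proof (intro sum.cong refl)
    fix c d assume cd: "c \<in> units l" "d \<in> units l"
    have "int l dvd int c - int d \<longleftrightarrow> d = c"
    proof
      assume dv: "int l dvd int c - int d"
      have "\<bar>int c - int d\<bar> < int l" using cd by (auto simp: units_l)
      then have "int c - int d = 0" using dvd_imp_le_int[of "int c - int d" "int l"] dv by fastforce
      then show "d = c" by simp
    qed simp
    then show "nu c * cnj (nu d) * (\<Sum>x<l. ee (of_int (int c - int d) * of_nat x / of_nat l)) = (if d = c then nu c * cnj (nu c) * of_nat l else 0)"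
      unfolding ee_sum[OF l_pos] by auto
  qed
  also have "\<dots> = (\<Sum>c\<in>units l. 1)"
  proof (intro sum.cong refl)
    fix c assume c: "c \<in> units l"
    have "nu c * cnj (nu c) = of_real (norm (nu c) ^ 2)" by (rule complex_norm_square[symmetric])
    then have "nu c * cnj (nu c) * of_nat l = 1" unfolding norm_nu[OF c] using l_pos by simp
    then show "(\<Sum>d\<in>units l. if d = c then nu c * cnj (nu c) * of_nat l else 0) = 1"
      using c cu by (simp add: sum.delta)
  qed
  also have "\<dots> = complex_of_real (real l - 1)" using l_pos cu by (simp add: of_nat_diff)
  finally show ?thesis by (simp only: of_real_eq_iff)
qed

text \<open>On the nonzero squares, half of the nonzero classes, \<open>MM\<close> is chi12(l). The
  total sum 0 and the Parseval sum l-1 leave the nonresidues with mean -chi12(l) and mean square 1,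
  so the sum of |MM + chi12(l)|^2 over them is 0.\<close>

theorem MM_eq_Legendre: "MM n = of_int (chi12 l * Legendre n (int l))"
proof -
  define chi where "chi = complex_of_int (chi12 l)"
  have chi2: "norm chi = 1" "chi * cnj chi = 1"
    using chi_l by (auto simp: chi_def zmult_eq_1_iff)
  define R where "R = (\<lambda>k. k\<^sup>2 mod l) ` {1..(l - 1) div 2}"
  define Nn where "Nn = {1..<l} - R"
  have inj: "inj_on (\<lambda>k. k\<^sup>2 mod l) {1..(l - 1) div 2}"
  proof (rule linorder_inj_onI)
    fix j k assume jk: "j < k" "j \<in> {1..(l - 1) div 2}" "k \<in> {1..(l - 1) div 2}"
    show "j\<^sup>2 mod l \<noteq> k\<^sup>2 mod l"
    proof
      assume "j\<^sup>2 mod l = k\<^sup>2 mod l"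
      then have "l dvd k\<^sup>2 - j\<^sup>2" using mod_eq_dvd_iff_nat[of "j\<^sup>2" "k\<^sup>2" l] jk(1) by (simp add: power_mono)
      also have "k\<^sup>2 - j\<^sup>2 = (k - j) * (k + j)"
      proof -
        obtain d where "k = j + d" using jk(1) less_imp_add_positive by metis
        then show ?thesis by (simp add: power2_eq_square algebra_simps)
      qed
      finally have dv: "l dvd (k - j) * (k + j)" .
      have "2 * ((l - 1) div 2) \<le> l - 1" by simp
      then have b: "0 < k - j" "k - j < l" "0 < k + j" "k + j < l" using jk l_pos unfolding atLeastAtMost_iff by linarith+
      have "l dvd k - j \<or> l dvd k + j" using dv prime_dvd_mult_iff[OF prime_l] by blast
      then show False using nat_dvd_not_less[OF b(1,2)] nat_dvd_not_less[OF b(3,4)] by blast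
    qed
  qed (simp add: linorder_class.linear)
  have Rs: "R \<subseteq> {1..<l}"
  proof
    fix x assume "x \<in> R"
    then obtain k where k: "k \<in> {1..(l - 1) div 2}" "x = k\<^sup>2 mod l" unfolding R_def by blast
    have "\<not> l dvd k" using k(1) l_pos by (auto dest!: dvd_imp_le)
    then have "\<not> l dvd k\<^sup>2" using prime_l prime_dvd_power by blast
    then show "x \<in> {1..<l}" using k(2) l_pos by (simp add: dvd_eq_mod_eq_0 Suc_leI)
  qed
  have odd_l: "odd l" using prime_l l_ge_7 prime_odd_nat by auto
  have cR: "card R = (l - 1) div 2" unfolding R_def card_image[OF inj] by simp
  have fin: "finite R" "finite Nn" by (simp_all add: R_def Nn_def)
  have "card Nn = (l - 1) - card R" unfolding Nn_def using Rs by (simp add: card_Diff_subset fin)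
  then have cN: "card Nn = card R" using cR odd_l by (auto elim!: oddE)
  have MR: "MM (int x) = chi" if xR: "x \<in> R" for x
  proof -
    obtain k where k: "k \<in> {1..(l - 1) div 2}" "x = k\<^sup>2 mod l" using xR unfolding R_def by blast
    have "\<not> l dvd k" using k(1) l_pos by (auto dest!: dvd_imp_le)
    then have "MM (int (k\<^sup>2)) = chi" unfolding chi_def by (rule MM_square)
    moreover have "[int x = int (k\<^sup>2)] (mod int l)" unfolding cong_int_iff k(2) by (simp add: cong_def)
    ultimately show ?thesis using MM_cong by metis
  qed
  have split: "(\<Sum>x<l. g x) = g 0 + (\<Sum>x\<in>R. g x) + (\<Sum>x\<in>Nn. g x)" for g :: "nat \<Rightarrow> 'a::comm_monoid_add"
  proof -
    have "{..<l} = insert 0 (R \<union> Nn)" using Rs l_pos by (auto simp: Nn_def)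
    moreover have "0 \<notin> R \<union> Nn" "R \<inter> Nn = {}" using Rs by (auto simp: Nn_def)
    ultimately show ?thesis using fin by (simp add: sum.union_disjoint add.assoc)
  qed
  have s1: "(\<Sum>x\<in>Nn. MM (int x)) = - (of_nat (card R) * chi)"
    using MM_sum unfolding split[of "\<lambda>x. MM (int x)"] by (simp add: MM_0 MR eq_neg_iff_add_eq_0 add.commute)
  have s2: "(\<Sum>x\<in>Nn. norm (MM (int x)) ^ 2) = real (card R)"
  proof -
    have "real l - 1 = 2 * real (card R)" using cR odd_l by (auto elim!: oddE)
    then show ?thesis using MM_norm_sum unfolding split[of "\<lambda>x. norm (MM (int x)) ^ 2"] by (simp add: MM_0 MR chi2)
  qed
  have ex: "norm (MM (int x) + chi) ^ 2 = norm (MM (int x)) ^ 2 + 1 + 2 * Re (MM (int x) * cnj chi)" for x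
  proof -
    have "complex_of_real (norm (MM (int x) + chi) ^ 2) = (MM (int x) + chi) * cnj (MM (int x) + chi)" by (rule complex_norm_square)
    also have "\<dots> = MM (int x) * cnj (MM (int x)) + chi * cnj chi + (MM (int x) * cnj chi + cnj (MM (int x) * cnj chi))"
      by (simp add: algebra_simps)
    also have "MM (int x) * cnj chi + cnj (MM (int x) * cnj chi) = of_real (2 * Re (MM (int x) * cnj chi))"
      by (rule complex_add_cnj)
    also have "MM (int x) * cnj (MM (int x)) = of_real (norm (MM (int x)) ^ 2)" by (rule complex_norm_square[symmetric])
    finally have "complex_of_real (norm (MM (int x) + chi) ^ 2) = of_real (norm (MM (int x)) ^ 2 + 1 + 2 * Re (MM (int x) * cnj chi))"
      by (simp add: chi2)
    then show ?thesis by (simp only: of_real_eq_iff)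
  qed
  have "(\<Sum>x\<in>Nn. norm (MM (int x) + chi) ^ 2) = (\<Sum>x\<in>Nn. norm (MM (int x)) ^ 2) + real (card Nn) + 2 * Re ((\<Sum>x\<in>Nn. MM (int x)) * cnj chi)"
    unfolding ex by (simp add: sum.distrib sum_distrib_left sum_distrib_right)
  also have "\<dots> = 0" unfolding s1 s2 cN by (simp add: mult.assoc chi2)
  finally have z: "(\<Sum>x\<in>Nn. norm (MM (int x) + chi) ^ 2) = 0" .
  have MN: "MM (int x) = - chi" if "x \<in> Nn" for x
  proof -
    have "norm (MM (int x) + chi) ^ 2 = 0"
      using z that fin(2) by (subst (asm) sum_nonneg_eq_0_iff) auto
    then show ?thesis by (simp add: eq_neg_iff_add_eq_0)
  qed
  define x where "x = nat (n mod int l)"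
  have x: "int x = n mod int l" "x < l" using l_pos by (simp_all add: x_def nat_less_iff)
  have nx: "[n = int x] (mod int l)" unfolding x(1) by (simp add: cong_def)
  have Mn: "MM n = MM (int x)" by (rule MM_cong[OF nx])
  consider "x = 0" | "x \<in> R" | "x \<in> Nn" using x(2) by (fastforce simp: Nn_def)
  then show ?thesis
  proof cases
    case 1
    then have "[n = 0] (mod int l)" using nx by simp
    then show ?thesis using Mn 1 MM_0 by (simp add: Legendre_def)
  next
    case 2
    have nz: "\<not> [n = 0] (mod int l)"
    proof
      assume "[n = 0] (mod int l)"
      then have "int x = 0" unfolding x(1) by (simp add: cong_def)
      then show False using 2 Rs by auto
    qed
    obtain k where k: "x = k\<^sup>2 mod l" using 2 by (auto simp: R_def)
    then have "int x = (int k)\<^sup>2 mod int l" by (simp add: zmod_int)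
    then have "[(int k)\<^sup>2 = n] (mod int l)" unfolding x(1) by (simp add: cong_def)
    then have "QuadRes (int l) n" unfolding QuadRes_def by blast
    then show ?thesis using nz Mn MR[OF 2] by (simp add: Legendre_def chi_def)
  next
    case 3
    have nz: "\<not> [n = 0] (mod int l)"
    proof
      assume "[n = 0] (mod int l)"
      then have "int x = 0" unfolding x(1) by (simp add: cong_def)
      then show False using 3 by (auto simp: Nn_def)
    qed
    have "\<not> QuadRes (int l) n"
    proof
      assume "QuadRes (int l) n"
      then obtain y where y: "[y\<^sup>2 = n] (mod int l)" unfolding QuadRes_def by blast
      define k where "k = nat (y mod int l)"
      have k: "int k = y mod int l" using l_pos by (simp add: k_def)
      have "[int (k\<^sup>2) = y\<^sup>2] (mod int l)" unfolding of_nat_power k by (simp add: cong_def power_mod)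
      then have kn: "[int (k\<^sup>2) = n] (mod int l)" using y cong_trans by blast
      have "\<not> l dvd k"
      proof
        assume "l dvd k"
        then have "[int (k\<^sup>2) = 0] (mod int l)" by (simp add: cong_0_iff power2_eq_square)
        then show False using kn nz cong_sym cong_trans by blast
      qed
      then have "MM (int (k\<^sup>2)) = chi" unfolding chi_def by (rule MM_square)
      then have "chi = - chi" using MM_cong[OF kn] Mn MN[OF 3] by simp
      then show False using chi2(1) by auto
    qed
    then show ?thesis using nz Mn MN[OF 3] by (simp add: Legendre_def chi_def)
  qed
qed

end

context hecke_prime
begin

section \<open>The multipliers at level l^2 and the Hecke transform of 1/eta\<close>

lemma sum_split_l2:
  fixes g :: "nat \<Rightarrow> 'a::comm_monoid_add"
  shows "(\<Sum>b<l\<^sup>2. g b) = g 0 + (\<Sum>c\<in>units l. g (l * c)) + (\<Sum>b\<in>units (l\<^sup>2). g b)"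
proof -
  have "{..<l\<^sup>2} = insert 0 ((\<lambda>c. l * c) ` units l \<union> units (l\<^sup>2))"
  proof (rule subset_antisym; rule subsetI)
    fix b assume b: "b \<in> {..<l\<^sup>2}"
    show "b \<in> insert 0 ((\<lambda>c. l * c) ` units l \<union> units (l\<^sup>2))"
    proof (cases "l dvd b")
      case True
      then obtain c where c: "b = l * c" by blast
      then have "c < l" using b by (simp add: power2_eq_square)
      then show ?thesis using c by (cases "c = 0") (auto simp: units_l)
    next
      case False
      then show ?thesis using b by (simp add: units_def)
    qed
  next
    fix b assume "b \<in> insert 0 ((\<lambda>c. l * c) ` units l \<union> units (l\<^sup>2))"
    then consider "b = 0" | c where "c \<in> units l" "b = l * c" | "b \<in> units (l\<^sup>2)" by blast
    then show "b \<in> {..<l\<^sup>2}"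
    proof cases
      case 1
      then show ?thesis using l_pos by simp
    next
      case 2
      then show ?thesis using l_pos by (simp add: units_l power2_eq_square)
    next
      case 3
      then show ?thesis by (simp add: units_def)
    qed
  qed
  moreover have "0 \<notin> (\<lambda>c. l * c) ` units l \<union> units (l\<^sup>2)" using l_pos by (auto simp: units_l units_def[of "l\<^sup>2"])
  moreover have "(\<lambda>c. l * c) ` units l \<inter> units (l\<^sup>2) = {}" by (auto simp: units_def[of "l\<^sup>2"])
  moreover have "finite (units l)" "finite (units (l\<^sup>2))" by (simp_all add: units_def)
  moreover have "inj_on (\<lambda>c. l * c) (units l)" using l_pos by (auto simp: inj_on_def)
  ultimately show ?thesis by (simp add: sum.union_disjoint sum.reindex add.assoc)
qed

lemma card_units_l2: "real (card (units (l\<^sup>2))) = real (l\<^sup>2) - real l"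
proof -
  have "l\<^sup>2 = 1 + card (units l) + card (units (l\<^sup>2))" using sum_split_l2[of "\<lambda>_. 1::nat"] by simp
  moreover have "1 + card (units l) = l" using l_pos by (simp add: units_l)
  ultimately have "l\<^sup>2 = l + card (units (l\<^sup>2))" by simp
  then show ?thesis by (metis add_diff_cancel_left' of_nat_add)
qed

lemma eta_lc_relation:
  assumes c: "c \<in> units l" and z: "Im z > 0"
  shows "eta ((- 1 / z + 24 * of_nat (l * c)) / of_nat (l\<^sup>2)) = of_real (sqrt (real l)) * vmul l c * csqrt (- \<i> * z) * eta (z + 24 * of_nat (star l c) / of_nat l)"
proof -
  have l0: "of_nat l \<noteq> (0::complex)" "z \<noteq> 0" using l_pos z by auto
  have "(- 1 / z + 24 * of_nat (l * c)) / of_nat (l\<^sup>2) = (24 * of_nat c - 1 / (of_nat l * z)) / of_nat l"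
    using l0 by (simp add: field_simps power2_eq_square)
  moreover have "(of_nat l * z + 24 * of_nat (star l c)) / of_nat l = z + 24 * of_nat (star l c) / of_nat l"
    using l0 by (simp add: field_simps)
  ultimately show ?thesis
    using eta_vmul[OF lpow(1,2) c, of "of_nat l * z"] z l_pos csqrt_scale[OF l_pos, of z] by (simp add: mult_ac)
qed

lemma eta_unit_l2_relation:
  assumes b: "b \<in> units (l\<^sup>2)" and z: "Im z > 0"
  shows "eta ((- 1 / z + 24 * of_nat b) / of_nat (l\<^sup>2)) = vmul (l\<^sup>2) b * csqrt (- \<i> * z) * eta ((z + 24 * of_nat (star (l\<^sup>2) b)) / of_nat (l\<^sup>2))"
  using eta_vmul[OF lpow(3,4) b z] by (simp add: add.commute)

lemma sqrt_l_vmul: "c \<in> units l \<Longrightarrow> of_real (sqrt (real l)) * vmul l c = of_nat l * nu (star l c)"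
  unfolding nu_def star_l(2) using sqrt_l_nonzero by (simp add: field_simps)

text \<open>\<open>eta_sum\<close> with N = l^2 after inversion. The shifts 0, lc and the units
  modulo l^2 lead to three different kinds of arguments.\<close>

lemma eta_l2_relation:
  assumes z: "Im z > 0"
  shows "of_nat l * eta (of_nat (l\<^sup>2) * z) + (\<Sum>c\<in>units l. of_nat l * nu c * eta (z + 24 * of_nat c / of_nat l))
      + (\<Sum>b\<in>units (l\<^sup>2). vmul (l\<^sup>2) b * eta ((z + 24 * of_nat (star (l\<^sup>2) b)) / of_nat (l\<^sup>2)))
    = of_nat (l\<^sup>2) * of_int (chi12 l) * eta z"
proof -
  define C where "C = csqrt (- \<i> * z)"
  have C: "C \<noteq> 0" unfolding C_def by (rule csqrt_nonzero[OF z])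
  have l2: "l\<^sup>2 > 0" using l_pos by simp
  have l0: "of_nat l \<noteq> (0::complex)" "z \<noteq> 0" using l_pos z by auto
  have zz: "Im (- 1 / z / of_nat (l\<^sup>2)) > 0"
    using divide_pos_pos[of "Im (- 1 / z)" "real (l\<^sup>2)"] Im_minus_inverse_pos[OF z] l2 by (simp only: Im_divide_of_nat of_nat_0_less_iff)
  have "(\<Sum>b<l\<^sup>2. eta ((- 1 / z + 24 * of_nat b) / of_nat (l\<^sup>2))) = of_nat (l\<^sup>2) * of_int (chi12 l) * eta (- 1 / z)"
  proof -
    have "of_nat (l\<^sup>2) * (- 1 / z / of_nat (l\<^sup>2)) = - 1 / z" using l0 by simp
    moreover have "(\<Sum>b<l\<^sup>2. eta ((- 1 / z + 24 * of_nat b) / of_nat (l\<^sup>2))) = of_nat (l\<^sup>2) * of_int (chi12 l) * eta (of_nat (l\<^sup>2) * (- 1 / z / of_nat (l\<^sup>2)))"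
      unfolding add_divide_distrib by (rule eta_sum) (use zz in auto)
    ultimately show ?thesis by (simp only:)
  qed
  also have "\<dots> = C * (of_nat (l\<^sup>2) * of_int (chi12 l) * eta z)" unfolding C_def eta_inversion[OF z] by simp
  finally have "C * (of_nat (l\<^sup>2) * of_int (chi12 l) * eta z) = eta ((- 1 / z + 24 * of_nat 0) / of_nat (l\<^sup>2))
    + (\<Sum>c\<in>units l. eta ((- 1 / z + 24 * of_nat (l * c)) / of_nat (l\<^sup>2)))
    + (\<Sum>b\<in>units (l\<^sup>2). eta ((- 1 / z + 24 * of_nat b) / of_nat (l\<^sup>2)))"
    unfolding sum_split_l2 by simp
  also have "eta ((- 1 / z + 24 * of_nat 0) / of_nat (l\<^sup>2)) = C * (of_nat l * eta (of_nat (l\<^sup>2) * z))"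
    using eta_inversion_scaled[OF z l2] l0 by (simp add: C_def real_sqrt_power field_simps)
  also have "(\<Sum>c\<in>units l. eta ((- 1 / z + 24 * of_nat (l * c)) / of_nat (l\<^sup>2))) =
     (\<Sum>c\<in>units l. C * (of_nat l * nu (star l c) * eta (z + 24 * of_nat (star l c) / of_nat l)))"
    (is "_ = sum ?g _")
  proof (intro sum.cong refl)
    fix c assume c: "c \<in> units l"
    show "eta ((- 1 / z + 24 * of_nat (l * c)) / of_nat (l\<^sup>2)) = ?g c"
      unfolding eta_lc_relation[OF c z] sqrt_l_vmul[OF c] C_def by (simp only: mult_ac)
  qed
  also have "\<dots> = (\<Sum>c\<in>units l. C * (of_nat l * nu c * eta (z + 24 * of_nat c / of_nat l)))"
    by (rule sum.reindex_bij_betw[OF star_bij[OF lpow(1,2)]])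
  also have "(\<Sum>b\<in>units (l\<^sup>2). eta ((- 1 / z + 24 * of_nat b) / of_nat (l\<^sup>2))) =
     (\<Sum>b\<in>units (l\<^sup>2). C * (vmul (l\<^sup>2) b * eta ((z + 24 * of_nat (star (l\<^sup>2) b)) / of_nat (l\<^sup>2))))"
    (is "_ = sum ?g _")
  proof (intro sum.cong refl)
    fix b assume b: "b \<in> units (l\<^sup>2)"
    show "eta ((- 1 / z + 24 * of_nat b) / of_nat (l\<^sup>2)) = ?g b"
      unfolding eta_unit_l2_relation[OF b z] C_def by (simp only: mult_ac)
  qed
  finally have "C * (of_nat l * eta (of_nat (l\<^sup>2) * z) + (\<Sum>c\<in>units l. of_nat l * nu c * eta (z + 24 * of_nat c / of_nat l))
      + (\<Sum>b\<in>units (l\<^sup>2). vmul (l\<^sup>2) b * eta ((z + 24 * of_nat (star (l\<^sup>2) b)) / of_nat (l\<^sup>2)))) = C * (of_nat (l\<^sup>2) * of_int (chi12 l) * eta z)"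
    by (simp only: distrib_left sum_distrib_left)
  then show ?thesis using C by simp
qed

text \<open>With z = l^2 y everything is a series in e(y/24), compared at exponent l^2: the first
  term is absent, the second gives l \<open>MM 1\<close> = l chi12(l), and in the third all roots of
  unity become 1.\<close>

lemma sum_vmul_l2: "(\<Sum>b\<in>units (l\<^sup>2). vmul (l\<^sup>2) b) = of_nat (l\<^sup>2) - of_nat l"
proof -
  define r where "r = (\<lambda>c N. rot (ee (of_nat c / of_nat N)) eta_fps)"
  define F where "F = fps_const (of_nat l) * fps_dilate (l ^ 4) eta_fps
    + (\<Sum>c\<in>units l. fps_const (of_nat l * nu c) * fps_dilate (l\<^sup>2) (r c l))
    + (\<Sum>b\<in>units (l\<^sup>2). fps_const (vmul (l\<^sup>2) b) * r (star (l\<^sup>2) b) (l\<^sup>2))"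
  define H where "H = fps_const (of_nat (l\<^sup>2) * of_int (chi12 l)) * fps_dilate (l\<^sup>2) eta_fps"
  have l2: "l\<^sup>2 > 0" "l ^ 4 > 0" using l_pos by simp_all
  have r: "on_disc (r c N)" for c N unfolding r_def by (intro on_disc_rot on_disc_eta_fps norm_ee_real)
  have d1: "on_disc (fps_const (of_nat l) * fps_dilate (l ^ 4) eta_fps)"
    by (intro on_disc_mult on_disc_const on_disc_dilate[OF l2(2)] on_disc_eta_fps)
  have d2: "on_disc (fps_const (of_nat l * nu c) * fps_dilate (l\<^sup>2) (r c l))" for c
    by (intro on_disc_mult on_disc_const on_disc_dilate[OF l2(1)] r)
  have d3: "on_disc (fps_const (vmul (l\<^sup>2) b) * r (star (l\<^sup>2) b) (l\<^sup>2))" for b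
    by (intro on_disc_mult on_disc_const r)
  have "F = H"
  proof (rule eval_unique)
    show "on_disc F" unfolding F_def by (intro on_disc_add d1 on_disc_sum d2 d3)
    show "on_disc H" unfolding H_def by (intro on_disc_mult on_disc_const on_disc_dilate[OF l2(1)] on_disc_eta_fps)
    fix q :: complex assume q: "norm q < 1" "q \<noteq> 0"
    obtain y where y: "Im y > 0" "q = ee (y / 24)" using ee_surj[OF q(2,1)] by blast
    define z where "z = of_nat (l\<^sup>2) * y"
    have z: "Im z > 0" unfolding z_def using y l_pos by simp
    have l0: "of_nat l \<noteq> (0::complex)" using l_pos by simp
    have q2: "ee (z / 24) = q ^ l\<^sup>2" by (simp add: y(2) z_def ee_power)
    have e1: "eval_fps (fps_const (of_nat l) * fps_dilate (l ^ 4) eta_fps) q = of_nat l * eta (of_nat (l\<^sup>2) * z)"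
    proof -
      have "of_nat (l\<^sup>2) * z = of_nat (l ^ 4) * y" by (simp add: z_def power2_eq_square power4_eq_xxxx)
      then show ?thesis
        unfolding eval_mult[OF on_disc_const on_disc_dilate[OF l2(2) on_disc_eta_fps] q(1)] by (simp only: eta_dilate_eval[OF y(1) l2(2)] y(2) eval_fps_const)
    qed
    have e2: "eval_fps (fps_const (of_nat l * nu c) * fps_dilate (l\<^sup>2) (r c l)) q = of_nat l * nu c * eta (z + 24 * of_nat c / of_nat l)" for c
      unfolding eval_mult[OF on_disc_const on_disc_dilate[OF l2(1) r] q(1)] eval_dilate[OF l2(1) r q(1)] eta_shift_eval[OF z] q2
      by (simp add: r_def)
    have e3: "eval_fps (fps_const (vmul (l\<^sup>2) b) * r (star (l\<^sup>2) b) (l\<^sup>2)) q = vmul (l\<^sup>2) b * eta ((z + 24 * of_nat (star (l\<^sup>2) b)) / of_nat (l\<^sup>2))" for b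
    proof -
      have "(z + 24 * of_nat (star (l\<^sup>2) b)) / of_nat (l\<^sup>2) = y + 24 * of_nat (star (l\<^sup>2) b) / of_nat (l\<^sup>2)"
        using l0 by (simp add: z_def field_simps)
      then show ?thesis
        unfolding eval_mult[OF on_disc_const r q(1)] by (simp only: eta_shift_eval[OF y(1)] r_def y(2) eval_fps_const)
    qed
    have "eval_fps F q = of_nat l * eta (of_nat (l\<^sup>2) * z) + (\<Sum>c\<in>units l. of_nat l * nu c * eta (z + 24 * of_nat c / of_nat l))
      + (\<Sum>b\<in>units (l\<^sup>2). vmul (l\<^sup>2) b * eta ((z + 24 * of_nat (star (l\<^sup>2) b)) / of_nat (l\<^sup>2)))"
      unfolding F_def eval_add[OF on_disc_add[OF d1 on_disc_sum[OF d2]] on_disc_sum[OF d3] q(1)]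
        eval_add[OF d1 on_disc_sum[OF d2] q(1)] eval_sum[OF d2 q(1)] eval_sum[OF d3 q(1)] e1 e2 e3 ..
    also have "\<dots> = of_nat (l\<^sup>2) * of_int (chi12 l) * eta z" by (rule eta_l2_relation[OF z])
    also have "\<dots> = eval_fps H q"
      unfolding H_def eval_mult[OF on_disc_const on_disc_dilate[OF l2(1) on_disc_eta_fps] q(1)] z_def eta_dilate_eval[OF y(1) l2(1)]
      unfolding y(2) by simp
    finally show "eval_fps F q = eval_fps H q" .
  qed
  then have "fps_nth F (l\<^sup>2) = fps_nth H (l\<^sup>2)" by simp
  moreover have "fps_nth H (l\<^sup>2) = of_nat (l\<^sup>2) * of_int (chi12 l)"
    using l_pos e24_square[of 1] by (simp add: H_def fps_dilate_nth chi12_def)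
  moreover have "fps_nth F (l\<^sup>2) = of_nat l * of_int (chi12 l) + of_int (chi12 l) * (\<Sum>b\<in>units (l\<^sup>2). vmul (l\<^sup>2) b)"
  proof -
    have "\<not> l ^ 4 dvd l\<^sup>2"
    proof
      assume "l ^ 4 dvd l\<^sup>2"
      then have "l ^ 4 \<le> l\<^sup>2" using l_pos by (intro dvd_imp_le) auto
      then show False using power_strict_increasing[of 2 4 l] l_ge_7 by simp
    qed
    then have 1: "fps_nth (fps_const (of_nat l) * fps_dilate (l ^ 4) eta_fps) (l\<^sup>2) = (0::complex)"
      by (simp add: fps_dilate_nth)
    have "fps_nth (\<Sum>c\<in>units l. fps_const (of_nat l * nu c) * fps_dilate (l\<^sup>2) (r c l)) (l\<^sup>2) = of_nat l * MM 1"
      using l_pos e24_square[of 1] by (simp add: fps_sum_nth fps_dilate_nth r_def MM_def chi12_def sum_distrib_left mult_ac)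
    also have "MM 1 = of_int (chi12 l)" using MM_square[of 1] prime_l l_ge_7 by simp
    finally have 2: "fps_nth (\<Sum>c\<in>units l. fps_const (of_nat l * nu c) * fps_dilate (l\<^sup>2) (r c l)) (l\<^sup>2) = of_nat l * of_int (chi12 l)" .
    have "ee (of_nat c / of_nat (l\<^sup>2)) ^ l\<^sup>2 = 1" for c
      using l_pos by (simp add: ee_power del: of_nat_power)
    then have 3: "fps_nth (\<Sum>b\<in>units (l\<^sup>2). fps_const (vmul (l\<^sup>2) b) * r (star (l\<^sup>2) b) (l\<^sup>2)) (l\<^sup>2) = of_int (chi12 l) * (\<Sum>b\<in>units (l\<^sup>2). vmul (l\<^sup>2) b)"
      by (simp add: fps_sum_nth r_def sum_distrib_left mult_ac del: of_nat_power)
    show ?thesis unfolding F_def fps_add_nth 1 2 3 by simp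
  qed
  ultimately have "of_int (chi12 l) * (of_nat l + (\<Sum>b\<in>units (l\<^sup>2). vmul (l\<^sup>2) b)) = of_int (chi12 l) * of_nat (l\<^sup>2)"
    by (simp add: algebra_simps)
  moreover have "complex_of_int (chi12 l) \<noteq> 0" using chi_l by auto
  ultimately have "of_nat l + (\<Sum>b\<in>units (l\<^sup>2). vmul (l\<^sup>2) b) = of_nat (l\<^sup>2)" by (metis mult_left_cancel)
  then show ?thesis by (simp add: algebra_simps)
qed

text \<open>The multipliers have absolute value 1 and their sum equals their number, so each of them
  is 1.\<close>

lemma vmul_l2_eq_1: assumes b: "b \<in> units (l\<^sup>2)" shows "vmul (l\<^sup>2) b = 1"
proof -
  have n: "norm (vmul (l\<^sup>2) b) = 1" if "b \<in> units (l\<^sup>2)" for b by (rule norm_vmul[OF lpow(3,4) that])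
  have le: "Re (vmul (l\<^sup>2) b) \<le> 1" if "b \<in> units (l\<^sup>2)" for b using complex_Re_le_cmod[of "vmul (l\<^sup>2) b"] n[OF that] by simp
  have "(\<Sum>b\<in>units (l\<^sup>2). 1 - Re (vmul (l\<^sup>2) b)) = real (card (units (l\<^sup>2))) - Re (\<Sum>b\<in>units (l\<^sup>2). vmul (l\<^sup>2) b)"
    by (simp add: sum_subtractf)
  also have "\<dots> = 0" unfolding sum_vmul_l2 card_units_l2 by (simp flip: of_nat_power)
  finally have "(\<Sum>b\<in>units (l\<^sup>2). 1 - Re (vmul (l\<^sup>2) b)) = 0" .
  moreover have "finite (units (l\<^sup>2))" by (simp add: units_def)
  ultimately have "1 - Re (vmul (l\<^sup>2) b) = 0"
    using le b by (subst (asm) sum_nonneg_eq_0_iff) auto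
  then have re: "Re (vmul (l\<^sup>2) b) = 1" by simp
  then have "Im (vmul (l\<^sup>2) b) = 0" using n[OF b] cmod_power2[of "vmul (l\<^sup>2) b"] by simp
  then show ?thesis using re by (simp add: complex_eq_iff)
qed

text \<open>The Hecke operator of index l^2 in weight -1/2 applied to 1/eta, scaled by l^3 so that
  the coefficients become integral.\<close>

definition GG :: "complex \<Rightarrow> complex" where
  "GG z = of_nat l * (\<Sum>b<l\<^sup>2. inverse (eta ((z + 24 * of_nat b) / of_nat (l\<^sup>2))))
     + (\<Sum>c\<in>units l. inverse (nu c) * inverse (eta (z + 24 * of_nat c / of_nat l)))
     + inverse (eta (of_nat (l\<^sup>2) * z))"

text \<open>Inversion permutes the summands: b = 0 is exchanged with the last term, the shifts b =
  lc with the middle sum, and the units modulo l^2 are permuted among themselves, where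
  \<open>vmul_l2_eq_1\<close> removes the multipliers.\<close>

theorem GG_inversion:
  assumes z: "Im z > 0"
  shows "GG (- 1 / z) * csqrt (- \<i> * z) = GG z"
proof -
  define C where "C = csqrt (- \<i> * z)"
  have C: "C \<noteq> 0" unfolding C_def by (rule csqrt_nonzero[OF z])
  have l2: "l\<^sup>2 > 0" using l_pos by simp
  have l0: "of_nat l \<noteq> (0::complex)" "z \<noteq> 0" using l_pos z by auto
  define f where "f = (\<lambda>z. inverse (eta z))"
  define f1 where "f1 = (\<Sum>c\<in>units l. inverse (nu c) * f (z + 24 * of_nat c / of_nat l))"
  define f2 where "f2 = (\<Sum>c\<in>units l. of_nat l * f ((z + 24 * of_nat (l * c)) / of_nat (l\<^sup>2)))"
  define f3 where "f3 = (\<Sum>b\<in>units (l\<^sup>2). of_nat l * f ((z + 24 * of_nat b) / of_nat (l\<^sup>2)))"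
  have vnz: "vmul l c \<noteq> 0" if "c \<in> units l" for c using norm_vmul[OF lpow(1,2) that] by auto
  have s0: "C * (of_nat l * f ((- 1 / z + 24 * of_nat 0) / of_nat (l\<^sup>2))) = f (of_nat (l\<^sup>2) * z)"
  proof -
    have "eta ((- 1 / z + 24 * of_nat 0) / of_nat (l\<^sup>2)) = of_nat l * C * eta (of_nat (l\<^sup>2) * z)"
      using eta_inversion_scaled[OF z l2] l0 by (simp add: C_def real_sqrt_power field_simps)
    then show ?thesis using C l0 by (simp add: f_def field_simps)
  qed
  have s1: "C * (of_nat l * f ((- 1 / z + 24 * of_nat (l * c)) / of_nat (l\<^sup>2))) = inverse (nu (star l c)) * f (z + 24 * of_nat (star l c) / of_nat l)"
    if c: "c \<in> units l" for c
    unfolding f_def eta_lc_relation[OF c z] sqrt_l_vmul[OF c] C_def[symmetric] using C l0 by (simp add: field_simps)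
  have s2: "C * (of_nat l * f ((- 1 / z + 24 * of_nat b) / of_nat (l\<^sup>2))) = of_nat l * f ((z + 24 * of_nat (star (l\<^sup>2) b)) / of_nat (l\<^sup>2))"
    if b: "b \<in> units (l\<^sup>2)" for b
    unfolding f_def eta_unit_l2_relation[OF b z] vmul_l2_eq_1[OF b] C_def[symmetric] using C by simp
  have s3: "C * (inverse (nu c) * f (- 1 / z + 24 * of_nat c / of_nat l)) = of_nat l * f ((z + 24 * of_nat (l * star l c)) / of_nat (l\<^sup>2))"
    if c: "c \<in> units l" for c
  proof -
    define y where "y = z / of_nat (l\<^sup>2)"
    have y: "Im y > 0" unfolding y_def using z l_pos by (simp only: Im_divide_of_nat) simp
    have zy: "z = of_nat (l\<^sup>2) * y" using l0 by (simp add: y_def)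
    have a: "(z + 24 * of_nat (l * star l c)) / of_nat (l\<^sup>2) = y + 24 * of_nat (star l c) / of_nat l"
      using l0 by (simp add: y_def field_simps power2_eq_square)
    have Cy: "C = of_nat l * csqrt (- \<i> * y)" unfolding C_def zy csqrt_scale[OF l2] by (simp add: real_sqrt_power)
    have "of_real (sqrt (real l)) * vmul l c * nu c = vmul l c * vmul l (star l c)"
      using sqrt_l_nonzero by (simp add: nu_def)
    also have "\<dots> = 1" by (rule vmul_star[OF lpow(1,2) c])
    finally have m: "of_real (sqrt (real l)) * vmul l c = inverse (nu c)" by (metis inverse_unique mult.commute)
    have nz: "nu c \<noteq> 0" using vnz[OF star_l(1)[OF c]] sqrt_l_nonzero by (simp add: nu_def)
    have "eta (- 1 / z + 24 * of_nat c / of_nat l) = inverse (nu c) * csqrt (- \<i> * y) * eta (y + 24 * of_nat (star l c) / of_nat l)"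
      unfolding zy eta_l_relation[OF c y] m ..
    moreover define D where "D = csqrt (- \<i> * y)"
    moreover have "D \<noteq> 0" unfolding D_def by (rule csqrt_nonzero[OF y])
    ultimately show ?thesis unfolding a f_def Cy D_def[symmetric] using nz by (simp add: field_simps)
  qed
  have s4: "C * f (of_nat (l\<^sup>2) * (- 1 / z)) = of_nat l * f ((z + 24 * of_nat 0) / of_nat (l\<^sup>2))"
  proof -
    define y where "y = z / of_nat (l\<^sup>2)"
    have y: "Im y > 0" unfolding y_def using z l_pos by (simp only: Im_divide_of_nat) simp
    have zy: "z = of_nat (l\<^sup>2) * y" using l0 by (simp add: y_def)
    have Cy: "C = of_nat l * csqrt (- \<i> * y)" unfolding C_def zy csqrt_scale[OF l2] by (simp add: real_sqrt_power)
    have "of_nat (l\<^sup>2) * (- 1 / z) = - 1 / y" using l0 by (simp add: y_def)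
    then have "eta (of_nat (l\<^sup>2) * (- 1 / z)) = csqrt (- \<i> * y) * eta y" by (simp only: eta_inversion[OF y])
    then show ?thesis unfolding f_def Cy using csqrt_nonzero[OF y] by (simp add: y_def)
  qed
  have "GG (- 1 / z) = of_nat l * f ((- 1 / z + 24 * of_nat 0) / of_nat (l\<^sup>2))
      + (\<Sum>c\<in>units l. of_nat l * f ((- 1 / z + 24 * of_nat (l * c)) / of_nat (l\<^sup>2)))
      + (\<Sum>b\<in>units (l\<^sup>2). of_nat l * f ((- 1 / z + 24 * of_nat b) / of_nat (l\<^sup>2)))
      + (\<Sum>c\<in>units l. inverse (nu c) * f (- 1 / z + 24 * of_nat c / of_nat l)) + f (of_nat (l\<^sup>2) * (- 1 / z))"
    unfolding GG_def sum_split_l2 f_def by (simp only: distrib_left sum_distrib_left)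
  then have "C * GG (- 1 / z) = f (of_nat (l\<^sup>2) * z)
      + (\<Sum>c\<in>units l. inverse (nu (star l c)) * f (z + 24 * of_nat (star l c) / of_nat l))
      + (\<Sum>b\<in>units (l\<^sup>2). of_nat l * f ((z + 24 * of_nat (star (l\<^sup>2) b)) / of_nat (l\<^sup>2)))
      + (\<Sum>c\<in>units l. of_nat l * f ((z + 24 * of_nat (l * star l c)) / of_nat (l\<^sup>2)))
      + of_nat l * f ((z + 24 * of_nat 0) / of_nat (l\<^sup>2))"
    by (simp only: distrib_left sum_distrib_left s0 s4 sum.cong[OF refl s1] sum.cong[OF refl s2] sum.cong[OF refl s3] cong: sum.cong)
  also have "(\<Sum>c\<in>units l. inverse (nu (star l c)) * f (z + 24 * of_nat (star l c) / of_nat l)) = f1"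
    unfolding f1_def by (rule sum.reindex_bij_betw[OF star_bij[OF lpow(1,2)]])
  also have "(\<Sum>b\<in>units (l\<^sup>2). of_nat l * f ((z + 24 * of_nat (star (l\<^sup>2) b)) / of_nat (l\<^sup>2))) = f3"
    unfolding f3_def by (rule sum.reindex_bij_betw[OF star_bij[OF lpow(3,4)]])
  also have "(\<Sum>c\<in>units l. of_nat l * f ((z + 24 * of_nat (l * star l c)) / of_nat (l\<^sup>2))) = f2"
    unfolding f2_def by (rule sum.reindex_bij_betw[OF star_bij[OF lpow(1,2)]])
  also have "f (of_nat (l\<^sup>2) * z) + f1 + f3 + f2 + of_nat l * f ((z + 24 * of_nat 0) / of_nat (l\<^sup>2)) = GG z"
    unfolding GG_def sum_split_l2 f_def f1_def f2_def f3_def by (simp only: distrib_left sum_distrib_left add_ac)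
  finally show ?thesis by (simp add: C_def mult.commute)
qed

end

section \<open>The level 5 Hauptmodul and its trace\<close>

definition fps_section :: "nat \<Rightarrow> 'a::zero fps \<Rightarrow> 'a fps" where
  "fps_section m f = Abs_fps (\<lambda>n. fps_nth f (m * n))"

lemma fps_section_nth [simp]: "fps_nth (fps_section m f) n = fps_nth f (m * n)"
  by (simp add: fps_section_def)

lemma on_disc_section:
  assumes "on_disc f" "N > 0" shows "on_disc (fps_section N f)"
proof (rule on_discI)
  fix r :: real assume r: "0 < r" "r < 1"
  define x where "x = root N r"
  have x: "0 < x" "x < 1" "x ^ N = r" using r assms(2) by (simp_all add: x_def)
  have "summable (\<lambda>n. norm (fps_nth f n * of_real x ^ n))"
    by (rule on_disc_norm_summable[OF assms(1)]) (use x in simp)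
  then have "summable ((\<lambda>n. norm (fps_nth f n * of_real x ^ n)) \<circ> (\<lambda>n. N * n))"
    using assms(2) by (intro summable_reindex) (auto simp: inj_on_def)
  then show "summable (\<lambda>n. norm (fps_nth (fps_section N f) n) * r ^ n)"
    using x by (simp add: o_def norm_mult norm_power power_mult)
qed

text \<open>The factor k coprime to N accommodates the shifts 24b/l^2 forced by the period of
  eta.\<close>

lemma eval_section:
  assumes f: "on_disc f" and N: "N > 0" and k: "coprime k N" and z: "Im z > 0"
  shows "(\<Sum>b<N. eval_fps f (ee ((z + of_nat (k * b)) / of_nat N))) = of_nat N * eval_fps (fps_section N f) (ee z)"
proof -
  define w where "w = (\<lambda>b. ee (of_nat (k * b) / of_nat N))"
  have q: "norm (ee (z / of_nat N)) < 1" by (rule norm_ee_less_1) (use z N in simp)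
  have d: "on_disc (rot (w b) f)" for b unfolding w_def by (intro on_disc_rot norm_ee_real f)
  have "(\<Sum>b<N. rot (w b) f) = fps_const (of_nat N) * fps_dilate N (fps_section N f)"
  proof (rule fps_ext)
    fix n
    have "w b ^ n = ee (of_int (int (k * n)) * of_nat b / of_nat N)" for b
      by (simp add: w_def ee_power mult_ac)
    then have "(\<Sum>b<N. w b ^ n) = (if N dvd k * n then of_nat N else 0)"
      by (simp only: ee_sum[OF N] int_dvd_int_iff)
    also have "N dvd k * n \<longleftrightarrow> N dvd n" using k by (simp add: coprime_commute coprime_dvd_mult_right_iff)
    finally show "fps_nth (\<Sum>b<N. rot (w b) f) n = fps_nth (fps_const (of_nat N) * fps_dilate N (fps_section N f)) n"
      by (auto simp: fps_sum_nth fps_dilate_nth sum_distrib_right[symmetric])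
  qed
  then have "eval_fps (\<Sum>b<N. rot (w b) f) (ee (z / of_nat N)) = eval_fps (fps_const (of_nat N) * fps_dilate N (fps_section N f)) (ee (z / of_nat N))"
    by simp
  also have "\<dots> = of_nat N * eval_fps (fps_section N f) (ee z)"
    unfolding eval_mult[OF on_disc_const on_disc_dilate[OF N on_disc_section[OF f N]] q] eval_dilate[OF N on_disc_section[OF f N] q]
    using N by (simp add: ee_power)
  also have "eval_fps (\<Sum>b<N. rot (w b) f) (ee (z / of_nat N)) = (\<Sum>b<N. eval_fps f (ee ((z + of_nat (k * b)) / of_nat N)))"
    unfolding eval_sum[OF d q] by (simp add: eval_rot w_def ee_add[symmetric] add_divide_distrib add.commute)
  finally show ?thesis .
qed

definition hauptmodul :: "complex \<Rightarrow> complex" where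
  "hauptmodul z = (eta (5 * z) / eta z) ^ 6"

lemma hauptmodul_nonzero: "Im z > 0 \<Longrightarrow> hauptmodul z \<noteq> 0"
  by (simp add: hauptmodul_def eta_nonzero)

lemma hauptmodul_add_1: "hauptmodul (z + 1) = hauptmodul z"
proof -
  have "eta (5 * (z + 1)) = ee (5 / 24) * eta (5 * z)" "eta (z + 1) = ee (1 / 24) * eta z"
    using eta_add_of_int[of "5 * z" 5] eta_add_of_int[of z 1] by (simp_all add: algebra_simps)
  moreover have "(ee (5 / 24) / ee (1 / 24)) ^ 6 = 1"
  proof -
    have "ee (5 / 24) = ee (1 / 6) * ee (1 / 24)" unfolding ee_add[symmetric] by simp
    then have "ee (5 / 24) / ee (1 / 24) = ee (1 / 6)" by simp
    then show ?thesis using ee_of_int[of 1] by (simp add: ee_power)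
  qed
  ultimately show ?thesis by (simp add: hauptmodul_def power_divide power_mult_distrib)
qed

lemma hauptmodul_diff_1: "hauptmodul (z - 1) = hauptmodul z"
  using hauptmodul_add_1[of "z - 1"] by simp

text \<open>Inversion of numerator and denominator leaves only the factor sqrt(5)^6 = 125.\<close>

lemma hauptmodul_fricke:
  assumes z: "Im z > 0" shows "hauptmodul (- 1 / (5 * z)) = 1 / (125 * hauptmodul z)"
proof -
  define C where "C = csqrt (- \<i> * z)"
  have C: "C \<noteq> 0" unfolding C_def using z by auto
  have z0: "z \<noteq> 0" using z by auto
  have 1: "eta (- 1 / z) = C * eta z" unfolding C_def by (rule eta_inversion[OF z])
  have s: "of_real (sqrt 5) ^ 6 = (125::complex)"
  proof -
    have "sqrt 5 ^ 6 = (sqrt 5 ^ 2) ^ 3" by (simp only: power_mult[symmetric]) simp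
    then show ?thesis by (simp flip: of_real_power)
  qed
  have 2: "eta (- 1 / (5 * z)) = of_real (sqrt 5) * C * eta (5 * z)"
    using eta_inversion[of "5 * z"] z csqrt_of_real_mult[of 5 "- \<i> * z"] by (simp add: C_def mult.left_commute)
  have 3: "5 * (- 1 / (5 * z)) = - 1 / z" using z0 by simp
  have nz: "eta z \<noteq> 0" "eta (5 * z) \<noteq> 0" using z eta_nonzero[of z] eta_nonzero[of "5 * z"] by simp_all
  have "hauptmodul (- 1 / (5 * z)) = (C * eta z / (of_real (sqrt 5) * C * eta (5 * z))) ^ 6"
    unfolding hauptmodul_def 3 1 2 ..
  also have "\<dots> = 1 / (125 * hauptmodul z)"
    unfolding hauptmodul_def power_divide power_mult_distrib s using C nz by simp
  finally show ?thesis .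
qed

text \<open>z/(5z+1) is the translation by -1 conjugated with the Fricke involution z ->
  -1/(5z).\<close>

lemma hauptmodul_unipotent:
  assumes z: "Im z > 0" shows "hauptmodul (z / (5 * z + 1)) = hauptmodul z"
proof -
  define u where "u = - 1 / (5 * z) - 1"
  have u: "Im u > 0" using Im_minus_inverse_pos[of "5 * z"] z by (simp add: u_def)
  have z0: "z \<noteq> 0" using z by auto
  define w where "w = 5 * z + 1"
  have "5 * u = - (w / z)" using z0 by (simp add: u_def w_def field_simps)
  then have "w = - (5 * u * z)" using z0 by (simp add: field_simps)
  then have "z / w = - 1 / (5 * u)" using z0 by simp
  then have "z / (5 * z + 1) = - 1 / (5 * u)" by (simp only: w_def)
  then have "hauptmodul (z / (5 * z + 1)) = 1 / (125 * hauptmodul u)" by (simp only: hauptmodul_fricke[OF u])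
  also have "hauptmodul u = 1 / (125 * hauptmodul z)" unfolding u_def hauptmodul_diff_1 by (rule hauptmodul_fricke[OF z])
  finally show ?thesis by simp
qed

text \<open>By \<open>eta_modular\<close> the function changes only by a constant factor, whatever
  the phases are, and an elliptic fixed point shows that this factor is 1.\<close>

lemma hauptmodul_elliptic:
  assumes det: "a * a + b * 5 = (-1::int)" and z: "Im z > 0"
  shows "hauptmodul (moeb a b 5 (- a) z) = hauptmodul z"
proof -
  have d1: "a * (- a) - b * 5 = 1" "a * (- a) - (5 * b) * 1 = 1" using det by (simp_all add: algebra_simps)
  obtain v where v: "norm v = 1" "\<And>z. Im z > 0 \<Longrightarrow> eta (moeb a b 5 (- a) z) = v * csqrt (- \<i> * (of_int 5 * z + of_int (- a))) * eta z"
    by (rule eta_modular[OF d1(1)]) auto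
  obtain v' where v': "norm v' = 1" "\<And>z. Im z > 0 \<Longrightarrow> eta (moeb a (5 * b) 1 (- a) z) = v' * csqrt (- \<i> * (of_int 1 * z + of_int (- a))) * eta z"
    by (rule eta_modular[OF d1(2)]) auto
  have v0: "v \<noteq> 0" using v(1) by auto
  have m: "hauptmodul (moeb a b 5 (- a) z) = (v' / v) ^ 6 * hauptmodul z" if z: "Im z > 0" for z
  proof -
    define C where "C = csqrt (- \<i> * (5 * z - of_int a))"
    have "5 * z - of_int a \<noteq> 0" using z by (auto simp: complex_eq_iff)
    then have "C \<noteq> 0" by (simp add: C_def)
    moreover have "5 * moeb a b 5 (- a) z = moeb a (5 * b) 1 (- a) (5 * z)"
      by (simp add: moeb_def algebra_simps)
    then have "eta (5 * moeb a b 5 (- a) z) = v' * C * eta (5 * z)" using v'(2)[of "5 * z"] z by (simp add: C_def)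
    moreover have "eta (moeb a b 5 (- a) z) = v * C * eta z" using v(2)[OF z] by (simp add: C_def)
    ultimately show ?thesis unfolding hauptmodul_def by (simp add: power_divide power_mult_distrib)
  qed
  \<comment> \<open>The fixed point in the upper half plane: here 5w - a = i.\<close>
  define w where "w = (of_int a + \<i>) / 5"
  have w: "Im w > 0" by (simp add: w_def)
  have "moeb a b 5 (- a) w = w"
  proof -
    have "(of_int (a * a + b * 5) :: complex) = of_int (- 1)" by (simp only: det)
    then have e: "of_int a * of_int a + of_int b * 5 = (- 1 :: complex)" by simp
    have "5 * (of_int a * w + of_int b) = of_int a * \<i> + (of_int a * of_int a + of_int b * 5)"
      by (simp add: w_def algebra_simps)
    also have "\<dots> = 5 * (w * \<i>)" unfolding e by (simp add: w_def algebra_simps)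
    finally have "of_int a * w + of_int b = w * \<i>" by (subst (asm) mult_left_cancel) simp_all
    moreover have "of_int 5 * w + of_int (- a) = \<i>" by (simp add: w_def field_simps)
    ultimately show ?thesis by (simp only: moeb_def nonzero_mult_div_cancel_right[OF complex_i_not_zero])
  qed
  then have "(v' / v) ^ 6 = 1" using m[OF w] hauptmodul_nonzero[OF w] by simp
  then show ?thesis using m[OF z] by simp
qed

text \<open>The trace of 1/\<open>hauptmodul\<close> from Gamma_0(5) to the full modular group:
  besides the identity there are five cosets, with 1/\<open>hauptmodul\<close>(-1/(z+b)) = 125
  \<open>hauptmodul\<close>((z+b)/5).\<close>

definition JJ :: "complex \<Rightarrow> complex" where
  "JJ z = 1 / hauptmodul z + 125 * (\<Sum>b<5. hauptmodul ((z + of_nat b) / 5))"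

lemma sum_lessThan_5: "(\<Sum>i<5::nat. f i) = f 0 + f 1 + f 2 + f 3 + (f 4 :: 'a::comm_monoid_add)"
  by (simp add: eval_nat_numeral ac_simps)

text \<open>Inversion permutes the six cosets: the identity goes to b = 0 and back, b = 1 is
  exchanged with b = 4, and b = 2, 3 stay fixed because 2^2 and 3^2 are -1 modulo 5.\<close>

lemma JJ_inversion: assumes z: "Im z > 0" shows "JJ (- 1 / z) = JJ z"
proof -
  have z0: "z \<noteq> 0" using z by auto
  have w: "Im ((z + of_nat b) / 5) > 0" for b using z by (simp add: Im_divide_numeral)
  have 0: "1 / hauptmodul (- 1 / z) = 125 * hauptmodul ((z + of_nat 0) / 5)"
    using hauptmodul_fricke[of "z / 5"] w[of 0] by (simp add: Im_divide_numeral)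
  have 00: "125 * hauptmodul ((- 1 / z + of_nat 0) / 5) = 1 / hauptmodul z"
    using hauptmodul_fricke[OF z] by (simp add: mult.commute)
  have 1: "hauptmodul ((- 1 / z + of_nat 1) / 5) = hauptmodul ((z + of_nat 4) / 5)"
  proof -
    define v where "v = (z + of_nat 4) / 5 - 1"
    have v: "Im v > 0" using w[of 4] by (simp add: v_def)
    have zv: "z = 5 * v + 1" by (simp add: v_def field_simps)
    have "(- 1 / z + of_nat 1) / 5 = (z - 1) / z / 5" using z0 by (simp add: field_simps)
    also have "z - 1 = 5 * v" by (simp add: zv)
    also have "5 * v / z / 5 = v / (5 * v + 1)" unfolding zv[symmetric] by simp
    finally have "(- 1 / z + of_nat 1) / 5 = v / (5 * v + 1)" .
    then have "hauptmodul ((- 1 / z + of_nat 1) / 5) = hauptmodul v" by (simp only: hauptmodul_unipotent[OF v])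
    then show ?thesis unfolding v_def hauptmodul_diff_1 .
  qed
  have 4: "hauptmodul ((- 1 / z + of_nat 4) / 5) = hauptmodul ((z + of_nat 1) / 5)"
  proof -
    define x where "x = (- 1 / z + of_nat 4) / 5 - 1"
    have x: "Im x > 0" using Im_minus_inverse_pos[OF z] by (simp add: x_def Im_divide_numeral)
    have e: "5 * x + 1 = - 1 / z" by (simp add: x_def field_simps)
    have "x / (5 * x + 1) = (z + of_nat 1) / 5" unfolding e using z0 by (simp add: x_def field_simps)
    then have "hauptmodul x = hauptmodul ((z + of_nat 1) / 5)" using hauptmodul_unipotent[OF x] by (simp only:)
    then show ?thesis unfolding x_def hauptmodul_diff_1 .
  qed
  have 2: "hauptmodul ((- 1 / z + of_nat 2) / 5) = hauptmodul ((z + of_nat 2) / 5)"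
  proof -
    have m: "(- 1 / z + of_nat 2) / 5 = moeb 2 (-1) 5 (-2) ((z + of_nat 2) / 5)"
      using z0 by (simp add: moeb_def field_simps)
    show ?thesis unfolding m by (rule hauptmodul_elliptic[OF _ w]) simp
  qed
  have 3: "hauptmodul ((- 1 / z + of_nat 3) / 5) = hauptmodul ((z + of_nat 3) / 5)"
  proof -
    have m: "(- 1 / z + of_nat 3) / 5 = moeb 3 (-2) 5 (-3) ((z + of_nat 3) / 5)"
      using z0 by (simp add: moeb_def field_simps)
    show ?thesis unfolding m by (rule hauptmodul_elliptic[OF _ w]) simp
  qed
  show ?thesis unfolding JJ_def sum_lessThan_5 distrib_left 0 00 1 2 3 4 by (simp only: add_ac)
qed

text \<open>The expansion of q J; in 625 = 125 * 5 the factor 5 comes from summing over the five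
  shifts.\<close>

definition jf :: "int fps" where
  "jf = phi + 625 * fps_X * fps_section 5 (fps_X * psi)"

lemma cfps_section: "cfps (fps_section m f) = fps_section m (cfps f)"
  by (rule fps_ext) simp

lemma cfps_dil: "cfps (dil f) = fps_dilate 5 (cfps f)"
  by (rule fps_ext) (simp add: fps_dilate_nth dil_nth)

lemma cfps_euler_E_5: "cfps (euler_E 5) = fps_dilate 5 (cfps (euler_E 1))"
  unfolding cfps_dil[symmetric] by (subst dil_euler_E) simp_all

lemma on_disc_psi: "on_disc (cfps psi)" and on_disc_euler_5: "on_disc (cfps (euler_E 5))"
proof -
  show 5: "on_disc (cfps (euler_E 5))" unfolding cfps_euler_E_5 by (intro on_disc_dilate on_disc_euler) simp
  show "on_disc (cfps psi)" unfolding psi_def cfps_power cfps_mult by (intro on_disc_power on_disc_mult 5 on_disc_part)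
qed

lemma cfps_einv: "cfps einv = fps_dilate 5 (cfps part_gf)"
proof -
  have "dil (euler_E 1) * dil part_gf = 1"
    using arg_cong[OF euler_part, of dil] by (simp add: dil_simps del: One_nat_def)
  then have "euler_E 5 * dil part_gf = 1" using dil_euler_E[of 1] by simp
  then have e: "einv = dil part_gf" using einv by (metis mult.assoc mult.commute mult_1_right)
  show ?thesis unfolding e cfps_dil ..
qed

lemma on_disc_phi: "on_disc (cfps phi)"
  unfolding phi_def cfps_power cfps_mult cfps_einv
  by (intro on_disc_power on_disc_mult on_disc_euler on_disc_dilate on_disc_part) simp

lemma eta_5_eval: "eta (5 * z) = ee (5 * z / 24) * eval_fps (cfps (euler_E 5)) (ee z)" if z: "Im z > 0"
  unfolding cfps_euler_E_5 eta_def using eval_dilate[OF _ on_disc_euler norm_ee_less_1[OF z], of 5] by (simp add: ee_power)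

lemma hauptmodul_eval:
  assumes z: "Im z > 0"
  shows "hauptmodul z = eval_fps (cfps (fps_X * psi)) (ee z)"
proof -
  note q = norm_ee_less_1[OF z]
  have "hauptmodul z = (eta (5 * z) * inverse (eta z)) ^ 6" by (simp add: hauptmodul_def divide_inverse)
  also have "\<dots> = ((ee (5 * z / 24) * ee (- z / 24)) * (eval_fps (cfps (euler_E 5)) (ee z) * eval_fps (cfps part_gf) (ee z))) ^ 6"
    unfolding inverse_eta[OF z] eta_5_eval[OF z] by (simp only: mult_ac)
  also have "ee (5 * z / 24) * ee (- z / 24) = ee (z / 6)" unfolding ee_add[symmetric] by (simp add: field_simps)
  also have "(ee (z / 6) * (eval_fps (cfps (euler_E 5)) (ee z) * eval_fps (cfps part_gf) (ee z))) ^ 6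
     = ee z * eval_fps (cfps psi) (ee z)"
    unfolding psi_def cfps_power cfps_mult eval_power[OF on_disc_mult[OF on_disc_euler_5 on_disc_part] q]
      eval_mult[OF on_disc_euler_5 on_disc_part q] 
    unfolding power_mult_distrib ee_power by simp
  also have "\<dots> = eval_fps (cfps (fps_X * psi)) (ee z)"
    unfolding cfps_mult cfps_X eval_mult[OF on_disc_X on_disc_psi q] by simp
  finally show ?thesis .
qed

lemma on_disc_X_psi: "on_disc (cfps (fps_X * psi))"
  unfolding cfps_mult cfps_X by (intro on_disc_mult on_disc_X on_disc_psi)

lemma reciprocal: "a * b = 1 \<Longrightarrow> c \<noteq> 0 \<Longrightarrow> c * (1 / (c * b)) = a" for a b c :: "'a::field"
  by (cases "b = 0") (simp_all add: field_simps)

lemma on_disc_jf: "on_disc (cfps jf)"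
  and JJ_eval: "Im z > 0 \<Longrightarrow> ee z * JJ z = eval_fps (cfps jf) (ee z)"
proof -
  define W where "W = fps_section 5 (cfps (fps_X * psi))"
  have W: "on_disc W" unfolding W_def by (intro on_disc_section on_disc_X_psi) simp
  have j: "cfps jf = cfps phi + fps_const 625 * fps_X * W"
    unfolding jf_def W_def cfps_add cfps_mult cfps_X cfps_section cfps_numeral unfolding numeral_fps_const ..
  have d: "on_disc (fps_const 625 * fps_X)" by (intro on_disc_mult on_disc_const on_disc_X)
  show "on_disc (cfps jf)" unfolding j by (intro on_disc_add on_disc_phi on_disc_mult[OF d W])
  assume z: "Im z > 0"
  note q = norm_ee_less_1[OF z]
  have w: "Im ((z + of_nat b) / 5) > 0" for b using z by (simp add: Im_divide_numeral)
  have "(\<Sum>b<5. hauptmodul ((z + of_nat b) / 5)) = (\<Sum>b<5. eval_fps (cfps (fps_X * psi)) (ee ((z + of_nat (1 * b)) / of_nat 5)))"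
    using hauptmodul_eval[OF w] by simp
  also have "\<dots> = 5 * eval_fps W (ee z)" unfolding W_def by (subst eval_section[OF on_disc_X_psi _ _ z]) simp_all
  finally have 1: "(\<Sum>b<5. hauptmodul ((z + of_nat b) / 5)) = 5 * eval_fps W (ee z)" .
  have "eval_fps (cfps (phi * psi)) (ee z) = 1" unfolding phi_psi cfps_1 by simp
  then have "eval_fps (cfps phi) (ee z) * eval_fps (cfps psi) (ee z) = 1"
    unfolding cfps_mult eval_mult[OF on_disc_phi on_disc_psi q] .
  moreover have "hauptmodul z = ee z * eval_fps (cfps psi) (ee z)"
    unfolding hauptmodul_eval[OF z] cfps_mult cfps_X eval_mult[OF on_disc_X on_disc_psi q] by simp
  ultimately have 2: "ee z * (1 / hauptmodul z) = eval_fps (cfps phi) (ee z)"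
    using reciprocal[OF _ ee_nonzero] by (simp only:)
  show "ee z * JJ z = eval_fps (cfps jf) (ee z)"
    unfolding j eval_add[OF on_disc_phi on_disc_mult[OF d W] q] eval_mult[OF d W q] eval_mult[OF on_disc_const on_disc_X q]
      JJ_def 1 distrib_left 2 by simp
qed

lemma jf_nth_0: "fps_nth jf 0 = 1"
proof -
  have "fps_nth (euler_E 5 * einv) 0 = 1" unfolding einv by simp
  then have "fps_nth einv 0 = 1" by (simp add: euler_E_nth_0)
  then show ?thesis by (simp add: jf_def phi_def euler_E_nth_0 fps_power_zeroth)
qed

text \<open>q^i j^(s-i) starts with q^i and coefficient 1, so the coefficients are found one after
  another and remain integers.\<close>

lemma polar_part_elimination:
  fixes K j :: "int fps"
  assumes "fps_nth j 0 = 1"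
  shows "\<exists>P. fps_X ^ k dvd K - (\<Sum>i<k. of_int (P i) * fps_X ^ i * j ^ (s - i))"
proof (induction k)
  case (Suc k)
  then obtain P D where D: "K - (\<Sum>i<k. of_int (P i) * fps_X ^ i * j ^ (s - i)) = fps_X ^ k * D" by (auto elim: dvdE)
  define P' where "P' = P(k := fps_nth D 0)"
  have "(\<Sum>i<k. of_int (P' i) * fps_X ^ i * j ^ (s - i)) = (\<Sum>i<k. of_int (P i) * fps_X ^ i * j ^ (s - i))"
    by (intro sum.cong refl) (simp add: P'_def)
  then have "K - (\<Sum>i<Suc k. of_int (P' i) * fps_X ^ i * j ^ (s - i)) = fps_X ^ k * (D - of_int (fps_nth D 0) * j ^ (s - k))"
    using D by (simp add: P'_def algebra_simps)
  moreover have "fps_X ^ 1 dvd D - of_int (fps_nth D 0) * j ^ (s - k)"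
    unfolding fps_X_power_dvd_iff using assms by (simp add: fps_of_int[symmetric] fps_power_zeroth)
  ultimately have "fps_X ^ Suc k dvd K - (\<Sum>i<Suc k. of_int (P' i) * fps_X ^ i * j ^ (s - i))"
    by (simp add: mult_dvd_mono mult.commute)
  then show ?case by blast
qed simp

section \<open>The Hecke transform of the partition function\<close>

context hecke_prime
begin

definition s :: nat where "s = (l\<^sup>2 - 1) div 24"

lemma s_eq: "l\<^sup>2 = 24 * s + 1"
proof -
  have "\<not> 2 dvd l" "\<not> 3 dvd l"
    using coprime_common_divisor[OF coprime_l_12, of 2] coprime_common_divisor[OF coprime_l_12, of 3] by auto
  then have nd: "l mod 24 mod 2 \<noteq> 0" "l mod 24 mod 3 \<noteq> 0" by (simp_all add: mod_mod_cancel dvd_eq_mod_eq_0)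
  have "\<forall>r\<in>set [0..<24]. r mod 2 \<noteq> 0 \<longrightarrow> r mod 3 \<noteq> 0 \<longrightarrow> r\<^sup>2 mod 24 = (1::nat)" by code_simp
  moreover have "l mod 24 \<in> set [0..<24]" by simp
  ultimately have "(l mod 24)\<^sup>2 mod 24 = 1" using nd by blast
  then have "l\<^sup>2 mod 24 = 1" unfolding power_mod .
  then have "l\<^sup>2 = 24 * (l\<^sup>2 div 24) + 1" by (metis div_mult_mod_eq mult.commute)
  then obtain q where q: "l\<^sup>2 = 24 * q + 1" by blast
  then show ?thesis unfolding s_def q by simp
qed

text \<open>The expansion of q^(s + 1/24) \<open>GG\<close>; the factor q^s clears the pole that
  comes from 1/eta(l^2 z).\<close>

definition hecke_series :: "int fps" where
  "hecke_series = of_nat (l ^ 3) * fps_X ^ s * fps_section (l\<^sup>2) (fps_X ^ s * part_gf)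
     + of_int (int l * chi12 l) * fps_X ^ s * Abs_fps (\<lambda>m. Legendre (1 - 24 * int m) (int l) * fps_nth part_gf m)
     + Abs_fps (\<lambda>j. if l\<^sup>2 dvd j then fps_nth part_gf (j div l\<^sup>2) else 0)"

lemma l2_pos: "l\<^sup>2 > 0" using l_pos by simp

lemma cnj_ee_of_real: "cnj (ee (of_int n / of_nat N)) = ee (- of_int n / of_nat N)"
  using cnj_ee_real[of "real_of_int n / real N"] by simp

lemma inverse_nu: assumes c: "c \<in> units l" shows "inverse (nu c) = of_nat l * cnj (nu c)"
proof -
  have "nu c * cnj (nu c) = of_real (norm (nu c) ^ 2)" by (rule complex_norm_square[symmetric])
  then have "nu c * (of_nat l * cnj (nu c)) = 1" unfolding norm_nu[OF c] using l_pos by (simp add: field_simps)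
  then show ?thesis by (rule inverse_unique)
qed

text \<open>The inverse of nu(c) is l times its conjugate, so the sum is l times the conjugate of
  \<open>MM (- n)\<close>, which is real.\<close>

lemma inverse_nu_sum:
  "(\<Sum>c\<in>units l. inverse (nu c) * ee (of_int n * of_nat c / of_nat l)) = of_int (int l * chi12 l * Legendre (- n) (int l))"
proof -
  have "(\<Sum>c\<in>units l. inverse (nu c) * ee (of_int n * of_nat c / of_nat l)) = of_nat l * cnj (MM (- n))"
    unfolding MM_def cnj_sum sum_distrib_left
  proof (intro sum.cong refl)
    fix c assume c: "c \<in> units l"
    have "ee (of_int n * of_nat c / of_nat l) = cnj (ee (of_int (- n) * of_nat c / of_nat l))"
      using cnj_ee_of_real[of "- n * int c" l] by simp
    then show "inverse (nu c) * ee (of_int n * of_nat c / of_nat l) = of_nat l * cnj (nu c * ee (of_int (- n) * of_nat c / of_nat l))"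
      unfolding inverse_nu[OF c] by simp
  qed
  then show ?thesis unfolding MM_eq_Legendre by simp
qed

lemma GG_term1:
  assumes z: "Im z > 0"
  shows "ee (z / 24) * (\<Sum>b<l\<^sup>2. inverse (eta ((z + 24 * of_nat b) / of_nat (l\<^sup>2))))
    = of_nat (l\<^sup>2) * eval_fps (cfps (fps_section (l\<^sup>2) (fps_X ^ s * part_gf))) (ee z)"
proof -
  define F where "F = cfps (fps_X ^ s * part_gf)"
  have F: "on_disc F" unfolding F_def cfps_mult cfps_power cfps_X by (intro on_disc_mult on_disc_X_power on_disc_part)
  have l0: "(of_nat (l\<^sup>2) :: complex) = 24 * of_nat s + 1" unfolding s_eq by simp
  have nz: "(of_nat (l\<^sup>2) :: complex) \<noteq> 0" using l_pos by simp
  have "ee (z / 24) * inverse (eta ((z + 24 * of_nat b) / of_nat (l\<^sup>2))) = eval_fps F (ee ((z + of_nat (24 * b)) / of_nat (l\<^sup>2)))" for b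
  proof -
    define w where "w = (z + 24 * of_nat b) / of_nat (l\<^sup>2)"
    have w: "Im w > 0" unfolding w_def using z l_pos by (simp only: Im_divide_of_nat) simp
    have zw: "z = of_nat (l\<^sup>2) * w - 24 * of_nat b" using nz by (simp add: w_def)
    have "ee (z / 24) * ee (- w / 24) = ee (w * of_nat s + of_int (- int b))"
      unfolding ee_add[symmetric] zw l0 by (rule arg_cong[of _ _ ee]) (simp add: field_simps)
    also have "\<dots> = ee w ^ s" unfolding ee_add ee_of_int by (simp add: ee_power mult.commute)
    finally have "ee (z / 24) * inverse (eta w) = ee w ^ s * eval_fps (cfps part_gf) (ee w)"
      unfolding inverse_eta[OF w] by (simp add: mult.assoc[symmetric])
    also have "\<dots> = eval_fps F (ee w)"
      unfolding F_def cfps_mult cfps_power cfps_X eval_mult[OF on_disc_X_power on_disc_part norm_ee_less_1[OF w]] eval_power[OF on_disc_X norm_ee_less_1[OF w]] by simp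
    finally show ?thesis by (simp add: w_def)
  qed
  then have "ee (z / 24) * (\<Sum>b<l\<^sup>2. inverse (eta ((z + 24 * of_nat b) / of_nat (l\<^sup>2)))) = (\<Sum>b<l\<^sup>2. eval_fps F (ee ((z + of_nat (24 * b)) / of_nat (l\<^sup>2))))"
    by (simp only: sum_distrib_left)
  also have "\<dots> = of_nat (l\<^sup>2) * eval_fps (fps_section (l\<^sup>2) F) (ee z)"
  proof (rule eval_section[OF F l2_pos _ z])
    show "coprime 24 (l\<^sup>2)" unfolding s_eq
    proof (rule coprimeI)
      fix d :: nat assume d: "d dvd 24" "d dvd 24 * s + 1"
      have "d dvd 24 * s" using d(1) by (rule dvd_mult2)
      then show "is_unit d" using d(2) by (simp only: dvd_add_right_iff)
    qed
  qed
  finally show ?thesis unfolding F_def cfps_section .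
qed

lemma on_disc_twisted: "on_disc (cfps (Abs_fps (\<lambda>m. Legendre (1 - 24 * int m) (int l) * fps_nth part_gf m)))"
  by (rule on_disc_le[OF on_disc_part, of _ 1]) (simp add: Legendre_def)

lemma GG_term2:
  assumes z: "Im z > 0"
  shows "ee (z / 24) * (\<Sum>c\<in>units l. inverse (nu c) * inverse (eta (z + 24 * of_nat c / of_nat l)))
    = of_int (int l * chi12 l) * eval_fps (cfps (Abs_fps (\<lambda>m. Legendre (1 - 24 * int m) (int l) * fps_nth part_gf m))) (ee z)"
proof -
  define g where "g = (\<lambda>c. fps_const (inverse (nu c) * ee (- of_nat c / of_nat l)) * rot (ee (of_nat (24 * c) / of_nat l)) (cfps part_gf))"
  note q = norm_ee_less_1[OF z]
  have r: "on_disc (rot (ee (of_nat (24 * c) / of_nat l)) (cfps part_gf))" for c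
    by (intro on_disc_rot norm_ee_real on_disc_part)
  have g: "on_disc (g c)" for c unfolding g_def by (intro on_disc_mult on_disc_const r)
  have "ee (z / 24) * (inverse (nu c) * inverse (eta (z + 24 * of_nat c / of_nat l))) = eval_fps (g c) (ee z)" for c
  proof -
    define w where "w = z + 24 * of_nat c / of_nat l"
    have w: "Im w > 0" unfolding w_def using z by (simp add: Im_divide_of_nat)
    have "ee (z / 24) * ee (- w / 24) = ee (- of_nat c / of_nat l)"
      unfolding ee_add[symmetric] w_def by (rule arg_cong[of _ _ ee]) (simp add: field_simps)
    then have "ee (z / 24) * (inverse (nu c) * inverse (eta w)) = inverse (nu c) * ee (- of_nat c / of_nat l) * eval_fps (cfps part_gf) (ee w)"
      unfolding inverse_eta[OF w] by (simp add: mult_ac)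
    also have "ee w = ee (of_nat (24 * c) / of_nat l) * ee z" unfolding w_def ee_add[symmetric] by (simp add: add.commute)
    finally show ?thesis unfolding w_def g_def eval_mult[OF on_disc_const r q] eval_rot by simp
  qed
  then have "ee (z / 24) * (\<Sum>c\<in>units l. inverse (nu c) * inverse (eta (z + 24 * of_nat c / of_nat l))) = (\<Sum>c\<in>units l. eval_fps (g c) (ee z))"
    by (simp only: sum_distrib_left)
  also have "\<dots> = eval_fps (\<Sum>c\<in>units l. g c) (ee z)" by (rule eval_sum[OF g q, symmetric])
  also have "(\<Sum>c\<in>units l. g c) = fps_const (of_int (int l * chi12 l)) * cfps (Abs_fps (\<lambda>m. Legendre (1 - 24 * int m) (int l) * fps_nth part_gf m))"
  proof (rule fps_ext)
    fix n
    have e: "ee (- of_nat c / of_nat l) * ee (of_nat (24 * c) / of_nat l) ^ n = ee (of_int (24 * int n - 1) * of_nat c / of_nat l)" for c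
      unfolding ee_power ee_add[symmetric] by (rule arg_cong[of _ _ ee]) (use l_pos in \<open>simp add: field_simps\<close>)
    have "fps_nth (\<Sum>c\<in>units l. g c) n = (\<Sum>c\<in>units l. inverse (nu c) * (ee (- of_nat c / of_nat l) * ee (of_nat (24 * c) / of_nat l) ^ n)) * of_int (fps_nth part_gf n)"
      unfolding fps_sum_nth g_def sum_distrib_right fps_mult_left_const_nth rot_nth cfps_nth by (simp only: mult_ac)
    then show "fps_nth (\<Sum>c\<in>units l. g c) n = fps_nth (fps_const (of_int (int l * chi12 l)) * cfps (Abs_fps (\<lambda>m. Legendre (1 - 24 * int m) (int l) * fps_nth part_gf m))) n"
      unfolding e inverse_nu_sum by simp
  qed
  finally show ?thesis unfolding eval_mult[OF on_disc_const on_disc_twisted q] by simp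
qed

lemma cfps_part_dilate: "cfps (Abs_fps (\<lambda>j. if l\<^sup>2 dvd j then fps_nth part_gf (j div l\<^sup>2) else 0)) = fps_dilate (l\<^sup>2) (cfps part_gf)"
  by (rule fps_ext) (simp add: fps_dilate_nth)

lemma GG_term3:
  assumes z: "Im z > 0"
  shows "ee (of_nat s * z) * (ee (z / 24) * inverse (eta (of_nat (l\<^sup>2) * z))) = eval_fps (fps_dilate (l\<^sup>2) (cfps part_gf)) (ee z)"
proof -
  have lz: "Im (of_nat (l\<^sup>2) * z) > 0" using z l_pos by simp
  have l0: "(of_nat (l\<^sup>2) :: complex) = 24 * of_nat s + 1" unfolding s_eq by simp
  have "ee (of_nat s * z) * (ee (z / 24) * ee (- (of_nat (l\<^sup>2) * z) / 24)) = ee 0"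
    unfolding ee_add[symmetric] l0 by (rule arg_cong[of _ _ ee]) (simp add: field_simps)
  then show ?thesis
    unfolding inverse_eta[OF lz] eval_dilate[OF l2_pos on_disc_part norm_ee_less_1[OF z]] ee_power
    by (simp add: mult.assoc[symmetric])
qed

lemma on_disc_hecke: "on_disc (cfps hecke_series)"
  and GG_eval: "Im z > 0 \<Longrightarrow> ee (of_nat s * z) * (ee (z / 24) * GG z) = eval_fps (cfps hecke_series) (ee z)"
proof -
  define A B where "A = cfps (fps_section (l\<^sup>2) (fps_X ^ s * part_gf))"
    and "B = cfps (Abs_fps (\<lambda>m. Legendre (1 - 24 * int m) (int l) * fps_nth part_gf m))"
  have A: "on_disc A" unfolding A_def cfps_section cfps_mult cfps_power cfps_X
    by (intro on_disc_section on_disc_mult on_disc_X_power on_disc_part l2_pos)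
  have B: "on_disc B" unfolding B_def by (rule on_disc_twisted)
  have C: "on_disc (fps_dilate (l\<^sup>2) (cfps part_gf))" by (intro on_disc_dilate on_disc_part l2_pos)
  have h: "cfps hecke_series = fps_const (of_nat (l ^ 3)) * fps_X ^ s * A + fps_const (of_int (int l * chi12 l)) * fps_X ^ s * B + fps_dilate (l\<^sup>2) (cfps part_gf)"
    unfolding hecke_series_def cfps_add cfps_part_dilate cfps_mult A_def[symmetric] B_def[symmetric] cfps_power[of fps_X] cfps_X fps_of_nat[symmetric] fps_of_int[symmetric]
    by (intro arg_cong2[of _ _ _ _ "(+)"] arg_cong2[of _ _ _ _ "(*)"] refl) (auto intro!: fps_ext)
  have cX: "on_disc (fps_const c * fps_X ^ s)" for c by (intro on_disc_mult on_disc_const on_disc_X_power)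
  show "on_disc (cfps hecke_series)" unfolding h by (intro on_disc_add on_disc_mult[OF cX] A B C)
  assume z: "Im z > 0"
  note q = norm_ee_less_1[OF z]
  have "eval_fps (cfps hecke_series) (ee z) = of_nat (l ^ 3) * ee z ^ s * eval_fps A (ee z) + of_int (int l * chi12 l) * ee z ^ s * eval_fps B (ee z)
      + eval_fps (fps_dilate (l\<^sup>2) (cfps part_gf)) (ee z)"
    unfolding h eval_add[OF on_disc_add[OF on_disc_mult[OF cX A] on_disc_mult[OF cX B]] C q] eval_add[OF on_disc_mult[OF cX A] on_disc_mult[OF cX B] q]
      eval_mult[OF cX A q] eval_mult[OF cX B q] eval_mult[OF on_disc_const on_disc_X_power q] eval_power[OF on_disc_X q] by simp
  also have "\<dots> = ee z ^ s * (of_nat l * (of_nat (l\<^sup>2) * eval_fps A (ee z)) + of_int (int l * chi12 l) * eval_fps B (ee z))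
      + eval_fps (fps_dilate (l\<^sup>2) (cfps part_gf)) (ee z)"
    by (simp add: algebra_simps power3_eq_cube power2_eq_square)
  also have "\<dots> = ee (of_nat s * z) * (ee (z / 24) * GG z)"
    unfolding A_def B_def GG_term1[OF z, symmetric] GG_term2[OF z, symmetric] GG_term3[OF z, symmetric] GG_def ee_power
    by (simp only: distrib_left mult_ac)
  finally show "ee (of_nat s * z) * (ee (z / 24) * GG z) = eval_fps (cfps hecke_series) (ee z)" ..
qed

text \<open>\<open>GG\<close> times eta is invariant, the weights -1/2 and 1/2 cancelling. A
  polynomial in J with integer coefficients removes its polar part and constant term; the rest
  vanishes at the cusp, hence identically by \<open>modular_zero\<close>.\<close>

theorem hecke_identity:
  obtains P :: "nat \<Rightarrow> int" where
    "hecke_series * euler_E 1 = (\<Sum>i\<le>s. of_int (P i) * fps_X ^ i * jf ^ (s - i))"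
proof -
  define K where "K = hecke_series * euler_E 1"
  have K: "on_disc (cfps K)" unfolding K_def cfps_mult by (intro on_disc_mult on_disc_hecke on_disc_euler)
  define H where "H z = GG z * eta z" for z
  have HK: "ee (of_nat s * z) * H z = eval_fps (cfps K) (ee z)" if z: "Im z > 0" for z
  proof -
    have "ee (of_nat s * z) * H z = ee (of_nat s * z) * (ee (z / 24) * GG z) * eval_fps (cfps (euler_E 1)) (ee z)"
      unfolding H_def eta_def by (simp only: mult_ac)
    then show ?thesis unfolding GG_eval[OF z] K_def cfps_mult eval_mult[OF on_disc_hecke on_disc_euler norm_ee_less_1[OF z]] .
  qed
  have HS: "H (- 1 / z) = H z" if z: "Im z > 0" for z
    unfolding H_def eta_inversion[OF z] using GG_inversion[OF z] by (simp add: mult.assoc[symmetric])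
  \<comment> \<open>The s polar terms and, as the term number \<open>Suc s\<close>, the constant
    one.\<close>
  obtain P D where "K - (\<Sum>i<Suc s. of_int (P i) * fps_X ^ i * jf ^ (s - i)) = fps_X ^ Suc s * D"
    using polar_part_elimination[OF jf_nth_0, of "Suc s" K s] by (auto elim: dvdE)
  then have D: "K - (\<Sum>i\<le>s. of_int (P i) * fps_X ^ i * jf ^ (s - i)) = fps_X ^ Suc s * D" by (simp only: lessThan_Suc_atMost)
  define h where "h z = H z - (\<Sum>i\<le>s. of_int (P i) * JJ z ^ (s - i))" for z
  have jt: "on_disc (cfps (of_int (P i) * fps_X ^ i * jf ^ (s - i)))" for i
    unfolding cfps_mult cfps_power cfps_X cfps_of_int
    unfolding fps_of_int[symmetric]
    by (intro on_disc_mult on_disc_const on_disc_X_power on_disc_power on_disc_jf)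
  have XD: "on_disc (cfps (fps_X ^ Suc s * D))"
    unfolding D[symmetric] cfps_diff cfps_sum by (intro on_disc_diff K on_disc_sum jt)
  have hD: "ee (of_nat s * z) * h z = eval_fps (cfps (fps_X ^ Suc s * D)) (ee z)" if z: "Im z > 0" for z
  proof -
    note q = norm_ee_less_1[OF z]
    have t: "eval_fps (cfps (of_int (P i) * fps_X ^ i * jf ^ (s - i))) (ee z) = ee (of_nat s * z) * (of_int (P i) * JJ z ^ (s - i))" if i: "i \<le> s" for i
    proof -
      have "eval_fps (cfps (of_int (P i) * fps_X ^ i * jf ^ (s - i))) (ee z) = of_int (P i) * ee z ^ i * (ee z * JJ z) ^ (s - i)"
        unfolding cfps_mult cfps_power cfps_X cfps_of_int
        unfolding fps_of_int[symmetric] JJ_eval[OF z]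
          eval_mult[OF on_disc_mult[OF on_disc_const on_disc_X_power] on_disc_power[OF on_disc_jf] q] eval_mult[OF on_disc_const on_disc_X_power q]
          eval_power[OF on_disc_X q] eval_power[OF on_disc_jf q] by simp
      also have "\<dots> = ee z ^ (i + (s - i)) * (of_int (P i) * JJ z ^ (s - i))"
        by (simp only: power_mult_distrib power_add mult_ac)
      finally show ?thesis using i by (simp add: ee_power)
    qed
    show ?thesis
      unfolding D[symmetric] cfps_diff cfps_sum eval_diff[OF K on_disc_sum[OF jt] q] eval_sum[OF jt q] h_def right_diff_distrib HK[OF z] sum_distrib_left
      using t by simp
  qed
  have heq: "h z = ee (- (of_nat s * z)) * eval_fps (cfps (fps_X ^ Suc s * D)) (ee z)" if z: "Im z > 0" for z
    unfolding hD[OF z, symmetric] ee_minus by simp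
  \<comment> \<open>Dividing off q^(s+1) preserves convergence, so the difference h is q times a
    function continuous at q = 0.\<close>
  have D': "on_disc (cfps D)"
  proof (rule on_discI)
    fix r :: real assume r: "0 < r" "r < 1"
    have "summable (\<lambda>n. norm (fps_nth (cfps (fps_X ^ Suc s * D)) n * of_real r ^ n))"
      by (rule on_disc_norm_summable[OF XD]) (use r in simp)
    then have "summable (\<lambda>n. norm (fps_nth (cfps (fps_X ^ Suc s * D)) (n + Suc s) * of_real r ^ (n + Suc s)))"
      by (rule summable_ignore_initial_segment)
    moreover have "norm (fps_nth (cfps (fps_X ^ Suc s * D)) (n + Suc s) * of_real r ^ (n + Suc s)) = r ^ Suc s * (norm (fps_nth (cfps D) n) * r ^ n)" for n
    proof -
      have "fps_nth (fps_X ^ Suc s * D) (n + Suc s) = fps_nth D n" by (simp only: fps_X_power_mult_nth) simp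
      then show ?thesis using r by (simp only: cfps_nth norm_mult norm_power power_add) simp
    qed
    ultimately have "summable (\<lambda>n. r ^ Suc s * (norm (fps_nth (cfps D) n) * r ^ n))" by (simp only:)
    then show "summable (\<lambda>n. norm (fps_nth (cfps D) n) * r ^ n)" using r by (simp add: summable_cmult_iff)
  qed
  have heq': "h z = ee z * eval_fps (cfps D) (ee z)" if z: "Im z > 0" for z
  proof -
    have "h z = ee (- (of_nat s * z)) * (ee z ^ Suc s * eval_fps (cfps D) (ee z))"
      unfolding heq[OF z] cfps_mult cfps_power cfps_X eval_mult[OF on_disc_X_power D' norm_ee_less_1[OF z]] eval_power[OF on_disc_X norm_ee_less_1[OF z]] by simp
    also have "\<dots> = (ee (- (of_nat s * z)) * ee z ^ s) * (ee z * eval_fps (cfps D) (ee z))" by (simp add: mult_ac)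
    also have "ee (- (of_nat s * z)) * ee z ^ s = 1" by (simp add: ee_power ee_minus)
    finally show ?thesis by simp
  qed
  have ee1: "ee (z + 1) = ee z" for z using ee_of_int[of 1] by (simp add: ee_add)
  have h0: "h z = 0" if z: "Im z > 0" for z
  proof (rule modular_zero[OF _ _ _ _ z])
    have "(\<lambda>z. ee z * eval_fps (cfps D) (ee z)) holomorphic_on upper_half"
      by (intro holomorphic_intros holomorphic_on_eval_ee D') auto
    then show "h holomorphic_on upper_half" by (rule holomorphic_transform) (simp add: heq')
    show "h (- 1 / w) = h w" if "Im w > 0" for w
      unfolding h_def HS[OF that] JJ_inversion[OF that] ..
    show "h (w + 1) = h w" if "Im w > 0" for w
      using that heq'[of w] heq'[of "w + 1"] by (simp add: ee1)
    show "\<exists>Y. \<forall>z. Im z > Y \<longrightarrow> norm (h z) < e" if e: "e > 0" for e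
    proof -
      have "continuous_on (ball 0 1) (eval_fps (cfps D))"
        by (intro holomorphic_on_imp_continuous_on holomorphic_on_eval_fps) (auto intro!: on_discD[OF D'])
      then have "isCont (eval_fps (cfps D)) 0" by (simp add: continuous_on_eq_continuous_at)
      then have "((\<lambda>q. q * eval_fps (cfps D) q) \<longlongrightarrow> 0 * eval_fps (cfps D) 0) (at 0)"
        by (intro tendsto_mult tendsto_ident_at) (simp add: isCont_def)
      then obtain d where d: "d > 0" "\<And>q. q \<noteq> 0 \<Longrightarrow> norm q < d \<Longrightarrow> norm (q * eval_fps (cfps D) q) < e"
        using e unfolding tendsto_iff eventually_at by (auto simp: dist_norm)
      show ?thesis
      proof (intro exI allI impI)
        fix z :: complex assume Y: "Im z > max 0 (- ln d / (2 * pi))"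
        then have "norm (ee z) < d" unfolding norm_ee using d(1) by (subst ln_less_cancel_iff[symmetric]) (auto simp: field_simps)
        then show "norm (h z) < e" using d(2)[of "ee z"] heq'[of z] Y by simp
      qed
    qed
  qed
  have "cfps (fps_X ^ Suc s * D) = 0"
  proof (rule eval_unique[OF XD on_disc_0])
    fix q :: complex assume q: "norm q < 1" "q \<noteq> 0"
    obtain y where y: "Im y > 0" "q = ee (y / 24)" using ee_surj[OF q(2,1)] by blast
    have "Im (y / 24) > 0" using y by (simp add: Im_divide_numeral)
    then show "eval_fps (cfps (fps_X ^ Suc s * D)) q = eval_fps 0 q" using hD[of "y / 24"] h0[of "y / 24"] y(2) by simp
  qed
  then have "fps_X ^ Suc s * D = 0" using cfps_eq_iff[of _ 0] by (simp add: cfps_0)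
  then show ?thesis using that D unfolding K_def by simp
qed

end

section \<open>Congruences modulo powers of 5\<close>

text \<open>The modulus 0 is included and means equality, so the rearrangements proved for
  congruences also yield identities through \<open>feq_0\<close>.\<close>

definition feq :: "int \<Rightarrow> int fps \<Rightarrow> int fps \<Rightarrow> bool" where
  "feq M f g \<longleftrightarrow> (\<forall>n. M dvd fps_nth f n - fps_nth g n)"

lemma feqD: "feq M f g \<Longrightarrow> M dvd fps_nth f n - fps_nth g n"
  by (simp add: feq_def)

lemma feq_refl: "feq M f f"
  by (simp add: feq_def)

lemma feq_sym: "feq M f g \<Longrightarrow> feq M g f"
  by (simp add: feq_def dvd_diff_commute)

lemma feq_trans [trans]: assumes "feq M f g" "feq M g h" shows "feq M f h"
  unfolding feq_def
proof
  fix n show "M dvd fps_nth f n - fps_nth h n"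
    using dvd_add[OF feqD[OF assms(1), of n] feqD[OF assms(2), of n]] by simp
qed

lemma feq_add: assumes "feq M f f'" "feq M g g'" shows "feq M (f + g) (f' + g')"
  unfolding feq_def
proof
  fix n show "M dvd fps_nth (f + g) n - fps_nth (f' + g') n"
    using dvd_add[OF feqD[OF assms(1), of n] feqD[OF assms(2), of n]] by (simp add: algebra_simps)
qed

lemma feq_diff: assumes "feq M f f'" "feq M g g'" shows "feq M (f - g) (f' - g')"
  unfolding feq_def
proof
  fix n show "M dvd fps_nth (f - g) n - fps_nth (f' - g') n"
    using dvd_diff[OF feqD[OF assms(1), of n] feqD[OF assms(2), of n]] by (simp add: algebra_simps)
qed

lemma feq_mult: assumes "feq M f f'" "feq M g g'" shows "feq M (f * g) (f' * g')"
  unfolding feq_def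
proof
  fix n
  have "fps_nth (f * g) n - fps_nth (f' * g') n = (\<Sum>i=0..n. (fps_nth f i - fps_nth f' i) * fps_nth g (n - i) + fps_nth f' i * (fps_nth g (n - i) - fps_nth g' (n - i)))"
    unfolding fps_mult_nth sum_subtractf[symmetric] by (intro sum.cong refl) (simp add: algebra_simps)
  also have "M dvd \<dots>"
    by (rule dvd_sum) (rule dvd_add[OF dvd_mult2[OF feqD[OF assms(1)]] dvd_mult[OF feqD[OF assms(2)]]])
  finally show "M dvd fps_nth (f * g) n - fps_nth (f' * g') n" .
qed

lemma feq_power: "feq M f g \<Longrightarrow> feq M (f ^ n) (g ^ n)"
  by (induction n) (auto intro: feq_refl feq_mult)

lemma feq_sum: "(\<And>i. i \<in> A \<Longrightarrow> feq M (f i) (g i)) \<Longrightarrow> feq M (sum f A) (sum g A)"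
  by (induction A rule: infinite_finite_induct) (auto intro: feq_refl feq_add)

lemma feq_prod: "(\<And>i. i \<in> A \<Longrightarrow> feq M (f i) (g i)) \<Longrightarrow> feq M (prod f A) (prod g A)"
  by (induction A rule: infinite_finite_induct) (auto intro: feq_refl feq_mult)

lemma feq_dvd: "N dvd M \<Longrightarrow> feq M f g \<Longrightarrow> feq N f g"
  unfolding feq_def by (blast intro: dvd_trans)

lemma of_int_mult_nth: "fps_nth (of_int c * f) n = c * fps_nth (f :: int fps) n"
  by (simp add: fps_of_int[symmetric])

lemma feq_of_int: "M dvd c \<Longrightarrow> feq M (of_int c * f) 0"
  by (simp add: feq_def of_int_mult_nth)

lemma feqI_of_int: assumes "f - g = of_int M * h" shows "feq M f g"
  unfolding feq_def
proof
  fix n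
  have "fps_nth f n - fps_nth g n = fps_nth (f - g) n" by simp
  then show "M dvd fps_nth f n - fps_nth g n" unfolding assms of_int_mult_nth by simp
qed

lemma feq_cmult: assumes "feq M f g" shows "feq (k * M) (of_int k * f) (of_int k * g)"
  unfolding feq_def of_int_mult_nth right_diff_distrib[symmetric]
  by (intro allI mult_dvd_mono dvd_refl feqD[OF assms])

lemma feq_dil: "feq M f g \<Longrightarrow> feq M (dil f) (dil g)"
  by (simp add: feq_def dil_nth)

lemma feq_respart: "feq M f g \<Longrightarrow> feq M (respart r f) (respart r g)"
  by (simp add: feq_def respart_nth)

lemma feq_X_cancel: assumes "feq M (fps_X * f) (fps_X * g)" shows "feq M f g"
  unfolding feq_def
proof
  fix n show "M dvd fps_nth f n - fps_nth g n" using feqD[OF assms, of "Suc n"] by simp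
qed

lemma feq_0: "feq 0 f g \<Longrightarrow> f = g"
  by (simp add: feq_def fps_eq_iff)

lemma respart_of_int: "respart r (of_int c * f) = of_int c * respart r f"
  by (rule fps_ext) (simp add: respart_nth of_int_mult_nth)

lemma respart_sum: "respart r (\<Sum>i\<in>A. f i) = (\<Sum>i\<in>A. respart r (f i))"
  by (rule fps_ext) (simp add: respart_nth fps_sum_nth)

lemma sect_of_int: "sect r (of_int c * f) = of_int c * sect r f"
  by (rule fps_ext) (simp add: of_int_mult_nth)

lemma dil_of_int: "dil (of_int c) = of_int c"
  by (simp add: fps_of_int[symmetric] dil_const)

lemma dil_sum: "dil (\<Sum>i\<in>A. f i) = (\<Sum>i\<in>A. dil (f i))"
  by (rule fps_ext) (simp add: dil_nth fps_sum_nth)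

lemma sectI: assumes "r < 5" "respart r F = fps_X ^ r * dil G" shows "sect r F = G"
proof -
  have "fps_X ^ r * dil (sect r F) = fps_X ^ r * dil G" using assms by (simp add: respart_def)
  then show ?thesis by simp
qed

lemma sum_lessThan_add:
  fixes g :: "nat \<Rightarrow> 'a::comm_monoid_add"
  shows "(\<Sum>j<m + N. g j) = (\<Sum>j<m. g j) + (\<Sum>f<N. g (m + f))"
  by (induction N) (simp_all add: add.assoc)

text \<open>The first m terms disappear modulo M and the rest is renumbered; the range N can be kept
  because the coefficients vanish from N on.\<close>

lemma feq_shift_sum:
  fixes m N :: nat and c :: "nat \<Rightarrow> int"
  assumes "\<And>j. j < m \<Longrightarrow> M dvd c j" "\<And>j. N \<le> j \<Longrightarrow> c j = 0"
  shows "feq M (\<Sum>j<N. of_int (c j) * h j) (\<Sum>f<N. of_int (c (m + f)) * h (m + f))"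
proof -
  define g where "g j = of_int (c j) * h j" for j
  have "g (N + f) = 0" for f using assms(2)[of "N + f"] by (simp add: g_def)
  then have "(\<Sum>j<N. g j) = (\<Sum>j<N. g j) + (\<Sum>f<m. g (N + f))" by simp
  also have "\<dots> = (\<Sum>j<N + m. g j)" by (rule sum_lessThan_add[symmetric])
  also have "\<dots> = (\<Sum>j<m + N. g j)" by (simp add: add.commute)
  also have "\<dots> = (\<Sum>j<m. g j) + (\<Sum>f<N. g (m + f))" by (rule sum_lessThan_add)
  also have "feq M \<dots> ((\<Sum>j<m. 0) + (\<Sum>f<N. g (m + f)))"
    by (intro feq_add feq_sum feq_refl) (auto simp: g_def intro!: feq_of_int assms(1))
  finally show ?thesis by (simp add: g_def)
qed

lemma cancel_power:
  fixes a b :: "'a::comm_monoid_mult"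
  assumes "a * b = 1" shows "a ^ m * b ^ (m + n) = b ^ n"
proof -
  have "a ^ m * b ^ (m + n) = (a * b) ^ m * b ^ n" by (simp only: power_add power_mult_distrib mult_ac)
  then show ?thesis by (simp add: assms)
qed

lemmas euler_part_cancel = cancel_power[OF euler_part]
lemmas part_euler_cancel = cancel_power[OF euler_part[unfolded mult.commute[of "euler_E 1"]]]
lemmas euler_einv_cancel = cancel_power[OF einv]
lemmas einv_euler_cancel = cancel_power[OF einv[unfolded mult.commute[of "euler_E 5"]]]

lemma euler_5_dil: "euler_E 5 = dil (euler_E 1)"
  using dil_euler_E[of 1] by simp

lemma einv_dil: "einv = dil part_gf"
proof -
  have "euler_E 5 * dil part_gf = 1" unfolding euler_5_dil dil_mult[symmetric] euler_part dil_1 ..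
  then show ?thesis using einv by (metis mult.assoc mult.commute mult_1_right)
qed

lemma part_nth_0: "fps_nth part_gf 0 = 1"
  using arg_cong[OF euler_part, of "\<lambda>f. fps_nth f 0"] by simp

section \<open>Frobenius congruences modulo 5\<close>

lemma feq_one_minus: "feq 5 ((1 - fps_X ^ k) ^ 5) (1 - fps_X ^ (5 * k))"
proof (rule feqI_of_int)
  have "(1 - x) ^ 5 - (1 - x ^ 5) = of_int 5 * (- x + 2 * x^2 - 2 * x^3 + x^4)" for x :: "int fps"
    by (simp add: algebra_simps power_numeral_reduce)
  from this[of "fps_X ^ k"] show "(1 - fps_X ^ k) ^ 5 - (1 - fps_X ^ (5 * k))
     = of_int 5 * (- (fps_X ^ k) + 2 * (fps_X ^ k)^2 - 2 * (fps_X ^ k)^3 + (fps_X ^ k :: int fps)^4)"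
    by (simp only: power_mult[symmetric] mult.commute[of k 5])
qed

lemma euler_frobenius: "feq 5 (euler_E 1 ^ 5) (euler_E 5)"
  unfolding feq_def
proof
  fix n
  have a1: "fps_agree n (euler_E 1 ^ 5) (euler_trunc 1 n ^ 5)" by (intro fps_agree_power fps_agree_euler) auto
  have a2: "fps_agree n (euler_E 5) (euler_trunc 5 n)" by (intro fps_agree_euler) auto
  have t: "feq 5 (euler_trunc 1 n ^ 5) (euler_trunc 5 n)"
    unfolding euler_trunc_def prod_power_distrib
    by (intro feq_prod) (simp only: mult_1_left feq_one_minus)
  show "5 dvd fps_nth (euler_E 1 ^ 5) n - fps_nth (euler_E 5) n"
    using feqD[OF t, of n] a1 a2 by (simp add: fps_agree_def)
qed

lemma part_frobenius: "feq 5 (part_gf ^ 5) einv"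
proof -
  have "part_gf ^ 5 = part_gf ^ 5 * (euler_E 5 * einv)" by (simp add: einv)
  also have "feq 5 \<dots> (part_gf ^ 5 * (euler_E 1 ^ 5 * einv))"
    by (intro feq_mult feq_refl feq_sym[OF euler_frobenius])
  also have "part_gf ^ 5 * (euler_E 1 ^ 5 * einv) = (euler_E 1 * part_gf) ^ 5 * einv"
    by (simp only: power_mult_distrib mult_ac)
  also have "\<dots> = einv" unfolding euler_part by simp
  finally show ?thesis .
qed

lemma euler_5_power: "feq 5 (euler_E 5 ^ k) (euler_E 1 ^ (5 * k))"
  unfolding power_mult by (intro feq_power feq_sym[OF euler_frobenius])

lemma part_power_5: "feq 5 (part_gf ^ (5 * k)) (dil (part_gf ^ k))"
  unfolding power_mult dil_power einv_dil[symmetric] by (intro feq_power part_frobenius)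

lemma psi_einv: "feq 5 (einv * psi) (euler_E 1 ^ 19)"
proof -
  have "einv * psi = (einv ^ 1 * euler_E 5 ^ (1 + 5)) * part_gf ^ 6"
    by (simp add: psi_def power_mult_distrib)
  also have "\<dots> = euler_E 5 ^ 5 * part_gf ^ 6" unfolding einv_euler_cancel ..
  also have "feq 5 \<dots> (euler_E 1 ^ (5 * 5) * part_gf ^ 6)" by (intro feq_mult feq_refl euler_5_power)
  also have "euler_E 1 ^ (5 * 5) * part_gf ^ 6 = part_gf ^ 6 * euler_E 1 ^ (6 + 19)" by (simp add: mult.commute)
  also have "\<dots> = euler_E 1 ^ 19" by (rule part_euler_cancel)
  finally show ?thesis .
qed

lemma euler_5_part: "feq 5 (euler_E 5 ^ 4 * part_gf) (euler_E 1 ^ 19)"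
proof -
  have "feq 5 (euler_E 5 ^ 4 * part_gf) (euler_E 1 ^ (5 * 4) * part_gf)" by (intro feq_mult feq_refl euler_5_power)
  also have "euler_E 1 ^ (5 * 4) * part_gf = part_gf ^ 1 * euler_E 1 ^ (1 + 19)" by (simp add: mult.commute)
  also have "\<dots> = euler_E 1 ^ 19" by (rule part_euler_cancel)
  finally show ?thesis .
qed

text \<open>For r = 0 these are the classes n = 1, 2 modulo 5, where 24n-1 is a quadratic nonresidue
  and the partition series becomes q E_1^23 modulo 5. The parameter r follows shifts by powers of
  q.\<close>

definition keep :: "nat \<Rightarrow> int fps \<Rightarrow> int fps" where
  "keep r f = respart (r + 1) f + respart (r + 2) f"

lemma keep_nth: "fps_nth (keep r f) n = (if n mod 5 = (r + 1) mod 5 \<or> n mod 5 = (r + 2) mod 5 then fps_nth f n else 0)"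
proof -
  have "(r + 1) mod 5 \<noteq> (r + 2) mod 5" using mod_5_cases[of r] by (auto simp: mod_Suc)
  then show ?thesis by (auto simp: keep_def respart_nth)
qed

lemma keep_X: "keep (r + a) (fps_X ^ a * f) = fps_X ^ a * keep r f"
proof -
  have "r + a + 1 = r + 1 + a" "r + a + 2 = r + 2 + a" by simp_all
  then show ?thesis by (simp only: keep_def respart_X_mult distrib_left)
qed

lemma keep_dil: "keep r (dil g * f) = dil g * keep r f"
  by (simp only: keep_def respart_dil_mult distrib_left)

lemma keep_cong: assumes "r mod 5 = r' mod 5" shows "keep r f = keep r' f"
proof -
  have "(r + 1) mod 5 = (r' + 1) mod 5" "(r + 2) mod 5 = (r' + 2) mod 5" using assms by (simp_all add: mod_Suc)
  from respart_cong[OF this(1)] respart_cong[OF this(2)] show ?thesis by (simp only: keep_def)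
qed

lemma feq_keep: "feq M f g \<Longrightarrow> feq M (keep r f) (keep r g)"
  unfolding keep_def by (intro feq_add feq_respart)

lemma keep_sum_of_int: "keep r (\<Sum>i\<in>A. of_int (c i) * f i) = (\<Sum>i\<in>A. of_int (c i) * keep r (f i))"
  by (simp only: keep_def respart_sum respart_of_int distrib_left sum.distrib)

lemma quartic_identity:
  fixes A B C X :: "'a::comm_ring_1"
  assumes "B^2 = A * C"
  shows "(X * (-4*A^3*B) + X^6 * (-4*A*C^3 + 6*B^2*C^2)) + (X^2 * (6*A^2*B^2 - 4*A^3*C) + X^7 * (4*B*C^3)) - X*B*(A - X*B - X^2*C)^3
    = 5 * (- (A^3*B*X) + A^2*B^2*X^2 - B^4*X^4 + B^2*C^2*X^6 + B*C^3*X^7)"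
proof -
  have "(X * (-4*A^3*B) + X^6 * (-4*A*C^3 + 6*B^2*C^2)) + (X^2 * (6*A^2*B^2 - 4*A^3*C) + X^7 * (4*B*C^3)) - X*B*(A - X*B - X^2*C)^3
    = 5 * (- (A^3*B*X) + A^2*B^2*X^2 - B^4*X^4 + B^2*C^2*X^6 + B*C^3*X^7)
     + (B^2 - A*C) * (4*A^2*X^2 - 3*A*B*X^3 + 6*B^2*X^4 + 3*B*C*X^5 + 4*C^2*X^6)"
    by (simp add: algebra_simps power_numeral_reduce)
  then show ?thesis using assms by simp
qed

text \<open>The classes 1 and 2 of the fourth power of the dissection; with b^2 = ac they combine to
  y E_1^3 up to a multiple of 5.\<close>

lemma euler_4_keep: "feq 5 (keep 0 (euler_E 1 ^ 4)) (yy * euler_E 1 ^ 3)"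
proof (rule feqI_of_int)
  define E a b c where "E = euler_E 1" and "a = diss_a" and "b = euler_E 5" and "c = diss_c"
  have ac: "b\<^sup>2 = a * c" using diss_ac by (simp add: a_def b_def c_def)
  have E: "E = dil a - fps_X * dil b - fps_X\<^sup>2 * dil c"
    unfolding E_def a_def b_def c_def by (rule euler_E_dissection)
  have E4: "E ^ 4 = fps_X ^ 0 * dil (a ^ 4) + fps_X ^ 1 * dil (- 4 * a ^ 3 * b) + fps_X ^ 2 * dil (6 * a\<^sup>2 * b\<^sup>2 - 4 * a ^ 3 * c)
    + fps_X ^ 3 * dil (12 * a\<^sup>2 * b * c - 4 * a * b ^ 3) + fps_X ^ 4 * dil (6 * a\<^sup>2 * c\<^sup>2 - 12 * a * b\<^sup>2 * c + b ^ 4)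
    + fps_X ^ 5 * dil (- 12 * a * b * c\<^sup>2 + 4 * b ^ 3 * c) + fps_X ^ 6 * dil (- 4 * a * c ^ 3 + 6 * b\<^sup>2 * c\<^sup>2)
    + fps_X ^ 7 * dil (4 * b * c ^ 3) + fps_X ^ 8 * dil (c ^ 4)"
    unfolding E dil_simps by (simp add: algebra_simps power_numeral_reduce)
  have r1: "respart (0 + 1) (E ^ 4) = fps_X ^ 1 * dil (- 4 * a ^ 3 * b) + fps_X ^ 6 * dil (- 4 * a * c ^ 3 + 6 * b\<^sup>2 * c\<^sup>2)"
    unfolding E4 by (simp only: respart_add respart_X_dil) simp
  have r2: "respart (0 + 2) (E ^ 4) = fps_X ^ 2 * dil (6 * a\<^sup>2 * b\<^sup>2 - 4 * a ^ 3 * c) + fps_X ^ 7 * dil (4 * b * c ^ 3)"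
    unfolding E4 by (simp only: respart_add respart_X_dil) simp
  have d: "(dil b)\<^sup>2 = dil a * dil c" using arg_cong[OF ac, of dil] by (simp add: dil_simps)
  have "keep 0 (E ^ 4) = (fps_X * (-4*dil a^3*dil b) + fps_X^6 * (-4*dil a*dil c^3 + 6*dil b^2*dil c^2)) + (fps_X^2 * (6*dil a^2*dil b^2 - 4*dil a^3*dil c) + fps_X^7 * (4*dil b*dil c^3))"
    unfolding keep_def r1 r2 by (simp add: dil_simps)
  moreover note quartic_identity[OF d, of fps_X]
  ultimately show "keep 0 (euler_E 1 ^ 4) - yy * euler_E 1 ^ 3 = of_int 5 * (- (dil a^3*dil b*fps_X) + dil a^2*dil b^2*fps_X^2 - dil b^4*fps_X^4 + dil b^2*dil c^2*fps_X^6 + dil b*dil c^3*fps_X^7)"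
    unfolding E_def[symmetric] b_def[symmetric] E[symmetric] by simp
qed

text \<open>1/E_1 = E_1^4/E_1^5, and modulo 5 the denominator is a series in q^5 and passes through
  \<open>keep\<close>.\<close>

lemma part_keep: "feq 5 (keep 0 part_gf) (fps_X * euler_E 1 ^ 23)"
proof -
  have "part_gf = euler_E 1 ^ 4 * part_gf ^ (4 + 1)" unfolding euler_part_cancel by simp
  also have "\<dots> = part_gf ^ 5 * euler_E 1 ^ 4" by (simp add: mult.commute)
  finally have "keep 0 part_gf = keep 0 (part_gf ^ 5 * euler_E 1 ^ 4)" by simp
  also have "feq 5 \<dots> (keep 0 (dil part_gf * euler_E 1 ^ 4))"
    unfolding einv_dil[symmetric] by (intro feq_keep feq_mult feq_refl part_frobenius)
  also have "keep 0 (dil part_gf * euler_E 1 ^ 4) = einv * keep 0 (euler_E 1 ^ 4)" unfolding keep_dil einv_dil ..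
  also have "feq 5 \<dots> (einv * (yy * euler_E 1 ^ 3))" by (intro feq_mult feq_refl euler_4_keep)
  also have "feq 5 \<dots> (einv * (fps_X * dil (euler_E 1 ^ 5) * euler_E 1 ^ 3))"
    by (intro feq_mult feq_refl feq_dil feq_sym[OF euler_frobenius])
  also have "einv * (fps_X * dil (euler_E 1 ^ 5) * euler_E 1 ^ 3) = fps_X * (einv ^ 1 * euler_E 5 ^ (1 + 4)) * euler_E 1 ^ 3"
    unfolding dil_power euler_5_dil[symmetric] by (simp add: mult_ac)
  also have "\<dots> = fps_X * euler_E 5 ^ 4 * euler_E 1 ^ 3" unfolding einv_euler_cancel ..
  also have "feq 5 \<dots> (fps_X * euler_E 1 ^ (5 * 4) * euler_E 1 ^ 3)" by (intro feq_mult feq_refl euler_5_power)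
  also have "fps_X * euler_E 1 ^ (5 * 4) * euler_E 1 ^ 3 = fps_X * euler_E 1 ^ 23"
    by (simp only: mult.assoc power_add[symmetric]) simp
  finally show ?thesis .
qed

text \<open>\<open>keep 0\<close> is idempotent, and by \<open>part_keep\<close> the series q E_1^23
  lies in its image modulo 5.\<close>

lemma euler_23_keep: "feq 5 (keep 4 (euler_E 1 ^ 23)) (euler_E 1 ^ 23)"
proof (rule feq_X_cancel)
  have kk: "keep 0 (keep 0 f) = keep 0 f" for f by (rule fps_ext) (simp add: keep_nth)
  have "fps_X ^ 1 * keep 4 (euler_E 1 ^ 23) = keep (4 + 1) (fps_X ^ 1 * euler_E 1 ^ 23)" by (rule keep_X[symmetric])
  also have "\<dots> = keep 0 (fps_X * euler_E 1 ^ 23)" unfolding power_one_right by (rule keep_cong) simp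
  finally have "fps_X * keep 4 (euler_E 1 ^ 23) = keep 0 (fps_X * euler_E 1 ^ 23)" unfolding power_one_right .
  also have "feq 5 \<dots> (keep 0 (keep 0 part_gf))" by (rule feq_keep[OF feq_sym[OF part_keep]])
  also have "keep 0 (keep 0 part_gf) = keep 0 part_gf" by (rule kk)
  also have "feq 5 \<dots> (fps_X * euler_E 1 ^ 23)" by (rule part_keep)
  finally show "feq 5 (fps_X * keep 4 (euler_E 1 ^ 23)) (fps_X * euler_E 1 ^ 23)" .
qed

section \<open>Watson's iteration for the series c\<close>

lemma sect_even_step:
  assumes N: "6 * e + 5 < N"
  shows "sect 4 (part_gf * (fps_X * psi) ^ e) = einv * (\<Sum>f<N. of_int (neg_coeff (6 * e + 5) (e + 1 + f)) * (fps_X ^ f * psi ^ (f + 1)))"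
proof (rule sectI)
  \<comment> \<open>Up to a series in q^5, psi^e/E_1 is E_1^(-6e-1) = E_1^(4-n), which selects row
    n.\<close>
  define n where "n = 6 * e + 5"
  have nN: "n < N" using N by (simp add: n_def)
  have lo: "neg_coeff n j = 0" if "j < e + 1" for j by (rule neg_coeff_low) (use that n_def in simp)
  have hi: "neg_coeff n j = 0" if "N \<le> j" for j by (rule neg_coeff_high) (use that nN in auto)
  have n4: "n = 4 + (6 * e + 1)" by (simp add: n_def)
  have P: "euler_E 1 ^ 4 * part_gf ^ n = part_gf ^ (6 * e + 1)" unfolding n4 by (rule euler_part_cancel)
  have ps: "psi ^ e = dil (euler_E 1 ^ (6 * e)) * part_gf ^ (6 * e)"
    unfolding psi_def euler_5_dil dil_power by (simp only: power_mult[symmetric] power_mult_distrib)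
  have f1: "part_gf * (fps_X * psi) ^ e = fps_X ^ e * (dil (euler_E 1 ^ (6 * e)) * (euler_E 1 ^ 4 * part_gf ^ n))"
    unfolding P power_mult_distrib ps by (simp only: power_add power_one_right mult_ac)
  have "respart 4 (part_gf * (fps_X * psi) ^ e) = respart (4 + 4 * n + e) (part_gf * (fps_X * psi) ^ e)"
  proof (rule respart_cong)
    have "4 + 4 * n + e = 4 + 5 * (5 * e + 4)" by (simp add: n_def)
    then show "4 mod 5 = (4 + 4 * n + e) mod 5" by (simp only: mod_mult_self2)
  qed
  also have "\<dots> = fps_X ^ e * (dil (euler_E 1 ^ (6 * e)) * (\<Sum>j<N. of_int (neg_coeff n j) * neg_term n j))"
    unfolding f1 respart_X_mult respart_dil_mult neg_section[OF nN] ..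
  also have "(\<Sum>j<N. of_int (neg_coeff n j) * neg_term n j) = (\<Sum>f<N. of_int (neg_coeff n (e + 1 + f)) * neg_term n (e + 1 + f))"
    by (rule feq_0[OF feq_shift_sum]) (simp_all add: lo hi)
  also have "fps_X ^ e * (dil (euler_E 1 ^ (6 * e)) * \<dots>) = (\<Sum>f<N. fps_X ^ 4 * dil (einv * (of_int (neg_coeff n (e + 1 + f)) * (fps_X ^ f * psi ^ (f + 1)))))"
    unfolding sum_distrib_left
  proof (intro sum.cong refl)
    fix f
    show "fps_X ^ e * (dil (euler_E 1 ^ (6 * e)) * (of_int (neg_coeff n (e + 1 + f)) * neg_term n (e + 1 + f)))
      = fps_X ^ 4 * dil (einv * (of_int (neg_coeff n (e + 1 + f)) * (fps_X ^ f * psi ^ (f + 1))))"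
    proof (cases "5 * (e + 1 + f) + 4 < n")
      case True
      then show ?thesis by (simp only: neg_coeff_low of_int_0 mult_zero_left mult_zero_right dil_0)
    next
      case False
      have x: "fps_X ^ e * fps_X ^ (5 * (e + 1 + f) + 4 - n) = fps_X ^ 4 * dil (fps_X ^ f)"
        unfolding dil_power dil_X power_mult[symmetric] power_add[symmetric] using False by (intro arg_cong[of _ _ "power fps_X"]) (simp add: n_def)
      have "euler_E 1 ^ (6 * e) * (psi ^ (e + 1 + f) * euler_E 5 ^ 4 * einv ^ n) = (phi * psi) ^ e * psi ^ (f + 1) * (euler_E 5 ^ 4 * einv ^ (4 + 1))"
        unfolding phi_def n4 power_add power_mult by (simp only: power_mult_distrib power_one_right mult_ac)
      also have "\<dots> = einv * psi ^ (f + 1)" unfolding euler_einv_cancel phi_psi by simp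
      finally have k: "dil (euler_E 1 ^ (6 * e)) * dil (psi ^ (e + 1 + f) * euler_E 5 ^ 4 * einv ^ n) = dil (einv * psi ^ (f + 1))"
        by (simp only: dil_mult[symmetric])
      have "fps_X ^ e * (dil (euler_E 1 ^ (6 * e)) * (of_int (neg_coeff n (e + 1 + f)) * neg_term n (e + 1 + f)))
        = of_int (neg_coeff n (e + 1 + f)) * ((fps_X ^ e * fps_X ^ (5 * (e + 1 + f) + 4 - n)) * (dil (euler_E 1 ^ (6 * e)) * dil (psi ^ (e + 1 + f) * euler_E 5 ^ 4 * einv ^ n)))"
        unfolding neg_term_def by (simp only: mult_ac)
      also have "\<dots> = fps_X ^ 4 * dil (einv * (of_int (neg_coeff n (e + 1 + f)) * (fps_X ^ f * psi ^ (f + 1))))"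
        unfolding x k unfolding dil_mult dil_of_int by (simp only: mult_ac)
      finally show ?thesis .
    qed
  qed
  also have "\<dots> = fps_X ^ 4 * dil (einv * (\<Sum>f<N. of_int (neg_coeff (6 * e + 5) (e + 1 + f)) * (fps_X ^ f * psi ^ (f + 1))))"
    unfolding n_def by (simp only: sum_distrib_left dil_sum)
  finally show "respart 4 (part_gf * (fps_X * psi) ^ e) = fps_X ^ 4 * dil (einv * (\<Sum>f<N. of_int (neg_coeff (6 * e + 5) (e + 1 + f)) * (fps_X ^ f * psi ^ (f + 1))))" .
qed simp

lemma sect_odd_step:
  assumes N: "6 * e + 6 < N"
  shows "sect 3 (euler_E 1 ^ 4 * (fps_X ^ e * psi ^ (e + 1))) = euler_E 5 ^ 4 * (\<Sum>f<N. of_int (neg_coeff (6 * e + 6) (e + 1 + f)) * (fps_X * psi) ^ f)"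
proof (rule sectI)
  \<comment> \<open>Up to a series in q^5, E_1^4 psi^(e+1) is E_1^(4-n).\<close>
  define n where "n = 6 * (e + 1)"
  have nN: "n < N" using N by (simp add: n_def)
  have lo: "neg_coeff n j = 0" if "j < e + 1" for j by (rule neg_coeff_low) (use that n_def in simp)
  have hi: "neg_coeff n j = 0" if "N \<le> j" for j by (rule neg_coeff_high) (use that nN in auto)
  have nn: "6 * e + 6 = n" by (simp add: n_def)
  have ps: "psi ^ (e + 1) = dil (euler_E 1 ^ n) * part_gf ^ n"
    unfolding psi_def euler_5_dil dil_power n_def by (simp only: power_mult[symmetric] power_mult_distrib)
  have f1: "euler_E 1 ^ 4 * (fps_X ^ e * psi ^ (e + 1)) = fps_X ^ e * (dil (euler_E 1 ^ n) * (euler_E 1 ^ 4 * part_gf ^ n))"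
    unfolding ps by (simp only: mult_ac)
  have "respart 3 (euler_E 1 ^ 4 * (fps_X ^ e * psi ^ (e + 1))) = respart (4 + 4 * n + e) (euler_E 1 ^ 4 * (fps_X ^ e * psi ^ (e + 1)))"
  proof (rule respart_cong)
    have "4 + 4 * n + e = 3 + 5 * (5 * e + 5)" by (simp add: n_def)
    then show "3 mod 5 = (4 + 4 * n + e) mod 5" by (simp only: mod_mult_self2)
  qed
  also have "\<dots> = fps_X ^ e * (dil (euler_E 1 ^ n) * (\<Sum>j<N. of_int (neg_coeff n j) * neg_term n j))"
    unfolding f1 respart_X_mult respart_dil_mult neg_section[OF nN] ..
  also have "(\<Sum>j<N. of_int (neg_coeff n j) * neg_term n j) = (\<Sum>f<N. of_int (neg_coeff n (e + 1 + f)) * neg_term n (e + 1 + f))"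
    by (rule feq_0[OF feq_shift_sum]) (simp_all add: lo hi)
  also have "fps_X ^ e * (dil (euler_E 1 ^ n) * \<dots>) = (\<Sum>f<N. fps_X ^ 3 * dil (euler_E 5 ^ 4 * (of_int (neg_coeff n (e + 1 + f)) * (fps_X * psi) ^ f)))"
    unfolding sum_distrib_left
  proof (intro sum.cong refl)
    fix f
    show "fps_X ^ e * (dil (euler_E 1 ^ n) * (of_int (neg_coeff n (e + 1 + f)) * neg_term n (e + 1 + f)))
      = fps_X ^ 3 * dil (euler_E 5 ^ 4 * (of_int (neg_coeff n (e + 1 + f)) * (fps_X * psi) ^ f))"
    proof (cases "5 * (e + 1 + f) + 4 < n")
      case True
      then show ?thesis by (simp only: neg_coeff_low of_int_0 mult_zero_left mult_zero_right dil_0)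
    next
      case False
      have x: "fps_X ^ e * fps_X ^ (5 * (e + 1 + f) + 4 - n) = fps_X ^ 3 * dil (fps_X ^ f)"
        unfolding dil_power dil_X power_mult[symmetric] power_add[symmetric] using False by (intro arg_cong[of _ _ "power fps_X"]) (simp add: n_def)
      have "euler_E 1 ^ n * (psi ^ (e + 1 + f) * euler_E 5 ^ 4 * einv ^ n) = (phi * psi) ^ (e + 1) * psi ^ f * euler_E 5 ^ 4"
        unfolding phi_def n_def power_add[of psi "e + 1" f] power_mult by (simp only: power_mult_distrib mult_ac)
      also have "\<dots> = euler_E 5 ^ 4 * psi ^ f" unfolding phi_psi by simp
      finally have k: "dil (euler_E 1 ^ n) * dil (psi ^ (e + 1 + f) * euler_E 5 ^ 4 * einv ^ n) = dil (euler_E 5 ^ 4 * psi ^ f)"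
        by (simp only: dil_mult[symmetric])
      have "fps_X ^ e * (dil (euler_E 1 ^ n) * (of_int (neg_coeff n (e + 1 + f)) * neg_term n (e + 1 + f)))
        = of_int (neg_coeff n (e + 1 + f)) * ((fps_X ^ e * fps_X ^ (5 * (e + 1 + f) + 4 - n)) * (dil (euler_E 1 ^ n) * dil (psi ^ (e + 1 + f) * euler_E 5 ^ 4 * einv ^ n)))"
        unfolding neg_term_def by (simp only: mult_ac)
      also have "\<dots> = fps_X ^ 3 * dil (euler_E 5 ^ 4 * (of_int (neg_coeff n (e + 1 + f)) * (fps_X * psi) ^ f))"
        unfolding x k unfolding power_mult_distrib[of fps_X psi] dil_mult dil_of_int by (simp only: mult_ac)
      finally show ?thesis .
    qed
  qed
  also have "\<dots> = fps_X ^ 3 * dil (euler_E 5 ^ 4 * (\<Sum>f<N. of_int (neg_coeff (6 * e + 6) (e + 1 + f)) * (fps_X * psi) ^ f))"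
    unfolding nn by (simp only: sum_distrib_left dil_sum)
  finally show "respart 3 (euler_E 1 ^ 4 * (fps_X ^ e * psi ^ (e + 1))) = fps_X ^ 3 * dil (euler_E 5 ^ 4 * (\<Sum>f<N. of_int (neg_coeff (6 * e + 6) (e + 1 + f)) * (fps_X * psi) ^ f))" .
qed simp

text \<open>Ramanujan's identity: the section is exactly 5 E_5^5/E_1^6, and E_5 is E_1^5 modulo
  5.\<close>

lemma part_sect_4: "feq 25 (sect 4 part_gf) (of_int 5 * euler_E 1 ^ 19)"
proof -
  have c: "neg_coeff (6 * 0 + 5) (0 + 1 + f) = (if f = 0 then 5 else 0)" for f
    using neg_coeff_rec[of 0 "1 + f"] neg_coeff_base[of f] by simp
  have "sect 4 part_gf = einv * (\<Sum>f<6. of_int (neg_coeff (6 * 0 + 5) (0 + 1 + f)) * (fps_X ^ f * psi ^ (f + 1)))"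
    using sect_even_step[of 0 6] by simp
  also have "\<dots> = of_int 5 * (einv * psi)" unfolding c by (simp add: eval_nat_numeral mult_ac)
  also have "feq (5 * 5) \<dots> (of_int 5 * euler_E 1 ^ 19)" by (rule feq_cmult[OF psi_einv])
  finally show ?thesis by simp
qed

lemma double_sum_of_int:
  fixes u :: "'a::comm_ring_1"
  shows "(\<Sum>e<D. of_int (y e) * (u * (\<Sum>f<N. of_int (c e f) * g f))) = u * (\<Sum>f<(N::nat). of_int (\<Sum>e<(D::nat). y e * c e f) * g f)"
proof -
  have "(\<Sum>e<D. of_int (y e) * (u * (\<Sum>f<N. of_int (c e f) * g f))) = (\<Sum>e<D. \<Sum>f<N. u * (of_int (y e * c e f) * g f))"
    unfolding sum_distrib_left of_int_mult by (intro sum.cong refl) (simp only: mult_ac)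
  also have "\<dots> = (\<Sum>f<N. \<Sum>e<D. u * (of_int (y e * c e f) * g f))" by (rule sum.swap)
  also have "\<dots> = u * (\<Sum>f<N. of_int (\<Sum>e<D. y e * c e f) * g f)"
    by (simp only: of_int_sum sum_distrib_left sum_distrib_right)
  finally show ?thesis .
qed

text \<open>The base 5 digits, lowest first, are 4, 3, 4, 3, ...: the classes of the successive
  sections. The resulting residue r satisfies 24r + 19 = 0 modulo 5^a.\<close>

fun residue_index :: "nat \<Rightarrow> nat" where
  "residue_index 0 = 0"
| "residue_index (Suc a) = residue_index a + (if even a then 4 else 3) * 5 ^ a"

lemma residue_index_eq: "24 * residue_index a + 19 = (if odd a then 23 else 19) * 5 ^ a"
  by (induction a) (auto split: if_splits)

text \<open>For both rows the exponent in \<open>neg_coeff_dvd\<close> is 2f + 1 - 2e when that is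
  nonnegative. So a valuation a + 2e in position e becomes at least (a+1) + 2f in position
  f.\<close>

lemma dvd_neg_coeff_mult:
  assumes "5 ^ (a + 2 * e) dvd y" "6 * e + 5 \<le> n" "n \<le> 6 * e + 6"
  shows "5 ^ (a + 1 + 2 * f) dvd y * neg_coeff n (e + 1 + f)"
proof -
  have "5 ^ (a + 2 * e) * 5 ^ ((6 * (e + 1 + f) + 9 - 2 * n) div 3) dvd y * neg_coeff n (e + 1 + f)"
    using assms by (intro mult_dvd_mono neg_coeff_dvd) auto
  moreover have "1 + 2 * f \<le> 2 * e + (6 * (e + 1 + f) + 9 - 2 * n) div 3"
  proof -
    have "3 * (1 + 2 * f) + 2 * n \<le> 6 * (e + 1 + f) + 9 + 0 + 3 * (2 * e)" using assms(3) by (simp | linarith)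
    then have "3 * (1 + 2 * f) - 0 \<le> 6 * (e + 1 + f) + 9 - 2 * n + 3 * (2 * e)" by (rule nat_diff_le_diff)
    then have "3 * (1 + 2 * f) \<le> 6 * (e + 1 + f) + 9 - 2 * n + 3 * (2 * e)" by (simp only: diff_zero)
    then have "3 * (1 + 2 * f) div 3 \<le> 2 * e + (6 * (e + 1 + f) + 9 - 2 * n) div 3" by (rule div_3_le)
    moreover have "3 * (1 + 2 * f) div 3 = 1 + 2 * f" by (rule nonzero_mult_div_cancel_left) simp
    ultimately show ?thesis by (simp only:)
  qed
  then have "(5::int) ^ (a + 1 + 2 * f) dvd 5 ^ (a + 2 * e + (6 * (e + 1 + f) + 9 - 2 * n) div 3)"
    by (intro le_imp_power_dvd) simp
  ultimately show ?thesis unfolding power_add[symmetric] by (rule dvd_trans[rotated])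
qed

definition tower :: "nat \<Rightarrow> (nat \<Rightarrow> int) \<Rightarrow> nat \<Rightarrow> int fps" where
  "tower a y D = (if even a then euler_E 5 ^ 4 * (part_gf * (\<Sum>e<D. of_int (y e) * (fps_X * psi) ^ e))
     else euler_E 1 ^ 4 * (einv * (\<Sum>e<D. of_int (y e) * (fps_X ^ e * psi ^ (e + 1)))))"

text \<open>Every section gains one power of 5, and position e carries 2e further powers; this
  invariant reproduces itself through \<open>dvd_neg_coeff_mult\<close>.\<close>

lemma c_gf_tower:
  "\<exists>y D. 0 < D \<and> (\<forall>e. 5 ^ (a + 2 * e) dvd y e) \<and> (\<forall>N. fps_nth c_gf (5 ^ a * N + residue_index a) = fps_nth (tower a y D) N)"
proof (induction a)
  case 0
  have "\<forall>e. (5::int) ^ (0 + 2 * e) dvd (if e = 0 then 1 else 0)" by simp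
  moreover have "tower 0 (\<lambda>e. if e = 0 then 1 else 0) 1 = c_gf"
    by (simp add: tower_def c_gf_def part_gf_def)
  ultimately show ?case by (intro exI[of _ "\<lambda>e. if e = 0 then 1 else 0"] exI[of _ 1]) simp
next
  case (Suc a)
  then obtain y D where D: "0 < D" and y: "\<And>e. 5 ^ (a + 2 * e) dvd y e"
    and c: "\<And>N. fps_nth c_gf (5 ^ a * N + residue_index a) = fps_nth (tower a y D) N" by blast
  define r where "r = (if even a then 4 else 3 :: nat)"
  define n where "n e = (if even a then 6 * e + 5 else 6 * e + 6)" for e :: nat
  define N' where "N' = 6 * D + 7"
  define y' where "y' f = (\<Sum>e<D. y e * neg_coeff (n e) (e + 1 + f))" for f
  have c': "fps_nth c_gf (5 ^ Suc a * N + residue_index (Suc a)) = fps_nth (sect r (tower a y D)) N" for N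
    using c[of "5 * N + r"] by (simp add: r_def algebra_simps)
  have y': "5 ^ (Suc a + 2 * f) dvd y' f" for f
    unfolding y'_def using dvd_neg_coeff_mult[OF y, of _ "n _" f] by (intro dvd_sum) (simp add: n_def)
  have "sect r (tower a y D) = tower (Suc a) y' N'"
  proof (cases "even a")
    case True
    have "sect 4 (euler_E 5 ^ 4 * (part_gf * (\<Sum>e<D. of_int (y e) * (fps_X * psi) ^ e)))
      = euler_E 1 ^ 4 * sect 4 (\<Sum>e<D. of_int (y e) * (part_gf * (fps_X * psi) ^ e))"
      unfolding euler_5_dil dil_power[symmetric] by (subst sect_dil_mult) (simp_all add: sum_distrib_left mult.left_commute)
    also have "sect 4 (\<Sum>e<D. of_int (y e) * (part_gf * (fps_X * psi) ^ e))
      = (\<Sum>e<D. of_int (y e) * (einv * (\<Sum>f<N'. of_int (neg_coeff (n e) (e + 1 + f)) * (fps_X ^ f * psi ^ (f + 1)))))"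
      unfolding sect_sum sect_of_int
    proof (intro sum.cong refl)
      fix e assume "e \<in> {..<D}"
      then have N: "6 * e + 5 < N'" by (simp add: N'_def)
      have n: "n e = 6 * e + 5" using True by (simp add: n_def)
      show "of_int (y e) * sect 4 (part_gf * (fps_X * psi) ^ e) = of_int (y e) * (einv * (\<Sum>f<N'. of_int (neg_coeff (n e) (e + 1 + f)) * (fps_X ^ f * psi ^ (f + 1))))"
        unfolding n sect_even_step[OF N] ..
    qed
    also have "\<dots> = einv * (\<Sum>f<N'. of_int (y' f) * (fps_X ^ f * psi ^ (f + 1)))"
      unfolding y'_def by (rule double_sum_of_int)
    finally show ?thesis using True by (simp add: tower_def r_def)
  next
    case False
    have "sect 3 (euler_E 1 ^ 4 * (einv * (\<Sum>e<D. of_int (y e) * (fps_X ^ e * psi ^ (e + 1)))))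
      = sect 3 (dil part_gf * (\<Sum>e<D. of_int (y e) * (euler_E 1 ^ 4 * (fps_X ^ e * psi ^ (e + 1)))))"
      unfolding einv_dil sum_distrib_left by (simp only: mult_ac)
    also have "\<dots> = part_gf * sect 3 (\<Sum>e<D. of_int (y e) * (euler_E 1 ^ 4 * (fps_X ^ e * psi ^ (e + 1))))"
      by (rule sect_dil_mult) simp
    also have "sect 3 (\<Sum>e<D. of_int (y e) * (euler_E 1 ^ 4 * (fps_X ^ e * psi ^ (e + 1))))
      = (\<Sum>e<D. of_int (y e) * (euler_E 5 ^ 4 * (\<Sum>f<N'. of_int (neg_coeff (n e) (e + 1 + f)) * (fps_X * psi) ^ f)))"
      unfolding sect_sum sect_of_int
    proof (intro sum.cong refl)
      fix e assume "e \<in> {..<D}"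
      then have N: "6 * e + 6 < N'" by (simp add: N'_def)
      have n: "n e = 6 * e + 6" using False by (simp add: n_def)
      show "of_int (y e) * sect 3 (euler_E 1 ^ 4 * (fps_X ^ e * psi ^ (e + 1))) = of_int (y e) * (euler_E 5 ^ 4 * (\<Sum>f<N'. of_int (neg_coeff (n e) (e + 1 + f)) * (fps_X * psi) ^ f))"
        unfolding n sect_odd_step[OF N] ..
    qed
    also have "\<dots> = euler_E 5 ^ 4 * (\<Sum>f<N'. of_int (y' f) * (fps_X * psi) ^ f)"
      unfolding y'_def by (rule double_sum_of_int)
    finally show ?thesis using False by (simp add: tower_def r_def mult.left_commute)
  qed
  moreover have "0 < N'" by (simp add: N'_def)
  ultimately show ?case using c' y' by metis
qed

lemma feq_sum_head:
  fixes D :: nat and y :: "nat \<Rightarrow> int"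
  assumes "0 < D" "\<And>e. 0 < e \<Longrightarrow> M dvd y e"
  shows "feq M (\<Sum>e<D. of_int (y e) * g e) (of_int (y 0) * g 0)"
proof -
  obtain D' where D: "D = Suc D'" using assms(1) by (cases D) auto
  have "feq M (of_int (y 0) * g 0 + (\<Sum>e<D'. of_int (y (Suc e)) * g (Suc e))) (of_int (y 0) * g 0 + (\<Sum>e<D'. 0))"
    by (intro feq_add feq_refl feq_sum feq_of_int assms(2)) simp
  then show ?thesis unfolding D sum.lessThan_Suc_shift by simp
qed

text \<open>Modulo 5^(a+1) only the position e = 0 survives. Its cofactor is E_5^4/E_1 or
  E_5^5/E_1^2, which E_5 = E_1^5 modulo 5 turns into E_1^19 or E_1^23.\<close>

theorem c_gf_residue:
  obtains k where "\<And>N. 5 ^ (a + 1) dvd fps_nth c_gf (5 ^ a * N + residue_index a) - 5 ^ a * k * fps_nth (euler_E 1 ^ (if odd a then 23 else 19)) N"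
proof -
  obtain y D where D: "0 < D" and y: "\<And>e. 5 ^ (a + 2 * e) dvd y e"
    and c: "\<And>N. fps_nth c_gf (5 ^ a * N + residue_index a) = fps_nth (tower a y D) N" using c_gf_tower by blast
  obtain k where k: "y 0 = 5 ^ a * k" using y[of 0] by (auto elim: dvdE)
  have ye: "5 ^ (a + 1) dvd y e" if "0 < e" for e
    using y[of e] that by (elim dvd_trans[rotated], intro le_imp_power_dvd) simp
  define G where "G = (if even a then euler_E 5 ^ 4 * part_gf else euler_E 1 ^ 4 * (einv * psi))"
  have "feq (5 ^ (a + 1)) (tower a y D) (of_int (y 0) * G)"
  proof (cases "even a")
    case True
    have "feq (5 ^ (a + 1)) (euler_E 5 ^ 4 * (part_gf * (\<Sum>e<D. of_int (y e) * (fps_X * psi) ^ e))) (euler_E 5 ^ 4 * (part_gf * (of_int (y 0) * (fps_X * psi) ^ 0)))"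
      by (intro feq_mult feq_refl feq_sum_head D ye)
    then show ?thesis using True by (simp add: tower_def G_def mult_ac)
  next
    case False
    have "feq (5 ^ (a + 1)) (euler_E 1 ^ 4 * (einv * (\<Sum>e<D. of_int (y e) * (fps_X ^ e * psi ^ (e + 1))))) (euler_E 1 ^ 4 * (einv * (of_int (y 0) * (fps_X ^ 0 * psi ^ (0 + 1)))))"
      by (intro feq_mult feq_refl feq_sum_head D ye)
    then show ?thesis using False by (simp add: tower_def G_def mult_ac)
  qed
  also have "of_int (y 0) * G = of_int (5 ^ a) * (of_int k * G)" unfolding k by (simp add: mult_ac)
  also have "feq (5 ^ (a + 1)) \<dots> (of_int (5 ^ a) * (of_int k * euler_E 1 ^ (if odd a then 23 else 19)))"
  proof -
    have "feq 5 G (euler_E 1 ^ (if odd a then 23 else 19))"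
    proof (cases "even a")
      case True
      then show ?thesis using euler_5_part by (simp add: G_def)
    next
      case False
      have "feq 5 (euler_E 1 ^ 4 * (einv * psi)) (euler_E 1 ^ 4 * euler_E 1 ^ 19)" by (intro feq_mult feq_refl psi_einv)
      then show ?thesis using False by (simp add: G_def power_add[symmetric])
    qed
    then have "feq (5 ^ a * 5) (of_int (5 ^ a) * (of_int k * G)) (of_int (5 ^ a) * (of_int k * euler_E 1 ^ (if odd a then 23 else 19)))"
      by (intro feq_cmult feq_mult feq_refl)
    then show ?thesis by (simp add: mult.commute)
  qed
  finally have f: "feq (5 ^ (a + 1)) (tower a y D) (of_int (5 ^ a) * (of_int k * euler_E 1 ^ (if odd a then 23 else 19)))" .
  show ?thesis
  proof (rule that)
    fix N
    show "5 ^ (a + 1) dvd fps_nth c_gf (5 ^ a * N + residue_index a) - 5 ^ a * k * fps_nth (euler_E 1 ^ (if odd a then 23 else 19)) N"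
      using feqD[OF f, of N] unfolding c of_int_mult_nth mult.assoc .
  qed
qed

text \<open>Distinct leading exponents up to S meet a series that vanishes up to S, so induction on
  the exponent makes every coefficient d divisible by M. This is how the nonconstant powers of J are
  discarded.\<close>

lemma triangular_cong:
  fixes V :: "int fps" and S :: nat
  assumes f: "feq M V (\<Sum>t\<in>T. of_int (d t) * (fps_X ^ o' t * u t))" and V: "\<And>j. j \<le> S \<Longrightarrow> fps_nth V j = 0"
    and T: "finite T" "inj_on o' T" "\<And>t. t \<in> T \<Longrightarrow> o' t \<le> S" "\<And>t. t \<in> T \<Longrightarrow> d t = 0 \<or> fps_nth (u t) 0 = 1"
  shows "feq M V 0"
proof -
  have "\<forall>t\<in>T. o' t = j \<longrightarrow> M dvd d t" for j
  proof (induction j rule: less_induct)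
    case (less j)
    show ?case
    proof (intro ballI impI)
      fix t assume t: "t \<in> T" "o' t = j"
      define h where "h t' = fps_nth (of_int (d t') * (fps_X ^ o' t' * u t')) j" for t'
      have "M dvd fps_nth V j - (\<Sum>t\<in>T. h t)" using feqD[OF f, of j] by (simp add: fps_sum_nth h_def)
      then have "M dvd (\<Sum>t\<in>T. h t)" using V[of j] T(3)[OF t(1)] t(2) by simp
      also have "(\<Sum>t\<in>T. h t) = h t + (\<Sum>t'\<in>T - {t}. h t')" by (rule sum.remove[OF T(1) t(1)])
      finally have a: "M dvd h t + (\<Sum>t'\<in>T - {t}. h t')" .
      have "M dvd (\<Sum>t'\<in>T - {t}. h t')"
      proof (rule dvd_sum)
        fix t' assume t': "t' \<in> T - {t}"
        have "o' t' \<noteq> j" using T(2) t t' by (auto simp: inj_on_def)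
        then consider "o' t' < j" | "j < o' t'" by linarith
        then show "M dvd h t'"
        proof cases
          case 1
          then have "M dvd d t'" using less t' by blast
          then show ?thesis unfolding h_def of_int_mult_nth by (rule dvd_mult2)
        next
          case 2
          then show ?thesis by (simp add: h_def of_int_mult_nth fps_X_power_mult_nth)
        qed
      qed
      then have "M dvd h t" using a by (simp add: dvd_add_left_iff)
      then show "M dvd d t" using T(4)[OF t(1)] t(2) by (auto simp: h_def of_int_mult_nth fps_X_power_mult_nth)
    qed
  qed
  then have "feq M (\<Sum>t\<in>T. of_int (d t) * (fps_X ^ o' t * u t)) (\<Sum>t\<in>T. 0)" by (intro feq_sum feq_of_int) blast
  then show ?thesis using feq_trans[OF f] by simp
qed

lemma theta_nth: "fps_nth (fps_X * fps_deriv f) m = int m * fps_nth f m"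
  by (cases m) simp_all

lemma deriv_part_power: "fps_deriv (part_gf ^ n) = - of_nat n * (part_gf ^ (n + 1) * fps_deriv (euler_E 1))"
proof (induction n)
  case (Suc n)
  define E p where "E = euler_E 1" and "p = part_gf"
  have Ep: "E * p = 1" unfolding E_def p_def by (rule euler_part)
  then have "fps_deriv (E * p) = 0" by simp
  then have "p * (E * fps_deriv p + fps_deriv E * p) = 0" by simp
  moreover have "p * (E * fps_deriv p + fps_deriv E * p) = (E * p) * fps_deriv p + p ^ 2 * fps_deriv E"
    by (simp add: algebra_simps power2_eq_square)
  ultimately have d: "fps_deriv p = - (p ^ 2 * fps_deriv E)" unfolding Ep by (simp add: eq_neg_iff_add_eq_0)
  have "fps_deriv (p ^ Suc n) = p * fps_deriv (p ^ n) + fps_deriv p * p ^ n" by simp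
  also have "\<dots> = - of_nat (Suc n) * (p ^ (Suc n + 1) * fps_deriv E)"
    unfolding d Suc.IH[folded E_def p_def] by (simp add: algebra_simps power2_eq_square)
  finally show ?case unfolding E_def p_def .
qed simp

text \<open>With P = 1/E_1, the operator q d/dq sends P^(24i) to -24i P^(24i+1) q E_1'. So the
  series is P^(24i) minus 1/i times q d/dq P^(24i), and at q^i the two parts cancel.\<close>

lemma part_power_theta_nth:
  assumes "i > 0"
  shows "fps_nth (part_gf ^ (24 * i + 1) * (euler_E 1 + of_int 24 * (fps_X * fps_deriv (euler_E 1)))) i = 0"
proof -
  define Z where "Z = part_gf ^ (24 * i + 1) * (fps_X * fps_deriv (euler_E 1))"
  have "fps_X * fps_deriv (part_gf ^ (24 * i)) = of_int (- int (24 * i)) * Z"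
    unfolding deriv_part_power Z_def by (simp add: mult_ac)
  then have "int i * fps_nth (part_gf ^ (24 * i)) i = - int (24 * i) * fps_nth Z i"
    unfolding theta_nth[symmetric] by (simp only: of_int_mult_nth)
  then have "int i * (fps_nth (part_gf ^ (24 * i)) i + 24 * fps_nth Z i) = 0" by (simp add: algebra_simps)
  then have z: "fps_nth (part_gf ^ (24 * i)) i + 24 * fps_nth Z i = 0" using assms by simp
  have "part_gf ^ (24 * i + 1) * euler_E 1 = part_gf ^ (24 * i)"
    using euler_part_cancel[of 1 "24 * i"] by (simp add: mult.commute add.commute)
  then have "part_gf ^ (24 * i + 1) * (euler_E 1 + of_int 24 * (fps_X * fps_deriv (euler_E 1))) = part_gf ^ (24 * i) + of_int 24 * Z"
    unfolding Z_def distrib_left by (simp only: mult.left_commute)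
  then show ?thesis using z by (simp only: fps_add_nth of_int_mult_nth)
qed

lemma jf_phi: "feq 625 jf phi"
  by (rule feqI_of_int[of _ _ _ "fps_X * fps_section 5 (fps_X * psi)"]) (simp add: jf_def mult.assoc)

lemma phi_cong: "feq 5 phi (part_gf ^ 24)"
proof -
  have "feq 5 phi ((euler_E 1 * part_gf ^ 5) ^ 6)" unfolding phi_def
    by (intro feq_power feq_mult feq_refl feq_sym[OF part_frobenius])
  also have "euler_E 1 * part_gf ^ 5 = part_gf ^ 4" using euler_part_cancel[of 1 4] by simp
  finally show ?thesis by (simp add: power_mult[symmetric])
qed

lemma euler_nth_34: assumes "n mod 5 = 3 \<or> n mod 5 = 4" shows "fps_nth (euler_E 1) n = 0"
proof -
  have "fps_nth (sect (n mod 5) (euler_E 1)) (n div 5) = 0" unfolding euler_sect_34[OF assms] by simp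
  then show ?thesis by (simp add: mult.commute[of 5])
qed

context hecke_prime
begin

lemma s_pos: "0 < s"
  using power_mono[OF l_ge_7, of 2] s_eq by simp

lemma l_mod_5: "l mod 5 \<noteq> 0"
proof
  assume "l mod 5 = 0"
  then have "5 dvd l" by (simp add: dvd_eq_mod_eq_0)
  then have "5 = (1::nat) \<or> 5 = l" using prime_l unfolding prime_nat_iff by blast
  then show False using l_ge_7 by simp
qed

lemma l_square_mod_5: "l\<^sup>2 mod 5 = 1 \<or> l\<^sup>2 mod 5 = 4"
proof -
  have "l mod 5 = 1 \<or> l mod 5 = 2 \<or> l mod 5 = 3 \<or> l mod 5 = 4" using l_mod_5 mod_5_cases[of l] by auto
  then show ?thesis unfolding power_mod[of l 5 2, symmetric] by (elim disjE) simp_all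
qed

lemma s_mod_5: "s mod 5 = 0 \<or> s mod 5 = 2"
  using l_square_mod_5 mod_5_cases[of s] unfolding s_eq mod_5_24 by (elim disjE) simp_all

lemma Legendre_1: "Legendre 1 (int l) = 1"
proof -
  have "\<not> [1 = 0] (mod int l)" using l_ge_7 by (simp add: cong_def)
  moreover have "QuadRes (int l) 1" unfolding QuadRes_def by (rule exI[of _ 1]) simp
  ultimately show ?thesis by (simp add: Legendre_def)
qed

lemma hecke_nth: "fps_nth hecke_series j = (if j < s then 0 else int l ^ 3 * (if l\<^sup>2 * (j - s) < s then 0 else fps_nth part_gf (l\<^sup>2 * (j - s) - s))
    + int l * chi12 l * (Legendre (1 - 24 * int (j - s)) (int l) * fps_nth part_gf (j - s))) + (if l\<^sup>2 dvd j then fps_nth part_gf (j div l\<^sup>2) else 0)"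
  unfolding hecke_series_def mult.assoc fps_add_nth of_int_of_nat_eq[where ?'a = "int fps" and n = "l ^ 3", symmetric] of_int_mult_nth fps_X_power_mult_nth fps_section_nth
  by simp

lemma hecke_nth_ge: "fps_nth hecke_series (s + m) = int l ^ 3 * (if l\<^sup>2 * m < s then 0 else fps_nth part_gf (l\<^sup>2 * m - s))
    + int l * chi12 l * (Legendre (1 - 24 * int m) (int l) * fps_nth part_gf m) + (if l\<^sup>2 dvd s + m then fps_nth part_gf ((s + m) div l\<^sup>2) else 0)"
  unfolding hecke_nth[of "s + m"] by simp

lemma l2_not_dvd: "0 < j \<Longrightarrow> j \<le> s \<Longrightarrow> \<not> l\<^sup>2 dvd j"
  using s_eq by (auto dest!: dvd_imp_le)

text \<open>Below q^s only the dilated summand is present, and l^2 > s leaves just its constant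
  term.\<close>

lemma hecke_nth_low: "j < s \<Longrightarrow> fps_nth hecke_series j = (if j = 0 then 1 else 0)"
  using l2_not_dvd[of j] by (cases "j = 0") (simp_all add: hecke_nth part_nth_0)

text \<open>Only the twisted summand contributes, through m = 0 and (1/l) = 1; the first summand
  starts later because s > 0.\<close>

lemma hecke_nth_s: "fps_nth hecke_series s = int l * chi12 l"
  unfolding hecke_nth using l2_not_dvd[of s] s_pos by (simp add: Legendre_1 part_nth_0)

context
  fixes Q :: "nat \<Rightarrow> int"
  assumes Q: "hecke_series * euler_E 1 = (\<Sum>i\<le>s. of_int (Q i) * fps_X ^ (s - i) * jf ^ i)"
begin

lemma hecke_eq: "hecke_series = (\<Sum>i\<le>s. of_int (Q i) * (fps_X ^ (s - i) * (jf ^ i * part_gf)))"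
proof -
  have "hecke_series = hecke_series * euler_E 1 * part_gf" unfolding mult.assoc euler_part by simp
  also have "\<dots> = (\<Sum>i\<le>s. of_int (Q i) * (fps_X ^ (s - i) * (jf ^ i * part_gf)))"
    unfolding Q sum_distrib_right by (simp only: mult.assoc)
  finally show ?thesis .
qed

lemma hecke_phi: "feq 625 hecke_series (\<Sum>i\<le>s. of_int (Q i) * (fps_X ^ (s - i) * (phi ^ i * part_gf)))"
proof -
  have "feq 625 (\<Sum>i\<le>s. of_int (Q i) * (fps_X ^ (s - i) * (jf ^ i * part_gf))) (\<Sum>i\<le>s. of_int (Q i) * (fps_X ^ (s - i) * (phi ^ i * part_gf)))"
    by (intro feq_sum feq_mult feq_refl feq_power jf_phi)
  then show ?thesis by (simp only: hecke_eq[symmetric])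
qed

lemma hecke_part: "feq 5 hecke_series (\<Sum>i\<le>s. of_int (Q i) * (fps_X ^ (s - i) * part_gf ^ (24 * i + 1)))"
proof -
  have "feq 5 hecke_series (\<Sum>i\<le>s. of_int (Q i) * (fps_X ^ (s - i) * (phi ^ i * part_gf)))"
    by (rule feq_dvd[OF _ hecke_phi]) simp
  also have "feq 5 \<dots> (\<Sum>i\<le>s. of_int (Q i) * (fps_X ^ (s - i) * ((part_gf ^ 24) ^ i * part_gf)))"
    by (intro feq_sum feq_mult feq_refl feq_power phi_cong)
  finally show ?thesis by (simp only: power_mult power_add power_one_right)
qed

text \<open>E_1 + 24 q E_1' acts as a test series: at q^s it annihilates all summands with i > 0 by
  \<open>part_power_theta_nth\<close> and isolates Q 0. On the other side only the exponents 0 and s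
  of \<open>hecke_series\<close> contribute.\<close>

lemma leading_cong: "5 dvd Q 0 - chi12 l * (int l + int l ^ 2)"
proof -
  define D where "D = euler_E 1 + of_int 24 * (fps_X * fps_deriv (euler_E 1))"
  have Dn: "fps_nth D m = (24 * int m + 1) * fps_nth (euler_E 1) m" for m
    unfolding D_def fps_add_nth of_int_mult_nth theta_nth by (simp add: algebra_simps)
  have D0: "fps_nth D 0 = 1" unfolding Dn by simp
  have Es: "fps_nth (euler_E 1) s = chi12 l"
    using e24_pentagonal[of s] unfolding s_eq[symmetric] e24_square by (rule sym)
  have l2: "int (l\<^sup>2) = 24 * int s + 1" unfolding s_eq by simp
  have Ds: "fps_nth D s = int (l\<^sup>2) * chi12 l" unfolding Dn Es l2 ..
  have "fps_nth (hecke_series * D) s = (\<Sum>i\<in>{0..s}. fps_nth hecke_series i * fps_nth D (s - i))" by (rule fps_mult_nth)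
  also have "\<dots> = (\<Sum>i\<in>{0, s}. fps_nth hecke_series i * fps_nth D (s - i))"
    by (rule sum.mono_neutral_right) (auto simp: hecke_nth_low)
  also have "\<dots> = int (l\<^sup>2) * chi12 l + int l * chi12 l"
    using s_pos by (simp add: hecke_nth_low hecke_nth_s D0 Ds)
  finally have L: "fps_nth (hecke_series * D) s = int (l\<^sup>2) * chi12 l + int l * chi12 l" .
  have t: "fps_nth (of_int (Q i) * (fps_X ^ (s - i) * part_gf ^ (24 * i + 1)) * D) s = (if i = 0 then Q 0 else 0)" if i: "i \<le> s" for i
  proof -
    have "fps_nth (of_int (Q i) * (fps_X ^ (s - i) * part_gf ^ (24 * i + 1)) * D) s = Q i * fps_nth (part_gf ^ (24 * i + 1) * D) i"
      unfolding mult.assoc of_int_mult_nth fps_X_power_mult_nth using i by simp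
    then show ?thesis
      using part_power_theta_nth[of i] unfolding D_def[symmetric] by (cases "i = 0") (simp_all add: D0 part_nth_0)
  qed
  have "feq 5 (hecke_series * D) ((\<Sum>i\<le>s. of_int (Q i) * (fps_X ^ (s - i) * part_gf ^ (24 * i + 1))) * D)"
    by (intro feq_mult feq_refl hecke_part)
  note fD = feqD[OF this, of s]
  have st: "(\<Sum>i\<le>s. fps_nth (of_int (Q i) * (fps_X ^ (s - i) * part_gf ^ (24 * i + 1)) * D) s) = (\<Sum>i\<le>s. if i = 0 then Q 0 else 0)"
    by (rule sum.cong[OF refl], rule t) simp
  from fD have "5 dvd int (l\<^sup>2) * chi12 l + int l * chi12 l - (\<Sum>i\<le>s. if i = 0 then Q 0 else 0)"
    unfolding L sum_distrib_right fps_sum_nth st .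
  then have "5 dvd int (l\<^sup>2) * chi12 l + int l * chi12 l - Q 0" by (simp add: sum.delta)
  then have "5 dvd Q 0 - (int (l\<^sup>2) * chi12 l + int l * chi12 l)" by (simp only: dvd_diff_commute)
  then show ?thesis by (simp add: algebra_simps)
qed

text \<open>After \<open>keep\<close> the summands with i > 0 either vanish modulo 5 or can be
  grouped by distinct leading exponents at most s, while \<open>hecke_series\<close> has nothing
  there in these classes. So \<open>triangular_cong\<close> leaves the summand i = 0.\<close>

lemma hecke_keep: "feq 5 (keep s hecke_series) (of_int (Q 0) * (fps_X ^ (s + 1) * euler_E 1 ^ 23))"
proof -
  define v where "v i = keep i (part_gf ^ (24 * i + 1))" for i
  define u where "u i = (if i mod 5 = 4 then dil (part_gf ^ (24 * ((i + 1) div 5))) * euler_E 1 ^ 23 else v i)" for i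
  define A where "A i = (if i mod 5 = 3 \<or> i mod 5 = 4 then of_int (Q i) * (fps_X ^ (s - i) * u i) else 0)" for i
  define B where "B i = (if i mod 5 = 0 then of_int (Q i) * (fps_X ^ (s - i) * (fps_X * (dil (part_gf ^ (24 * (i div 5))) * euler_E 1 ^ 23))) else 0)" for i
  define C where "C i = (if i < s \<and> i mod 5 = 4 then of_int (Q (Suc i)) * (fps_X ^ (s - i) * u i) else 0)" for i
  \<comment> \<open>A summand whose index is a multiple of 5 gets an additional q from
    \<open>part_keep\<close>, so it has the same leading exponent as its predecessor, and also the
    same cofactor; their coefficients are added. Only the index 0 has no predecessor.\<close>
  define d where "d i = (if i mod 5 = 3 \<or> i mod 5 = 4 then Q i else 0) + (if i < s \<and> i mod 5 = 4 then Q (Suc i) else 0)" for i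
  have v0: "feq 5 (v i) (fps_X * (dil (part_gf ^ (24 * (i div 5))) * euler_E 1 ^ 23))" if i: "i mod 5 = 0" for i
  proof -
    have e: "24 * i + 1 = 5 * (24 * (i div 5)) + 1" using mult_div_mod_eq[of 5 i] i by linarith
    have "v i = keep 0 (part_gf ^ (5 * (24 * (i div 5))) * part_gf)"
      unfolding v_def e power_add power_one_right by (rule keep_cong) (use i in simp)
    also have "feq 5 \<dots> (keep 0 (dil (part_gf ^ (24 * (i div 5))) * part_gf))" by (intro feq_keep feq_mult feq_refl part_power_5)
    also have "keep 0 (dil (part_gf ^ (24 * (i div 5))) * part_gf) = dil (part_gf ^ (24 * (i div 5))) * keep 0 part_gf" by (rule keep_dil)
    also have "feq 5 \<dots> (dil (part_gf ^ (24 * (i div 5))) * (fps_X * euler_E 1 ^ 23))" by (intro feq_mult feq_refl part_keep)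
    finally show ?thesis by (simp only: mult.left_commute)
  qed
  \<comment> \<open>Here the power of 1/E_1 is a series in q^5, while the kept classes are 2 and
    3.\<close>
  have v1: "feq 5 (v i) 0" if i: "i mod 5 = 1" for i
  proof -
    have "(24 * i + 1) mod 5 = 0" unfolding mod_5_24 i by simp
    then have e: "24 * i + 1 = 5 * ((24 * i + 1) div 5)" by (metis add_0_right mult_div_mod_eq)
    have "feq 5 (v i) (keep i (dil (part_gf ^ ((24 * i + 1) div 5))))" unfolding v_def by (subst e) (intro feq_keep part_power_5)
    also have "keep i (dil g) = 0" for g
    proof (rule fps_ext)
      fix n
      have r: "(i + 1) mod 5 = 2" "(i + 2) mod 5 = 3" using i by (simp_all add: mod_Suc)
      show "fps_nth (keep i (dil g)) n = fps_nth 0 n" unfolding keep_nth r by (auto simp: dil_nth dvd_eq_mod_eq_0)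
    qed
    finally show ?thesis .
  qed
  \<comment> \<open>Here it is a series in q^5 times E_1, and E_1 has no exponents in the kept
    classes 3 and 4.\<close>
  have v2: "feq 5 (v i) 0" if i: "i mod 5 = 2" for i
  proof -
    have "(24 * i + 2) mod 5 = 0" unfolding mod_5_24 i by simp
    then have e: "24 * i + 2 = 5 * ((24 * i + 2) div 5)" by (metis add_0_right mult_div_mod_eq)
    have "part_gf ^ (24 * i + 1) = euler_E 1 * part_gf ^ (24 * i + 2)"
      using euler_part_cancel[of 1 "24 * i + 1"] by simp
    then have "v i = keep i (part_gf ^ (5 * ((24 * i + 2) div 5)) * euler_E 1)" unfolding v_def e[symmetric] by (simp only: mult.commute)
    also have "feq 5 \<dots> (keep i (dil (part_gf ^ ((24 * i + 2) div 5)) * euler_E 1))" by (intro feq_keep feq_mult feq_refl part_power_5)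
    also have "keep i (dil (part_gf ^ ((24 * i + 2) div 5)) * euler_E 1) = dil (part_gf ^ ((24 * i + 2) div 5)) * keep i (euler_E 1)" by (rule keep_dil)
    also have "keep i (euler_E 1) = 0"
    proof (rule fps_ext)
      fix n
      have r: "(i + 1) mod 5 = 3" "(i + 2) mod 5 = 4" using i by (simp_all add: mod_Suc)
      show "fps_nth (keep i (euler_E 1)) n = fps_nth 0 n" unfolding keep_nth r using euler_nth_34[of n] by (simp del: One_nat_def)
    qed
    finally show ?thesis by simp
  qed
  have v4: "feq 5 (v i) (u i)" if i: "i mod 5 = 4" for i
  proof -
    have "(i + 1) mod 5 = 0" using i by (simp add: mod_Suc)
    then have "i + 1 = 5 * ((i + 1) div 5)" by (metis add_0_right mult_div_mod_eq)
    moreover have "24 * i + 24 = 24 * (i + 1)" by simp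
    ultimately have e: "24 * i + 24 = 5 * (24 * ((i + 1) div 5))" by linarith
    have "24 * i + 24 = 23 + (24 * i + 1)" by simp
    then have "part_gf ^ (24 * i + 1) = euler_E 1 ^ 23 * part_gf ^ (24 * i + 24)"
      by (simp only: euler_part_cancel)
    then have "v i = keep 4 (part_gf ^ (5 * (24 * ((i + 1) div 5))) * euler_E 1 ^ 23)"
      unfolding v_def e[symmetric] using keep_cong[of i 4] i by (simp add: mult.commute)
    also have "feq 5 \<dots> (keep 4 (dil (part_gf ^ (24 * ((i + 1) div 5))) * euler_E 1 ^ 23))" by (intro feq_keep feq_mult feq_refl part_power_5)
    also have "keep 4 (dil (part_gf ^ (24 * ((i + 1) div 5))) * euler_E 1 ^ 23) = dil (part_gf ^ (24 * ((i + 1) div 5))) * keep 4 (euler_E 1 ^ 23)" by (rule keep_dil)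
    also have "feq 5 \<dots> (dil (part_gf ^ (24 * ((i + 1) div 5))) * euler_E 1 ^ 23)" by (intro feq_mult feq_refl euler_23_keep)
    finally show ?thesis using i by (simp add: u_def)
  qed
  have AB: "feq 5 (of_int (Q i) * (fps_X ^ (s - i) * v i)) (A i + B i)" for i
  proof -
    have m: "feq 5 (of_int (Q i) * (fps_X ^ (s - i) * v i)) (of_int (Q i) * (fps_X ^ (s - i) * w))" if "feq 5 (v i) w" for w
      by (intro feq_mult feq_refl that)
    have "i mod 5 = 0 \<or> i mod 5 = 1 \<or> i mod 5 = 2 \<or> i mod 5 = 3 \<or> i mod 5 = 4" by (rule mod_5_cases)
    then show ?thesis
    proof (elim disjE)
      assume 1: "i mod 5 = 0"
      from this show ?thesis using m[OF v0[OF 1]] by (simp add: A_def B_def)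
    next
      assume 2: "i mod 5 = 1"
      from this show ?thesis using m[OF v1[OF 2]] by (simp add: A_def B_def)
    next
      assume 3: "i mod 5 = 2"
      from this show ?thesis using m[OF v2[OF 3]] by (simp add: A_def B_def)
    next
      assume 4: "i mod 5 = 3"
      then show ?thesis by (simp add: A_def B_def u_def feq_refl)
    next
      assume 5: "i mod 5 = 4"
      from this show ?thesis using m[OF v4[OF 5]] by (simp add: A_def B_def)
    qed
  qed
  have BC: "B (Suc i) = C i" if i: "i < s" for i
  proof (cases "i mod 5 = 4")
    case True
    then have j: "Suc i mod 5 = 0" "Suc i div 5 = (i + 1) div 5" by (simp_all add: mod_Suc)
    have x: "s - i = Suc (s - Suc i)" using i by simp
    have "B (Suc i) = of_int (Q (Suc i)) * (fps_X ^ (s - Suc i) * (fps_X * (dil (part_gf ^ (24 * ((i + 1) div 5))) * euler_E 1 ^ 23)))"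
      unfolding B_def j by simp
    also have "\<dots> = of_int (Q (Suc i)) * (fps_X ^ (s - i) * u i)"
      unfolding x power_Suc2 u_def by (simp only: True refl simp_thms if_True mult.assoc)
    also have "\<dots> = C i" using True i by (simp add: C_def)
    finally show ?thesis .
  next
    case False
    then have "Suc i mod 5 \<noteq> 0" by (auto simp: mod_Suc)
    then show ?thesis using False by (simp add: B_def C_def)
  qed
  have B0: "B 0 = of_int (Q 0) * (fps_X ^ (s + 1) * euler_E 1 ^ 23)"
    by (simp add: B_def dil_1 mult_ac)
  have "keep s (\<Sum>i\<le>s. of_int (Q i) * (fps_X ^ (s - i) * part_gf ^ (24 * i + 1))) = (\<Sum>i\<le>s. of_int (Q i) * (fps_X ^ (s - i) * v i))"
    unfolding keep_sum_of_int v_def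
  proof (intro sum.cong refl)
    fix i assume "i \<in> {..s}"
    then have "i + (s - i) = s" by simp
    then show "of_int (Q i) * keep s (fps_X ^ (s - i) * part_gf ^ (24 * i + 1)) = of_int (Q i) * (fps_X ^ (s - i) * keep i (part_gf ^ (24 * i + 1)))"
      using keep_X[of i "s - i"] by simp
  qed
  then have "feq 5 (keep s hecke_series) (\<Sum>i\<le>s. of_int (Q i) * (fps_X ^ (s - i) * v i))"
    using feq_keep[OF hecke_part, of s] by simp
  also have "feq 5 \<dots> (\<Sum>i\<le>s. A i + B i)" by (intro feq_sum AB)
  also have "(\<Sum>i\<le>s. A i + B i) = (\<Sum>i\<le>s. A i) + (B 0 + (\<Sum>i<s. B (Suc i)))"
    unfolding sum.distrib by (simp only: sum.atMost_shift)
  also have "(\<Sum>i<s. B (Suc i)) = (\<Sum>i<s. C i)" by (intro sum.cong refl) (simp add: BC)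
  also have "\<dots> = (\<Sum>i\<le>s. C i)" unfolding lessThan_Suc_atMost[symmetric] by (simp add: C_def)
  also have "(\<Sum>i\<le>s. A i) + (B 0 + (\<Sum>i\<le>s. C i)) = B 0 + (\<Sum>i\<le>s. A i + C i)" by (simp add: sum.distrib)
  also have "(\<Sum>i\<le>s. A i + C i) = (\<Sum>i\<le>s. of_int (d i) * (fps_X ^ (s - i) * u i))"
    by (intro sum.cong refl) (auto simp: A_def C_def d_def distrib_right)
  finally have "feq 5 (keep s hecke_series - B 0) (B 0 + (\<Sum>i\<le>s. of_int (d i) * (fps_X ^ (s - i) * u i)) - B 0)"
    by (intro feq_diff feq_refl)
  then have f: "feq 5 (keep s hecke_series - B 0) (\<Sum>i\<in>{..s}. of_int (d i) * (fps_X ^ (s - i) * u i))" by simp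
  have "feq 5 (keep s hecke_series - B 0) 0"
  proof (rule triangular_cong[OF f, of s])
    fix j assume j: "j \<le> s"
    have "fps_nth (B 0) j = 0" unfolding B0 of_int_mult_nth fps_X_power_mult_nth using j by simp
    moreover have "fps_nth (keep s hecke_series) j = 0"
    proof (cases "j mod 5 = (s + 1) mod 5 \<or> j mod 5 = (s + 2) mod 5")
      case True
      have r: "(s + 1) mod 5 \<noteq> s mod 5" "(s + 2) mod 5 \<noteq> s mod 5" using mod_5_cases[of s] by (auto simp: mod_Suc)
      have r0: "(s + 1) mod 5 \<noteq> 0 mod 5" "(s + 2) mod 5 \<noteq> 0 mod 5" using s_mod_5 by (auto simp: mod_Suc)
      have "j \<noteq> s" using True r by metis
      moreover have "j \<noteq> 0" using True r0 by metis
      ultimately show ?thesis using j by (simp add: keep_nth hecke_nth_low)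
    qed (simp add: keep_nth)
    ultimately show "fps_nth (keep s hecke_series - B 0) j = 0" by simp
  next
    fix i assume "i \<in> {..s}"
    show "d i = 0 \<or> fps_nth (u i) 0 = 1"
    proof (cases "i mod 5 = 3 \<or> i mod 5 = 4")
      case True
      have "(i + 2) mod 5 = 0" if "i mod 5 = 3" using that by (simp add: mod_Suc)
      then have "fps_nth (u i) 0 = 1" using True
        by (auto simp: u_def v_def keep_nth dil_nth fps_power_zeroth part_nth_0)
      then show ?thesis ..
    qed (simp add: d_def)
  qed (auto simp: inj_on_def)
  then have "feq 5 (keep s hecke_series - B 0 + B 0) (0 + B 0)" by (intro feq_add feq_refl)
  then show ?thesis unfolding B0 by simp
qed

text \<open>phi^i/E_1 is a series in q^5 times E_1^(6i-1), so \<open>pos_section\<close> applies.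
  Terms with e < i vanish modulo 25; those with e = i + t depend on i only through their
  coefficient, so the double sum becomes a single sum over t with distinct leading exponents s - 1 -
  5t.\<close>

lemma hecke_respart: "feq 25 (respart (s + 4) hecke_series) (of_int (Q 0) * (fps_X ^ s * respart 4 part_gf))"
proof -
  define N where "N = 6 * s + 1"
  define c where "c i t = pos_coeff (6 * i - 1) (i + t)" for i t
  define g where "g t = fps_X ^ (s - (1 + 5 * t)) * dil (phi ^ t * einv)" for t
  define D where "D t = (\<Sum>i<s. Q (Suc i) * c (Suc i) t)" for t
  define T where "T = {t. t < N \<and> 1 + 5 * t \<le> s}"
  have tm: "feq 25 (fps_X ^ (s - i) * respart (4 + i) (phi ^ i * part_gf)) (\<Sum>t<N. of_int (c i t) * g t)" if i: "0 < i" "i \<le> s" for i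
  proof -
    define k where "k = 6 * i - 1"
    have k: "6 * i = 1 + k" "k < N" using i by (auto simp: k_def N_def)
    have "phi ^ i * part_gf = einv ^ (6 * i) * (part_gf ^ 1 * euler_E 1 ^ (1 + k))"
      unfolding phi_def k(1)[symmetric] power_mult by (simp only: power_mult_distrib power_one_right mult_ac)
    also have "\<dots> = dil (part_gf ^ (6 * i)) * euler_E 1 ^ k" unfolding part_euler_cancel einv_dil dil_power ..
    finally have "respart (4 + i) (phi ^ i * part_gf) = dil (part_gf ^ (6 * i)) * respart (4 + i) (euler_E 1 ^ k)"
      by (simp only: respart_dil_mult)
    also have "respart (4 + i) (euler_E 1 ^ k) = respart k (euler_E 1 ^ k)"
    proof (rule respart_cong)
      have "k = 4 + i + 5 * (i - 1)" using k(1) i by simp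
      then show "(4 + i) mod 5 = k mod 5" by (simp only: mod_mult_self2)
    qed
    also have "\<dots> = (\<Sum>e<N. of_int (pos_coeff k e) * pos_term k e)" by (rule pos_section[OF k(2)])
    finally have "fps_X ^ (s - i) * respart (4 + i) (phi ^ i * part_gf) = fps_X ^ (s - i) * (dil (part_gf ^ (6 * i)) * (\<Sum>e<N. of_int (pos_coeff k e) * pos_term k e))"
      by simp
    also have "feq 25 \<dots> (fps_X ^ (s - i) * (dil (part_gf ^ (6 * i)) * (\<Sum>t<N. of_int (pos_coeff k (i + t)) * pos_term k (i + t))))"
    proof (intro feq_mult feq_refl feq_shift_sum)
      fix e assume "e < i"
      \<comment> \<open>For e at most i-1 and k = 6i-1 the number k - 5e - 1 is at least i + 3,
        hence at least 4.\<close>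
      then have "2 \<le> (k - 5 * e - 1) div 2" using k(1) by linarith
      then have "(5::int) ^ 2 dvd 5 ^ ((k - 5 * e - 1) div 2)" by (rule le_imp_power_dvd)
      also have "\<dots> dvd pos_coeff k e" by (rule pos_coeff_dvd)
      finally show "25 dvd pos_coeff k e" by simp
    next
      fix e assume "N \<le> e"
      then show "pos_coeff k e = 0" using k(2) by (intro pos_coeff_eq_0) simp
    qed
    also have "fps_X ^ (s - i) * (dil (part_gf ^ (6 * i)) * (\<Sum>t<N. of_int (pos_coeff k (i + t)) * pos_term k (i + t))) = (\<Sum>t<N. of_int (c i t) * g t)"
      unfolding sum_distrib_left
    proof (intro sum.cong refl)
      fix t
      have ck: "c i t = pos_coeff k (i + t)" by (simp add: c_def k_def)
      show "fps_X ^ (s - i) * (dil (part_gf ^ (6 * i)) * (of_int (pos_coeff k (i + t)) * pos_term k (i + t))) = of_int (c i t) * g t"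
      proof (cases "k < 5 * (i + t)")
        case True
        then show ?thesis unfolding ck by (simp add: pos_coeff_eq_0)
      next
        case False
        then have x: "s - i + (k - 5 * (i + t)) = s - (1 + 5 * t)" using k(1) i by simp
        have "part_gf ^ (6 * i) * (phi ^ (i + t) * euler_E 5 ^ k) = (euler_E 1 * part_gf) ^ (6 * i) * phi ^ t * (euler_E 5 ^ k * einv ^ (6 * i))"
          unfolding phi_def power_add power_mult by (simp only: power_mult_distrib mult_ac)
        also have "\<dots> = phi ^ t * (euler_E 5 ^ k * einv ^ (k + 1))" unfolding euler_part k(1) by (simp add: add.commute)
        also have "\<dots> = phi ^ t * einv" unfolding euler_einv_cancel by simp
        finally have y: "dil (part_gf ^ (6 * i)) * dil (phi ^ (i + t) * euler_E 5 ^ k) = dil (phi ^ t * einv)"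
          by (simp only: dil_mult[symmetric])
        have "fps_X ^ (s - i) * (dil (part_gf ^ (6 * i)) * (of_int (pos_coeff k (i + t)) * pos_term k (i + t)))
          = of_int (pos_coeff k (i + t)) * (fps_X ^ (s - i + (k - 5 * (i + t))) * (dil (part_gf ^ (6 * i)) * dil (phi ^ (i + t) * euler_E 5 ^ k)))"
          unfolding pos_term_def power_add by (simp only: mult_ac)
        then show ?thesis unfolding x y ck g_def .
      qed
    qed
    finally show ?thesis .
  qed
  have "respart (s + 4) (\<Sum>i\<le>s. of_int (Q i) * (fps_X ^ (s - i) * (phi ^ i * part_gf)))
     = (\<Sum>i\<le>s. of_int (Q i) * (fps_X ^ (s - i) * respart (4 + i) (phi ^ i * part_gf)))"
    unfolding respart_sum respart_of_int
  proof (intro sum.cong refl)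
    fix i assume "i \<in> {..s}"
    then have "s + 4 = 4 + i + (s - i)" by simp
    then show "of_int (Q i) * respart (s + 4) (fps_X ^ (s - i) * (phi ^ i * part_gf)) = of_int (Q i) * (fps_X ^ (s - i) * respart (4 + i) (phi ^ i * part_gf))"
      by (simp only: respart_X_mult)
  qed
  then have "feq 25 (respart (s + 4) hecke_series) (\<Sum>i\<le>s. of_int (Q i) * (fps_X ^ (s - i) * respart (4 + i) (phi ^ i * part_gf)))"
    using feq_respart[OF hecke_phi, of "s + 4"] by (intro feq_dvd[of 25 625]) simp_all
  also have "(\<Sum>i\<le>s. of_int (Q i) * (fps_X ^ (s - i) * respart (4 + i) (phi ^ i * part_gf)))
     = of_int (Q 0) * (fps_X ^ s * respart 4 part_gf) + (\<Sum>i<s. of_int (Q (Suc i)) * (fps_X ^ (s - Suc i) * respart (4 + Suc i) (phi ^ Suc i * part_gf)))"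
    unfolding sum.atMost_shift by simp
  also have "feq 25 \<dots> (of_int (Q 0) * (fps_X ^ s * respart 4 part_gf) + (\<Sum>i<s. of_int (Q (Suc i)) * (1 * (\<Sum>t<N. of_int (c (Suc i) t) * g t))))"
    unfolding mult_1_left by (intro feq_add feq_refl feq_sum feq_mult[OF feq_refl] tm) auto
  also have "(\<Sum>i<s. of_int (Q (Suc i)) * (1 * (\<Sum>t<N. of_int (c (Suc i) t) * g t))) = (\<Sum>t<N. of_int (D t) * g t)"
    unfolding D_def by (subst double_sum_of_int) simp
  also have "\<dots> = (\<Sum>t\<in>T. of_int (D t) * g t)"
  proof (rule sum.mono_neutral_right)
    show "\<forall>t\<in>{..<N} - T. of_int (D t) * g t = 0"
    proof
      fix t assume "t \<in> {..<N} - T"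
      then have t: "s < 1 + 5 * t" by (auto simp: T_def)
      have "c (Suc i) t = 0" if "i < s" for i
        unfolding c_def by (rule pos_coeff_eq_0) (use t that in simp)
      then show "of_int (D t) * g t = 0" by (simp add: D_def)
    qed
  qed (auto simp: T_def)
  finally have "feq 25 (respart (s + 4) hecke_series - of_int (Q 0) * (fps_X ^ s * respart 4 part_gf))
      (of_int (Q 0) * (fps_X ^ s * respart 4 part_gf) + (\<Sum>t\<in>T. of_int (D t) * g t) - of_int (Q 0) * (fps_X ^ s * respart 4 part_gf))"
    by (intro feq_diff feq_refl)
  then have f: "feq 25 (respart (s + 4) hecke_series - of_int (Q 0) * (fps_X ^ s * respart 4 part_gf))
      (\<Sum>t\<in>T. of_int (D t) * (fps_X ^ (s - (1 + 5 * t)) * dil (phi ^ t * einv)))" by (simp add: g_def)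
  have "feq 25 (respart (s + 4) hecke_series - of_int (Q 0) * (fps_X ^ s * respart 4 part_gf)) 0"
  proof (rule triangular_cong[OF f, of s])
    fix j assume j: "j \<le> s"
    have "fps_nth (of_int (Q 0) * (fps_X ^ s * respart 4 part_gf)) j = 0"
      unfolding of_int_mult_nth fps_X_power_mult_nth using j by (simp add: respart_nth)
    moreover have "fps_nth (respart (s + 4) hecke_series) j = 0"
    proof (cases "j mod 5 = (s + 4) mod 5")
      case True
      have e: "(s + 4) mod 5 = (s mod 5 + 4) mod 5" by (simp only: mod_add_left_eq)
      have r: "(s + 4) mod 5 \<noteq> s mod 5" "(s + 4) mod 5 \<noteq> 0 mod 5"
        unfolding e using s_mod_5 by (elim disjE; simp)+
      have "j \<noteq> s" using True r(1) by metis
      moreover have "j \<noteq> 0" using True r(2) by metis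
      ultimately show ?thesis using j by (simp add: respart_nth hecke_nth_low)
    qed (simp add: respart_nth)
    ultimately show "fps_nth (respart (s + 4) hecke_series - of_int (Q 0) * (fps_X ^ s * respart 4 part_gf)) j = 0" by simp
  next
    show "inj_on (\<lambda>t. s - (1 + 5 * t)) T" by (auto simp: inj_on_def T_def)
    show "finite T" by (simp add: T_def)
    have "fps_nth einv 0 = 1" by (simp add: einv_dil dil_nth part_nth_0)
    then show "D t = 0 \<or> fps_nth (dil (phi ^ t * einv)) 0 = 1" for t
      by (simp add: dil_nth phi_def fps_power_zeroth)
  qed auto
  then have "feq 25 (respart (s + 4) hecke_series - of_int (Q 0) * (fps_X ^ s * respart 4 part_gf) + of_int (Q 0) * (fps_X ^ s * respart 4 part_gf)) (0 + of_int (Q 0) * (fps_X ^ s * respart 4 part_gf))"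
    by (intro feq_add feq_refl)
  then show ?thesis by simp
qed

end

lemma hecke_relations:
  obtains q where "5 dvd q - chi12 l * (int l + int l ^ 2)"
    "\<And>m. m mod 5 = 1 \<or> m mod 5 = 2 \<Longrightarrow> 5 dvd fps_nth hecke_series (s + m) - q * fps_nth (euler_E 1 ^ 23) (m - 1)"
    "\<And>m. m mod 5 = 4 \<Longrightarrow> 25 dvd fps_nth hecke_series (s + m) - q * fps_nth part_gf m"
proof -
  obtain P where P: "hecke_series * euler_E 1 = (\<Sum>i\<le>s. of_int (P i) * fps_X ^ i * jf ^ (s - i))" by (rule hecke_identity)
  define Q where "Q i = P (s - i)" for i
  have "(\<Sum>i\<le>s. of_int (P i) * fps_X ^ i * jf ^ (s - i)) = (\<Sum>i\<le>s. of_int (Q i) * fps_X ^ (s - i) * jf ^ i)"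
    by (rule sum.reindex_bij_witness[of _ "\<lambda>i. s - i" "\<lambda>i. s - i"]) (auto simp: Q_def)
  with P have Q: "hecke_series * euler_E 1 = (\<Sum>i\<le>s. of_int (Q i) * fps_X ^ (s - i) * jf ^ i)" by simp
  show ?thesis
  proof (rule that)
    show "5 dvd Q 0 - chi12 l * (int l + int l ^ 2)" by (rule leading_cong[OF Q])
    show "5 dvd fps_nth hecke_series (s + m) - Q 0 * fps_nth (euler_E 1 ^ 23) (m - 1)" if m: "m mod 5 = 1 \<or> m mod 5 = 2" for m
    proof -
      have e: "(s + m) mod 5 = (s + m mod 5) mod 5" by (simp only: mod_add_right_eq)
      have a1: "(s + m) mod 5 = (s + 1) mod 5 \<or> (s + m) mod 5 = (s + 2) mod 5" unfolding e using m by (elim disjE) simp_all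
      have "0 < m" using m by (cases m) auto
      then have a2: "\<not> s + m < s + 1" "s + m - (s + 1) = m - 1" by simp_all
      from a1 a2 show ?thesis using feqD[OF hecke_keep[OF Q], of "s + m"] unfolding keep_nth of_int_mult_nth fps_X_power_mult_nth by simp
    qed
    show "25 dvd fps_nth hecke_series (s + m) - Q 0 * fps_nth part_gf m" if m: "m mod 5 = 4" for m
    proof -
      have "(s + m) mod 5 = (s + 4) mod 5" using m mod_add_right_eq[of s m 5] by simp
      then show ?thesis using feqD[OF hecke_respart[OF Q], of "s + m"] m unfolding respart_nth of_int_mult_nth fps_X_power_mult_nth by simp
    qed
  qed
qed

end

section \<open>The Hecke relation for c\<close>

lemma Legendre_values: "Legendre a p = 0 \<or> Legendre a p = 1 \<or> Legendre a p = - 1"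
  by (simp add: Legendre_def)

lemma sign_cong_imp_eq:
  fixes x y :: int and m :: nat
  assumes "int m dvd x - y" "2 < m" "\<bar>x\<bar> \<le> 1" "\<bar>y\<bar> \<le> 1"
  shows "x = y"
proof (rule ccontr)
  assume "x \<noteq> y"
  then have "\<bar>int m\<bar> \<le> \<bar>x - y\<bar>" using assms(1) by (intro dvd_imp_le_int) auto
  then show False using assms by linarith
qed

lemma abs_Legendre_le: "\<bar>Legendre a p\<bar> \<le> 1"
  using Legendre_values[of a p] by auto

text \<open>Euler's criterion gives the congruence modulo p, and numbers among -1, 0, 1 that agree
  modulo p > 2 are equal.\<close>

lemma Legendre_mult:
  assumes p: "prime p" "2 < p"
  shows "Legendre (a * b) (int p) = Legendre a (int p) * Legendre b (int p)"
proof (rule sign_cong_imp_eq[OF _ p(2)])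
  define k where "k = (p - 1) div 2"
  have e: "int p dvd Legendre c (int p) - c ^ k" for c
    using euler_criterion[OF p, of c] unfolding k_def cong_iff_dvd_diff .
  have "Legendre (a * b) (int p) - Legendre a (int p) * Legendre b (int p)
     = (Legendre (a * b) (int p) - (a * b) ^ k) - (Legendre a (int p) - a ^ k) * Legendre b (int p) - a ^ k * (Legendre b (int p) - b ^ k)"
    by (simp add: algebra_simps power_mult_distrib)
  then show "int p dvd Legendre (a * b) (int p) - Legendre a (int p) * Legendre b (int p)"
    using e by (simp only: dvd_diff dvd_mult dvd_mult2)
  show "\<bar>Legendre a (int p) * Legendre b (int p)\<bar> \<le> 1"
    using Legendre_values[of a "int p"] Legendre_values[of b "int p"] by auto
qed (rule abs_Legendre_le)

text \<open>Divides a congruence modulo MN by M. With M = N = 5 it passes from p(5n+4) to the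
  coefficients of E_1^19.\<close>

lemma combine_congruence:
  fixes N x y q :: int
  assumes "M * N dvd x * P1 + y * p + P3 - q * p" "M * N dvd P1 - M * A" "M * N dvd p - M * a" "M * N dvd P3 - M * T" "N dvd q - q'" "M \<noteq> 0"
  shows "N dvd x * A + y * a + T - q' * a"
proof -
  have "M * (x * A + y * a + T - q * a) = (x * P1 + y * p + P3 - q * p) - x * (P1 - M * A) - (y - q) * (p - M * a) - (P3 - M * T)"
    by (simp add: algebra_simps)
  also have "M * N dvd \<dots>" by (rule dvd_diff[OF dvd_diff[OF dvd_diff[OF assms(1) dvd_mult[OF assms(2)]] dvd_mult[OF assms(3)]] assms(4)])
  finally have "N dvd x * A + y * a + T - q * a" using assms(6) by simp
  then have "N dvd (x * A + y * a + T - q * a) + (q - q') * a" using assms(5) by (intro dvd_add dvd_mult2) auto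
  then show ?thesis by (simp add: algebra_simps)
qed

text \<open>Multiplication by L turns L^3 A into A, as L^4 = 1 modulo 5; the factor x L^2 that
  arises is the one replaced by x', later (15/l).\<close>

lemma solve_congruence:
  fixes L :: int
  assumes "5 dvd L ^ 3 * A + L * x * m * a + T - x * (L + L ^ 2) * a" "5 dvd L ^ 4 - 1" "5 dvd x' - x * L ^ 2"
  shows "5 dvd A - (x' * (1 + L - m) * a - L * T)"
proof -
  have "A - (x' * (1 + L - m) * a - L * T) = L * (L ^ 3 * A + L * x * m * a + T - x * (L + L ^ 2) * a)
     - (L ^ 4 - 1) * A - (x' - x * L ^ 2) * ((1 + L - m) * a)"
    by (simp add: algebra_simps power_numeral_reduce)
  then show ?thesis using assms by (simp only: dvd_diff dvd_mult dvd_mult2)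
qed

context hecke_prime
begin

lemma l_gt_2: "2 < l" using l_ge_7 by simp

lemma l_fourth_power: "5 dvd int l ^ 4 - 1"
proof -
  have "l mod 5 = 1 \<or> l mod 5 = 2 \<or> l mod 5 = 3 \<or> l mod 5 = 4" using l_mod_5 mod_5_cases[of l] by auto
  then have "l ^ 4 mod 5 = 1" unfolding power_mod[of l 5 4, symmetric] by (elim disjE) simp_all
  from arg_cong[OF this, of int] have "int l ^ 4 mod 5 = 1" by (simp add: zmod_int)
  then show ?thesis using mod_eq_dvd_iff[of "int l ^ 4" 5 1] by simp
qed

lemma prime_5: "prime (5::nat)" and prime_3: "prime (3::nat)"
  by simp_all

text \<open>Reciprocity at 5 has no sign, and (l/5) is l^2 modulo 5 by Euler's criterion.\<close>

lemma Legendre_5: "5 dvd Legendre 5 (int l) - int l ^ 2"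
proof -
  have "Legendre (int 5) (int l) * Legendre (int l) (int 5) = (-1) ^ ((5 - 1) div 2 * ((l - 1) div 2))"
    by (rule Quadratic_Reciprocity) (use prime_5 prime_l l_ge_7 in auto)
  also have "\<dots> = (1::int)" by simp
  finally have "Legendre 5 (int l) * Legendre (int l) 5 = 1" by simp
  then have "Legendre 5 (int l) = Legendre (int l) 5"
    using Legendre_values[of 5 "int l"] Legendre_values[of "int l" 5] by auto
  moreover have "int 5 dvd Legendre (int l) (int 5) - int l ^ ((5 - 1) div 2)"
    using euler_criterion[OF prime_5, of "int l"] unfolding cong_iff_dvd_diff by simp
  ultimately show ?thesis by simp
qed

lemma Legendre_3: "Legendre 3 (int l) = chi12 l"
proof -
  define L where "L = Legendre (int l) 3"
  have qr: "Legendre (int 3) (int l) * Legendre (int l) (int 3) = (-1) ^ ((3 - 1) div 2 * ((l - 1) div 2))"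
    by (rule Quadratic_Reciprocity) (use prime_3 prime_l l_ge_7 in auto)
  have "int 3 dvd Legendre (int l) (int 3) - int l ^ ((3 - 1) div 2)"
    using euler_criterion[OF prime_3, of "int l"] unfolding cong_iff_dvd_diff by simp
  then have L3: "3 dvd L - int l" by (simp add: L_def)
  have Lv: "L = 0 \<or> L = 1 \<or> L = - 1" unfolding L_def by (rule Legendre_values)
  have Lm: "L mod 3 = int (l mod 12 mod 3)"
    using mod_eq_dvd_iff[of L 3 "int l"] L3 by (simp add: zmod_int mod_mod_cancel)
  have lq: "l = 12 * (l div 12) + l mod 12" by simp
  have q: "Legendre 3 (int l) * L = (-1) ^ ((l - 1) div 2)" using qr by (simp add: L_def)
  have "l mod 12 = 1 \<or> l mod 12 = 5 \<or> l mod 12 = 7 \<or> l mod 12 = 11"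
    using chi_l by (auto simp: chi12_def split: if_splits)
  then show ?thesis
  proof (elim disjE)
    assume r: "l mod 12 = 1"
    obtain k where k: "l = 12 * k + 1" using lq unfolding r by blast
    have h: "(l - 1) div 2 = 6 * k + 0" using k by linarith
    have "L = 1" using Lm Lv unfolding r by auto
    moreover have "even ((l - 1) div 2)" unfolding h by simp
    ultimately show ?thesis using q r by (simp add: chi12_def)
  next
    assume r: "l mod 12 = 5"
    obtain k where k: "l = 12 * k + 5" using lq unfolding r by blast
    have h: "(l - 1) div 2 = 6 * k + 2" using k by linarith
    have "L = - 1" using Lm Lv unfolding r by auto
    moreover have "even ((l - 1) div 2)" unfolding h by simp
    ultimately show ?thesis using q r by (simp add: chi12_def)
  next
    assume r: "l mod 12 = 7"
    obtain k where k: "l = 12 * k + 7" using lq unfolding r by blast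
    have h: "(l - 1) div 2 = 6 * k + 3" using k by linarith
    have "L = 1" using Lm Lv unfolding r by auto
    moreover have "odd ((l - 1) div 2)" unfolding h by simp
    ultimately show ?thesis using q r by (simp add: chi12_def)
  next
    assume r: "l mod 12 = 11"
    obtain k where k: "l = 12 * k + 11" using lq unfolding r by blast
    have h: "(l - 1) div 2 = 6 * k + 5" using k by linarith
    have "L = - 1" using Lm Lv unfolding r by auto
    moreover have "odd ((l - 1) div 2)" unfolding h by simp
    ultimately show ?thesis using q r by (simp add: chi12_def)
  qed
qed

lemma Legendre_15: "5 dvd Legendre 15 (int l) - chi12 l * int l ^ 2"
proof -
  have "Legendre 15 (int l) = chi12 l * Legendre 5 (int l)"
    using Legendre_mult[OF prime_l l_gt_2, of 3 5] by (simp add: Legendre_3)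
  then have "Legendre 15 (int l) - chi12 l * int l ^ 2 = chi12 l * (Legendre 5 (int l) - int l ^ 2)"
    by (simp add: algebra_simps)
  then show ?thesis using Legendre_5 by simp
qed

text \<open>The last term of a Hecke relation, read in the coordinate 24n + b, where the index is
  divided by l^2. As a relation in T it transfers from the powers of E_1 to c.\<close>

definition third_term :: "nat \<Rightarrow> (nat \<Rightarrow> int) \<Rightarrow> nat \<Rightarrow> int \<Rightarrow> bool" where
  "third_term b f n T \<longleftrightarrow> (\<exists>k. 24 * n + b = l\<^sup>2 * (24 * k + b) \<and> T = f k) \<or> (\<not> l\<^sup>2 dvd 24 * n + b \<and> T = 0)"

lemma hecke_relations_ex: "\<exists>q. 5 dvd q - chi12 l * (int l + int l ^ 2)
    \<and> (\<forall>m. m mod 5 = 1 \<or> m mod 5 = 2 \<longrightarrow> 5 dvd fps_nth hecke_series (s + m) - q * fps_nth (euler_E 1 ^ 23) (m - 1))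
    \<and> (\<forall>m. m mod 5 = 4 \<longrightarrow> 25 dvd fps_nth hecke_series (s + m) - q * fps_nth part_gf m)"
  by (rule hecke_relations) blast

text \<open>The classes 0 and 1 are those in which 24n+23 is a quadratic nonresidue modulo 5, a
  property that the factor l^2 does not change.\<close>

lemma residue_transfer:
  assumes "24 * N + 23 = l\<^sup>2 * (24 * n + 23)"
  shows "N mod 5 = 0 \<or> N mod 5 = 1 \<longleftrightarrow> n mod 5 = 0 \<or> n mod 5 = 1"
proof -
  define i j where "i = n mod 5" and "j = N mod 5"
  have i: "(24 * n + 23) mod 5 = (4 * i + 23) mod 5" "i = 0 \<or> i = 1 \<or> i = 2 \<or> i = 3 \<or> i = 4"
    unfolding i_def by (rule mod_5_24, rule mod_5_cases)
  have j: "(24 * N + 23) mod 5 = (4 * j + 23) mod 5" "j = 0 \<or> j = 1 \<or> j = 2 \<or> j = 3 \<or> j = 4"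
    unfolding j_def by (rule mod_5_24, rule mod_5_cases)
  have "(24 * N + 23) mod 5 = (l\<^sup>2 mod 5) * ((24 * n + 23) mod 5) mod 5" unfolding assms by (simp only: mod_mult_eq)
  then have "(4 * j + 23) mod 5 = (l\<^sup>2 mod 5) * ((4 * i + 23) mod 5) mod 5" unfolding i(1) j(1) .
  then have "j = 0 \<or> j = 1 \<longleftrightarrow> i = 0 \<or> i = 1"
    using i(2) j(2) l_square_mod_5 by (elim disjE) simp_all
  then show ?thesis unfolding i_def j_def .
qed

text \<open>In the classes 0 and 1 the coefficient of E_1^23 is p(n+1) modulo 5 and the relation for
  \<open>hecke_series\<close> carries over. In the other classes all terms are divisible by 5 by
  \<open>euler_23_keep\<close>.\<close>

lemma euler_23_relation:
  assumes T: "third_term 23 (fps_nth (euler_E 1 ^ 23)) n T"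
  shows "5 dvd int l ^ 3 * fps_nth (euler_E 1 ^ 23) (l\<^sup>2 * n + 23 * s) + int l * chi12 l * Legendre (- 24 * int n - 23) (int l) * fps_nth (euler_E 1 ^ 23) n + T
    - chi12 l * (int l + int l ^ 2) * fps_nth (euler_E 1 ^ 23) n"
proof -
  define a where "a = fps_nth (euler_E 1 ^ 23)"
  have tr: "24 * (l\<^sup>2 * n + 23 * s) + 23 = l\<^sup>2 * (24 * n + 23)" by (simp add: s_eq algebra_simps)
  show ?thesis
  proof (cases "n mod 5 = 0 \<or> n mod 5 = 1")
    case True
    have pa: "5 dvd fps_nth part_gf (k + 1) - a k" if "k mod 5 = 0 \<or> k mod 5 = 1" for k
    proof -
      have "(k + 1) mod 5 = (0 + 1) mod 5 \<or> (k + 1) mod 5 = (0 + 2) mod 5" using that by (auto simp: mod_Suc)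
      then show ?thesis using feqD[OF part_keep, of "k + 1"] unfolding keep_nth a_def by simp
    qed
    have n1: "(n + 1) mod 5 = 1 \<or> (n + 1) mod 5 = 2" using True by (auto simp: mod_Suc)
    obtain q where q: "5 dvd q - chi12 l * (int l + int l ^ 2)"
      "\<And>m. m mod 5 = 1 \<or> m mod 5 = 2 \<Longrightarrow> 5 dvd fps_nth hecke_series (s + m) - q * fps_nth (euler_E 1 ^ 23) (m - 1)"
      "\<And>m. m mod 5 = 4 \<Longrightarrow> 25 dvd fps_nth hecke_series (s + m) - q * fps_nth part_gf m"
      using hecke_relations_ex by blast
    define P3 where "P3 = (if l\<^sup>2 dvd s + (n + 1) then fps_nth part_gf ((s + (n + 1)) div l\<^sup>2) else 0)"
    have f: "l\<^sup>2 * (n + 1) = l\<^sup>2 * n + 23 * s + 1 + s" by (simp add: s_eq algebra_simps)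
    have leg: "1 - 24 * int (n + 1) = - 24 * int n - 23" by simp
    have R: "5 dvd int l ^ 3 * fps_nth part_gf (l\<^sup>2 * n + 23 * s + 1) + int l * chi12 l * (Legendre (- 24 * int n - 23) (int l) * fps_nth part_gf (n + 1)) + P3 - q * a n"
    proof -
      have "fps_nth hecke_series (s + (n + 1)) = int l ^ 3 * fps_nth part_gf (l\<^sup>2 * n + 23 * s + 1) + int l * chi12 l * (Legendre (- 24 * int n - 23) (int l) * fps_nth part_gf (n + 1)) + P3"
        unfolding hecke_nth_ge P3_def[symmetric] f leg by (simp only: not_add_less2 if_False add_diff_cancel_right')
      then show ?thesis using q(2)[OF n1] unfolding a_def by (simp only: add_diff_cancel_right')
    qed
    have d3: "5 dvd P3 - T"
      using T unfolding third_term_def a_def[symmetric]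
    proof (elim disjE exE conjE)
      fix k assume k: "24 * n + 23 = l\<^sup>2 * (24 * k + 23)" "T = a k"
      have "24 * (s + (n + 1)) = (24 * n + 23) + (24 * s + 1)" by simp
      also have "\<dots> = 24 * (l\<^sup>2 * (k + 1))" unfolding k(1) s_eq[symmetric] by (simp add: algebra_simps)
      finally have "s + (n + 1) = l\<^sup>2 * (k + 1)" by simp
      then have "P3 = fps_nth part_gf (k + 1)" using l_pos by (simp add: P3_def)
      then show ?thesis using pa[of k] residue_transfer[OF k(1)] True k(2) by simp
    next
      assume k: "\<not> l\<^sup>2 dvd 24 * n + 23" "T = 0"
      have "\<not> l\<^sup>2 dvd s + (n + 1)"
      proof
        assume "l\<^sup>2 dvd s + (n + 1)"
        then have "l\<^sup>2 dvd 24 * (s + (n + 1))" by (rule dvd_mult)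
        also have "24 * (s + (n + 1)) = (24 * n + 23) + l\<^sup>2" using s_eq by simp
        finally show False using k(1) by simp
      qed
      then show ?thesis using k(2) by (simp add: P3_def)
    qed
    have dA: "5 dvd fps_nth part_gf (l\<^sup>2 * n + 23 * s + 1) - a (l\<^sup>2 * n + 23 * s)" by (rule pa) (use residue_transfer[OF tr] True in blast)
    have dn: "5 dvd fps_nth part_gf (n + 1) - a n" by (rule pa[OF True])
    have "5 dvd (int l ^ 3 * fps_nth part_gf (l\<^sup>2 * n + 23 * s + 1) + int l * chi12 l * (Legendre (- 24 * int n - 23) (int l) * fps_nth part_gf (n + 1)) + P3 - q * a n)
      - int l ^ 3 * (fps_nth part_gf (l\<^sup>2 * n + 23 * s + 1) - a (l\<^sup>2 * n + 23 * s))
      - int l * chi12 l * Legendre (- 24 * int n - 23) (int l) * (fps_nth part_gf (n + 1) - a n) - (P3 - T) + (q - chi12 l * (int l + int l ^ 2)) * a n"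
      by (rule dvd_add[OF dvd_diff[OF dvd_diff[OF dvd_diff[OF R dvd_mult[OF dA]] dvd_mult[OF dn]] d3] dvd_mult2[OF q(1)]])
    then show ?thesis unfolding a_def[symmetric] by (simp add: algebra_simps)
  next
    case False
    have az: "5 dvd a k" if "\<not> (k mod 5 = 0 \<or> k mod 5 = 1)" for k
    proof -
      have "\<not> (k mod 5 = (4 + 1) mod 5 \<or> k mod 5 = (4 + 2) mod 5)" using that by simp
      then show ?thesis using feqD[OF euler_23_keep, of k] unfolding keep_nth a_def by simp
    qed
    have "5 dvd a n" by (rule az[OF False])
    moreover have "5 dvd a (l\<^sup>2 * n + 23 * s)" by (rule az, unfold residue_transfer[OF tr], rule False)
    moreover have "5 dvd T" using T unfolding third_term_def a_def[symmetric]
    proof (elim disjE exE conjE)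
      fix k assume k: "24 * n + 23 = l\<^sup>2 * (24 * k + 23)" "T = a k"
      show "5 dvd T" unfolding k(2) by (rule az, unfold residue_transfer[OF k(1), symmetric], rule False)
    qed simp
    ultimately show ?thesis unfolding a_def[symmetric] by (intro dvd_add dvd_diff dvd_mult)
  qed
qed

text \<open>The relation for p(5n+4) modulo 25, divided by 5. The symbol (5/l) splits off because 1
  - 24(5n+4) = 5(-24n-19).\<close>

lemma euler_19_relation:
  assumes T: "third_term 19 (fps_nth (euler_E 1 ^ 19)) n T"
  shows "5 dvd int l ^ 3 * fps_nth (euler_E 1 ^ 19) (l\<^sup>2 * n + 19 * s) + int l * chi12 l * (Legendre 5 (int l) * Legendre (- 24 * int n - 19) (int l)) * fps_nth (euler_E 1 ^ 19) n + T
    - chi12 l * (int l + int l ^ 2) * fps_nth (euler_E 1 ^ 19) n"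
proof -
  define a where "a = fps_nth (euler_E 1 ^ 19)"
  have pa: "25 dvd fps_nth part_gf (5 * k + 4) - 5 * a k" for k
    using feqD[OF part_sect_4, of k] unfolding sect_nth of_int_mult_nth a_def .
  have n4: "(5 * n + 4) mod 5 = 4" by simp
  obtain q where q: "5 dvd q - chi12 l * (int l + int l ^ 2)"
    "\<And>m. m mod 5 = 1 \<or> m mod 5 = 2 \<Longrightarrow> 5 dvd fps_nth hecke_series (s + m) - q * fps_nth (euler_E 1 ^ 23) (m - 1)"
    "\<And>m. m mod 5 = 4 \<Longrightarrow> 25 dvd fps_nth hecke_series (s + m) - q * fps_nth part_gf m"
    using hecke_relations_ex by blast
  define P3 where "P3 = (if l\<^sup>2 dvd s + (5 * n + 4) then fps_nth part_gf ((s + (5 * n + 4)) div l\<^sup>2) else 0)"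
  have f: "l\<^sup>2 * (5 * n + 4) = 5 * (l\<^sup>2 * n + 19 * s) + 4 + s" by (simp add: s_eq algebra_simps)
  have leg: "Legendre (1 - 24 * int (5 * n + 4)) (int l) = Legendre 5 (int l) * Legendre (- 24 * int n - 19) (int l)"
    unfolding Legendre_mult[OF prime_l l_gt_2, symmetric] by (rule arg_cong[of _ _ "\<lambda>x. Legendre x (int l)"]) simp
  have R: "25 dvd int l ^ 3 * fps_nth part_gf (5 * (l\<^sup>2 * n + 19 * s) + 4) + int l * chi12 l * (Legendre 5 (int l) * Legendre (- 24 * int n - 19) (int l)) * fps_nth part_gf (5 * n + 4) + P3
     - q * fps_nth part_gf (5 * n + 4)"
  proof -
    have "fps_nth hecke_series (s + (5 * n + 4)) = int l ^ 3 * fps_nth part_gf (5 * (l\<^sup>2 * n + 19 * s) + 4) + int l * chi12 l * ((Legendre 5 (int l) * Legendre (- 24 * int n - 19) (int l)) * fps_nth part_gf (5 * n + 4)) + P3"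
      unfolding hecke_nth_ge P3_def[symmetric] f leg by (simp only: not_add_less2 if_False add_diff_cancel_right')
    then show ?thesis using q(3)[OF n4] by (simp only: mult.assoc)
  qed
  have d3: "25 dvd P3 - 5 * T"
    using T unfolding third_term_def a_def[symmetric]
  proof (elim disjE exE conjE)
    fix k assume k: "24 * n + 19 = l\<^sup>2 * (24 * k + 19)" "T = a k"
    have "24 * (s + (5 * n + 4)) = 5 * (24 * n + 19) + (24 * s + 1)" by simp
    also have "\<dots> = 24 * (l\<^sup>2 * (5 * k + 4))" unfolding k(1) s_eq[symmetric] by (simp add: algebra_simps)
    finally have "s + (5 * n + 4) = l\<^sup>2 * (5 * k + 4)" by simp
    then have "P3 = fps_nth part_gf (5 * k + 4)" using l_pos by (simp add: P3_def)
    then show ?thesis using pa[of k] k(2) by simp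
  next
    assume k: "\<not> l\<^sup>2 dvd 24 * n + 19" "T = 0"
    have c5: "coprime (l\<^sup>2) 5"
    proof -
      have "\<not> 5 dvd l" using l_mod_5 by (simp add: dvd_eq_mod_eq_0)
      then have "coprime 5 l" using prime_imp_coprime[OF prime_5] by blast
      then show ?thesis by (simp add: coprime_commute)
    qed
    have "\<not> l\<^sup>2 dvd s + (5 * n + 4)"
    proof
      assume "l\<^sup>2 dvd s + (5 * n + 4)"
      then have "l\<^sup>2 dvd 24 * (s + (5 * n + 4))" by (rule dvd_mult)
      also have "24 * (s + (5 * n + 4)) = 5 * (24 * n + 19) + l\<^sup>2" using s_eq by simp
      finally have "l\<^sup>2 dvd 5 * (24 * n + 19)" by (simp only: dvd_add_left_iff[OF dvd_refl])
      then show False using k(1) c5 coprime_dvd_mult_right_iff by blast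
    qed
    then show ?thesis using k(2) by (simp add: P3_def)
  qed
  show ?thesis unfolding a_def[symmetric]
  proof (rule combine_congruence[where M = 5 and N = 5, OF _ _ _ _ q(1)])
    have m: "(5 * 5 :: int) = 25" by simp
    show "5 * 5 dvd int l ^ 3 * fps_nth part_gf (5 * (l\<^sup>2 * n + 19 * s) + 4) + int l * chi12 l * (Legendre 5 (int l) * Legendre (- 24 * int n - 19) (int l)) * fps_nth part_gf (5 * n + 4) + P3
     - q * fps_nth part_gf (5 * n + 4)" unfolding m by (rule R)
    show "5 * 5 dvd fps_nth part_gf (5 * (l\<^sup>2 * n + 19 * s) + 4) - 5 * a (l\<^sup>2 * n + 19 * s)" "5 * 5 dvd fps_nth part_gf (5 * n + 4) - 5 * a n"
      unfolding m by (rule pa)+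
    show "5 * 5 dvd P3 - 5 * T" unfolding m by (rule d3)
  qed simp
qed

section \<open>The rational arguments of c\<close>

definition weight :: "nat \<Rightarrow> nat" where "weight a = (if odd a then 23 else 19)"

lemma residue_index_rat: "24 * (of_nat (residue_index a) :: rat) + 19 = of_nat (weight a) * 5 ^ a"
proof -
  have "of_nat (24 * residue_index a + 19) = (of_nat (weight a * 5 ^ a) :: rat)"
    unfolding residue_index_eq weight_def by simp
  then show ?thesis by simp
qed

lemma l2_rat: "(of_nat l)\<^sup>2 = 24 * of_nat s + (1 :: rat)"
proof -
  have "(of_nat (l\<^sup>2) :: rat) = of_nat (24 * s + 1)" by (simp only: s_eq)
  then show ?thesis by simp
qed

lemma y_arg_weight: "24 * y_arg a t = of_nat (weight a) * 5 ^ a * t\<^sup>2 - 19"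
  by (simp add: y_arg_def weight_def)

lemma rat_24_cancel: "24 * x = 24 * y \<Longrightarrow> x = (y :: rat)"
  by simp

lemma c_coeff_first: "c_coeff (5 ^ a * (of_nat l)\<^sup>2 * of_nat n + y_arg a (of_nat l)) = fps_nth c_gf (5 ^ a * (l\<^sup>2 * n + weight a * s) + residue_index a)"
proof -
  have "24 * (5 ^ a * (of_nat l)\<^sup>2 * of_nat n + y_arg a (of_nat l)) = 24 * of_nat (5 ^ a * (l\<^sup>2 * n + weight a * s) + residue_index a)"
  proof -
    have "24 * (5 ^ a * (of_nat l)\<^sup>2 * of_nat n + y_arg a (of_nat l)) = 24 * 5 ^ a * (of_nat l)\<^sup>2 * of_nat n + (of_nat (weight a) * 5 ^ a * (of_nat l)\<^sup>2 - 19)"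
      unfolding y_arg_weight[symmetric] by (simp add: algebra_simps)
    also have "\<dots> = 24 * 5 ^ a * (of_nat l)\<^sup>2 * of_nat n + 24 * of_nat s * of_nat (weight a) * 5 ^ a + (of_nat (weight a) * 5 ^ a - 19)"
      unfolding l2_rat by (simp add: algebra_simps)
    also have "\<dots> = 24 * of_nat (5 ^ a * (l\<^sup>2 * n + weight a * s) + residue_index a)"
      unfolding residue_index_rat[symmetric] by (simp add: algebra_simps)
    finally show ?thesis .
  qed
  then have e: "5 ^ a * (of_nat l)\<^sup>2 * of_nat n + y_arg a (of_nat l) = of_nat (5 ^ a * (l\<^sup>2 * n + weight a * s) + residue_index a)"
    by (rule rat_24_cancel)
  show ?thesis unfolding e by (rule c_coeff_of_nat)
qed

lemma c_coeff_second: "c_coeff (5 ^ a * of_nat n + delta_tilde a) = fps_nth c_gf (5 ^ a * n + residue_index a)"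
proof -
  have "24 * delta_tilde a = 24 * of_nat (residue_index a)"
    using residue_index_rat[of a] by (simp add: delta_tilde_def weight_def algebra_simps split: if_splits)
  then have "delta_tilde a = of_nat (residue_index a)" by simp
  then have "5 ^ a * of_nat n + delta_tilde a = of_nat (5 ^ a * n + residue_index a)" by simp
  then show ?thesis by (simp only: c_coeff_of_nat)
qed

text \<open>In the coordinate 24x + 19 the argument is 5^a (24n + \<open>weight a\<close>)/l^2. As l
  is prime to 5, it is a natural number exactly when l^2 divides 24n +
  \<open>weight a\<close>.\<close>

lemma c_coeff_third: "third_term (weight a) (\<lambda>k. fps_nth c_gf (5 ^ a * k + residue_index a)) n (c_coeff (5 ^ a * of_nat n / (of_nat l)\<^sup>2 + y_arg a (inverse (of_nat l))))"
proof -
  define x where "x = 5 ^ a * of_nat n / (of_nat l)\<^sup>2 + y_arg a (inverse (of_nat l))"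
  have l0: "(of_nat l :: rat)\<^sup>2 \<noteq> 0" using l_pos by simp
  have "24 * x = 24 * 5 ^ a * of_nat n / (of_nat l)\<^sup>2 + (of_nat (weight a) * 5 ^ a * (inverse (of_nat l))\<^sup>2 - 19)"
    unfolding y_arg_weight[symmetric] x_def by (simp add: algebra_simps)
  then have "24 * x + 19 = 5 ^ a * (24 * of_nat n + of_nat (weight a)) / (of_nat l)\<^sup>2"
    using l0 by (simp add: field_simps power_inverse)
  then have key: "(of_nat l)\<^sup>2 * (24 * x + 19) = 5 ^ a * (24 * of_nat n + of_nat (weight a))"
    using l0 by simp
  show ?thesis
  proof (cases "l\<^sup>2 dvd 24 * n + weight a")
    case True
    then obtain w where w: "24 * n + weight a = l\<^sup>2 * w" by blast
    \<comment> \<open>Because l^2 is 1 modulo 24, the cofactor w keeps the residue modulo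
      24.\<close>
    have "w mod 24 = weight a"
    proof -
      have "24 * n + weight a = w + 24 * (s * w)" unfolding w s_eq by (simp add: algebra_simps)
      then have "(24 * n + weight a) mod 24 = w mod 24" by (simp only: mod_mult_self2)
      then show ?thesis by (simp add: weight_def split: if_splits)
    qed
    then have "w = 24 * (w div 24) + weight a" using mult_div_mod_eq[of 24 w] by simp
    then obtain k where k: "w = 24 * k + weight a" by blast
    have "(of_nat (24 * n + weight a) :: rat) = of_nat (l\<^sup>2 * (24 * k + weight a))" unfolding w k ..
    then have "(of_nat l)\<^sup>2 * (24 * x + 19) = (of_nat l)\<^sup>2 * (5 ^ a * (24 * of_nat k + of_nat (weight a)))"
      using key by (simp add: mult.left_commute)
    then have "24 * x + 19 = 5 ^ a * (24 * of_nat k + of_nat (weight a))" using l0 by simp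
    then have "24 * x = 24 * (5 ^ a * of_nat k) + (of_nat (weight a) * 5 ^ a - 19)" by (simp add: algebra_simps)
    also have "\<dots> = 24 * of_nat (5 ^ a * k + residue_index a)" unfolding residue_index_rat[symmetric] by simp
    finally have "x = of_nat (5 ^ a * k + residue_index a)" by (rule rat_24_cancel)
    then have "c_coeff x = fps_nth c_gf (5 ^ a * k + residue_index a)" by (simp only: c_coeff_of_nat)
    then show ?thesis using w k unfolding third_term_def x_def by blast
  next
    case False
    have "x \<notin> \<nat>"
    proof
      assume "x \<in> \<nat>"
      then obtain k where "x = of_nat k" by (auto elim: Nats_cases)
      then have "(of_nat (l\<^sup>2 * (24 * k + 19)) :: rat) = of_nat (5 ^ a * (24 * n + weight a))" using key by simp
      then have "l\<^sup>2 * (24 * k + 19) = 5 ^ a * (24 * n + weight a)" by (simp only: of_nat_eq_iff)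
      from dvdI[OF this[symmetric]] have "l\<^sup>2 dvd 5 ^ a * (24 * n + weight a)" .
      moreover have "coprime (l\<^sup>2) (5 ^ a)"
      proof -
        have "\<not> 5 dvd l" using l_mod_5 by (simp add: dvd_eq_mod_eq_0)
        then have "coprime 5 l" using prime_imp_coprime[OF prime_5] by blast
        then show ?thesis by (simp add: coprime_commute)
      qed
      ultimately show False using False coprime_dvd_mult_right_iff by blast
    qed
    then have "c_coeff x = 0" by (simp add: c_coeff_def)
    then show ?thesis using False unfolding third_term_def x_def by blast
  qed
qed

text \<open>All three values of c are, modulo 5^(a+1), 5^a times one and the same integer k times
  coefficients of E_1^\<open>weight a\<close>, so a relation modulo 5 between those coefficients
  suffices.\<close>

lemma c_relation:
  assumes rel: "\<And>T. third_term (weight a) (fps_nth (euler_E 1 ^ weight a)) n T \<Longrightarrow>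
      5 dvd fps_nth (euler_E 1 ^ weight a) (l\<^sup>2 * n + weight a * s) - (f * fps_nth (euler_E 1 ^ weight a) n - int l * T)"
  shows "[c_coeff (5 ^ a * (of_nat l)\<^sup>2 * of_nat n + y_arg a (of_nat l)) = f * c_coeff (5 ^ a * of_nat n + delta_tilde a)
      - int l * c_coeff (5 ^ a * of_nat n / (of_nat l)\<^sup>2 + y_arg a (inverse (of_nat l)))] (mod 5 ^ (a + 1))"
proof -
  define e where "e = fps_nth (euler_E 1 ^ weight a)"
  define C where "C N = fps_nth c_gf (5 ^ a * N + residue_index a)" for N
  define T' where "T' = c_coeff (5 ^ a * of_nat n / (of_nat l)\<^sup>2 + y_arg a (inverse (of_nat l)))"
  have "\<exists>k. \<forall>N. 5 ^ (a + 1) dvd fps_nth c_gf (5 ^ a * N + residue_index a) - 5 ^ a * k * fps_nth (euler_E 1 ^ (if odd a then 23 else 19)) N"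
    by (rule c_gf_residue[of a]) blast
  then obtain k where k': "\<And>N. 5 ^ (a + 1) dvd fps_nth c_gf (5 ^ a * N + residue_index a) - 5 ^ a * k * fps_nth (euler_E 1 ^ (if odd a then 23 else 19)) N"
    by blast
  have k: "5 ^ (a + 1) dvd C N - 5 ^ a * k * e N" for N
    using k'[of N] unfolding C_def e_def weight_def .
  have "third_term (weight a) C n T'" using c_coeff_third unfolding C_def T'_def .
  then obtain T where T: "third_term (weight a) e n T" "5 ^ (a + 1) dvd T' - 5 ^ a * k * T"
    unfolding third_term_def
  proof (elim disjE exE conjE)
    fix j assume "24 * n + weight a = l\<^sup>2 * (24 * j + weight a)" "T' = C j"
    then show thesis using that[of "e j"] k[of j] unfolding third_term_def by blast
  next
    assume "\<not> l\<^sup>2 dvd 24 * n + weight a" "T' = 0"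
    then show thesis using that[of 0] unfolding third_term_def by simp
  qed
  have "(5 ^ a * 5 :: int) dvd 5 ^ a * (k * (e (l\<^sup>2 * n + weight a * s) - (f * e n - int l * T)))"
    by (intro mult_dvd_mono dvd_refl dvd_mult rel[OF T(1)[unfolded e_def], folded e_def])
  then have r: "5 ^ (a + 1) dvd 5 ^ a * (k * (e (l\<^sup>2 * n + weight a * s) - (f * e n - int l * T)))" by (simp add: mult.commute)
  have "C (l\<^sup>2 * n + weight a * s) - (f * C n - int l * T') = (C (l\<^sup>2 * n + weight a * s) - 5 ^ a * k * e (l\<^sup>2 * n + weight a * s))
     - f * (C n - 5 ^ a * k * e n) + int l * (T' - 5 ^ a * k * T) + 5 ^ a * (k * (e (l\<^sup>2 * n + weight a * s) - (f * e n - int l * T)))"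
    by (simp add: algebra_simps)
  also have "5 ^ (a + 1) dvd \<dots>" by (intro dvd_add dvd_diff dvd_mult k T(2) r)
  finally show ?thesis unfolding c_coeff_first c_coeff_second cong_iff_dvd_diff C_def T'_def .
qed

end

theorem theorem1p3:
  fixes l \<alpha> n :: nat
  assumes "prime l" and "l \<ge> 7" and "\<alpha> \<ge> 1"
  shows "(odd \<alpha> \<longrightarrow>
      [c_coeff (5 ^ \<alpha> * (of_nat l)\<^sup>2 * of_nat n + y_arg \<alpha> (of_nat l)) =
         Legendre 15 (int l) * (1 + int l - Legendre (- 24 * int n - 23) (int l))
           * c_coeff (5 ^ \<alpha> * of_nat n + delta_tilde \<alpha>)
         - int l * c_coeff (5 ^ \<alpha> * of_nat n / (of_nat l)\<^sup>2 + y_arg \<alpha> (inverse (of_nat l)))]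
      (mod 5 ^ (\<alpha> + 1)))
    \<and> (even \<alpha> \<longrightarrow>
      [c_coeff (5 ^ \<alpha> * (of_nat l)\<^sup>2 * of_nat n + y_arg \<alpha> (of_nat l)) =
         Legendre 15 (int l) * (1 + int l - (int l)\<^sup>2 * Legendre (- 24 * int n - 19) (int l))
           * c_coeff (5 ^ \<alpha> * of_nat n + delta_tilde \<alpha>)
         - int l * c_coeff (5 ^ \<alpha> * of_nat n / (of_nat l)\<^sup>2 + y_arg \<alpha> (inverse (of_nat l)))]
      (mod 5 ^ (\<alpha> + 1)))"
proof -
  interpret hecke_prime l by unfold_locales fact+
  show ?thesis
  proof (intro conjI impI)
    assume o: "odd \<alpha>"
    then have w: "weight \<alpha> = 23" by (simp add: weight_def)
    show "[c_coeff (5 ^ \<alpha> * (of_nat l)\<^sup>2 * of_nat n + y_arg \<alpha> (of_nat l)) =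
         Legendre 15 (int l) * (1 + int l - Legendre (- 24 * int n - 23) (int l))
           * c_coeff (5 ^ \<alpha> * of_nat n + delta_tilde \<alpha>)
         - int l * c_coeff (5 ^ \<alpha> * of_nat n / (of_nat l)\<^sup>2 + y_arg \<alpha> (inverse (of_nat l)))]
      (mod 5 ^ (\<alpha> + 1))"
      by (rule c_relation, unfold w) (rule solve_congruence[OF euler_23_relation l_fourth_power Legendre_15])
  next
    assume ev: "even \<alpha>"
    then have w: "weight \<alpha> = 19" by (simp add: weight_def)
    show "[c_coeff (5 ^ \<alpha> * (of_nat l)\<^sup>2 * of_nat n + y_arg \<alpha> (of_nat l)) =
         Legendre 15 (int l) * (1 + int l - (int l)\<^sup>2 * Legendre (- 24 * int n - 19) (int l))
           * c_coeff (5 ^ \<alpha> * of_nat n + delta_tilde \<alpha>)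
         - int l * c_coeff (5 ^ \<alpha> * of_nat n / (of_nat l)\<^sup>2 + y_arg \<alpha> (inverse (of_nat l)))]
      (mod 5 ^ (\<alpha> + 1))"
    proof (rule c_relation, unfold w)
      fix T assume T: "third_term 19 (fps_nth (euler_E 1 ^ 19)) n T"
      define a where "a = fps_nth (euler_E 1 ^ 19)"
      define m where "m = Legendre (- 24 * int n - 19) (int l)"
      have "5 dvd a (l\<^sup>2 * n + 19 * s) - (Legendre 15 (int l) * (1 + int l - Legendre 5 (int l) * m) * a n - int l * T)"
        unfolding a_def m_def by (rule solve_congruence[OF euler_19_relation[OF T] l_fourth_power Legendre_15])
      \<comment> \<open>The relation obtained contains (5/l); exchanging it for l^2 modulo 5 gives
        the stated factor.\<close>
      moreover have "5 dvd Legendre 15 (int l) * m * a n * (Legendre 5 (int l) - (int l)\<^sup>2)" by (rule dvd_mult[OF Legendre_5])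
      ultimately have "5 dvd a (l\<^sup>2 * n + 19 * s) - (Legendre 15 (int l) * (1 + int l - Legendre 5 (int l) * m) * a n - int l * T)
          - Legendre 15 (int l) * m * a n * (Legendre 5 (int l) - (int l)\<^sup>2)" by (rule dvd_diff)
      also have "a (l\<^sup>2 * n + 19 * s) - (Legendre 15 (int l) * (1 + int l - Legendre 5 (int l) * m) * a n - int l * T)
          - Legendre 15 (int l) * m * a n * (Legendre 5 (int l) - (int l)\<^sup>2)
        = a (l\<^sup>2 * n + 19 * s) - (Legendre 15 (int l) * (1 + int l - (int l)\<^sup>2 * m) * a n - int l * T)"
        by (simp add: algebra_simps)
      finally show "5 dvd fps_nth (euler_E 1 ^ 19) (l\<^sup>2 * n + 19 * s) - (Legendre 15 (int l) * (1 + int l - (int l)\<^sup>2 * Legendre (- 24 * int n - 19) (int l)) * fps_nth (euler_E 1 ^ 19) n - int l * T)"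
        unfolding a_def m_def .
    qed
  qed
qed

end
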